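(* Let $\mathscr{F}$ be an $\mathscr{L}$-foliation (of codimension one) of degree $3$ on $\mathbf{C}\mathbf{P}(4)$. If $\mathscr{L}$ is abelian, then, up to conjugation (by a linear change of the homogeneous coordinates $z_0,\dots,z_4$), $\mathscr{F}$ admits one of the following first integrals: $$z_0^{\kappa_0}z_1^{\kappa_1}z_2^{\kappa_2}z_3^{\kappa_3}z_4^{\kappa_4}\quad\text{with}\quad \sum_{j=0}^4\kappa_j=0,$$ $$\frac{z_1^{\kappa+\xi+1}}{z_2^{\kappa}z_3^{\xi}z_4}\exp\left(\frac{z_0}{z_1}\right),$$ $$\frac{z_3^{\kappa}z_4}{z_1^{1+\kappa}}\exp\left(\frac{z_1z_2-z_0z_3}{z_1z_3}\right),$$ $$\frac{z_0z_4^2-z_1z_2z_4+z_1z_3^2}{z_1z_4^2},$$ $$\left(\frac{z_1}{z_4}\right)\exp\left(\frac{z_0z_4^2-z_1z_2z_4+z_1z_3^2}{z_1z_4^2}\right),$$ $$\frac{z_1^{\kappa}z_4^{1-\kappa}}{z_0}\exp\left(\frac{z_3^2-z_2z_4}{z_4^2}\right),$$ $$\frac{z_0}{z_4}\exp\left(\frac{z_1z_4^2+z_2z_3z_4-z_3^3}{z_4^3}\right),$$ $$\frac{z_0z_4^3+z_1z_3z_4^2-\frac{z_2^2z_4^2}{2}-\frac{z_3^4}{4}+z_2z_3^2z_4}{z_4^4},$$ where the $\kappa_i$, $\kappa$ and $\xi$ are complex numbers.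
   Context: A codimension one foliation $\mathscr{F}$ of degree $\nu$ on $\mathbf{C}\mathbf{P}(n)$ is given in homogeneous coordinates by a $1$-form $\omega=\sum_{k=0}^nA_kdz_k$ on $\mathbf{C}^{n+1}$, with $A_k$ homogeneous polynomials of degree $\nu+1$, $\omega\wedge d\omega=0$, $\sum z_kA_k=0$, and $\{A_0=\dots=A_n=0\}$ of codimension $\geq2$. Let $\chi(\mathbf{C}\mathbf{P}(n))$ be the Lie algebra of holomorphic vector fields on $\mathbf{C}\mathbf{P}(n)$. $\mathscr{F}$ is an $\mathscr{L}$-foliation if there is a Lie subalgebra $\mathscr{L}\subset\chi(\mathbf{C}\mathbf{P}(n))$ such that, for generic $z$, $\mathscr{L}(z)=\{X(z):X\in\mathscr{L}\}$ is the tangent space at $z$ to the leaf of $\mathscr{F}$ (so it has dimension $n-1$); $\mathscr{L}$ always denotes the maximal such subalgebra, i.e. the algebra of all holomorphic vector fields on $\mathbf{C}\mathbf{P}(n)$ tangent to $\mathscr{F}$. A first integral is a non-constant (possibly multivalued) function constant on the leaves of $\mathscr{F}$. *)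

theory Defs
  imports "HOL-Analysis.Analysis"
begin

text \<open>Homogeneous coordinates on the projective space of dimension n are vectors
  \<open>z :: complex ^ 'n\<close> with \<open>CARD('n) = n + 1\<close>.  For dimension 4 the index type is the
  numeral type \<open>5\<close>, whose elements are \<open>0, 1, 2, 3, 4\<close>.\<close>

section \<open>Polynomials, Zariski topology, codimension\<close>

definition monomial :: "('n::finite \<Rightarrow> nat) \<Rightarrow> complex ^ 'n \<Rightarrow> complex" where
  "monomial \<alpha> z = (\<Prod>i\<in>UNIV. (z $ i) ^ \<alpha> i)"

definition polynomial_fun :: "(complex ^ 'n::finite \<Rightarrow> complex) \<Rightarrow> bool" where
  "polynomial_fun p \<longleftrightarrow>
     (\<exists>S c. finite S \<and> (\<forall>z. p z = (\<Sum>\<alpha>\<in>S. c \<alpha> * monomial \<alpha> z)))"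

definition homogeneous_poly :: "nat \<Rightarrow> (complex ^ 'n::finite \<Rightarrow> complex) \<Rightarrow> bool" where
  "homogeneous_poly d p \<longleftrightarrow>
     (\<exists>c. \<forall>z. p z = (\<Sum>\<alpha> | (\<Sum>i\<in>UNIV. \<alpha> i) = d. c \<alpha> * monomial \<alpha> z))"

definition zariski_closed :: "(complex ^ 'n::finite) set \<Rightarrow> bool" where
  "zariski_closed Z \<longleftrightarrow>
     (\<exists>P. (\<forall>p\<in>P. polynomial_fun p) \<and> Z = {z. \<forall>p\<in>P. p z = 0})"

definition zariski_irreducible :: "(complex ^ 'n::finite) set \<Rightarrow> bool" where
  "zariski_irreducible Y \<longleftrightarrow> zariski_closed Y \<and> Y \<noteq> {} \<and>
     (\<forall>S T. zariski_closed S \<and> zariski_closed T \<and> Y = S \<union> T \<longrightarrow> Y = S \<or> Y = T)"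

text \<open>Krull codimension: the codimension of an irreducible closed set is the supremum of the
  lengths of the chains of irreducible closed sets starting at it, and that of a closed set is
  the infimum over the irreducible closed sets it contains.\<close>

definition codim_at_least :: "nat \<Rightarrow> (complex ^ 'n::finite) set \<Rightarrow> bool" where
  "codim_at_least c Z \<longleftrightarrow>
     (\<forall>Y. zariski_irreducible Y \<and> Y \<subseteq> Z \<longrightarrow>
        (\<exists>C :: nat \<Rightarrow> (complex ^ 'n) set. C 0 = Y \<and>
           (\<forall>i\<le>c. zariski_irreducible (C i)) \<and> (\<forall>i<c. C i \<subset> C (Suc i))))"

text \<open>A property of points of projective space holds generically if it holds off a proper
  algebraic subset; it suffices to remove a hypersurface.\<close>

definition generically :: "(complex ^ 'n::finite \<Rightarrow> bool) \<Rightarrow> bool" where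
  "generically Q \<longleftrightarrow>
     (\<exists>d p. homogeneous_poly d p \<and> (\<exists>z. p z \<noteq> 0) \<and> (\<forall>z. z \<noteq> 0 \<and> p z \<noteq> 0 \<longrightarrow> Q z))"


section \<open>Codimension one foliations\<close>

text \<open>The 1-form \<open>\<Sum>k. A\<^sub>k dz\<^sub>k\<close> is represented by its coefficient map
  \<open>A :: complex ^ 'n \<Rightarrow> complex ^ 'n\<close>.\<close>

definition form_app :: "(complex ^ 'n \<Rightarrow> complex ^ 'n) \<Rightarrow> complex ^ 'n \<Rightarrow> complex ^ 'n \<Rightarrow> complex"
  where "form_app A z v = (\<Sum>k\<in>UNIV. A z $ k * v $ k)"

definition partial_deriv :: "'n \<Rightarrow> (complex ^ 'n::finite \<Rightarrow> complex) \<Rightarrow> complex ^ 'n \<Rightarrow> complex"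
  where "partial_deriv j f z = deriv (\<lambda>t. f (z + t *s axis j 1)) 0"

text \<open>\<open>d\<omega> = \<Sum>j k. \<partial>\<^sub>jA\<^sub>k dz\<^sub>j \<and> dz\<^sub>k\<close>, and \<open>\<omega> \<and> d\<omega>\<close>, as alternating forms.\<close>

definition ext_deriv_app ::
    "(complex ^ 'n \<Rightarrow> complex ^ 'n) \<Rightarrow> complex ^ 'n \<Rightarrow> complex ^ 'n \<Rightarrow> complex ^ 'n \<Rightarrow> complex"
  where "ext_deriv_app A z u v =
    (\<Sum>j\<in>UNIV. \<Sum>k\<in>UNIV. partial_deriv j (\<lambda>y. A y $ k) z * (u $ j * v $ k - u $ k * v $ j))"

definition wedge_ext_deriv_app ::
    "(complex ^ 'n \<Rightarrow> complex ^ 'n) \<Rightarrow> complex ^ 'n \<Rightarrow>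
      complex ^ 'n \<Rightarrow> complex ^ 'n \<Rightarrow> complex ^ 'n \<Rightarrow> complex"
  where "wedge_ext_deriv_app A z u v w =
    form_app A z u * ext_deriv_app A z v w
    - form_app A z v * ext_deriv_app A z u w
    + form_app A z w * ext_deriv_app A z u v"

definition sing_set :: "(complex ^ 'n \<Rightarrow> complex ^ 'n) \<Rightarrow> (complex ^ 'n) set" where
  "sing_set A = {z. \<forall>k. A z $ k = 0}"

definition foliation :: "nat \<Rightarrow> (complex ^ 'n \<Rightarrow> complex ^ 'n) \<Rightarrow> bool" where
  "foliation \<nu> A \<longleftrightarrow>
     (\<forall>k. homogeneous_poly (\<nu> + 1) (\<lambda>z. A z $ k)) \<and>
     (\<forall>z u v w. wedge_ext_deriv_app A z u v w = 0) \<and>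
     (\<forall>z. (\<Sum>k\<in>UNIV. z $ k * A z $ k) = 0) \<and>
     codim_at_least 2 (sing_set A)"

text \<open>Pull-back of a 1-form by the linear map \<open>z \<mapsto> M z\<close>.\<close>

definition pullback_form ::
    "complex ^ 'n ^ 'n \<Rightarrow> (complex ^ 'n \<Rightarrow> complex ^ 'n) \<Rightarrow> complex ^ 'n \<Rightarrow> complex ^ 'n"
  where "pullback_form M A z = (\<chi> j. \<Sum>k\<in>UNIV. A (M *v z) $ k * M $ k $ j)"


section \<open>Holomorphic vector fields on projective space\<close>

definition holomorphic_fun_on :: "(complex ^ 'n) set \<Rightarrow> (complex ^ 'n \<Rightarrow> complex) \<Rightarrow> bool" where
  "holomorphic_fun_on S f \<longleftrightarrow>
     (\<forall>z\<in>S. \<exists>D. (f has_derivative D) (at z within S) \<and> (\<forall>c v. D (c *s v) = c * D v))"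

text \<open>The affine chart \<open>z\<^sub>k \<noteq> 0\<close>: a point is represented by its homogeneous coordinates
  normalised by \<open>w\<^sub>k = 1\<close>, and its tangent space there is \<open>{v. v\<^sub>k = 0}\<close>.\<close>

definition chart :: "'n \<Rightarrow> (complex ^ 'n) set" where
  "chart k = {w. w $ k = 1}"

text \<open>A vector field is given by its expressions \<open>X k\<close> in the affine charts, which correspond to
  each other under the coordinate changes \<open>w \<mapsto> w / w\<^sub>j\<close>, whose differential is
  \<open>v \<mapsto> (v - (v\<^sub>j / w\<^sub>j) w) / w\<^sub>j\<close>.  Outside \<open>chart k\<close> the map \<open>X k\<close> has
  the dummy value 0.\<close>

type_synonym 'n vfield = "'n \<Rightarrow> complex ^ 'n \<Rightarrow> complex ^ 'n"

definition holo_vfields :: "'n::finite vfield set" where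
  "holo_vfields = {X.
     (\<forall>k w. w \<notin> chart k \<longrightarrow> X k w = 0) \<and>
     (\<forall>k. \<forall>w\<in>chart k. X k w $ k = 0) \<and>
     (\<forall>k i. holomorphic_fun_on (chart k) (\<lambda>w. X k w $ i)) \<and>
     (\<forall>j k. \<forall>w\<in>chart k. w $ j \<noteq> 0 \<longrightarrow>
        X j ((1 / w $ j) *s w) = (1 / w $ j) *s (X k w - (X k w $ j / w $ j) *s w))}"

text \<open>The Lie bracket, computed in each chart.\<close>

definition vfield_bracket :: "'n::finite vfield \<Rightarrow> 'n vfield \<Rightarrow> 'n vfield" where
  "vfield_bracket X Y = (\<lambda>k w. \<chi> i.
     deriv (\<lambda>t. Y k (w + t *s X k w) $ i) 0 - deriv (\<lambda>t. X k (w + t *s Y k w) $ i) 0)"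

definition lie_subalgebra :: "'n::finite vfield set \<Rightarrow> bool" where
  "lie_subalgebra L \<longleftrightarrow> L \<subseteq> holo_vfields \<and>
     (\<lambda>k w. 0) \<in> L \<and>
     (\<forall>X\<in>L. \<forall>Y\<in>L. (\<lambda>k w. X k w + Y k w) \<in> L) \<and>
     (\<forall>c. \<forall>X\<in>L. (\<lambda>k w. c *s X k w) \<in> L) \<and>
     (\<forall>X\<in>L. \<forall>Y\<in>L. vfield_bracket X Y \<in> L)"

definition abelian :: "'n::finite vfield set \<Rightarrow> bool" where
  "abelian L \<longleftrightarrow> (\<forall>X\<in>L. \<forall>Y\<in>L. vfield_bracket X Y = (\<lambda>k w. 0))"

text \<open>At a regular point the tangent space to the leaf is the kernel of the form, read in
  the chart \<open>k\<close> at the normalised representative.\<close>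

definition L_foliation :: "(complex ^ 'n::finite \<Rightarrow> complex ^ 'n) \<Rightarrow> bool" where
  "L_foliation A \<longleftrightarrow> (\<exists>L. lie_subalgebra L \<and>
     generically (\<lambda>z. \<forall>k. z $ k \<noteq> 0 \<longrightarrow>
       (let w = (1 / z $ k) *s z
        in {X k w | X. X \<in> L} = {v. v $ k = 0 \<and> form_app A w v = 0})))"

definition tangent_algebra :: "(complex ^ 'n::finite \<Rightarrow> complex ^ 'n) \<Rightarrow> 'n vfield set" where
  "tangent_algebra A = {X \<in> holo_vfields. \<forall>k. \<forall>w\<in>chart k. form_app A w (X k w) = 0}"


section \<open>Multivalued functions and first integrals\<close>

text \<open>A multivalued function is given, in homogeneous coordinates, by the set of all its
  holomorphic determinations \<open>(V, f)\<close> on nonempty connected open sets \<open>V\<close>; the values of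
  \<open>f\<close> outside \<open>V\<close> are irrelevant.\<close>

type_synonym 'n multifun = "((complex ^ 'n) set \<times> (complex ^ 'n \<Rightarrow> complex)) set"

definition region :: "(complex ^ 'n::finite) set \<Rightarrow> bool" where
  "region V \<longleftrightarrow> open V \<and> connected V \<and> V \<noteq> {}"

text \<open>Leaves are swept out by the curves tangent to the foliation that avoid its singular set.
  Since \<open>\<Sum>k. z\<^sub>k A\<^sub>k = 0\<close>, radial curves are tangent, so a function constant along
  these curves is one on projective space.\<close>

definition leaf_connected_in ::
    "(complex ^ 'n \<Rightarrow> complex ^ 'n) \<Rightarrow> (complex ^ 'n) set \<Rightarrow> complex ^ 'n \<Rightarrow> complex ^ 'n \<Rightarrow> bool"
  where "leaf_connected_in A V x y \<longleftrightarrow>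
    (\<exists>\<gamma> :: real \<Rightarrow> complex ^ 'n. \<gamma> C1_differentiable_on {0..1} \<and>
       \<gamma> ` {0..1} \<subseteq> V - {0} - sing_set A \<and> \<gamma> 0 = x \<and> \<gamma> 1 = y \<and>
       (\<forall>t\<in>{0..1}. form_app A (\<gamma> t) (vector_derivative \<gamma> (at t)) = 0))"

text \<open>A multivalued function is constant on the leaves if each determination is so along the
  leaves of the restricted foliation.\<close>

definition first_integral ::
    "(complex ^ 'n::finite \<Rightarrow> complex ^ 'n) \<Rightarrow> 'n multifun \<Rightarrow> bool" where
  "first_integral A F \<longleftrightarrow>
     closure (\<Union>(V, f)\<in>F. V) = UNIV \<and>
     (\<forall>(V, f)\<in>F. region V \<and> holomorphic_fun_on V f \<and> \<not> f constant_on V \<and>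
        (\<forall>x y. leaf_connected_in A V x y \<longrightarrow> f x = f y))"

text \<open>Determinations of \<open>z\<^sub>i\<^sup>a = exp (a log z\<^sub>i)\<close>.\<close>

definition power_det :: "'n \<Rightarrow> complex \<Rightarrow> 'n::finite multifun" where
  "power_det i a = {(V, p). region V \<and>
     (\<exists>l. holomorphic_fun_on V l \<and> (\<forall>z\<in>V. exp (l z) = z $ i \<and> p z = exp (a * l z)))}"

definition integral1 :: "(5 \<Rightarrow> complex) \<Rightarrow> 5 multifun" where
  "integral1 \<kappa> = {(V, f). region V \<and>
     (\<exists>p. (\<forall>i. (V, p i) \<in> power_det i (\<kappa> i)) \<and>
        (\<forall>z\<in>V. f z = p 0 z * p 1 z * p 2 z * p 3 z * p 4 z))}"

definition integral2 :: "complex \<Rightarrow> complex \<Rightarrow> 5 multifun" where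
  "integral2 \<kappa> \<xi> = {(V, f). region V \<and>
     (\<exists>p q r. (V, p) \<in> power_det 1 (\<kappa> + \<xi> + 1) \<and> (V, q) \<in> power_det 2 \<kappa> \<and>
        (V, r) \<in> power_det 3 \<xi> \<and>
        (\<forall>z\<in>V. z $ 4 \<noteq> 0 \<and>
           f z = p z / (q z * r z * z $ 4) * exp (z $ 0 / z $ 1)))}"

definition integral3 :: "complex \<Rightarrow> 5 multifun" where
  "integral3 \<kappa> = {(V, f). region V \<and>
     (\<exists>p q. (V, p) \<in> power_det 3 \<kappa> \<and> (V, q) \<in> power_det 1 (1 + \<kappa>) \<and>
        (\<forall>z\<in>V. f z = p z * z $ 4 / q z *
           exp ((z $ 1 * z $ 2 - z $ 0 * z $ 3) / (z $ 1 * z $ 3))))}"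

definition integral4 :: "5 multifun" where
  "integral4 = {(V, f). region V \<and>
     (\<forall>z\<in>V. z $ 1 \<noteq> 0 \<and> z $ 4 \<noteq> 0 \<and>
        f z = (z $ 0 * (z $ 4)^2 - z $ 1 * z $ 2 * z $ 4 + z $ 1 * (z $ 3)^2) /
              (z $ 1 * (z $ 4)^2))}"

definition integral5 :: "5 multifun" where
  "integral5 = {(V, f). region V \<and>
     (\<forall>z\<in>V. z $ 1 \<noteq> 0 \<and> z $ 4 \<noteq> 0 \<and>
        f z = z $ 1 / z $ 4 *
          exp ((z $ 0 * (z $ 4)^2 - z $ 1 * z $ 2 * z $ 4 + z $ 1 * (z $ 3)^2) /
               (z $ 1 * (z $ 4)^2)))}"

definition integral6 :: "complex \<Rightarrow> 5 multifun" where
  "integral6 \<kappa> = {(V, f). region V \<and>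
     (\<exists>p q. (V, p) \<in> power_det 1 \<kappa> \<and> (V, q) \<in> power_det 4 (1 - \<kappa>) \<and>
        (\<forall>z\<in>V. z $ 0 \<noteq> 0 \<and>
           f z = p z * q z / z $ 0 * exp (((z $ 3)^2 - z $ 2 * z $ 4) / (z $ 4)^2)))}"

definition integral7 :: "5 multifun" where
  "integral7 = {(V, f). region V \<and>
     (\<forall>z\<in>V. z $ 4 \<noteq> 0 \<and>
        f z = z $ 0 / z $ 4 *
          exp ((z $ 1 * (z $ 4)^2 + z $ 2 * z $ 3 * z $ 4 - (z $ 3)^3) / (z $ 4)^3))}"

definition integral8 :: "5 multifun" where
  "integral8 = {(V, f). region V \<and>
     (\<forall>z\<in>V. z $ 4 \<noteq> 0 \<and>
        f z = (z $ 0 * (z $ 4)^3 + z $ 1 * z $ 3 * (z $ 4)^2 - (z $ 2)^2 * (z $ 4)^2 / 2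
               - (z $ 3)^4 / 4 + z $ 2 * (z $ 3)^2 * z $ 4) / (z $ 4)^4)}"

end

theory Submission
  imports Defs
    "HOL-Computational_Algebra.Polynomial_Factorial"
    "HOL-Computational_Algebra.Fundamental_Theorem_Algebra"
    "HOL-Computational_Algebra.Field_as_Ring"
    "HOL-Complex_Analysis.Cauchy_Integral_Formula"
begin

text \<open>A holomorphic vector field on projective space is, in a chart, the projection of a linear
  vector field \<open>z \<mapsto> B z\<close> (\<open>vfield_linear\<close>), and fields with zero bracket come from commuting matrices
  (\<open>bracket_zero_imp_commute\<close>).  At a generic point the algebra of the foliation supplies three fields, hence
  commuting matrices \<open>B\<^sub>1, B\<^sub>2, B\<^sub>3\<close> which span, together with the radial direction \<open>z\<close>, the kernel
  of the form.  So the form is parallel to \<open>det (z, B\<^sub>1 z, B\<^sub>2 z, B\<^sub>3 z, -)\<close>.  Both have degree 4 and the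
  coefficients of the first have no common factor, because its singular set has codimension at
  least two; therefore they agree up to a constant (\<open>L_foliation_orbit_form\<close>).  The underlying algebra is
  unique factorisation in a polynomial ring and the Nullstellensatz for one prime polynomial
  (\<open>eval_family_lift\<close>).

  Let \<open>V\<close> be the span of \<open>1, B\<^sub>1, B\<^sub>2, B\<^sub>3\<close>.  The singular set contains no hyperplane, so every
  hyperplane contains a point \<open>z\<close> such that \<open>B \<mapsto> B z\<close> is injective on \<open>V\<close>.  This is the
  decisive restriction.  It implies that each weight of \<open>V\<close> has only one eigencovector up to scalars
  (\<open>eigencovector_unique\<close>), whence the commutative algebra \<open>R\<close> generated by \<open>V\<close> acts on the space
  with a cyclic vector and every local factor of \<open>R\<close> is a truncated polynomial ring
  \<open>\<complex>[x] / x\<^sup>d\<close>.  So \<open>R\<close> has dimension 5, the space is identified with \<open>R\<close>, and \<open>V\<close> is a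
  hyperplane in \<open>R\<close>, the kernel of a functional \<open>\<lambda>\<close> with \<open>\<lambda> 1 = 0\<close>, which is
  nonzero on the socle of each factor (\<open>block_structure\<close>).

  On the units of \<open>R\<close> the multivalued function \<open>exp (\<lambda> (log z))\<close> is a first integral: its
  logarithmic derivative along \<open>z \<mapsto> B z\<close> is \<open>\<lambda> B\<close>, which vanishes for \<open>B \<in> V\<close>.  The
  generator \<open>x\<close> of a factor can be changed so that \<open>\<lambda>\<close> only sees the constant and the socle
  coefficient (\<open>normal_block3\<close>, \<open>normal_block4\<close>, \<open>normal_block5\<close>).  Then the seven partitions of 5 into block sizes
  \<open>d\<close> produce the list: 11111 gives the first integral of the statement, 2111 the second, 221 the third, 311 the sixth,
  41 the seventh, 5 the eighth, and 32 the fourth or the fifth, according to whether \<open>\<lambda>\<close> vanishes on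
  the two idempotents.  When \<open>\<lambda>\<close> vanishes on all idempotents,
  \<open>\<lambda> (log z)\<close> is rational and replaces its exponential.\<close>

section \<open>Polynomial functions\<close>

lemma polynomial_fun_monomial: "polynomial_fun (\<lambda>z. c * monomial \<alpha> z)"
  unfolding polynomial_fun_def
  by (rule exI[of _ "{\<alpha>}"], rule exI[of _ "\<lambda>_. c"]) simp

lemma polynomial_fun_zero: "polynomial_fun (\<lambda>z. 0)"
  using polynomial_fun_monomial[of 0] by simp

lemma polynomial_fun_add:
  assumes "polynomial_fun p" "polynomial_fun q"
  shows "polynomial_fun (\<lambda>z. p z + q z)"
proof -
  obtain S c where S: "finite S" "\<And>z. p z = (\<Sum>\<alpha>\<in>S. c \<alpha> * monomial \<alpha> z)"
    using assms(1) unfolding polynomial_fun_def by auto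
  obtain T d where T: "finite T" "\<And>z. q z = (\<Sum>\<alpha>\<in>T. d \<alpha> * monomial \<alpha> z)"
    using assms(2) unfolding polynomial_fun_def by auto
  define e where "e \<alpha> = (if \<alpha> \<in> S then c \<alpha> else 0) + (if \<alpha> \<in> T then d \<alpha> else 0)" for \<alpha>
  have "p z + q z = (\<Sum>\<alpha>\<in>S \<union> T. e \<alpha> * monomial \<alpha> z)" for z
  proof -
    have "p z = (\<Sum>\<alpha>\<in>S \<union> T. (if \<alpha> \<in> S then c \<alpha> else 0) * monomial \<alpha> z)"
      unfolding S(2) by (rule sum.mono_neutral_cong_left) (use S(1) T(1) in auto)
    moreover have "q z = (\<Sum>\<alpha>\<in>S \<union> T. (if \<alpha> \<in> T then d \<alpha> else 0) * monomial \<alpha> z)"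
      unfolding T(2) by (rule sum.mono_neutral_cong_left) (use S(1) T(1) in auto)
    ultimately show ?thesis
      by (simp add: e_def sum.distrib[symmetric] ring_distribs)
  qed
  then show ?thesis
    unfolding polynomial_fun_def using S(1) T(1) by (intro exI[of _ "S \<union> T"] exI[of _ e]) auto
qed

lemma polynomial_fun_sum:
  assumes "finite I" "\<And>i. i \<in> I \<Longrightarrow> polynomial_fun (p i)"
  shows "polynomial_fun (\<lambda>z. \<Sum>i\<in>I. p i z)"
  using assms by (induction I) (auto simp: polynomial_fun_zero polynomial_fun_add)

lemma monomial_mult: "monomial \<alpha> z * monomial \<beta> z = monomial (\<lambda>i. \<alpha> i + \<beta> i) z"
  by (simp add: monomial_def prod.distrib power_add)

lemma polynomial_fun_mult:
  assumes "polynomial_fun p" "polynomial_fun q"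
  shows "polynomial_fun (\<lambda>z. p z * q z)"
proof -
  obtain S c where S: "finite S" "\<And>z. p z = (\<Sum>\<alpha>\<in>S. c \<alpha> * monomial \<alpha> z)"
    using assms(1) unfolding polynomial_fun_def by auto
  obtain T d where T: "finite T" "\<And>z. q z = (\<Sum>\<alpha>\<in>T. d \<alpha> * monomial \<alpha> z)"
    using assms(2) unfolding polynomial_fun_def by auto
  have "p z * q z = (\<Sum>\<alpha>\<in>S. \<Sum>\<beta>\<in>T. (c \<alpha> * d \<beta>) * monomial (\<lambda>i. \<alpha> i + \<beta> i) z)" for z
    by (simp add: S(2) T(2) sum_product monomial_mult[symmetric] mult_ac)
  then show ?thesis
    by (simp add: polynomial_fun_sum polynomial_fun_monomial S(1) T(1))
qed

lemma polynomial_fun_const: "polynomial_fun (\<lambda>z. c)"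
  using polynomial_fun_monomial[of c "\<lambda>_. 0"] by (simp add: monomial_def)

lemma polynomial_fun_coord: "polynomial_fun (\<lambda>z. z $ i)"
proof -
  have "monomial (\<lambda>j. if j = i then 1 else 0) z = z $ i" for z :: "complex ^ 'a"
    unfolding monomial_def by (subst prod.remove[of _ i]) auto
  then show ?thesis
    using polynomial_fun_monomial[of 1 "\<lambda>j. if j = i then 1 else 0"] by simp
qed

lemmas polynomial_fun_intros =
  polynomial_fun_add polynomial_fun_mult polynomial_fun_const polynomial_fun_coord polynomial_fun_sum

lemma polynomial_fun_prod:
  assumes "finite I" "\<And>i. i \<in> I \<Longrightarrow> polynomial_fun (p i)"
  shows "polynomial_fun (\<lambda>z. \<Prod>i\<in>I. p i z)"
  using assms by (induction I) (auto simp: polynomial_fun_const polynomial_fun_mult)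

lemma finite_exponents: "finite {\<alpha> :: 'n::finite \<Rightarrow> nat. (\<Sum>i\<in>UNIV. \<alpha> i) = d}"
proof (rule finite_subset)
  show "{\<alpha> :: 'n \<Rightarrow> nat. (\<Sum>i\<in>UNIV. \<alpha> i) = d} \<subseteq> PiE UNIV (\<lambda>_. {..d})"
    by (auto simp: PiE_def intro: member_le_sum)
  show "finite (PiE (UNIV :: 'n set) (\<lambda>_. {..d}))"
    by (rule finite_PiE) auto
qed

lemma homogeneous_imp_polynomial_fun: "homogeneous_poly d p \<Longrightarrow> polynomial_fun p"
  unfolding homogeneous_poly_def polynomial_fun_def using finite_exponents by blast

lemma monomial_scale: "monomial \<alpha> (t *s z) = t ^ (\<Sum>i\<in>UNIV. \<alpha> i) * monomial \<alpha> z"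
  by (simp add: monomial_def power_mult_distrib prod.distrib power_sum)

lemma homogeneous_scale:
  assumes "homogeneous_poly d p" shows "p (t *s z) = t ^ d * p z"
proof -
  obtain c where c: "\<And>z. p z = (\<Sum>\<alpha> | (\<Sum>i\<in>UNIV. \<alpha> i) = d. c \<alpha> * monomial \<alpha> z)"
    using assms unfolding homogeneous_poly_def by auto
  show ?thesis
    unfolding c sum_distrib_left by (rule sum.cong) (auto simp: monomial_scale)
qed

lemma polynomial_fun_on_line:
  assumes "polynomial_fun p"
  obtains P where "\<And>t. p (z + t *s v) = poly P t"
proof -
  have mono: "\<exists>P. \<forall>t. monomial \<alpha> (z + t *s v) = poly P t" for \<alpha>
    by (rule exI[of _ "\<Prod>i\<in>UNIV. [:z $ i, v $ i:] ^ \<alpha> i"]) (simp add: monomial_def poly_prod)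
  obtain S c where S: "finite S" "\<And>z. p z = (\<Sum>\<alpha>\<in>S. c \<alpha> * monomial \<alpha> z)"
    using assms unfolding polynomial_fun_def by auto
  obtain Q where Q: "\<And>\<alpha> t. monomial \<alpha> (z + t *s v) = poly (Q \<alpha>) t"
    using mono by metis
  show ?thesis
    by (rule that[of "\<Sum>\<alpha>\<in>S. smult (c \<alpha>) (Q \<alpha>)"]) (simp add: S(2) Q poly_sum)
qed

section \<open>The Nullstellensatz for hypersurfaces\<close>

text \<open>A ring with points in \<open>'p\<close> that behaves like the polynomials on an affine space: elements are
  determined by their values, and a prime divides everything that vanishes on its zero set.\<close>

definition eval_family :: "('p \<Rightarrow> 'a::factorial_ring_gcd \<Rightarrow> complex) \<Rightarrow> bool" where
  "eval_family ev \<longleftrightarrow>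
     (\<forall>a. ev a 0 = 0 \<and> ev a 1 = 1) \<and>
     (\<forall>a x y. ev a (x + y) = ev a x + ev a y \<and> ev a (x * y) = ev a x * ev a y) \<and>
     (\<forall>x. (\<forall>a. ev a x = 0) \<longrightarrow> x = 0) \<and>
     (\<forall>\<pi> x. prime_elem \<pi> \<and> (\<forall>a. ev a \<pi> = 0 \<longrightarrow> ev a x = 0) \<longrightarrow> \<pi> dvd x)"

definition eval_lift :: "('p \<Rightarrow> 'a::zero \<Rightarrow> complex) \<Rightarrow> 'p \<times> complex \<Rightarrow> 'a poly \<Rightarrow> complex" where
  "eval_lift ev = (\<lambda>(a, b) p. poly (map_poly (ev a) p) b)"

lemma eval_lift_pCons:
  "ev a 0 = 0 \<Longrightarrow> eval_lift ev (a, b) (pCons c p) = ev a c + b * eval_lift ev (a, b) p"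
  by (simp add: eval_lift_def map_poly_pCons)

lemma eval_lift_0: "eval_lift ev (a, b) 0 = 0"
  by (simp add: eval_lift_def)

lemma eval_lift_1: "ev a 0 = 0 \<Longrightarrow> eval_lift ev (a, b) 1 = ev a 1"
  by (simp add: one_pCons eval_lift_pCons eval_lift_0)

lemma map_poly_hom:
  fixes f :: "'a::comm_ring_1 \<Rightarrow> 'b::comm_ring_1"
  assumes "f 0 = 0" "\<And>x y. f (x + y) = f x + f y" "\<And>x y. f (x * y) = f x * f y"
  shows "map_poly f (p + q) = map_poly f p + map_poly f q"
    and "map_poly f (p * q) = map_poly f p * map_poly f q"
proof -
  have add: "map_poly f (p + q) = map_poly f p + map_poly f q" for p q
    by (rule poly_eqI) (simp add: coeff_map_poly assms)
  have sm: "map_poly f (smult c q) = smult (f c) (map_poly f q)" for c q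
    by (rule poly_eqI) (simp add: coeff_map_poly assms)
  show "map_poly f (p + q) = map_poly f p + map_poly f q" by (rule add)
  show "map_poly f (p * q) = map_poly f p * map_poly f q"
    by (induction p) (simp_all add: map_poly_pCons assms(1) add sm)
qed

text \<open>Pseudo-division replaces division with remainder, at the price of constant factors, so that a
  non-zero element of least degree in the ideal of \<open>p\<close> and \<open>q\<close> is almost a common divisor.\<close>

lemma ideal_min_degree:
  fixes p q :: "'a::idom poly"
  assumes "p \<noteq> 0"
  obtains r s t where "r \<noteq> 0" "r = s * p + t * q"
    "\<exists>c u. c \<noteq> 0 \<and> smult c p = r * u" "\<exists>c u. c \<noteq> 0 \<and> smult c q = r * u"
proof -
  define I where "I = {r. r \<noteq> 0 \<and> (\<exists>s t. r = s * p + t * q)}"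
  have "p = 1 * p + 0 * q" by simp
  then have "p \<in> I" using assms unfolding I_def by blast
  then obtain r where r: "r \<in> I" "\<And>r'. r' \<in> I \<Longrightarrow> degree r \<le> degree r'"
    using arg_min_natI[of "\<lambda>r. r \<in> I" p degree] arg_min_nat_le[of "\<lambda>r. r \<in> I" _ degree] by metis
  obtain s t where st: "r = s * p + t * q" "r \<noteq> 0" using r(1) unfolding I_def by auto
  have main: "\<exists>c u. c \<noteq> 0 \<and> smult c f = r * u" if "f = s' * p + t' * q" for f s' t'
  proof -
    obtain u e where ue: "pseudo_divmod f r = (u, e)" by fastforce
    define c where "c = lead_coeff r ^ (Suc (degree f) - degree r)"
    have 1: "smult c f = r * u + e" and 2: "e = 0 \<or> degree e < degree r"
      using pseudo_divmod[OF st(2) ue] unfolding c_def by auto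
    have c: "c \<noteq> 0" using st(2) by (simp add: c_def)
    have "e = smult c f - r * u" using 1 by simp
    also have "\<dots> = (smult c s' - u * s) * p + (smult c t' - u * t) * q"
      unfolding that st(1) by (simp add: algebra_simps smult_add_right)
    finally have "e = 0" using r(2)[of e] 2 unfolding I_def by force
    then show ?thesis using c 1 by auto
  qed
  have "\<exists>c u. c \<noteq> 0 \<and> smult c p = r * u" by (rule main[of p 1 0]) simp
  moreover have "\<exists>c u. c \<noteq> 0 \<and> smult c q = r * u" by (rule main[of q 0 1]) simp
  ultimately show ?thesis using that st by blast
qed

text \<open>Adjoining a variable.  A prime of degree 0 is handled coefficientwise.  For a prime \<open>\<pi>\<close> of
  positive degree that does not divide \<open>q\<close>, the almost common divisor of \<open>\<pi>\<close> and \<open>q\<close> must be a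
  non-zero constant \<open>c = s \<pi> + t q\<close>.  At a base point where neither \<open>c\<close> nor the leading
  coefficient of \<open>\<pi>\<close> vanishes, \<open>\<pi>\<close> has a root by the fundamental theorem of algebra; there
  \<open>q\<close> vanishes too, and so would \<open>c\<close>.\<close>

lemma eval_family_lift:
  fixes ev :: "'p \<Rightarrow> 'a::{factorial_ring_gcd,semiring_gcd_mult_normalize} \<Rightarrow> complex"
  assumes ev: "eval_family ev"
  shows "eval_family (eval_lift ev)"
proof -
  have ev0: "ev a 0 = 0" and ev1: "ev a 1 = 1" and eva: "ev a (x + y) = ev a x + ev a y"
    and evm: "ev a (x * y) = ev a x * ev a y" for a x y
    using ev unfolding eval_family_def by auto
  have evz: "x = 0" if "\<And>a. ev a x = 0" for x
    using that ev unfolding eval_family_def by blast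
  have evp: "\<pi> dvd x" if "prime_elem \<pi>" "\<And>a. ev a \<pi> = 0 \<Longrightarrow> ev a x = 0" for \<pi> x
    using that ev unfolding eval_family_def by blast
  have add: "eval_lift ev c (x + y) = eval_lift ev c x + eval_lift ev c y"
    and mult: "eval_lift ev c (x * y) = eval_lift ev c x * eval_lift ev c y" for c x y
    by (auto simp: eval_lift_def map_poly_hom ev0 eva evm split: prod.splits)
  have zero: "eval_lift ev c 0 = 0" and one: "eval_lift ev c 1 = 1" for c
    by (auto simp: eval_lift_def ev1 split: prod.splits)
  have const: "eval_lift ev (a, b) [:x:] = ev a x" for a b x
    by (simp add: eval_lift_def map_poly_pCons ev0)
  have all0: "ev a (coeff p i) = 0" if "\<And>b. eval_lift ev (a, b) p = 0" for a p i
  proof -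
    have "map_poly (ev a) p = 0"
      using that poly_all_0_iff_0[of "map_poly (ev a) p"] by (simp add: eval_lift_def)
    then have "coeff (map_poly (ev a) p) i = 0" by simp
    then show ?thesis by (simp add: coeff_map_poly ev0)
  qed
  have pr: "\<pi> dvd q" if pi: "prime_elem \<pi>" and van: "\<And>c. eval_lift ev c \<pi> = 0 \<Longrightarrow> eval_lift ev c q = 0" for \<pi> q
  proof (cases "degree \<pi> = 0")
    case True
    then obtain c where c: "\<pi> = [:c:]" by (metis degree_eq_zeroE)
    then have "prime_elem c" using pi prime_elem_const_poly_iff by blast
    have "c dvd coeff q i" for i
      by (rule evp[OF \<open>prime_elem c\<close>]) (rule all0, rule van, simp add: c const)
    then show ?thesis by (simp add: c const_poly_dvd_iff)
  next
    case False
    show ?thesis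
    proof (rule ccontr)
      assume nd: "\<not> \<pi> dvd q"
      have "\<pi> \<noteq> 0" using False by auto
      then obtain r s t where r: "r \<noteq> 0" "r = s * \<pi> + t * q"
        "\<exists>c u. c \<noteq> 0 \<and> smult c \<pi> = r * u" "\<exists>c u. c \<noteq> 0 \<and> smult c q = r * u"
        by (rule ideal_min_degree)
      have deg: "\<not> \<pi> dvd [:c:]" if "c \<noteq> 0" for c
        using that False dvd_imp_degree_le[of \<pi> "[:c:]"] by auto
      show False
      proof (cases "degree r = 0")
        case True
        then obtain c where c: "r = [:c:]" by (metis degree_eq_zeroE)
        have "c * lead_coeff \<pi> \<noteq> 0" using r(1) c \<open>\<pi> \<noteq> 0\<close> by simp
        then obtain a where a: "ev a (c * lead_coeff \<pi>) \<noteq> 0" using evz by blast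
        then have a1: "ev a c \<noteq> 0" and a2: "ev a (lead_coeff \<pi>) \<noteq> 0" by (auto simp: evm)
        have "coeff (map_poly (ev a) \<pi>) (degree \<pi>) \<noteq> 0"
          using a2 by (simp add: coeff_map_poly ev0)
        then have "degree \<pi> \<le> degree (map_poly (ev a) \<pi>)" by (rule le_degree)
        then have "\<not> constant (poly (map_poly (ev a) \<pi>))"
          using False by (simp add: constant_degree)
        then obtain b where b: "eval_lift ev (a, b) \<pi> = 0"
          using Fundamental_Theorem_Algebra.fundamental_theorem_of_algebra by (auto simp: eval_lift_def)
        have "eval_lift ev (a, b) r = 0"
          unfolding r(2) add mult using b van by simp
        then show False using a1 c const by simp
      next
        case False
        obtain c u where cu: "c \<noteq> 0" "smult c \<pi> = r * u" using r(3) by auto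
        obtain d w where dw: "d \<noteq> 0" "smult d q = r * w" using r(4) by auto
        have "\<pi> dvd r * u" unfolding cu(2)[symmetric] by (simp add: dvd_smult)
        then consider "\<pi> dvd r" | "\<pi> dvd u" using pi prime_elem_dvd_mult_iff by blast
        then show False
        proof cases
          case 1
          then have "\<pi> dvd [:d:] * q" using dw(2) by simp
          then show False using pi prime_elem_dvd_mult_iff deg[OF dw(1)] nd by blast
        next
          case 2
          then obtain u' where "u = \<pi> * u'" by auto
          then have "\<pi> * [:c:] = \<pi> * (r * u')" using cu(2) by simp
          then have "[:c:] = r * u'" using \<open>\<pi> \<noteq> 0\<close> mult_left_cancel by blast
          then have "r dvd [:c:]" by simp
          then have "degree r \<le> degree [:c:]" using \<open>c \<noteq> 0\<close> by (intro dvd_imp_degree_le) auto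
          then show False using False by simp
        qed
      qed
    qed
  qed
  have z: "x = 0" if "\<And>c. eval_lift ev c x = 0" for x
  proof (rule poly_eqI)
    fix i
    show "coeff x i = coeff 0 i"
      using evz[of "coeff x i"] all0[of _ x i] that by simp
  qed
  show ?thesis
    unfolding eval_family_def using add mult zero one z pr by blast
qed

lemma eval_family_base: "eval_family (\<lambda>(_::unit) (c::complex). c)"
  unfolding eval_family_def prime_elem_def by (auto simp: dvd_field_iff)

section \<open>Hypersurfaces and codimension two\<close>

locale polynomial_ring =
  fixes ev :: "complex ^ 'n::finite \<Rightarrow> 'a::{factorial_ring_gcd,semiring_gcd_mult_normalize} \<Rightarrow> complex"
  assumes family: "eval_family ev"
    and poly_ev: "polynomial_fun (\<lambda>z. ev z p)"
    and ev_ex: "polynomial_fun f \<Longrightarrow> \<exists>p. \<forall>z. f z = ev z p"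
begin

lemma ev_surj: assumes "polynomial_fun f" obtains p where "\<And>z. f z = ev z p"
  using ev_ex[OF assms] by blast

lemma ev_add: "ev z (p + q) = ev z p + ev z q"
  and ev_mult: "ev z (p * q) = ev z p * ev z q"
  and ev_0: "ev z 0 = 0" and ev_1: "ev z 1 = 1"
  and ev_eq_0: "(\<And>z. ev z p = 0) \<Longrightarrow> p = 0"
  and ev_prime: "prime_elem \<pi> \<Longrightarrow> (\<And>z. ev z \<pi> = 0 \<Longrightarrow> ev z p = 0) \<Longrightarrow> \<pi> dvd p"
  using family unfolding eval_family_def by blast+

text \<open>The zero set \<open>Y\<close> of a prime is irreducible, so the codimension hypothesis gives irreducible sets
  \<open>Y \<subset> C\<^sub>1 \<subset> C\<^sub>2\<close>.  Some non-zero \<open>p\<close> vanishes on \<open>C\<^sub>1\<close>.  After removing all factors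
  \<open>\<pi>\<close> from \<open>p\<close>, the rest \<open>q\<close> still vanishes on \<open>C\<^sub>1\<close>, because \<open>C\<^sub>1\<close> is irreducible and not
  inside \<open>Y\<close>; but then \<open>q\<close> vanishes on \<open>Y\<close> and \<open>\<pi>\<close> divides it.\<close>

lemma codim_no_prime:
  assumes cod: "codim_at_least 2 Z" and pi: "prime_elem \<pi>" and sub: "{z. ev z \<pi> = 0} \<subseteq> Z"
  shows False
proof -
  let ?Y = "{z. ev z \<pi> = 0}"
  have clY: "zariski_closed ?Y"
    unfolding zariski_closed_def by (rule exI[of _ "{\<lambda>z. ev z \<pi>}"]) (auto simp: poly_ev)
  have sep: "\<exists>q. (\<forall>z\<in>S. ev z q = 0) \<and> ev x q \<noteq> 0" if "zariski_closed S" "x \<notin> S" for S x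
  proof -
    obtain P where P: "\<forall>p\<in>P. polynomial_fun p" "S = {z. \<forall>p\<in>P. p z = 0}"
      using \<open>zariski_closed S\<close> unfolding zariski_closed_def by auto
    then obtain p where p: "p \<in> P" "p x \<noteq> 0" using \<open>x \<notin> S\<close> by auto
    then obtain q where q: "\<And>z. p z = ev z q" using ev_surj P(1) by metis
    have "\<forall>z\<in>S. ev z q = 0" using P(2) p(1) q by auto
    then show ?thesis using p(2) q by auto
  qed
  have npi: "\<not> \<pi> dvd p" if "ev x p \<noteq> 0" "ev x \<pi> = 0" for p x
    using that by (auto simp: ev_mult)
  have irrY: "zariski_irreducible ?Y"
    unfolding zariski_irreducible_def
  proof (intro conjI allI impI clY)
    show "?Y \<noteq> {}"
    proof
      assume "?Y = {}"
      then have "\<pi> dvd 1" using ev_prime[OF pi, of 1] by auto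
      then show False using pi by (simp add: prime_elem_def)
    qed
    fix S T :: "(complex ^ 'n) set" assume ST: "zariski_closed S \<and> zariski_closed T \<and> ?Y = S \<union> T"
    show "?Y = S \<or> ?Y = T"
    proof (rule ccontr)
      assume n: "\<not> (?Y = S \<or> ?Y = T)"
      then obtain x where x: "ev x \<pi> = 0" "x \<notin> S" using ST by blast
      from n obtain y where y: "ev y \<pi> = 0" "y \<notin> T" using ST by blast
      obtain p where p: "\<forall>z\<in>S. ev z p = 0" "ev x p \<noteq> 0" using sep ST x by blast
      obtain q where q: "\<forall>z\<in>T. ev z q = 0" "ev y q \<noteq> 0" using sep ST y by blast
      have "\<pi> dvd p * q"
        using ST p(1) q(1) by (intro ev_prime[OF pi]) (auto simp: ev_mult set_eq_iff)
      then show False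
        using npi[OF p(2) x(1)] npi[OF q(2) y(1)] pi prime_elem_dvd_mult_iff by blast
    qed
  qed
  obtain C where C: "C 0 = ?Y" "\<forall>i\<le>(2::nat). zariski_irreducible (C i)" "\<forall>i<2. C i \<subset> C (Suc i)"
    using cod irrY sub unfolding codim_at_least_def by metis
  have C01: "?Y \<subset> C 1" and C12: "C 1 \<subset> C 2" using C(1,3) by (auto simp: numeral_2_eq_2)
  have cl1: "zariski_closed (C 1)" and irr1: "zariski_irreducible (C 1)"
    using C(2)[rule_format, of 1] by (simp_all add: zariski_irreducible_def)
  obtain y where "y \<in> C 2" "y \<notin> C 1" using C12 by blast
  then obtain p where p: "\<forall>z\<in>C 1. ev z p = 0" "ev y p \<noteq> 0" using sep[OF cl1] by blast
  have "p \<noteq> 0" using p(2) ev_0 by auto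
  have pu: "\<not> is_unit \<pi>" "\<pi> \<noteq> 0" using pi by (auto simp: prime_elem_def)
  obtain q where q: "p = \<pi> ^ multiplicity \<pi> p * q" "\<not> \<pi> dvd q"
    using multiplicity_decompose'[OF \<open>p \<noteq> 0\<close> pu(1)] by blast
  have "C 1 = (C 1 \<inter> ?Y) \<union> (C 1 \<inter> {z. ev z q = 0})"
  proof -
    have pow: "ev z (a ^ n) = ev z a ^ n" for z a n
      by (induction n) (auto simp: ev_1 ev_mult)
    have "ev z \<pi> = 0 \<or> ev z q = 0" if "z \<in> C 1" for z
    proof -
      have "ev z (\<pi> ^ multiplicity \<pi> p * q) = 0" using p(1) that q(1) by auto
      then have "ev z \<pi> ^ multiplicity \<pi> p * ev z q = 0" by (simp only: ev_mult pow)
      then show ?thesis by auto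
    qed
    then show ?thesis by blast
  qed
  moreover have "zariski_closed (C 1 \<inter> {z. ev z r = 0})" for r
  proof -
    obtain P where P: "\<forall>p\<in>P. polynomial_fun p" "C 1 = {z. \<forall>p\<in>P. p z = 0}"
      using cl1 unfolding zariski_closed_def by auto
    show ?thesis unfolding zariski_closed_def
      by (rule exI[of _ "insert (\<lambda>z. ev z r) P"]) (use P poly_ev in auto)
  qed
  ultimately have "C 1 = C 1 \<inter> ?Y \<or> C 1 = C 1 \<inter> {z. ev z q = 0}"
    using irr1 unfolding zariski_irreducible_def by blast
  then have "C 1 \<subseteq> {z. ev z q = 0}" using C01 by blast
  then have "\<pi> dvd q" using C01 by (intro ev_prime[OF pi]) auto
  then show False using q(2) by simp
qed

lemma codim_no_hypersurface:
  assumes cod: "codim_at_least 2 Z" and g: "\<not> is_unit g" and sub: "{z. ev z g = 0} \<subseteq> Z"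
  shows False
proof -
  obtain \<pi> where "prime \<pi>" "\<pi> dvd g"
  proof (cases "g = 0")
    case True
    obtain x where x: "\<And>z. z $ undefined = ev z x"
      using ev_surj[OF polynomial_fun_coord] by blast
    have "x \<noteq> 0" using x[of 1] ev_0[of 1] by auto
    moreover have "\<not> is_unit x"
    proof
      assume "is_unit x"
      then obtain h where "1 = x * h" ..
      then show False using ev_mult[of 0 x h] ev_1[of 0] x[of 0] by simp
    qed
    ultimately obtain \<pi> :: 'a where "prime \<pi>" using prime_divisor_exists[of x] by blast
    then show ?thesis using that True by simp
  qed (use g prime_divisor_exists that in blast)
  then obtain h where "g = \<pi> * h" by (auto elim: dvdE)
  then have "{z. ev z \<pi> = 0} \<subseteq> Z" using sub by (auto simp: ev_mult)
  then show ?thesis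
    using codim_no_prime[OF cod prime_imp_prime_elem[OF \<open>prime \<pi>\<close>]] by blast
qed

text \<open>By the codimension hypothesis the coefficients of \<open>A\<close> have greatest common divisor 1, so parallelism
  makes \<open>D\<close> a polynomial multiple of \<open>A\<close>.  The factor is constant along rays where \<open>A\<close> does not
  vanish, as both sides are homogeneous of the same degree, and hence equals its value at 0.\<close>

lemma polynomial_proportional:
  fixes A D :: "complex ^ 'n \<Rightarrow> complex ^ 'n"
  assumes cod: "codim_at_least 2 (sing_set A)"
    and A: "\<And>k. homogeneous_poly d (\<lambda>z. A z $ k)" 
    and D: "\<And>k. polynomial_fun (\<lambda>z. D z $ k)" and D': "\<And>k t z. D (t *s z) $ k = t ^ d * D z $ k"
    and par: "\<And>z i j. A z $ i * D z $ j = A z $ j * D z $ i"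
  obtains c where "\<And>z. D z = c *s A z"
proof -
  obtain a where a: "\<And>z k. A z $ k = ev z (a k)"
  proof -
    have "\<exists>P. \<forall>z. A z $ k = ev z P" for k
      using ev_surj[OF homogeneous_imp_polynomial_fun[OF A[of k]]] by metis
    then obtain a where "\<forall>k z. A z $ k = ev z (a k)" by metis
    then show ?thesis using that by blast
  qed
  obtain e where e: "\<And>z k. D z $ k = ev z (e k)"
  proof -
    have "\<exists>P. \<forall>z. D z $ k = ev z P" for k
      using ev_surj[OF D[of k]] by metis
    then obtain a where "\<forall>k z. D z $ k = ev z (a k)" by metis
    then show ?thesis using that by blast
  qed
  have ext: "p = q" if "\<And>z. ev z p = ev z q" for p q
  proof -
    have "ev z (p + (-1) * q) = 0" for z
    proof -
      have "ev z (-1) + ev z 1 = 0" by (simp add: ev_add[symmetric] ev_0)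
      then have "ev z (-1) = -1" by (simp add: ev_1 eq_neg_iff_add_eq_0)
      then show ?thesis by (simp only: ev_add ev_mult that) simp
    qed
    then have "p + (-1) * q = 0" by (rule ev_eq_0)
    then show ?thesis by simp
  qed
  have par': "a i * e j = a j * e i" for i j
    by (rule ext) (simp only: ev_mult a[symmetric] e[symmetric] par)
  have G1: "is_unit (Gcd (range a))"
  proof (rule ccontr)
    assume n: "\<not> is_unit (Gcd (range a))"
    have "{z. ev z (Gcd (range a)) = 0} \<subseteq> sing_set A"
    proof
      fix z assume z: "z \<in> {z. ev z (Gcd (range a)) = 0}"
      have "ev z (a k) = 0" for k
      proof -
        have "Gcd (range a) dvd a k" by (rule Gcd_dvd) simp
        then obtain h where "a k = Gcd (range a) * h" ..
        then show ?thesis using z by (simp add: ev_mult)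
      qed
      then show "z \<in> sing_set A" by (simp add: sing_set_def a)
    qed
    then show False using codim_no_hypersurface[OF cod n] by blast
  qed
  have "\<exists>k. a k \<noteq> 0"
  proof (rule ccontr)
    assume "\<not> ?thesis"
    then have "range a = {0}" by auto
    then show False using G1 by simp
  qed
  then obtain k0 where k0: "a k0 \<noteq> 0" ..
  have "a k0 dvd e k0 * a k" for k 
  proof -
    have "e k0 * a k = a k0 * e k" using par'[of k0 k] by (simp add: mult.commute)
    then show ?thesis by simp
  qed
  then have "a k0 dvd Gcd ((*) (e k0) ` range a)" by (intro Gcd_greatest) (simp only: image_image, blast)
  then have "a k0 dvd e k0 * Gcd (range a)" by (simp add: Gcd_mult)
  then have "a k0 dvd e k0" using G1 by (simp add: dvd_mult_unit_iff)
  then obtain c where c: "e k0 = a k0 * c" ..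
  have ec: "e i = a i * c" for i
  proof -
    have "a k0 * e i = a k0 * (a i * c)" using par'[of k0 i] c by (simp add: mult_ac)
    then show ?thesis using k0 by simp
  qed
  have Dc: "D z $ i = ev z c * A z $ i" for z i by (simp add: e ec a ev_mult)
  have c0: "ev z c = ev 0 c" if i: "A z $ i \<noteq> 0" for z i
  proof -
    obtain P where P: "\<And>t. ev (0 + t *s z) c = poly P t"
      using polynomial_fun_on_line[OF poly_ev] by blast
    have const: "poly P t = ev z c" if t: "t \<noteq> 0" for t
    proof -
      have "t ^ d * A z $ i * ev (t *s z) c = t ^ d * A z $ i * ev z c"
        using D'[of t z i] Dc[of "t *s z" i] Dc[of z i] homogeneous_scale[OF A[of i], of t z]
        by (simp add: mult_ac)
      then show ?thesis using i t P[of t] by simp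
    qed
    have "P - [:ev z c:] = 0"
    proof (rule ccontr)
      assume "P - [:ev z c:] \<noteq> 0"
      then have "finite {t. poly (P - [:ev z c:]) t = 0}" by (rule poly_roots_finite)
      moreover have "UNIV - {0} \<subseteq> {t. poly (P - [:ev z c:]) t = 0}" using const by auto
      ultimately have "finite (UNIV - {0} :: complex set)" by (rule finite_subset[rotated])
      then show False by (simp add: infinite_UNIV_char_0)
    qed
    then have "poly P 0 = ev z c" by simp
    then show ?thesis using P[of 0] by simp
  qed
  have "D z = ev 0 c *s A z" for z
    unfolding vec_eq_iff
  proof
    fix i show "D z $ i = (ev 0 c *s A z) $ i"
      using Dc[of z i] c0[of z i] by (cases "A z $ i = 0") auto
  qed
  then show ?thesis by (rule that)
qed

lemma nonzero_on_hyperplane: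
  fixes A :: "complex ^ 'n \<Rightarrow> complex ^ 'n"
  assumes cod: "codim_at_least 2 (sing_set A)" and l: "l \<noteq> (0 :: complex ^ 'n)"
  obtains z where "(\<Sum>k\<in>UNIV. l $ k * z $ k) = 0" "A z \<noteq> 0"
proof -
  have "polynomial_fun (\<lambda>z. \<Sum>k\<in>UNIV. l $ k * z $ k)"
    by (intro polynomial_fun_sum polynomial_fun_mult polynomial_fun_const polynomial_fun_coord finite)
  then obtain g where g: "\<And>z :: complex ^ 'n. (\<Sum>k\<in>UNIV. l $ k * z $ k) = ev z g"
    using ev_ex by blast
  have "\<not> is_unit g"
  proof
    assume "is_unit g"
    then obtain h where h: "1 = g * h" ..
    have "ev 0 g = 0" using g[of 0] by simp
    then show False using h ev_mult[of 0 g h] ev_1[of 0] by simp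
  qed
  then have "\<not> {z. ev z g = 0} \<subseteq> sing_set A" using codim_no_hypersurface[OF cod] by blast
  then obtain z where z: "ev z g = 0" "z \<notin> sing_set A" by blast
  then have "A z \<noteq> 0" by (auto simp: sing_set_def)
  then show ?thesis using that[of z] g[of z] z(1) by simp
qed

end

section \<open>The polynomial ring in five variables\<close>

text \<open>Iterated univariate polynomials inherit unique factorisation from one level to the next, and each
  level is an instance of \<open>eval_family_lift\<close>.\<close>

type_synonym poly5 = "complex poly poly poly poly poly"

definition ev5 :: "complex ^ 5 \<Rightarrow> poly5 \<Rightarrow> complex" where
  "ev5 z = eval_lift (eval_lift (eval_lift (eval_lift (eval_lift (\<lambda>(_::unit) (c::complex). c)))))
     ((((((), z $ 0), z $ 1), z $ 2), z $ 3), z $ 4)"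

lemma UNIV_5: "(UNIV :: 5 set) = {0, 1, 2, 3, 4}"
proof -
  have "x \<in> {0, 1, 2, 3, 4}" for x :: 5
  proof (induct x)
    case (of_int z)
    then have "z = 0 \<or> z = 1 \<or> z = 2 \<or> z = 3 \<or> z = 4" by fastforce
    then show ?case by auto
  qed
  then show ?thesis by auto
qed

lemma vec5_exists: "\<exists>z :: complex ^ 5. z $ 0 = a \<and> z $ 1 = b \<and> z $ 2 = c \<and> z $ 3 = d \<and> z $ 4 = e"
  by (rule exI[of _ "\<chi> i. if i = 0 then a else if i = 1 then b else if i = 2 then c
      else if i = 3 then d else e"]) simp

lemma eval_family_reindex:
  assumes ev: "eval_family ev" and f: "surj f"
  shows "eval_family (\<lambda>z. ev (f z))"
proof -
  have all: "(\<forall>z. P (f z)) \<longleftrightarrow> (\<forall>a. P a)" for P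
    using f by (metis surj_def)
  have 3: "(\<forall>x. (\<forall>a. ev (f a) x = 0) \<longrightarrow> x = 0)"
    using ev unfolding eval_family_def all[of "\<lambda>a. ev a _ = 0"] by blast
  have 4: "\<forall>\<pi> x. prime_elem \<pi> \<and> (\<forall>a. ev (f a) \<pi> = 0 \<longrightarrow> ev (f a) x = 0) \<longrightarrow> \<pi> dvd x"
    using ev unfolding eval_family_def all[of "\<lambda>a. ev a _ = 0 \<longrightarrow> ev a _ = 0"] by blast
  show ?thesis
    unfolding eval_family_def
    apply (intro conjI 3 4)
    using ev unfolding eval_family_def by simp_all
qed

lemma eval_family_ev5: "eval_family ev5"
proof -
  have "surj (\<lambda>z :: complex ^ 5. ((((((), z $ 0), z $ 1), z $ 2), z $ 3), z $ 4))"
    unfolding surj_def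
  proof
    fix p :: "((((unit \<times> complex) \<times> complex) \<times> complex) \<times> complex) \<times> complex"
    obtain z :: "complex ^ 5" where "z $ 0 = snd (fst (fst (fst (fst p))))"
      "z $ 1 = snd (fst (fst (fst p)))" "z $ 2 = snd (fst (fst p))" "z $ 3 = snd (fst p)"
      "z $ 4 = snd p"
      using vec5_exists by blast
    then show "\<exists>z :: complex ^ 5. p = ((((((), z $ 0), z $ 1), z $ 2), z $ 3), z $ 4)"
      by (intro exI[of _ z]) (simp add: prod_eq_iff)
  qed
  moreover have "eval_family (eval_lift (eval_lift (eval_lift (eval_lift (eval_lift (\<lambda>(_::unit) (c::complex). c))))))"
    by (rule eval_family_lift)+ (rule eval_family_base)
  ultimately show ?thesis
    unfolding ev5_def by (rule eval_family_reindex[rotated])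
qed

lemma polynomial_fun_lift:
  assumes "\<And>c. polynomial_fun (\<lambda>z. ev (g z) c)" "polynomial_fun h" "\<And>a. ev a 0 = 0"
  shows "polynomial_fun (\<lambda>z. eval_lift ev (g z, h z) p)"
  by (induction p)
    (auto simp: eval_lift_def map_poly_pCons assms(3) polynomial_fun_const
      intro!: polynomial_fun_add polynomial_fun_mult assms(1,2))

lemma polynomial_fun_ev5: "polynomial_fun (\<lambda>z. ev5 z p)"
  unfolding ev5_def
  by (intro polynomial_fun_lift polynomial_fun_coord) (auto simp: polynomial_fun_const eval_lift_def split: prod.splits)

lemma ev5_add: "ev5 z (p + q) = ev5 z p + ev5 z q"
  and ev5_mult: "ev5 z (p * q) = ev5 z p * ev5 z q"
  and ev5_0: "ev5 z 0 = 0" and ev5_1: "ev5 z 1 = 1"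
  using eval_family_ev5 unfolding eval_family_def by blast+

lemma ev5_const: "ev5 z [:[:[:[:[:c:]:]:]:]:] = c"
  by (simp add: ev5_def eval_lift_pCons eval_lift_0)

lemma ev5_coord: "\<exists>p. \<forall>z. ev5 z p = z $ i"
proof -
  have "ev5 z [:[:[:[:[:0, 1:]:]:]:]:] = z $ 0" "ev5 z [:[:[:[:0, 1:]:]:]:] = z $ 1"
    "ev5 z [:[:[:0, 1:]:]:] = z $ 2" "ev5 z [:[:0, 1:]:] = z $ 3" "ev5 z [:0, 1:] = z $ 4" for z
    by (simp_all add: ev5_def eval_lift_pCons eval_lift_0 eval_lift_1)
  moreover have "i \<in> {0, 1, 2, 3, 4}" using UNIV_5 by blast
  ultimately show ?thesis by blast
qed

lemma polynomial_fun_5: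
  assumes "polynomial_fun p" obtains P where "\<And>z. p z = ev5 z P"
proof -
  obtain X where X: "\<And>i z. ev5 z (X i) = z $ i" using ev5_coord by metis
  have pow: "ev5 z (p ^ n) = ev5 z p ^ n" for z p n
    by (induction n) (auto simp: ev5_1 ev5_mult)
  have prod: "ev5 z (\<Prod>i\<in>I. f i) = (\<Prod>i\<in>I. ev5 z (f i))" if "finite I" for z f and I :: "5 set"
    using that by induction (auto simp: ev5_1 ev5_mult)
  have sum: "ev5 z (\<Sum>i\<in>I. f i) = (\<Sum>i\<in>I. ev5 z (f i))" if "finite I" for z f and I :: "(5 \<Rightarrow> nat) set"
    using that by induction (auto simp: ev5_0 ev5_add)
  obtain S c where S: "finite S" "\<And>z. p z = (\<Sum>\<alpha>\<in>S. c \<alpha> * monomial \<alpha> z)"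
    using assms(1) unfolding polynomial_fun_def by auto
  have eq: "p z = ev5 z (\<Sum>\<alpha>\<in>S. [:[:[:[:[:c \<alpha>:]:]:]:]:] * (\<Prod>i\<in>UNIV. X i ^ \<alpha> i))" for z
    by (simp only: sum[OF S(1)] S(2) ev5_mult ev5_const prod[OF finite] pow X monomial_def)
  show ?thesis
    using eq by (rule that)
qed

lemma polynomial_ring_ev5: "polynomial_ring ev5"
proof
  show "eval_family ev5" by (fact eval_family_ev5)
  show "polynomial_fun (\<lambda>z. ev5 z p)" for p by (fact polynomial_fun_ev5)
  show "\<exists>p. \<forall>z. f z = ev5 z p" if "polynomial_fun f" for f
    using that polynomial_fun_5 by blast
qed

lemmas polynomial_proportional = polynomial_ring.polynomial_proportional[OF polynomial_ring_ev5]
lemmas nonzero_on_hyperplane = polynomial_ring.nonzero_on_hyperplane[OF polynomial_ring_ev5]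

section \<open>Holomorphic vector fields on projective space\<close>

lemma bounded_linear_vec_line: "bounded_linear (\<lambda>t :: complex. t *s (v :: complex ^ 'n::finite))"
proof -
  have "linear (\<lambda>t :: complex. t *s v)"
    by (rule linearI) (simp_all add: vec_eq_iff distrib_right)
  then show ?thesis by (simp add: linear_conv_bounded_linear)
qed

lemma holomorphic_on_line:
  fixes f :: "complex ^ 'n::finite \<Rightarrow> complex"
  assumes f: "holomorphic_fun_on S f" and S: "\<And>t. w + t *s v \<in> S"
  shows "(\<lambda>t. f (w + t *s v)) holomorphic_on UNIV"
    and "(f has_derivative D) (at w within S) \<Longrightarrow> (\<forall>c v. D (c *s v) = c * D v) \<Longrightarrow>
      ((\<lambda>t. f (w + t *s v)) has_field_derivative D v) (at 0)"
proof -
  have main: "((\<lambda>t. f (w + t *s v)) has_field_derivative D v) (at t)"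
    if D: "(f has_derivative D) (at (w + t *s v) within S)" "\<forall>c v. D (c *s v) = c * D v" for D t
  proof -
    have 1: "((\<lambda>t. w + t *s v) has_derivative (\<lambda>s. s *s v)) (at t within UNIV)"
      using has_derivative_add[OF has_derivative_const[of w]
          bounded_linear_imp_has_derivative[OF bounded_linear_vec_line[of v]]] by simp
    have "(f \<circ> (\<lambda>t. w + t *s v) has_derivative D \<circ> (\<lambda>s. s *s v)) (at t within UNIV)"
      by (rule diff_chain_within[OF 1]) (use D(1) S in \<open>auto intro: has_derivative_subset\<close>)
    then show ?thesis
      using D(2) by (simp add: has_field_derivative_def o_def mult.commute[of _ "D v"])
  qed
  show "(\<lambda>t. f (w + t *s v)) holomorphic_on UNIV"
    unfolding holomorphic_on_def
  proof
    fix t :: complex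
    obtain D where "(f has_derivative D) (at (w + t *s v) within S)" "\<forall>c v. D (c *s v) = c * D v"
      using f S[of t] unfolding holomorphic_fun_on_def by blast
    from main[OF this] show "(\<lambda>t. f (w + t *s v)) field_differentiable at t within UNIV"
      by (auto simp: field_differentiable_def)
  qed
  show "((\<lambda>t. f (w + t *s v)) has_field_derivative D v) (at 0)"
    if "(f has_derivative D) (at w within S)" "\<forall>c v. D (c *s v) = c * D v"
    using main[of D 0] that by simp
qed

lemma holomorphic_fun_continuous_on: "holomorphic_fun_on S f \<Longrightarrow> continuous_on S f"
  unfolding holomorphic_fun_on_def continuous_on_eq_continuous_within
  using has_derivative_continuous by blast

lemma vfield_holomorphic: "X \<in> holo_vfields \<Longrightarrow> holomorphic_fun_on (chart k) (\<lambda>w. X k w $ i)"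
  unfolding holo_vfields_def by blast

lemma vfield_transition:
  assumes "X \<in> holo_vfields" "w $ k = 1" "w $ j \<noteq> 0"
  shows "(w $ j)^2 * X j ((1 / w $ j) *s w) $ i = w $ j * X k w $ i - X k w $ j * w $ i"
proof -
  have "X j ((1 / w $ j) *s w) = (1 / w $ j) *s (X k w - (X k w $ j / w $ j) *s w)"
    using assms unfolding holo_vfields_def chart_def by blast
  then have "X j ((1 / w $ j) *s w) $ i = (1 / w $ j) * (X k w $ i - (X k w $ j / w $ j) * w $ i)"
    by (simp only: vector_smult_component vector_minus_component)
  then show ?thesis using assms(3) by (simp add: field_simps power2_eq_square)
qed

text \<open>After division by its largest coordinate \<open>w\<^sub>j\<close> a point lies in a compact polydisc of chart
  \<open>j\<close>, where the field is bounded; the transition to chart \<open>k\<close> costs a factor quadratic in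
  \<open>w\<^sub>j\<close>.\<close>

lemma vfield_quadratic_bound:
  fixes X :: "'n::finite vfield"
  assumes X: "X \<in> holo_vfields"
  obtains C where "C \<ge> 0" "\<And>w i. w $ k = 1 \<Longrightarrow> norm (X k w $ i) \<le> C * (norm w)^2"
proof -
  define K :: "'n \<Rightarrow> (complex ^ 'n) set" where "K j = {w. w $ j = 1 \<and> (\<forall>i. norm (w $ i) \<le> 1)}" for j
  have Kc: "compact (K j)" for j
  proof -
    have "closed (K j)" unfolding K_def
      by (intro closed_Collect_conj closed_Collect_all closed_Collect_eq closed_Collect_le continuous_intros)
    moreover have "bounded (K j)"
      unfolding bounded_iff
    proof (intro exI ballI)
      fix w assume "w \<in> K j"
      then have "(\<Sum>i\<in>UNIV. norm (w $ i)) \<le> (\<Sum>i\<in>(UNIV :: 'n set). 1)"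
        by (intro sum_mono) (simp add: K_def)
      then show "norm w \<le> (\<Sum>i\<in>(UNIV :: 'n set). 1)" 
        using L2_set_le_sum[of UNIV "\<lambda>i. norm (w $ i)"] by (simp add: norm_vec_def)
    qed
    ultimately show ?thesis using compact_eq_bounded_closed by blast
  qed
  have "\<exists>B. \<forall>w\<in>K j. norm (X j w $ i) \<le> B" for i j
  proof -
    note vfield_holomorphic[OF X, of j i]
    then have "continuous_on (K j) (\<lambda>w. X j w $ i)"
      by (rule continuous_on_subset[OF holomorphic_fun_continuous_on]) (auto simp: K_def chart_def)
    then have "bounded ((\<lambda>w. X j w $ i) ` K j)"
      using Kc compact_continuous_image compact_imp_bounded by blast
    then show ?thesis unfolding bounded_iff by auto
  qed
  then obtain B where B: "\<And>j i w. w \<in> K j \<Longrightarrow> norm (X j w $ i) \<le> B j i" by metis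
  define C where "C = (\<Sum>j\<in>UNIV. \<Sum>i\<in>UNIV. \<bar>B j i\<bar>)"
  have BC: "norm (X j w $ i) \<le> C" if "w \<in> K j" for j i w
  proof -
    have "norm (X j w $ i) \<le> \<bar>B j i\<bar>" using B[OF that, of i] by linarith
    also have "\<dots> \<le> (\<Sum>i\<in>UNIV. \<bar>B j i\<bar>)" by (rule member_le_sum) auto
    also have "\<dots> \<le> C" unfolding C_def by (rule member_le_sum[of j UNIV "\<lambda>j. \<Sum>i\<in>UNIV. \<bar>B j i\<bar>"]) (auto intro: sum_nonneg)
    finally show ?thesis .
  qed
  have C0: "C \<ge> 0" unfolding C_def by (intro sum_nonneg) auto
  have "norm (X k w $ i) \<le> 2 * C * (norm w)^2" if w: "w $ k = 1" for w i
  proof -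
    obtain j where j: "\<And>i. norm (w $ i) \<le> norm (w $ j)"
    proof -
      have "Max (range (\<lambda>i. norm (w $ i))) \<in> range (\<lambda>i. norm (w $ i))" by (rule Max_in) auto
      then obtain j where "Max (range (\<lambda>i. norm (w $ i))) = norm (w $ j)" by (rule rangeE)
      then have "norm (w $ i) \<le> norm (w $ j)" for i
        using Max_ge[of "range (\<lambda>i. norm (w $ i))" "norm (w $ i)"] by simp
      then show ?thesis by (rule that)
    qed
    have j1: "norm (w $ j) \<ge> 1" using j[of k] w by simp
    then have wj: "w $ j \<noteq> 0" by auto
    define u where "u = (1 / w $ j) *s w"
    have uK: "u \<in> K j" unfolding K_def u_def using wj j by (auto simp: norm_divide divide_le_eq_1)
    have Xk: "X k w $ k = 0" using X w unfolding holo_vfields_def chart_def by blast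
    have tr: "(w $ j)^2 * X j u $ i = w $ j * X k w $ i - X k w $ j * w $ i" for i
      unfolding u_def by (rule vfield_transition[OF X w wj])
    have 1: "norm (X k w $ j) \<le> C * norm (w $ j)^2"
    proof -
      have "X k w $ j = - ((w $ j)^2 * X j u $ k)" using tr[of k] Xk w by simp
      then show ?thesis using BC[OF uK, of k] by (simp add: norm_mult norm_power mult.commute[of C] mult_left_mono)
    qed
    have "w $ j * X k w $ i = (w $ j)^2 * X j u $ i + X k w $ j * w $ i" using tr[of i] by simp
    then have "norm (w $ j) * norm (X k w $ i) \<le> norm (w $ j)^2 * norm (X j u $ i) + norm (X k w $ j) * norm (w $ i)"
      using norm_triangle_ineq[of "(w $ j)^2 * X j u $ i" "X k w $ j * w $ i"]
      by (simp add: norm_mult[symmetric] norm_power[symmetric])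
    also have "\<dots> \<le> norm (w $ j)^2 * C + (C * norm (w $ j)^2) * norm (w $ j)"
      by (intro add_mono mult_mono BC[OF uK] 1 j) (use C0 in auto)
    also have "\<dots> \<le> norm (w $ j) * (2 * C * norm (w $ j)^2)"
    proof -
      have "norm (w $ j)^2 * C * 1 \<le> norm (w $ j)^2 * C * norm (w $ j)"
        by (rule mult_left_mono[OF j1]) (use C0 in auto)
      then show ?thesis by (simp add: algebra_simps power2_eq_square)
    qed
    finally have "norm (X k w $ i) \<le> 2 * C * norm (w $ j)^2" using j1 by (auto simp: mult_le_cancel_left)
    also have "\<dots> \<le> 2 * C * (norm w)^2"
      by (intro mult_left_mono power_mono Finite_Cartesian_Product.norm_nth_le) (use C0 in auto)
    finally show ?thesis .
  qed
  then show ?thesis using that[of "2 * C"] C0 by auto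
qed

lemma vfield_quadratic_on_line:
  fixes X :: "'n::finite vfield"
  assumes X: "X \<in> holo_vfields" and w: "w $ k = 1" "v $ k = 0"
  obtains a b c where "\<And>t. X k (w + t *s v) $ i = a + b * t + c * t^2"
proof -
  obtain C where C: "C \<ge> 0" "\<And>w i. w $ k = 1 \<Longrightarrow> norm (X k w $ i) \<le> C * (norm w)^2"
    using vfield_quadratic_bound[OF X, of k] by blast
  let ?f = "\<lambda>t. X k (w + t *s v) $ i"
  have hol: "?f holomorphic_on UNIV"
    by (rule holomorphic_on_line(1)[OF vfield_holomorphic[OF X]]) (use w in \<open>auto simp: chart_def\<close>)
  have bd: "norm (?f t) \<le> (C * (norm w + norm v)^2) * norm t ^ 2" if t: "1 \<le> norm t" for t
  proof -
    have "norm (t *s v) = norm t * norm v"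
    proof -
      have "norm (t *s v) = L2_set (\<lambda>i. norm t * norm (v $ i)) UNIV"
        by (simp add: norm_vec_def norm_mult)
      also have "\<dots> = norm t * norm v" by (simp add: norm_vec_def L2_set_right_distrib)
      finally show ?thesis .
    qed
    then have "norm (w + t *s v) \<le> norm w * 1 + norm t * norm v"
      using norm_triangle_ineq[of w "t *s v"] by simp
    also have "\<dots> \<le> norm w * norm t + norm t * norm v"
      by (intro add_right_mono mult_left_mono t) auto
    finally have 1: "norm (w + t *s v) \<le> (norm w + norm v) * norm t" by (simp add: algebra_simps)
    have "norm (?f t) \<le> C * (norm (w + t *s v))^2" by (rule C) (use w in auto)
    also have "\<dots> \<le> C * ((norm w + norm v) * norm t)^2"
      by (intro mult_left_mono power_mono 1 C) auto
    finally show ?thesis by (simp add: power_mult_distrib mult.assoc)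
  qed
  have quad: "(\<Sum>k\<le>(2::nat). d k * t ^ k) = d 0 + d 1 * t + d 2 * t^2" for d and t :: complex
    by (simp add: numeral_2_eq_2)
  define d where "d k = (deriv ^^ k) ?f 0 / fact k" for k
  have Lv: "?f t = (\<Sum>k\<le>2. d k * t ^ k)" for t
    unfolding d_def by (rule Liouville_polynomial[OF hol bd])
  show ?thesis
    by (rule that[of "d 0" "d 1" "d 2"]) (rule trans[OF Lv quad])
qed

text \<open>Write \<open>e\<close> for the origin of the chart.  Along rays the field is quadratic:
  \<open>X (e + y) = G 0 + D y + Q y\<close> with \<open>D\<close> linear.  Regularity at infinity forces \<open>Q y\<close> to be a
  multiple \<open>q y\<close> of \<open>y\<close>, and \<open>q\<close> turns out to be linear.  These data are the entries of \<open>B\<close>.\<close>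

lemma vfield_linear:
  fixes X :: "'n::finite vfield"
  assumes X: "X \<in> holo_vfields"
  obtains B where "\<And>w. w $ h = 1 \<Longrightarrow> X h w = B *v w - (B *v w) $ h *s w"
proof -
  define e where "e = (axis h 1 :: complex ^ 'n)"
  have eo: "e $ h = 1" and ei: "\<And>i. i \<noteq> h \<Longrightarrow> e $ i = 0" by (auto simp: e_def axis_def)
  have e_chart: "e \<in> chart h" by (simp add: chart_def eo)
  have Xo: "X h w $ h = 0" if "w $ h = 1" for w
    using X that unfolding holo_vfields_def chart_def by blast
  have "\<exists>D. ((\<lambda>w. X h w $ i) has_derivative D) (at e within chart h) \<and> (\<forall>c v. D (c *s v) = c * D v)" for i
    using X e_chart unfolding holo_vfields_def holomorphic_fun_on_def by blast
  then obtain D where D: "\<And>i. ((\<lambda>w. X h w $ i) has_derivative D i) (at e within chart h)"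
    "\<And>i c v. D i (c *s v) = c * D i v" by metis
  have D_add: "D i (u + v) = D i u + D i v" for i u v
    using D(1)[of i] by (simp add: has_derivative_def bounded_linear.linear linear_add)
  have D_sum: "D i (\<Sum>k\<in>S. f k) = (\<Sum>k\<in>S. D i (f k))" if "finite S" for i f and S :: "'n set"
    using that D(2)[of i 0 0] by induction (auto simp: D_add)
  define G where "G i y = X h (e + y) $ i" for i y
  define Q where "Q i y = G i y - G i 0 - D i y" for i y
  have G_line: "\<exists>a b c. \<forall>t. G i (u + t *s v) = a + b * t + c * t^2" if uv: "u $ h = 0" "v $ h = 0" for i u v
  proof -
    obtain a b c where "\<And>t. X h ((e + u) + t *s v) $ i = a + b * t + c * t^2"
      by (rule vfield_quadratic_on_line[OF X, of "e + u" h v i]) (use uv eo in auto)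
    then show ?thesis by (auto simp: G_def add.assoc)
  qed
  have G_ray: "G i (t *s y) = G i 0 + t * D i y + t^2 * Q i y" if y: "y $ h = 0" for i y t
  proof -
    obtain a b c where abc: "\<And>t. G i (0 + t *s y) = a + b * t + c * t^2"
      using G_line[of 0 y i] y by (metis zero_index)
    have a: "a = G i 0" using abc[of 0] by simp
    have "((\<lambda>t. X h (e + t *s y) $ i) has_field_derivative D i y) (at 0)"
      by (rule holomorphic_on_line(2)[OF vfield_holomorphic[OF X]])
        (use y D eo in \<open>auto simp: chart_def\<close>)
    then have "((\<lambda>t. a + b * t + c * t^2) has_field_derivative D i y) (at 0)"
      using abc by (simp add: G_def)
    moreover have "((\<lambda>t. a + b * t + c * t^2) has_field_derivative b) (at 0)"
      by (auto intro!: derivative_eq_intros)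
    ultimately have b: "b = D i y" using DERIV_unique by blast
    have "c = Q i y" using abc[of 1] by (simp add: Q_def a b)
    then show ?thesis using abc[of t] a b by (simp add: mult.commute)
  qed
  have Q_hom: "Q i (t *s y) = t^2 * Q i y" if "y $ h = 0" for i t y
    using G_ray[OF that, of i t] D(2)[of i t y] by (simp add: Q_def)
  \<comment> \<open>The expression of the field in chart \<open>j\<close> is regular at the point at infinity on the ray of \<open>y\<close>,
    which is the parameter value \<open>s = 0\<close>; the terms of order two must cancel there.\<close>
  have Q_rad: "Q i y * y $ j = Q j y * y $ i" if y: "y $ h = 0" and yj: "y $ j \<noteq> 0" and io: "i \<noteq> h" for i j y
  proof -
    have jo: "j \<noteq> h" using y yj by auto
    let ?L = "\<lambda>s. s * ((y $ j)^2 * X j ((1 / y $ j) *s y + s *s ((1 / y $ j) *s e)) $ i)"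
    let ?C = "y $ j * Q i y - y $ i * Q j y"
    let ?R = "\<lambda>s. (y $ j * G i 0 - y $ i * G j 0) * s^2 + (y $ j * D i y - y $ i * D j y) * s + ?C"
    have eq: "?L s = ?R s" if s: "s \<noteq> 0" for s
    proof -
      define w where "w = e + (1 / s) *s y"
      have w: "w $ h = 1" "w $ j = y $ j / s" "w $ i = y $ i / s" "w $ j \<noteq> 0"
        using eo ei y yj io jo s by (auto simp: w_def)
      have pt: "(1 / w $ j) *s w = (1 / y $ j) *s y + s *s ((1 / y $ j) *s e)"
        unfolding vec_eq_iff
      proof
        fix k
        have "w $ k = e $ k + y $ k / s" by (simp add: w_def)
        moreover have "1 / w $ j = s / y $ j" by (simp add: w(2))
        moreover have "s / y $ j * (y $ k / s) = y $ k / y $ j" using s by simp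
        ultimately show "((1 / w $ j) *s w) $ k = ((1 / y $ j) *s y + s *s ((1 / y $ j) *s e)) $ k"
          by (simp only: vector_smult_component vector_add_component distrib_left) simp
      qed
      have "(w $ j)^2 * X j ((1 / w $ j) *s w) $ i = w $ j * X h w $ i - X h w $ j * w $ i"
        by (rule vfield_transition[OF X w(1,4)])
      moreover have "X h w $ k = G k 0 + (1/s) * D k y + (1/s)^2 * Q k y" for k
        using G_ray[OF y, of k "1/s"] by (simp add: G_def w_def)
      ultimately have "(y $ j)^2 / s^2 * X j ((1 / y $ j) *s y + s *s ((1 / y $ j) *s e)) $ i =
        y $ j / s * (G i 0 + (1/s) * D i y + (1/s)^2 * Q i y) - (G j 0 + (1/s) * D j y + (1/s)^2 * Q j y) * (y $ i / s)"
        using pt w by (simp add: power_divide)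
      then have "s^3 * ((y $ j)^2 / s^2 * X j ((1 / y $ j) *s y + s *s ((1 / y $ j) *s e)) $ i) =
        s^3 * (y $ j / s * (G i 0 + (1/s) * D i y + (1/s)^2 * Q i y) - (G j 0 + (1/s) * D j y + (1/s)^2 * Q j y) * (y $ i / s))"
        by simp
      moreover have "s^3 * (a^2 / s^2 * T) = s * (a^2 * T)" for a T
        using s by (simp add: power2_eq_square power3_eq_cube)
      moreover have "s^3 * (a / s * (g + (1/s) * d + (1/s)^2 * q) - (g' + (1/s) * d' + (1/s)^2 * q') * (b / s)) =
          (a * g - b * g') * s^2 + (a * d - b * d') * s + (a * q - b * q')" for a b g d q g' d' q'
      proof -
        define r where "r = 1 / s"
        have rs: "r * s = 1" and div: "x / s = x * r" for x using s by (simp_all add: r_def)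
        show ?thesis unfolding div using rs by algebra
      qed
      ultimately show ?thesis by (simp only:)
    qed
    have "(\<lambda>s. X j ((1 / y $ j) *s y + s *s ((1 / y $ j) *s e)) $ i) holomorphic_on UNIV"
      by (rule holomorphic_on_line(1)[OF vfield_holomorphic[OF X]])
        (use yj ei[OF jo] in \<open>auto simp: chart_def\<close>)
    then have "continuous_on UNIV (\<lambda>s. ?L s - ?R s)"
      by (intro continuous_intros holomorphic_on_imp_continuous_on)
    then have "isCont (\<lambda>s. ?L s - ?R s) 0"
      using continuous_on_eq_continuous_at open_UNIV UNIV_I by blast
    then have "((\<lambda>s. ?L s - ?R s) \<longlongrightarrow> ?L 0 - ?R 0) (at 0)" by (simp only: isCont_def)
    moreover have "eventually (\<lambda>s. ?L s - ?R s = 0) (at 0)"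
      using eq by (simp add: eventually_at_filter)
    ultimately have "?L 0 - ?R 0 = 0"
      by (intro tendsto_unique[OF at_neq_bot _ tendsto_eventually])
    then show ?thesis by (simp add: mult.commute)
  qed
  define q where "q y = (if y = 0 then 0 else Q (SOME j. y $ j \<noteq> 0) y / y $ (SOME j. y $ j \<noteq> 0))" for y
  have Q_q: "Q i y = q y * y $ i" if y: "y $ h = 0" "i \<noteq> h" for i y
  proof (cases "y = 0")
    case True
    then show ?thesis using Q_hom[of 0 i 0] by simp
  next
    case False
    then have "y $ (SOME j. y $ j \<noteq> 0) \<noteq> 0" by (metis (mono_tags) someI vec_eq_iff zero_index)
    then have "Q i y * y $ (SOME j. y $ j \<noteq> 0) = Q (SOME j. y $ j \<noteq> 0) y * y $ i"
      by (rule Q_rad[OF y(1) _ y(2)])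
    then show ?thesis
      using False \<open>y $ (SOME j. y $ j \<noteq> 0) \<noteq> 0\<close> by (simp add: q_def eq_divide_eq)
  qed
  have q_hom: "q (t *s y) = t * q y" if y: "y $ h = 0" for t y
  proof (cases "t = 0 \<or> y = 0")
    case True
    then show ?thesis by (auto simp: q_def)
  next
    case False
    then obtain i where i: "y $ i \<noteq> 0" by (metis vec_eq_iff zero_index)
    then have io: "i \<noteq> h" using y by auto
    have "q (t *s y) * (t * y $ i) = t^2 * (q y * y $ i)"
      using Q_q[of "t *s y" i] Q_q[of y i] Q_hom[OF y, of i t] y io by auto
    then show ?thesis using i False by (simp add: power2_eq_square)
  qed
  \<comment> \<open>One component shows that \<open>q\<close> is quadratic on the line; another one, which vanishes at
    \<open>t = 0\<close>, shows that \<open>t\<close> times it is quadratic as well.\<close>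
  have q_line: "\<exists>b. \<forall>t. q (u + t *s v) = q u + b * t"
    if u: "u $ h = 0" and v: "v $ h = 0" and ij: "u $ i \<noteq> 0" "v $ i = 0" "u $ j = 0" "v $ j \<noteq> 0" for u v i j
  proof -
    have io: "i \<noteq> h" and jo: "j \<noteq> h" using u v ij by auto
    obtain a b c where 1: "\<And>t. G i (u + t *s v) = a + b * t + c * t^2" using G_line[OF u v] by blast
    obtain a' b' c' where 2: "\<And>t. G j (u + t *s v) = a' + b' * t + c' * t^2" using G_line[OF u v] by blast
    have 3: "q (u + t *s v) * u $ i = (a - G i 0 - D i u) + (b - D i v) * t + c * t^2" for t
      using Q_q[of "u + t *s v" i] u v io ij 1[of t] by (simp add: Q_def D_add D(2) algebra_simps)
    have 4: "q (u + t *s v) * (t * v $ j) = (a' - G j 0 - D j u) + (b' - D j v) * t + c' * t^2" for t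
      using Q_q[of "u + t *s v" j] u v jo ij 2[of t] by (simp add: Q_def D_add D(2) algebra_simps)
    define \<alpha> \<beta> \<gamma> where "\<alpha> = (a - G i 0 - D i u) / u $ i" "\<beta> = (b - D i v) / u $ i" "\<gamma> = c / u $ i"
    have q3: "q (u + t *s v) = \<alpha> + \<beta> * t + \<gamma> * t^2" for t
    proof -
      have "q (u + t *s v) = ((a - G i 0 - D i u) + (b - D i v) * t + c * t^2) / u $ i"
        using 3[of t] ij(1) by (simp add: eq_divide_eq)
      then show ?thesis by (simp add: \<alpha>_\<beta>_\<gamma>_def add_divide_distrib)
    qed
    have cub: "(\<alpha> + \<beta> * t + \<gamma> * t^2) * (t * v $ j) = (a' - G j 0 - D j u) + (b' - D j v) * t + c' * t^2" for t
      using 4[of t] q3[of t] by simp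
    define m A' B' where "m = v $ j" "A' = a' - G j 0 - D j u" "B' = b' - D j v"
    note cub' = cub[folded m_A'_B'_def]
    have "A' = 0" "(\<alpha> + \<beta> + \<gamma>) * m = A' + B' + c'" "(\<alpha> - \<beta> + \<gamma>) * m = - A' + B' - c'"
      "(\<alpha> + 2 * \<beta> + 4 * \<gamma>) * m * 2 = A' + 2 * B' + 4 * c'"
      using cub'[of 0] cub'[of 1] cub'[of "-1"] cub'[of 2] by (simp_all add: algebra_simps)
    then have "\<gamma> * m = 0" by algebra
    then have "\<gamma> * v $ j = 0" by (simp add: m_A'_B'_def)
    then have "\<gamma> = 0" using ij by simp
    then have "q (u + t *s v) = q u + \<beta> * t" for t using q3[of t] q3[of 0] by simp
    then show ?thesis by blast
  qed
  have q_add: "q (u + v) = q u + q v"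
    if u: "u $ h = 0" and v: "v $ h = 0" and ij: "u $ i \<noteq> 0" "v $ i = 0" "u $ j = 0" "v $ j \<noteq> 0" for u v i j
  proof -
    obtain b where b: "\<And>t. q (u + t *s v) = q u + b * t" using q_line[OF u v ij] by blast
    obtain b' where b': "\<And>t. q (v + t *s u) = q v + b' * t" using q_line[OF v u ij(4,3,2,1)] by blast
    have "u + 2 *s v = 2 *s (v + (1/2) *s u)" by (simp add: vec_eq_iff algebra_simps)
    moreover have "q (2 *s (v + (1/2) *s u)) = 2 * q (v + (1/2) *s u)"
      by (rule q_hom) (use u v in simp)
    ultimately have "q (u + 2 *s v) = 2 * q (v + (1/2) *s u)" by (simp only:)
    then have "q u + b * 2 = 2 * q v + b'" using b b' by simp
    moreover have "q u + b = q v + b'" using b[of 1] b'[of 1] by (simp add: add.commute)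
    ultimately have "b = q v" by algebra
    then show ?thesis using b[of 1] by simp
  qed
  have q_sum: "q (\<Sum>k\<in>S. y $ k *s axis k 1) = (\<Sum>k\<in>S. y $ k * q (axis k 1))"
    if y: "y $ h = 0" and S: "finite S" for y :: "complex ^ 'n" and S
    using S
  proof induction
    case empty
    then show ?case by (simp add: q_def)
  next
    case (insert k S)
    let ?v = "\<Sum>k\<in>S. y $ k *s axis k 1 :: complex ^ 'n" and ?u = "y $ k *s axis k 1 :: complex ^ 'n"
    have v_nth: "?v $ i = (if i \<in> S then y $ i else 0)" for i
      using insert.hyps(1) by (simp add: sum_component axis_def if_distrib[of "\<lambda>x. _ * x"] sum.delta cong: if_cong)
    have u_nth: "?u $ i = (if i = k then y $ i else 0)" for i by (simp add: axis_def)
    have u: "?u $ h = 0" "?v $ h = 0" unfolding v_nth u_nth using y by auto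
    have uh: "q ?u = y $ k * q (axis k 1)"
    proof (cases "k = h")
      case True
      then show ?thesis using y by (simp add: q_def)
    next
      case False
      then show ?thesis using q_hom[of "axis k 1" "y $ k"] by (simp add: axis_def)
    qed
    have "q (?u + ?v) = q ?u + q ?v"
    proof (cases "?u = 0 \<or> ?v = 0")
      case True
      have "q 0 = 0" by (simp add: q_def)
      then show ?thesis using True
        by (elim disjE) (simp_all only: add.left_neutral add.right_neutral)
    next
      case False
      then obtain j where j: "?v $ j \<noteq> 0" by (metis vec_eq_iff zero_index)
      then have "j \<in> S" unfolding v_nth by (auto split: if_splits)
      then have "j \<noteq> k" using insert.hyps by auto
      have "y $ k \<noteq> 0" using False by auto
      show ?thesis
        by (rule q_add[OF u, of k j]) (unfold v_nth u_nth,
          use j[unfolded v_nth] \<open>j \<noteq> k\<close> \<open>y $ k \<noteq> 0\<close> insert.hyps in auto)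
    qed
    then have "q (?u + ?v) = y $ k * q (axis k 1) + (\<Sum>k\<in>S. y $ k * q (axis k 1))"
      by (simp only: uh insert.IH)
    then show ?case by (simp only: sum.insert[OF insert.hyps])
  qed
  have basis: "(\<Sum>k\<in>UNIV. y $ k *s axis k 1) = y" for y :: "complex ^ 'n"
    by (simp add: vec_eq_iff sum_component axis_def if_distrib[of "\<lambda>x. _ * x"] sum.delta cong: if_cong)
  define B :: "complex ^ 'n ^ 'n" where
    "B = (\<chi> i k. if i = h then (if k = h then 0 else - q (axis k 1))
                 else (if k = h then G i 0 else D i (axis k 1)))"
  have "X h w = B *v w - (B *v w) $ h *s w" if w: "w $ h = 1" for w
  proof -
    define y where "y = w - e"
    have y: "y $ h = 0" "w = e + y" "\<And>k. k \<noteq> h \<Longrightarrow> w $ k = y $ k" using w eo ei by (auto simp: y_def)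
    have split: "(\<Sum>k\<in>UNIV. f k) = f h + (\<Sum>k\<in>UNIV - {h}. f k)" for f :: "'n \<Rightarrow> complex"
      by (rule sum.remove) auto
    have Dy: "D i y = (\<Sum>k\<in>UNIV - {h}. y $ k * D i (axis k 1))" for i
    proof -
      have "D i y = (\<Sum>k\<in>UNIV. y $ k * D i (axis k 1))"
        by (subst basis[of y, symmetric]) (simp add: D_sum D(2) del: basis)
      then show ?thesis using y(1) by (simp add: split)
    qed
    have qy: "q y = (\<Sum>k\<in>UNIV - {h}. y $ k * q (axis k 1))"
      using q_sum[OF y(1), of UNIV] y(1) by (simp add: basis split)
    have "(\<Sum>k\<in>UNIV - {h}. B $ h $ k * w $ k) = (\<Sum>k\<in>UNIV - {h}. - (y $ k * q (axis k 1)))"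
      by (rule sum.cong) (auto simp: B_def y(3))
    then have Bo: "(B *v w) $ h = - q y"
      by (simp add: matrix_vector_mult_def split qy sum_negf B_def)
    have Bi: "(B *v w) $ i = G i 0 + D i y" if i: "i \<noteq> h" for i
    proof -
      have "(\<Sum>k\<in>UNIV - {h}. B $ i $ k * w $ k) = (\<Sum>k\<in>UNIV - {h}. y $ k * D i (axis k 1))"
        by (rule sum.cong) (use i in \<open>auto simp: B_def y(3)\<close>)
      then show ?thesis using i w by (simp add: matrix_vector_mult_def split Dy B_def)
    qed
    show ?thesis
      unfolding vec_eq_iff
    proof
      fix i
      show "X h w $ i = (B *v w - (B *v w) $ h *s w) $ i"
      proof (cases "i = h")
        case True
        then show ?thesis using Xo[OF w] w by simp
      next
        case False
        have "X h w $ i = G i 0 + D i y + Q i y" by (simp add: Q_def G_def y(2))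
        then show ?thesis using False Bi[OF False] Bo Q_q[OF y(1) False] y(3)[OF False] by simp
      qed
    qed
  qed
  then show ?thesis by (rule that)
qed

text \<open>The bracket of the fields of \<open>B\<close> and \<open>C\<close> is the field of the commutator, and only scalar
  matrices induce the zero field.  A scalar commutator is zero since its trace is.\<close>

lemma bracket_zero_imp_commute:
  fixes X Y :: "'n::finite vfield"
  assumes X: "\<And>w. w $ h = 1 \<Longrightarrow> X h w = B *v w - (B *v w) $ h *s w"
    and Y: "\<And>w. w $ h = 1 \<Longrightarrow> Y h w = C *v w - (C *v w) $ h *s w"
    and br: "vfield_bracket X Y h = (\<lambda>w. 0)"
  shows "B ** C = C ** B"
proof -
  have der: "deriv (\<lambda>t. Z h (w + t *s v) $ i) 0 = (E *v v) $ i - (E *v v) $ h * w $ i - (E *v w) $ h * v $ i"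
    if Z: "\<And>w. w $ h = 1 \<Longrightarrow> Z h w = E *v w - (E *v w) $ h *s w" and w: "w $ h = 1" "v $ h = 0"
    for Z :: "'n vfield" and E w v i
  proof -
    have "(\<lambda>t. Z h (w + t *s v) $ i) =
        (\<lambda>t. (E *v w) $ i + t * (E *v v) $ i - ((E *v w) $ h + t * (E *v v) $ h) * (w $ i + t * v $ i))"
      using w by (simp add: Z fun_eq_iff vec.add vec.scale algebra_simps)
    moreover have "(\<dots> has_field_derivative (E *v v) $ i - (E *v v) $ h * w $ i - (E *v w) $ h * v $ i) (at 0)"
      by (auto intro!: derivative_eq_intros)
    ultimately show ?thesis using DERIV_imp_deriv by auto
  qed
  define F where "F = C ** B - B ** C"
  have F: "(F *v w) $ i = (F *v w) $ h * w $ i" if w: "w $ h = 1" for w i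
  proof -
    define b where "b = B *v w"
    define c where "c = C *v w"
    have v: "(b - b $ h *s w) $ h = 0" "(c - c $ h *s w) $ h = 0" using w by auto
    define p where "p = deriv (\<lambda>t. Y h (w + t *s (b - b $ h *s w)) $ i) 0"
    define q where "q = deriv (\<lambda>t. X h (w + t *s (c - c $ h *s w)) $ i) 0"
    have "vfield_bracket X Y h w $ i = 0" using br by simp
    then have pq: "p - q = 0"
      by (simp add: vfield_bracket_def X[OF w] Y[OF w] b_def c_def p_def q_def)
    have p: "p = ((C *v b) $ i - b $ h * c $ i) - ((C *v b) $ h - b $ h * c $ h) * w $ i
        - c $ h * (b $ i - b $ h * w $ i)"
      using der[of Y C w "b - b $ h *s w" i, OF _ w v(1)]
      by (simp add: Y p_def matrix_vector_mult_diff_distrib vec.scale c_def[symmetric])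
    have q: "q = ((B *v c) $ i - c $ h * b $ i) - ((B *v c) $ h - c $ h * b $ h) * w $ i
        - b $ h * (c $ i - c $ h * w $ i)"
      using der[of X B w "c - c $ h *s w" i, OF _ w v(2)]
      by (simp add: X q_def matrix_vector_mult_diff_distrib vec.scale b_def[symmetric])
    have "((C *v b) $ i - (B *v c) $ i) - ((C *v b) $ h - (B *v c) $ h) * w $ i = p - q"
      unfolding p q by (simp add: algebra_simps)
    then have "((C *v b) $ i - (B *v c) $ i) - ((C *v b) $ h - (B *v c) $ h) * w $ i = 0"
      using pq by simp
    moreover have "F *v w = C *v b - B *v c"
      by (simp add: F_def b_def c_def matrix_vector_mult_diff_rdistrib matrix_vector_mul_assoc)
    ultimately show ?thesis by simp
  qed
  define e where "e = (axis h 1 :: complex ^ 'n)"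
  have eo: "e $ h = 1" "\<And>i. i \<noteq> h \<Longrightarrow> e $ i = 0" by (auto simp: e_def axis_def)
  define f where "f = (F *v e) $ h"
  have Fe: "F *v e = f *s e"
    unfolding vec_eq_iff
  proof
    fix i show "(F *v e) $ i = (f *s e) $ i" using F[OF eo(1), of i] by (simp add: f_def)
  qed
  have Fk: "F *v axis k 1 = f *s axis k 1" for k
  proof (cases "k = h")
    case True
    then show ?thesis using Fe e_def by simp
  next
    case False
    define a where "a = (axis k 1 :: complex ^ 'n)"
    have a: "a $ h = 0" "a $ k = 1" "\<And>i. i \<noteq> k \<Longrightarrow> a $ i = 0" using False by (auto simp: a_def axis_def)
    have Fa: "F *v (e + t *s a) = f *s e + t *s (F *v a)" for t by (simp add: vec.add vec.scale Fe)
    have 1: "f * e $ i + t * (F *v a) $ i = (f + t * (F *v a) $ h) * (e $ i + t * a $ i)" for i t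
      using F[of "e + t *s a" i] eo a by (simp add: Fa)
    have "(F *v a) $ h = 0" using 1[of k 1] 1[of k "-1"] a(2) eo(2)[OF False] by algebra
    then show ?thesis
      unfolding a_def[symmetric] vec_eq_iff
    proof (intro allI)
      fix i show "(F *v a) $ i = (f *s a) $ i"
        using \<open>(F *v a) $ h = 0\<close> 1[of i 1] by (simp add: algebra_simps)
    qed
  qed
  have Fmat: "F $ i $ k = (if i = k then f else 0)" for i k
  proof -
    have "F $ i $ k = (F *v axis k 1) $ i"
      by (simp add: matrix_vector_mult_def axis_def if_distrib[of "\<lambda>x. _ * x"] cong: if_cong)
    also have "\<dots> = (f *s axis k 1) $ i" by (simp only: Fk)
    also have "\<dots> = (if i = k then f else 0)" by (simp add: axis_def)
    finally show ?thesis .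
  qed
  have "trace F = of_nat CARD('n) * f" by (simp add: trace_def Fmat)
  moreover have "trace F = 0" by (simp add: F_def trace_sub trace_mul_sym[of C B])
  ultimately have "f = 0" by simp
  then have "F = 0" by (simp add: vec_eq_iff Fmat)
  then show ?thesis by (simp add: F_def)
qed

section \<open>Covectors and non-vanishing of polynomials\<close>

definition dot :: "complex ^ 'n::finite \<Rightarrow> complex ^ 'n \<Rightarrow> complex" where
  "dot l z = (\<Sum>k\<in>UNIV. l $ k * z $ k)"

lemma form_app_dot: "form_app A z v = dot (A z) v"
  by (simp add: form_app_def dot_def)

lemma dot_commute: "dot x y = dot y x"
  by (simp add: dot_def mult.commute)

lemma dot_add_right: "dot l (x + y) = dot l x + dot l y"
  and dot_diff_right: "dot l (x - y) = dot l x - dot l y"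
  and dot_scale_right: "dot l (c *s x) = c * dot l x"
  and dot_zero_right [simp]: "dot l 0 = 0"
  and dot_sum_right: "dot l (\<Sum>i\<in>I. f i) = (\<Sum>i\<in>I. dot l (f i))"
proof -
  show "dot l (x + y) = dot l x + dot l y" "dot l (x - y) = dot l x - dot l y"
    "dot l (c *s x) = c * dot l x" "dot l 0 = 0"
    by (simp_all add: dot_def algebra_simps sum.distrib sum_subtractf sum_distrib_left)
  show "dot l (\<Sum>i\<in>I. f i) = (\<Sum>i\<in>I. dot l (f i))"
    by (simp add: dot_def sum_distrib_left) (rule sum.swap)
qed

lemma dot_add_left: "dot (x + y) l = dot x l + dot y l"
  and dot_diff_left: "dot (x - y) l = dot x l - dot y l"
  and dot_scale_left: "dot (c *s x) l = c * dot x l"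
  and dot_zero_left [simp]: "dot 0 l = 0"
  by (simp_all add: dot_commute[of _ l] dot_add_right dot_diff_right dot_scale_right)

lemma dot_axis_right [simp]: "dot l (axis k 1) = l $ k"
  and dot_axis_left [simp]: "dot (axis k 1) l = l $ k"
  by (simp_all add: dot_def axis_def if_distrib[of "\<lambda>x. _ * x"] if_distrib[of "\<lambda>x. x * _"] cong: if_cong)

lemma dot_eq_0: "(\<And>v. dot l v = 0) \<Longrightarrow> l = 0"
  by (metis dot_axis_right vec_eq_iff zero_index)

lemma matrix_vector_dot: "(N *v x) $ i = dot (N $ i) x"
  by (simp add: matrix_vector_mult_def dot_def)

lemma nonsingular_iff_injective:
  fixes N :: "complex ^ 'n::finite ^ 'n"
  shows "det N \<noteq> 0 \<longleftrightarrow> (\<forall>x. N *v x = 0 \<longrightarrow> x = 0)"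
  using invertible_det_nz[of N] matrix_left_invertible_ker[of N] invertible_left_inverse[of N] by blast

lemma nonsingular_rows_span:
  fixes N :: "complex ^ 'n::finite ^ 'n"
  assumes "det N \<noteq> 0"
  obtains x where "v = (\<Sum>i\<in>UNIV. x i *s N $ i)"
proof -
  obtain M where M: "M ** N = mat 1"
    using assms invertible_det_nz invertible_left_inverse by metis
  have "v = (\<Sum>i\<in>UNIV. (v v* M) $ i *s N $ i)"
  proof -
    have "v = (v v* M) v* N" by (simp add: vector_matrix_mul_assoc M)
    also have "x v* N = (\<Sum>i\<in>UNIV. x $ i *s N $ i)" for x
      by (simp add: vec_eq_iff vector_matrix_mult_def sum_component mult.commute)
    finally show ?thesis .
  qed
  then show ?thesis by (rule that)
qed

text \<open>The restriction to a line through \<open>a\<close> is a product of two univariate polynomials.\<close>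

lemma polynomial_fun_cancel:
  assumes f: "polynomial_fun f" and g: "polynomial_fun g" and f0: "f a \<noteq> 0"
    and fg: "\<And>z. f z * g z = 0"
  shows "g z = 0"
proof -
  obtain F where F: "\<And>t. f (a + t *s (z - a)) = poly F t" using polynomial_fun_on_line[OF f] by blast
  obtain G where G: "\<And>t. g (a + t *s (z - a)) = poly G t" using polynomial_fun_on_line[OF g] by blast
  have "poly (F * G) t = 0" for t using fg F G by (metis poly_mult)
  then have "F * G = 0" using poly_all_0_iff_0 by blast
  moreover have "F \<noteq> 0" using F[of 0] f0 by auto
  ultimately have "G = 0" by simp
  then show ?thesis using G[of 1] by simp
qed

lemma polynomial_fun_nonzero_mult:
  assumes "polynomial_fun f" "polynomial_fun g" "f a \<noteq> 0" "g b \<noteq> 0"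
  obtains z where "f z \<noteq> 0" "g z \<noteq> 0"
  using polynomial_fun_cancel[OF assms(1,2,3), of b] assms(4) by force

lemma polynomial_fun_nonzero_prod:
  assumes "finite S" "polynomial_fun f" "f a \<noteq> 0"
    "\<And>l. l \<in> S \<Longrightarrow> polynomial_fun (g l) \<and> (\<exists>b. g l b \<noteq> 0)"
  obtains z where "f z \<noteq> 0" "\<And>l. l \<in> S \<Longrightarrow> g l z \<noteq> 0"
proof -
  have "\<exists>z. f z * (\<Prod>l\<in>S. g l z) \<noteq> 0"
    using assms(1,4)
  proof (induction S)
    case empty
    then show ?case using assms(3) by auto
  next
    case (insert l S)
    then obtain b where b: "f b * (\<Prod>l\<in>S. g l b) \<noteq> 0" by auto
    obtain c where c: "g l c \<noteq> 0" using insert.prems by blast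
    have "polynomial_fun (\<lambda>z. f z * (\<Prod>l\<in>S. g l z))"
      using insert by (intro polynomial_fun_mult polynomial_fun_prod assms(2)) auto
    moreover have "polynomial_fun (g l)" using insert.prems by blast
    ultimately obtain z where "f z * (\<Prod>l\<in>S. g l z) \<noteq> 0" "g l z \<noteq> 0"
      using polynomial_fun_nonzero_mult[of "\<lambda>z. f z * (\<Prod>l\<in>S. g l z)" "g l" b c] b c by blast
    then show ?case using insert.hyps by auto
  qed
  then obtain z where "f z * (\<Prod>l\<in>S. g l z) \<noteq> 0" by blast
  then show ?thesis using that[of z] assms(1) by auto
qed

lemma polynomial_fun_dot: "polynomial_fun (\<lambda>z. dot l z)"
  unfolding dot_def by (intro polynomial_fun_sum polynomial_fun_mult polynomial_fun_const polynomial_fun_coord finite)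

lemma polynomial_fun_matrix: "polynomial_fun (\<lambda>z. (B *v z) $ i)"
  by (simp add: matrix_vector_dot polynomial_fun_dot)

lemma polynomial_fun_det:
  assumes "\<And>i j. polynomial_fun (\<lambda>z. N z $ i $ j)"
  shows "polynomial_fun (\<lambda>z. det (N z))"
  unfolding det_def
  by (intro polynomial_fun_sum polynomial_fun_mult polynomial_fun_prod polynomial_fun_const assms
      finite_permutations finite)

section \<open>From abelian foliations to commuting matrices\<close>

text \<open>At \<open>z\<close> the vectors \<open>B z\<close> with \<open>B \<in> V\<close> fill the kernel of the covector \<open>\<mu>\<close>, each
  of them attained once.  For a foliation, \<open>\<mu>\<close> is the form at a point outside the singular
  set.\<close>

definition regular_point :: "(complex ^ 'n ^ 'n) set \<Rightarrow> complex ^ 'n \<Rightarrow> complex ^ 'n::finite \<Rightarrow> bool" where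
  "regular_point V z \<mu> \<longleftrightarrow> \<mu> \<noteq> 0 \<and> (\<forall>v. dot \<mu> v = 0 \<longleftrightarrow> (\<exists>B\<in>V. v = B *v z)) \<and>
     (\<forall>B\<in>V. B *v z = 0 \<longrightarrow> B = 0)"

definition mspan :: "complex ^ 'n ^ 'n \<Rightarrow> complex ^ 'n ^ 'n \<Rightarrow> complex ^ 'n ^ 'n \<Rightarrow> complex ^ 'n ^ 'n \<Rightarrow> (complex ^ 'n::finite ^ 'n) set"
  where "mspan B0 B1 B2 B3 =
    {B. \<exists>a b c d. \<forall>v. B *v v = a *s (B0 *v v) + b *s (B1 *v v) + c *s (B2 *v v) + d *s (B3 *v v)}"

text \<open>Tangency on a dense set of points extends to all points, because the pairing of the form with the
  linear lift is a polynomial.\<close>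

lemma tangent_polynomial:
  fixes X :: "'n::finite vfield"
  assumes A: "\<And>k. homogeneous_poly d (\<lambda>z. A z $ k)" and E: "\<And>z. dot (A z) z = 0"
    and p: "homogeneous_poly e p" "p a \<noteq> 0"
    and tan: "\<And>z. z \<noteq> 0 \<Longrightarrow> p z \<noteq> 0 \<Longrightarrow> z $ k \<noteq> 0 \<Longrightarrow> dot (A ((1 / z $ k) *s z)) (X k ((1 / z $ k) *s z)) = 0"
    and B: "\<And>w. w $ k = 1 \<Longrightarrow> X k w = B *v w - (B *v w) $ k *s w"
  shows "dot (A z) (B *v z) = 0"
proof -
  have gen: "dot (A z) (B *v z) = 0" if "p z \<noteq> 0" "z $ k \<noteq> 0" for z
  proof -
    define w where "w = (1 / z $ k) *s z"
    have w1: "w $ k = 1" and z: "z = z $ k *s w" using that(2) by (auto simp: w_def vec_eq_iff)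
    have "z \<noteq> 0" using that(2) by auto
    then have "dot (A w) (X k w) = 0" using tan[of z] that by (simp add: w_def)
    then have "dot (A w) (B *v w) = 0" using E[of w] by (simp add: B[OF w1] dot_diff_right dot_scale_right)
    moreover have "A z = (z $ k) ^ d *s A w"
    proof -
      have "A (z $ k *s w) $ i = (z $ k) ^ d * A w $ i" for i by (rule homogeneous_scale[OF A])
      then have "A (z $ k *s w) = (z $ k) ^ d *s A w" by (simp add: vec_eq_iff)
      then show ?thesis by (simp only: z[symmetric])
    qed
    moreover have "B *v z = z $ k *s (B *v w)"
    proof -
      have "B *v (z $ k *s w) = z $ k *s (B *v w)" by (simp add: vec.scale)
      then show ?thesis by (simp only: z[symmetric])
    qed
    ultimately show ?thesis by (simp add: dot_scale_right dot_scale_left)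
  qed
  have "polynomial_fun p" using p(1) by (rule homogeneous_imp_polynomial_fun)
  then obtain b where b: "p b \<noteq> 0" "b $ k \<noteq> 0"
    using polynomial_fun_nonzero_mult[OF _ polynomial_fun_coord[of k], of p a 1] p(2) by auto
  have "polynomial_fun (\<lambda>z. dot (A z) (B *v z))"
    unfolding dot_def
    by (intro polynomial_fun_sum polynomial_fun_mult polynomial_fun_matrix homogeneous_imp_polynomial_fun[OF A] finite)
  moreover have "polynomial_fun (\<lambda>z. p z * z $ k)"
    by (intro polynomial_fun_mult \<open>polynomial_fun p\<close> polynomial_fun_coord)
  moreover have "p b * b $ k \<noteq> 0" using b by simp
  moreover have "p z * z $ k * dot (A z) (B *v z) = 0" for z
    using gen[of z] by (cases "p z = 0 \<or> z $ k = 0") auto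
  ultimately show ?thesis
    using polynomial_fun_cancel[of "\<lambda>z. p z * z $ k" "\<lambda>z. dot (A z) (B *v z)" b z] by blast
qed

text \<open>The generic tangent space has a basis inside the chart; together with the point \<open>w\<close> itself and a
  transversal \<open>u\<close> it spans everything, which is expressed by the triviality of the common
  annihilator.\<close>

lemma kernel_frame:
  fixes a w :: "complex ^ 5"
  assumes a: "a \<noteq> 0" "dot a w = 0" and w: "w $ 0 = 1"
  obtains v1 v2 v3 u where "v1 $ 0 = 0" "dot a v1 = 0" "v2 $ 0 = 0" "dot a v2 = 0" "v3 $ 0 = 0" "dot a v3 = 0"
    "\<And>x. dot w x = 0 \<Longrightarrow> dot v1 x = 0 \<Longrightarrow> dot v2 x = 0 \<Longrightarrow> dot v3 x = 0 \<Longrightarrow> dot u x = 0 \<Longrightarrow> x = 0"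
proof -
  have "\<exists>k. k \<noteq> 0 \<and> a $ k \<noteq> 0"
  proof (rule ccontr)
    assume n: "\<not> ?thesis"
    have "dot a w = a $ 0 + (\<Sum>k\<in>UNIV - {0}. a $ k * w $ k)"
      using w by (simp add: dot_def sum.remove[of UNIV 0])
    also have "(\<Sum>k\<in>UNIV - {0}. a $ k * w $ k) = 0" by (rule sum.neutral) (use n in auto)
    finally have "a $ 0 = 0" using a(2) by simp
    then have "a = 0" using n by (metis vec_eq_iff zero_index)
    then show False using a(1) by simp
  qed
  then obtain k where k: "k \<noteq> 0" "a $ k \<noteq> 0" by blast
  obtain j1 j2 j3 where J: "(UNIV :: 5 set) = {0, k, j1, j2, j3}" "j1 \<noteq> 0" "j2 \<noteq> 0" "j3 \<noteq> 0"
  proof -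
    have "k \<in> {1, 2, 3, 4}" using k(1) UNIV_5 by blast
    then consider "k = 1" | "k = 2" | "k = 3" | "k = 4" by blast
    then show ?thesis
    proof cases
      case 1 show ?thesis by (rule that[of 2 3 4]) (use 1 UNIV_5 in auto)
    next
      case 2 show ?thesis by (rule that[of 1 3 4]) (use 2 UNIV_5 in auto)
    next
      case 3 show ?thesis by (rule that[of 1 2 4]) (use 3 UNIV_5 in auto)
    next
      case 4 show ?thesis by (rule that[of 1 2 3]) (use 4 UNIV_5 in auto)
    qed
  qed
  define v where "v j = a $ k *s axis j 1 - a $ j *s axis k 1" for j
  have v: "(v j) $ 0 = 0" "dot a (v j) = 0" if "j \<noteq> 0" for j
    using that k(1) by (simp add: v_def axis_def) (simp add: v_def dot_diff_right dot_scale_right)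
  have "x = 0" if x: "dot w x = 0" "dot (v j1) x = 0" "dot (v j2) x = 0" "dot (v j3) x = 0" "dot (axis k 1) x = 0" for x
  proof -
    have xk: "x $ k = 0" using x(5) by simp
    have "x $ j = 0" if "dot (v j) x = 0" for j
      using that k(2) xk by (simp add: v_def dot_diff_left dot_scale_left)
    then have xj: "x $ j1 = 0" "x $ j2 = 0" "x $ j3 = 0" using x by auto
    have xne: "x $ i = 0" if "i \<noteq> 0" for i using J(1) UNIV_I[of i] that xk xj by auto
    have "dot w x = x $ 0 + (\<Sum>k\<in>UNIV - {0}. w $ k * x $ k)"
      using w by (simp add: dot_def sum.remove[of UNIV 0])
    also have "(\<Sum>k\<in>UNIV - {0}. w $ k * x $ k) = 0" by (rule sum.neutral) (use xne in auto)
    finally show "x = 0" using x(1) xne by (metis add.right_neutral vec_eq_iff zero_index)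
  qed
  then show ?thesis using that[of "v j1" "v j2" "v j3" "axis k 1"] v J(2-4) by blast
qed

text \<open>The algebra that exhibits an L-foliation consists of fields tangent everywhere, so the commutativity of
  the maximal algebra applies to it.\<close>

lemma holo_tangent:
  fixes A :: "complex ^ 'n::finite \<Rightarrow> complex ^ 'n"
  assumes fol: "foliation \<nu> A" and X: "X \<in> holo_vfields"
    and p: "homogeneous_poly e p" "p a \<noteq> 0"
    and tan: "\<And>z k. z \<noteq> 0 \<Longrightarrow> p z \<noteq> 0 \<Longrightarrow> z $ k \<noteq> 0 \<Longrightarrow> dot (A ((1 / z $ k) *s z)) (X k ((1 / z $ k) *s z)) = 0"
  shows "X \<in> tangent_algebra A"
    and "(\<And>w. w $ k = 1 \<Longrightarrow> X k w = B *v w - (B *v w) $ k *s w) \<Longrightarrow> dot (A z) (B *v z) = 0"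
proof -
  have A: "homogeneous_poly (\<nu> + 1) (\<lambda>z. A z $ k)" for k using fol unfolding foliation_def by blast
  have E: "dot (A z) z = 0" for z
    using fol unfolding foliation_def dot_def by (simp add: mult.commute)
  show B: "dot (A z) (B *v z) = 0" if "\<And>w. w $ k = 1 \<Longrightarrow> X k w = B *v w - (B *v w) $ k *s w" for B and z :: "complex ^ 'n" and k :: 'n
    by (rule tangent_polynomial[where A = A and p = p and X = X and k = k and B = B, OF A E p tan that])
  show "X \<in> tangent_algebra A"
    unfolding tangent_algebra_def
  proof (intro CollectI conjI allI ballI X)
    fix k :: 'n and w assume "w \<in> chart k"
    then have w: "w $ k = 1" by (simp add: chart_def)
    obtain B where Bw: "\<And>w. w $ k = 1 \<Longrightarrow> X k w = B *v w - (B *v w) $ k *s w"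
      using vfield_linear[OF X, of k] by blast
    show "form_app A w (X k w) = 0"
      using B[OF Bw, of w] E[of w] by (simp add: form_app_dot Bw[OF w] dot_diff_right dot_scale_right)
  qed
qed

definition frame :: "complex ^ 5 ^ 5 \<Rightarrow> complex ^ 5 ^ 5 \<Rightarrow> complex ^ 5 ^ 5 \<Rightarrow> complex ^ 5 \<Rightarrow> complex ^ 5 \<Rightarrow> complex ^ 5 ^ 5"
  where "frame B1 B2 B3 z v = (\<chi> i. if i = 4 then v else if i = 0 then z else if i = 1 then B1 *v z
    else if i = 2 then B2 *v z else B3 *v z)"

text \<open>The contraction of the volume form with the radial field and the three linear fields.\<close>

definition orbit_form :: "complex ^ 5 ^ 5 \<Rightarrow> complex ^ 5 ^ 5 \<Rightarrow> complex ^ 5 ^ 5 \<Rightarrow> complex ^ 5 \<Rightarrow> complex ^ 5"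
  where "orbit_form B1 B2 B3 z = (\<chi> k. det (frame B1 B2 B3 z (axis k 1)))"

lemma frame_nth: "frame B1 B2 B3 z v $ 0 = z" "frame B1 B2 B3 z v $ 1 = B1 *v z"
  "frame B1 B2 B3 z v $ 2 = B2 *v z" "frame B1 B2 B3 z v $ 3 = B3 *v z" "frame B1 B2 B3 z v $ 4 = v"
  by (simp_all add: frame_def)

lemma forall_5: "(\<forall>i::5. P i) \<longleftrightarrow> P 0 \<and> P 1 \<and> P 2 \<and> P 3 \<and> P 4"
  using UNIV_5 by (metis UNIV_I empty_iff insert_iff)

lemma sum_5: "sum f (UNIV :: 5 set) = f 0 + f 1 + f 2 + f 3 + f 4"
  unfolding UNIV_5 by (simp add: add.assoc)

lemma prod_5: "prod f (UNIV :: 5 set) = f 0 * f 1 * f 2 * f 3 * f 4"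
  unfolding UNIV_5 by (simp add: mult.assoc)

lemma dot_orbit_form: "dot (orbit_form B1 B2 B3 z) v = det (frame B1 B2 B3 z v)"
proof -
  let ?c = "\<lambda>i. if i = 0 then z else if i = 1 then B1 *v z else if i = 2 then B2 *v z else B3 *v z"
  have fr: "frame B1 B2 B3 z u = (\<chi> i. if i = 4 then u else ?c i)" for u by (simp add: frame_def)
  have "v = (\<Sum>k\<in>UNIV. v $ k *s axis k 1)"
    by (simp add: vec_eq_iff sum_component axis_def if_distrib[of "\<lambda>x. _ * x"] cong: if_cong)
  then have "det (frame B1 B2 B3 z v) = det (\<chi> i. if i = 4 then (\<Sum>k\<in>UNIV. v $ k *s axis k 1) else ?c i)"
    by (simp only: fr)
  also have "\<dots> = (\<Sum>k\<in>UNIV. det (\<chi> i. if i = 4 then v $ k *s axis k 1 else ?c i))"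
    by (rule det_linear_row_sum) simp
  also have "\<dots> = (\<Sum>k\<in>UNIV. v $ k * det (\<chi> i. if i = 4 then axis k 1 else ?c i))"
    by (simp only: det_row_mul)
  finally show ?thesis by (simp add: dot_def orbit_form_def fr mult.commute)
qed

lemma orbit_form_kernel:
  "dot (orbit_form B1 B2 B3 z) z = 0" "dot (orbit_form B1 B2 B3 z) (B1 *v z) = 0"
  "dot (orbit_form B1 B2 B3 z) (B2 *v z) = 0" "dot (orbit_form B1 B2 B3 z) (B3 *v z) = 0"
  unfolding dot_orbit_form
  by (rule det_identical_rows[of 0 4] det_identical_rows[of 1 4] det_identical_rows[of 2 4] det_identical_rows[of 3 4];
      simp add: row_def frame_nth)+

lemma orbit_form_scale: "orbit_form B1 B2 B3 (t *s z) = t ^ 4 *s orbit_form B1 B2 B3 z"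
proof -
  have "det (frame B1 B2 B3 (t *s z) v) = t ^ 4 * det (frame B1 B2 B3 z v)" for v
  proof -
    have "frame B1 B2 B3 (t *s z) v = (\<chi> i. (if i = 4 then 1 else t) *s frame B1 B2 B3 z v $ i)"
      unfolding vec_eq_iff[of "frame _ _ _ _ _"] forall_5 by (simp add: frame_nth vec.scale)
    then show ?thesis by (simp add: det_rows_mul prod_5 power4_eq_xxxx)
  qed
  then show ?thesis by (simp add: orbit_form_def vec_eq_iff)
qed

lemma polynomial_fun_orbit_form: "polynomial_fun (\<lambda>z. orbit_form B1 B2 B3 z $ k)"
proof -
  have "polynomial_fun (\<lambda>z. frame B1 B2 B3 z (axis k 1) $ i $ j)" for i j
  proof -
    have "i \<in> {0, 1, 2, 3, 4}" using UNIV_5 by blast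
    then show ?thesis
      by (elim insertE emptyE)
        (simp_all add: frame_nth polynomial_fun_matrix polynomial_fun_coord polynomial_fun_const)
  qed
  then show ?thesis unfolding orbit_form_def by (simp add: polynomial_fun_det)
qed

lemma frame_kernel:
  assumes "dot l z = 0" "dot l (B1 *v z) = 0" "dot l (B2 *v z) = 0" "dot l (B3 *v z) = 0" "dot l v = 0"
    and "det (frame B1 B2 B3 z v) \<noteq> 0"
  shows "l = 0"
proof -
  have "frame B1 B2 B3 z v *v l = 0"
    unfolding vec_eq_iff forall_5 using assms by (simp add: matrix_vector_dot frame_nth dot_commute)
  then show ?thesis using assms(6) nonsingular_iff_injective by blast
qed

lemma mspan_mem: "B0 \<in> mspan B0 B1 B2 B3" "B1 \<in> mspan B0 B1 B2 B3" "B2 \<in> mspan B0 B1 B2 B3" "B3 \<in> mspan B0 B1 B2 B3"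
proof -
  have "B0 *v v = 1 *s (B0 *v v) + 0 *s (B1 *v v) + 0 *s (B2 *v v) + 0 *s (B3 *v v)" for v by simp
  then show "B0 \<in> mspan B0 B1 B2 B3" unfolding mspan_def by blast
  have "B1 *v v = 0 *s (B0 *v v) + 1 *s (B1 *v v) + 0 *s (B2 *v v) + 0 *s (B3 *v v)" for v by simp
  then show "B1 \<in> mspan B0 B1 B2 B3" unfolding mspan_def by blast
  have "B2 *v v = 0 *s (B0 *v v) + 0 *s (B1 *v v) + 1 *s (B2 *v v) + 0 *s (B3 *v v)" for v by simp
  then show "B2 \<in> mspan B0 B1 B2 B3" unfolding mspan_def by blast
  have "B3 *v v = 0 *s (B0 *v v) + 0 *s (B1 *v v) + 0 *s (B2 *v v) + 1 *s (B3 *v v)" for v by simp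
  then show "B3 \<in> mspan B0 B1 B2 B3" unfolding mspan_def by blast
qed

lemma orbit_form_regular:
  assumes nz: "orbit_form B1 B2 B3 z \<noteq> 0" and A: "A \<noteq> 0"
    and ker: "\<And>B. B \<in> {mat 1, B1, B2, B3} \<Longrightarrow> dot A (B *v z) = 0"
  shows "regular_point (mspan (mat 1) B1 B2 B3) z A"
proof -
  obtain u where u: "det (frame B1 B2 B3 z u) \<noteq> 0"
    using nz dot_eq_0[of "orbit_form B1 B2 B3 z"] by (auto simp: dot_orbit_form)
  have k: "dot A z = 0" "dot A (B1 *v z) = 0" "dot A (B2 *v z) = 0" "dot A (B3 *v z) = 0"
    using ker[of "mat 1"] ker[of B1] ker[of B2] ker[of B3] by simp_all
  have Au: "dot A u \<noteq> 0" using frame_kernel[OF k _ u] A by blast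
  show ?thesis
    unfolding regular_point_def
  proof (intro conjI allI ballI impI A iffI)
    fix v assume "\<exists>B\<in>mspan (mat 1) B1 B2 B3. v = B *v z"
    then show "dot A v = 0" using k by (auto simp: mspan_def dot_add_right dot_scale_right)
  next
    fix v assume v: "dot A v = 0"
    obtain x where x: "v = (\<Sum>i\<in>UNIV. x i *s frame B1 B2 B3 z u $ i)" using nonsingular_rows_span[OF u] .
    then have x': "v = x 0 *s z + x 1 *s (B1 *v z) + x 2 *s (B2 *v z) + x 3 *s (B3 *v z) + x 4 *s u"
      by (simp add: sum_5 frame_nth)
    then have "x 4 * dot A u = 0" using v k by (simp add: dot_add_right dot_scale_right)
    then have x4: "x 4 = 0" using Au by simp
    define B where "B = mat (x 0) + (mat (x 1) ** B1 + (mat (x 2) ** B2 + mat (x 3) ** B3))"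
    have matv: "mat c *v y = c *s y" for c and y :: "complex ^ 5"
      by (simp add: vec_eq_iff matrix_vector_mult_def mat_def if_distrib[of "\<lambda>x. x * _"] cong: if_cong)
    have Bv: "B *v y = x 0 *s y + x 1 *s (B1 *v y) + x 2 *s (B2 *v y) + x 3 *s (B3 *v y)" for y
      by (simp add: B_def matrix_vector_mult_add_rdistrib matrix_vector_mul_assoc[symmetric] matv add.assoc)
    then have "B \<in> mspan (mat 1) B1 B2 B3" unfolding mspan_def by auto
    moreover have "v = B *v z" using x' x4 Bv by simp
    ultimately show "\<exists>B\<in>mspan (mat 1) B1 B2 B3. v = B *v z" by blast
  next
    fix B assume "B \<in> mspan (mat 1) B1 B2 B3" and Bz: "B *v z = 0"
    then obtain a b c d where B: "\<And>v. B *v v = a *s v + b *s (B1 *v v) + c *s (B2 *v v) + d *s (B3 *v v)"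
      unfolding mspan_def by auto
    define y :: "complex ^ 5" where "y = (\<chi> i. if i = 0 then a else if i = 1 then b else if i = 2 then c else if i = 3 then d else 0)"
    have "y v* frame B1 B2 B3 z u = (\<Sum>i\<in>UNIV. y $ i *s frame B1 B2 B3 z u $ i)"
      by (simp add: vec_eq_iff vector_matrix_mult_def sum_component mult.commute)
    also have "\<dots> = 0" using B[of z] Bz by (simp add: sum_5 frame_nth y_def)
    finally have "transpose (frame B1 B2 B3 z u) *v y = 0" by simp
    then have "y = 0" using u nonsingular_iff_injective[of "transpose (frame B1 B2 B3 z u)"] by (simp add: det_transpose)
    then have "y $ 0 = 0" "y $ 1 = 0" "y $ 2 = 0" "y $ 3 = 0" by simp_all
    then have "a = 0" "b = 0" "c = 0" "d = 0" by (simp_all add: y_def)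
    then have "B *v v = 0 *v v" for v by (simp add: B)
    then show "B = 0" by (simp add: matrix_eq)
  qed
qed

text \<open>Three fields of the algebra whose values at one generic point \<open>w\<close> span the tangent space of the leaf have
  lifts \<open>B\<^sub>1, B\<^sub>2, B\<^sub>3\<close> for which the orbit form does not vanish at \<open>w\<close>.  Both forms annihilate the
  same four vectors at every point, so they are parallel.\<close>

lemma L_foliation_orbit_form:
  fixes A :: "complex ^ 5 \<Rightarrow> complex ^ 5"
  assumes fol: "foliation 3 A" and L: "L_foliation A" and ab: "abelian (tangent_algebra A)"
  obtains B1 B2 B3 c where "B1 ** B2 = B2 ** B1" "B1 ** B3 = B3 ** B1" "B2 ** B3 = B3 ** B2"
    "c \<noteq> 0" "\<And>z. orbit_form B1 B2 B3 z = c *s A z"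
proof -
  have A: "homogeneous_poly 4 (\<lambda>z. A z $ k)" for k using fol unfolding foliation_def by simp
  have E: "dot (A z) z = 0" for z
    using fol unfolding foliation_def dot_def by (simp add: mult.commute)
  have cod: "codim_at_least 2 (sing_set A)" using fol unfolding foliation_def by blast
  obtain L where Ls: "lie_subalgebra L" and gen: "generically (\<lambda>z. \<forall>k. z $ k \<noteq> 0 \<longrightarrow>
       (let w = (1 / z $ k) *s z
        in {X k w | X. X \<in> L} = {v. v $ k = 0 \<and> form_app A w v = 0}))"
    using L unfolding L_foliation_def by blast
  obtain e p a where p: "homogeneous_poly e p" "p a \<noteq> 0" and
    gen: "\<And>z k. z \<noteq> 0 \<Longrightarrow> p z \<noteq> 0 \<Longrightarrow> z $ k \<noteq> 0 \<Longrightarrow>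
      {X k ((1 / z $ k) *s z) | X. X \<in> L} = {v. v $ k = 0 \<and> dot (A ((1 / z $ k) *s z)) v = 0}"
    using gen unfolding generically_def form_app_dot Let_def by auto
  have LX: "X \<in> holo_vfields" if "X \<in> L" for X using that Ls unfolding lie_subalgebra_def by blast
  have tan: "dot (A ((1 / z $ k) *s z)) (X k ((1 / z $ k) *s z)) = 0"
    if "X \<in> L" "z \<noteq> 0" "p z \<noteq> 0" "z $ k \<noteq> 0" for X z k
    using gen[OF that(2-4)] that(1) by blast
  have T1: "X \<in> tangent_algebra A" if "X \<in> L" for X
    by (rule holo_tangent(1)[OF fol LX[OF that] p]) (rule tan[OF that])
  have T2: "dot (A z) (B *v z) = 0"
    if "X \<in> L" "\<And>w. w $ 0 = 1 \<Longrightarrow> X 0 w = B *v w - (B *v w) $ 0 *s w" for X B z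
    by (rule holo_tangent(2)[where X = X and k = 0 and B = B, OF fol LX[OF that(1)] p tan[OF that(1)] that(2)])
  obtain z0 k0 where z0: "A z0 $ k0 \<noteq> 0"
    using nonzero_on_hyperplane[OF cod, of "axis 0 1"] by (metis axis_eq_0_iff vec_eq_iff zero_index zero_neq_one)
  obtain z1 where z1: "p z1 \<noteq> 0" "z1 $ 0 \<noteq> 0"
    using polynomial_fun_nonzero_mult[OF homogeneous_imp_polynomial_fun[OF p(1)] polynomial_fun_coord[of 0] p(2), of 1] by auto
  have "polynomial_fun (\<lambda>z. p z * z $ 0)"
    by (intro polynomial_fun_mult homogeneous_imp_polynomial_fun[OF p(1)] polynomial_fun_coord)
  then obtain z where z: "p z \<noteq> 0" "z $ 0 \<noteq> 0" "A z $ k0 \<noteq> 0"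
    using polynomial_fun_nonzero_mult[OF _ homogeneous_imp_polynomial_fun[OF A[of k0]], of "\<lambda>z. p z * z $ 0" z1 z0] z1 z0 by auto
  define w where "w = (1 / z $ 0) *s z"
  have w0: "w $ 0 = 1" using z by (simp add: w_def)
  have "A w $ k0 = (1 / z $ 0) ^ 4 * A z $ k0" unfolding w_def by (rule homogeneous_scale[OF A])
  then have Aw: "A w \<noteq> 0" using z by auto
  obtain v1 v2 v3 u where v: "v1 $ 0 = 0" "dot (A w) v1 = 0" "v2 $ 0 = 0" "dot (A w) v2 = 0" "v3 $ 0 = 0" "dot (A w) v3 = 0"
    "\<And>x. dot w x = 0 \<Longrightarrow> dot v1 x = 0 \<Longrightarrow> dot v2 x = 0 \<Longrightarrow> dot v3 x = 0 \<Longrightarrow> dot u x = 0 \<Longrightarrow> x = 0"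
    using kernel_frame[OF Aw E w0] by blast
  have "z \<noteq> 0" using z by auto
  have ex: "\<exists>X\<in>L. X 0 w = v" if "v $ 0 = 0" "dot (A w) v = 0" for v
  proof -
    have "v \<in> {X 0 w | X. X \<in> L}"
      using gen[OF \<open>z \<noteq> 0\<close> z(1,2)] that unfolding w_def[symmetric] by simp
    then show ?thesis by auto
  qed
  obtain X1 where X1: "X1 \<in> L" "X1 0 w = v1" using ex[OF v(1,2)] by blast
  obtain X2 where X2: "X2 \<in> L" "X2 0 w = v2" using ex[OF v(3,4)] by blast
  obtain X3 where X3: "X3 \<in> L" "X3 0 w = v3" using ex[OF v(5,6)] by blast
  obtain B1 where B1: "\<And>w. w $ 0 = 1 \<Longrightarrow> X1 0 w = B1 *v w - (B1 *v w) $ 0 *s w"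
    using vfield_linear[OF LX[OF X1(1)], of 0] by blast
  obtain B2 where B2: "\<And>w. w $ 0 = 1 \<Longrightarrow> X2 0 w = B2 *v w - (B2 *v w) $ 0 *s w"
    using vfield_linear[OF LX[OF X2(1)], of 0] by blast
  obtain B3 where B3: "\<And>w. w $ 0 = 1 \<Longrightarrow> X3 0 w = B3 *v w - (B3 *v w) $ 0 *s w"
    using vfield_linear[OF LX[OF X3(1)], of 0] by blast
  have br: "vfield_bracket X Y 0 = (\<lambda>w. 0)" if "X \<in> L" "Y \<in> L" for X Y
  proof -
    have "X \<in> tangent_algebra A" "Y \<in> tangent_algebra A" using T1 that by blast+
    then have "vfield_bracket X Y = (\<lambda>k w. 0)" using ab unfolding abelian_def by blast
    then show ?thesis by simp
  qed
  have comm: "B1 ** B2 = B2 ** B1" "B1 ** B3 = B3 ** B1" "B2 ** B3 = B3 ** B2"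
    using bracket_zero_imp_commute[OF B1 B2 br[OF X1(1) X2(1)]]
      bracket_zero_imp_commute[OF B1 B3 br[OF X1(1) X3(1)]]
      bracket_zero_imp_commute[OF B2 B3 br[OF X2(1) X3(1)]] by blast+
  have tB: "dot (A z) (B1 *v z) = 0" "dot (A z) (B2 *v z) = 0" "dot (A z) (B3 *v z) = 0" for z
    by (rule T2[OF X1(1) B1], assumption, rule T2[OF X2(1) B2], assumption, rule T2[OF X3(1) B3])
  let ?D = "orbit_form B1 B2 B3"
  have Dw: "?D w \<noteq> 0"
  proof -
    have "det (frame B1 B2 B3 w u) \<noteq> 0"
      unfolding nonsingular_iff_injective
    proof (intro allI impI)
      fix x assume "frame B1 B2 B3 w u *v x = 0"
      then have "\<forall>i. dot (frame B1 B2 B3 w u $ i) x = 0" by (metis matrix_vector_dot zero_index)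
      then have d: "dot w x = 0" "dot (B1 *v w) x = 0" "dot (B2 *v w) x = 0" "dot (B3 *v w) x = 0" "dot u x = 0"
        by (simp_all add: forall_5 frame_nth)
      have "dot v1 x = 0" using d B1[OF w0] X1(2) by (simp add: dot_diff_left dot_scale_left)
      moreover have "dot v2 x = 0" using d B2[OF w0] X2(2) by (simp add: dot_diff_left dot_scale_left)
      moreover have "dot v3 x = 0" using d B3[OF w0] X3(2) by (simp add: dot_diff_left dot_scale_left)
      ultimately show "x = 0" using v(7) d by blast
    qed
    then show ?thesis using dot_orbit_form[of B1 B2 B3 w u] by auto
  qed
  have par: "A z $ i * ?D z $ j = A z $ j * ?D z $ i" for z i j
  proof (cases "?D z = 0")
    case True
    then show ?thesis by simp
  next
    case False
    then obtain u where u: "det (frame B1 B2 B3 z u) \<noteq> 0"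
      using dot_eq_0[of "?D z"] by (auto simp: dot_orbit_form)
    define l where "l = dot (?D z) u *s A z - dot (A z) u *s ?D z"
    have "l = 0"
      by (rule frame_kernel[OF _ _ _ _ _ u])
        (simp_all add: l_def dot_diff_left dot_scale_left orbit_form_kernel tB E mult.commute)
    then have "dot (?D z) u * A z $ k = dot (A z) u * ?D z $ k" for k
      by (simp add: l_def vec_eq_iff)
    then have "dot (?D z) u * (A z $ i * ?D z $ j) = dot (?D z) u * (A z $ j * ?D z $ i)"
      by (metis (no_types, lifting) mult.assoc mult.commute)
    then show ?thesis using u dot_orbit_form[of B1 B2 B3 z u] by simp
  qed
  have sc: "?D (t *s z) $ k = t ^ 4 * ?D z $ k" for t z k by (simp add: orbit_form_scale)
  obtain c where c: "\<And>z. ?D z = c *s A z"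
    using polynomial_proportional[OF cod A polynomial_fun_orbit_form sc par] by blast
  have "c \<noteq> 0" using Dw c[of w] by auto
  then show ?thesis using that comm c by blast
qed

definition comm_space :: "(complex ^ 'n::finite ^ 'n) set \<Rightarrow> bool" where
  "comm_space V \<longleftrightarrow> mat 1 \<in> V \<and> (\<forall>B\<in>V. \<forall>C\<in>V. B + C \<in> V \<and> B - C \<in> V \<and> B ** C = C ** B) \<and>
     (\<forall>B\<in>V. \<forall>c. mat c ** B \<in> V)"

lemma mat_vector: "mat c *v y = c *s (y :: complex ^ 'n::finite)"
  by (simp add: vec_eq_iff matrix_vector_mult_def mat_def if_distrib[of "\<lambda>x. x * _"] cong: if_cong)

lemma comm_space_mspan:
  assumes "B1 ** B2 = B2 ** B1" "B1 ** B3 = B3 ** B1" "B2 ** B3 = B3 ** (B2 :: complex ^ 'n::finite ^ 'n)"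
  shows "comm_space (mspan (mat 1) B1 B2 B3)"
proof -
  have c: "B1 *v (B2 *v v) = B2 *v (B1 *v v)" "B1 *v (B3 *v v) = B3 *v (B1 *v v)"
    "B2 *v (B3 *v v) = B3 *v (B2 *v v)" for v
    using assms by (simp_all add: matrix_vector_mul_assoc)
  have "B + C \<in> mspan (mat 1) B1 B2 B3 \<and> B - C \<in> mspan (mat 1) B1 B2 B3 \<and> B ** C = C ** B"
    if BC: "B \<in> mspan (mat 1) B1 B2 B3" "C \<in> mspan (mat 1) B1 B2 B3" for B C
  proof -
    obtain a0 a1 a2 a3 where a: "\<And>v. B *v v = a0 *s v + a1 *s (B1 *v v) + a2 *s (B2 *v v) + a3 *s (B3 *v v)"
      using BC(1) unfolding mspan_def by auto
    obtain b0 b1 b2 b3 where b: "\<And>v. C *v v = b0 *s v + b1 *s (B1 *v v) + b2 *s (B2 *v v) + b3 *s (B3 *v v)"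
      using BC(2) unfolding mspan_def by auto
    have "(B + C) *v v = (a0 + b0) *s (mat 1 *v v) + (a1 + b1) *s (B1 *v v) + (a2 + b2) *s (B2 *v v) + (a3 + b3) *s (B3 *v v)" for v
      by (simp add: matrix_vector_mult_add_rdistrib a b vec_eq_iff algebra_simps)
    moreover have "(B - C) *v v = (a0 - b0) *s (mat 1 *v v) + (a1 - b1) *s (B1 *v v) + (a2 - b2) *s (B2 *v v) + (a3 - b3) *s (B3 *v v)" for v
      by (simp add: matrix_vector_mult_diff_rdistrib a b vec_eq_iff algebra_simps)
    moreover have "B *v (C *v v) = C *v (B *v v)" for v
      by (simp add: a b vec.add vec.scale c vec_eq_iff algebra_simps)
    then have "B ** C = C ** B" by (simp add: matrix_eq matrix_vector_mul_assoc[symmetric])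
    ultimately show ?thesis unfolding mspan_def by blast
  qed
  moreover have "mat c ** B \<in> mspan (mat 1) B1 B2 B3" if BC: "B \<in> mspan (mat 1) B1 B2 B3" for B c
  proof -
    obtain a0 a1 a2 a3 where a: "\<And>v. B *v v = a0 *s v + a1 *s (B1 *v v) + a2 *s (B2 *v v) + a3 *s (B3 *v v)"
      using BC unfolding mspan_def by auto
    have "(mat c ** B) *v v = (c * a0) *s (mat 1 *v v) + (c * a1) *s (B1 *v v) + (c * a2) *s (B2 *v v) + (c * a3) *s (B3 *v v)" for v
      by (simp add: matrix_vector_mul_assoc[symmetric] mat_vector a vec_eq_iff algebra_simps)
    then show ?thesis unfolding mspan_def by blast
  qed
  ultimately show ?thesis unfolding comm_space_def using mspan_mem by blast
qed

lemma L_foliation_comm_space: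
  fixes A :: "complex ^ 5 \<Rightarrow> complex ^ 5"
  assumes fol: "foliation 3 A" and L: "L_foliation A" and ab: "abelian (tangent_algebra A)"
  obtains V where "comm_space V" "\<And>z. A z \<noteq> 0 \<Longrightarrow> regular_point V z (A z)"
    "\<And>l. l \<noteq> 0 \<Longrightarrow> \<exists>z. dot l z = 0 \<and> A z \<noteq> 0"
    "\<And>S. finite S \<Longrightarrow> 0 \<notin> S \<Longrightarrow> \<exists>z. A z \<noteq> 0 \<and> (\<forall>l\<in>S. dot l z \<noteq> 0)"
proof -
  have A: "homogeneous_poly 4 (\<lambda>z. A z $ k)" for k using fol unfolding foliation_def by simp
  have cod: "codim_at_least 2 (sing_set A)" using fol unfolding foliation_def by blast
  obtain B1 B2 B3 c where B: "B1 ** B2 = B2 ** B1" "B1 ** B3 = B3 ** B1" "B2 ** B3 = B3 ** B2"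
    "c \<noteq> 0" "\<And>z. orbit_form B1 B2 B3 z = c *s A z"
    using L_foliation_orbit_form[OF fol L ab] by blast
  have ker: "dot (A z) (B *v z) = 0" if "B \<in> {mat 1, B1, B2, B3}" for B z
  proof -
    have "dot (orbit_form B1 B2 B3 z) (B *v z) = 0" using that orbit_form_kernel[of B1 B2 B3 z] by auto
    then show ?thesis using B(4,5) by (simp add: dot_scale_left)
  qed
  have reg: "regular_point (mspan (mat 1) B1 B2 B3) z (A z)" if "A z \<noteq> 0" for z
    by (rule orbit_form_regular[OF _ that ker]) (use B(4,5) that in auto)
  have hyp: "\<exists>z. dot l z = 0 \<and> A z \<noteq> 0" if "l \<noteq> 0" for l
    using nonzero_on_hyperplane[OF cod that] unfolding dot_def by blast
  have fin: "\<exists>z. A z \<noteq> 0 \<and> (\<forall>l\<in>S. dot l z \<noteq> 0)" if S: "finite S" "0 \<notin> S" for S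
  proof -
    obtain z0 k where z0: "A z0 $ k \<noteq> 0"
      using hyp[of "axis 0 1"] by (metis axis_eq_0_iff vec_eq_iff zero_index zero_neq_one)
    have "polynomial_fun (dot l) \<and> (\<exists>b. dot l b \<noteq> 0)" if "l \<in> S" for l
    proof -
      have "l \<noteq> 0" using S(2) that by auto
      then have "\<exists>b. dot l b \<noteq> 0" using dot_eq_0 by blast
      then show ?thesis using polynomial_fun_dot[of l] by blast
    qed
    then obtain z where "A z $ k \<noteq> 0" "\<And>l. l \<in> S \<Longrightarrow> dot l z \<noteq> 0"
      using polynomial_fun_nonzero_prod[OF S(1) homogeneous_imp_polynomial_fun[OF A[of k]] z0, of dot] by blast
    then show ?thesis by (metis zero_index)
  qed
  show ?thesis using that[OF comm_space_mspan[OF B(1-3)] reg hyp fin] .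
qed

section \<open>Eigenvectors and covectors\<close>

lemma vec_family_dependent:
  fixes g :: "'i \<Rightarrow> complex ^ 'n::finite"
  assumes "finite I" "card I > CARD('n)"
  obtains c i where "(\<Sum>i\<in>I. c i *s g i) = 0" "i \<in> I" "c i \<noteq> 0"
proof (cases "inj_on g I")
  case False
  then obtain i j where ij: "i \<in> I" "j \<in> I" "i \<noteq> j" "g i = g j" unfolding inj_on_def by blast
  define c where "c k = (if k = i then 1 else if k = j then - 1 else 0 :: complex)" for k
  have "(\<Sum>k\<in>I. c k *s g k) = (\<Sum>k\<in>{i, j}. c k *s g k)"
    by (rule sum.mono_neutral_right) (use assms ij in \<open>auto simp: c_def\<close>)
  also have "\<dots> = 0" using ij by (simp add: c_def)
  finally show ?thesis using that[of c i] ij by (simp add: c_def)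
next
  case True
  have "\<not> vec.independent (g ` I)"
  proof
    assume "vec.independent (g ` I)"
    then have "card (g ` I) \<le> vec.dim (UNIV :: (complex ^ 'n) set)"
      by (intro vec.independent_card_le_dim) auto
    then have "card I \<le> CARD('n)" by (simp only: vec_dim_card card_image[OF True])
    then show False using assms(2) by simp
  qed
  then obtain u v where u: "(\<Sum>v\<in>g ` I. u v *s v) = 0" "v \<in> g ` I" "u v \<noteq> 0"
    using vec.dependent_finite[of "g ` I"] assms(1) by auto
  then obtain i where i: "i \<in> I" "v = g i" by blast
  have "(\<Sum>i\<in>I. u (g i) *s g i) = 0" using u(1) sum.reindex[OF True, of "\<lambda>v. u v *s v"] by (simp add: o_def)
  then show ?thesis using that[of "\<lambda>i. u (g i)" i] i u(3) by simp
qed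

lemma independent_family_spans:
  fixes b :: "'i \<Rightarrow> complex ^ 'n::finite"
  assumes I: "finite I" "card I \<ge> CARD('n)"
    and indep: "\<And>c i. (\<Sum>i\<in>I. c i *s b i) = 0 \<Longrightarrow> i \<in> I \<Longrightarrow> c i = 0"
  shows "card I = CARD('n)" and "\<exists>c. v = (\<Sum>i\<in>I. c i *s b i)"
proof -
  show cI: "card I = CARD('n)"
    using vec_family_dependent[OF I(1), of b] indep I(2) by (metis le_neq_implies_less)
  obtain c j where c: "(\<Sum>j\<in>Some ` I \<union> {None}. c j *s (case j of None \<Rightarrow> v | Some i \<Rightarrow> b i)) = 0"
    "j \<in> Some ` I \<union> {None}" "c j \<noteq> 0"
  proof (rule vec_family_dependent[of "Some ` I \<union> {None}" "case_option v b"])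
    have "card (Some ` I \<union> {None}) = Suc (card I)"
      using I(1) by (simp add: card_image)
    then show "CARD('n) < card (Some ` I \<union> {None})" using cI by simp
  qed (use I(1) in auto)
  have eq: "c None *s v + (\<Sum>i\<in>I. c (Some i) *s b i) = 0"
    using c(1) I(1) by (simp add: sum.reindex image_iff)
  have "c None \<noteq> 0"
  proof
    assume n: "c None = 0"
    then have "c (Some i) = 0" if "i \<in> I" for i using eq indep[of "\<lambda>i. c (Some i)" i] that by simp
    then show False using c(2,3) n by auto
  qed
  then have "v = (\<Sum>i\<in>I. (- c (Some i) / c None) *s b i)"
  proof -
    assume nz: "c None \<noteq> 0"
    have "c None *s (\<Sum>i\<in>I. (- c (Some i) / c None) *s b i) = (\<Sum>i\<in>I. - (c (Some i) *s b i))"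
      by (simp add: vec.scale_sum_right nz)
    also have "\<dots> = - (\<Sum>i\<in>I. c (Some i) *s b i)" by (simp add: sum_negf)
    also have "\<dots> = c None *s v" using eq by (simp add: minus_unique add.commute)
    finally show ?thesis using nz by simp
  qed
  then show "\<exists>c. v = (\<Sum>i\<in>I. c i *s b i)" by (rule exI[of _ "\<lambda>i. - c (Some i) / c None"])
qed

text \<open>The iterates \<open>x, f x, f (f x), \<dots>\<close> are linearly dependent, so some polynomial in \<open>f\<close> kills the
  starting vector; in one of least degree, the cofactor of a linear factor produces an eigenvector.\<close>

lemma eigenvector_on_subspace:
  fixes f :: "complex ^ 'n::finite \<Rightarrow> complex ^ 'n"
  assumes W: "vec.subspace W" "v \<in> W" "v \<noteq> 0"
    and f: "\<And>x. x \<in> W \<Longrightarrow> f x \<in> W" "\<And>x y. x \<in> W \<Longrightarrow> y \<in> W \<Longrightarrow> f (x + y) = f x + f y"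
      "\<And>c x. x \<in> W \<Longrightarrow> f (c *s x) = c *s f x"
  obtains x c where "x \<in> W" "x \<noteq> 0" "f x = c *s x"
proof -
  note sub = vec.subspace_0[OF W(1)] vec.subspace_add[OF W(1)] vec.subspace_scale[OF W(1)]
  define P where "P p = fold_coeffs (\<lambda>a w. a *s v + f w) p 0" for p
  have f0: "f 0 = 0" using f(3)[of 0 0] sub(1) by simp
  have P0: "P 0 = 0" by (simp add: P_def)
  have PC: "P (pCons a p) = a *s v + f (P p)" for a p
    by (cases "a = 0 \<and> p = 0") (auto simp: P_def f0)
  have PW: "P p \<in> W" for p
    by (induction p) (simp_all add: P0 PC sub W(2) f(1))
  have Padd: "P (p + q) = P p + P q" for p q
    by (induction p q rule: poly_induct2) (simp_all add: P0 PC PW f(2) vec.scale_left_distrib)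
  have Psm: "P (smult c p) = c *s P p" for c p
    by (induction p) (simp_all add: P0 PC PW f(3) vec.scale_right_distrib)
  have Pmonom: "P (monom a k) = a *s (f ^^ k) v" for a k
  proof -
    have "P (monom a k) = a *s (f ^^ k) v \<and> (f ^^ k) v \<in> W"
      by (induction k) (simp_all add: monom_0 monom_Suc PC P0 f0 f(1,3) W(2))
    then show ?thesis ..
  qed
  have Psum: "P (\<Sum>i\<in>I. g i) = (\<Sum>i\<in>I. P (g i))" if "finite I" for g and I :: "nat set"
    using that by induction (simp_all add: P0 Padd)
  obtain c i where ci: "(\<Sum>k\<in>{..CARD('n)}. c k *s (f ^^ k) v) = 0" "i \<in> {..CARD('n)}" "c i \<noteq> 0"
    using vec_family_dependent[of "{..CARD('n)}" "\<lambda>k. (f ^^ k) v"] by auto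
  define p0 where "p0 = (\<Sum>k\<in>{..CARD('n)}. monom (c k) k)"
  have "P p0 = 0" using ci(1) by (simp add: p0_def Psum Pmonom)
  moreover have "coeff p0 i = c i" using ci(2) by (simp add: p0_def coeff_sum)
  then have "p0 \<noteq> 0" using ci(3) by auto
  ultimately obtain p where p: "p \<noteq> 0 \<and> P p = 0" and pmin: "\<And>q. q \<noteq> 0 \<and> P q = 0 \<Longrightarrow> degree p \<le> degree q"
    using arg_min_natI[of "\<lambda>p. p \<noteq> 0 \<and> P p = 0" p0 degree] arg_min_nat_le[of "\<lambda>p. p \<noteq> 0 \<and> P p = 0" _ degree]
    by blast
  have "degree p \<noteq> 0"
  proof
    assume "degree p = 0"
    then obtain a where "p = [:a:]" by (metis degree_eq_zeroE)
    then show False using p W(3) by (simp add: PC P0 f0)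
  qed
  then have "\<not> constant (poly p)" by (simp add: constant_degree)
  then obtain r where "poly p r = 0" using Fundamental_Theorem_Algebra.fundamental_theorem_of_algebra[of p] by auto
  then obtain q where q: "p = [:- r, 1:] * q" by (metis poly_eq_0_iff_dvd dvdE)
  have "q \<noteq> 0" using p q by auto
  have "degree p = Suc (degree q)" using \<open>q \<noteq> 0\<close> unfolding q by (subst degree_mult_eq) auto
  then have Pq: "P q \<noteq> 0" using pmin[of q] \<open>q \<noteq> 0\<close> by auto
  have "p = pCons 0 q + smult (- r) q" using q by simp
  then have "P p = f (P q) + (- r) *s P q" by (simp only: Padd Psm PC) simp
  then have "f (P q) = r *s P q" using p by (simp add: eq_neg_iff_add_eq_0)
  then show ?thesis using that[OF PW Pq] by blast
qed

lemma common_eigenvector: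
  fixes F :: "(complex ^ 'n::finite ^ 'n) set"
  assumes W: "vec.subspace W" "v \<in> W" "v \<noteq> 0"
    and inv: "\<And>B x. B \<in> F \<Longrightarrow> x \<in> W \<Longrightarrow> B *v x \<in> W"
    and comm: "\<And>B C. B \<in> F \<Longrightarrow> C \<in> F \<Longrightarrow> B ** C = C ** B"
  obtains x where "x \<in> W" "x \<noteq> 0" "\<And>B. B \<in> F \<Longrightarrow> \<exists>c. B *v x = c *s x"
proof -
  define good where "good U \<longleftrightarrow> vec.subspace U \<and> U \<subseteq> W \<and> U \<noteq> {0} \<and> (\<forall>B\<in>F. \<forall>x\<in>U. B *v x \<in> U)" for U
  have "good W" using W inv by (auto simp: good_def)
  then obtain U where U: "good U" and Umin: "\<And>U'. good U' \<Longrightarrow> vec.dim U \<le> vec.dim U'"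
    using arg_min_natI[of good W vec.dim] arg_min_nat_le[of good _ vec.dim] by blast
  then have Us: "vec.subspace U" "U \<subseteq> W" "U \<noteq> {0}" and Ui: "\<And>B x. B \<in> F \<Longrightarrow> x \<in> U \<Longrightarrow> B *v x \<in> U"
    by (auto simp: good_def)
  obtain u where u: "u \<in> U" "u \<noteq> 0" using Us(1,3) vec.subspace_0 by blast
  have "\<exists>c. B *v u = c *s u" if B: "B \<in> F" for B
  proof -
    obtain x c where x: "x \<in> U" "x \<noteq> 0" "B *v x = c *s x"
      by (rule eigenvector_on_subspace[OF Us(1) u, of "\<lambda>x. B *v x"])
        (auto simp: Ui[OF B] vec.add vec.scale)
    define E where "E = {y \<in> U. B *v y = c *s y}"
    have E: "vec.subspace E"
      unfolding vec.subspace_def E_def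
      using vec.subspace_0[OF Us(1)] vec.subspace_add[OF Us(1)] vec.subspace_scale[OF Us(1)]
      by (auto simp: vec.add vec.scale vec.scale_right_distrib mult.commute)
    have "C *v y \<in> E" if "C \<in> F" "y \<in> E" for C y
    proof -
      have "B *v (C *v y) = C *v (B *v y)" using comm[OF B that(1)] by (simp add: matrix_vector_mul_assoc)
      then show ?thesis using that Ui by (simp add: E_def vec.scale)
    qed
    then have "good E" unfolding good_def using E x Us(2) by (auto simp: E_def)
    then have "vec.dim U \<le> vec.dim E" by (rule Umin)
    then have "E = U" using vec.subspace_dim_equal[OF E Us(1)] by (auto simp: E_def)
    then show ?thesis using u(1) by (auto simp: E_def)
  qed
  then show ?thesis using that u Us(2) by blast
qed

lemma dot_kernel_subset:
  fixes l m :: "complex ^ 'n::finite"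
  assumes "\<And>w. dot l w = 0 \<Longrightarrow> dot m w = 0"
  obtains c where "m = c *s l"
proof (cases "l = 0")
  case True
  then have "m = 0" using assms dot_eq_0 by (metis dot_zero_left)
  then show ?thesis using that[of 0] by simp
next
  case False
  then obtain k where k: "l $ k \<noteq> 0" by (metis vec_eq_iff zero_index)
  have m: "m $ j = m $ k / l $ k * l $ j" for j
  proof -
    have "dot m (l $ k *s axis j 1 - l $ j *s axis k 1) = 0"
      by (rule assms) (simp add: dot_diff_right dot_scale_right)
    then show ?thesis using k by (simp add: dot_diff_right dot_scale_right field_simps)
  qed
  show ?thesis
    by (rule that[of "m $ k / l $ k"]) (simp only: vec_eq_iff vector_smult_component m[symmetric], simp)
qed

lemma dot_transpose: "dot (transpose M *v l) y = dot l (M *v y)"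
proof -
  have "dot (transpose M *v l) y = (\<Sum>j\<in>UNIV. \<Sum>i\<in>UNIV. M $ i $ j * l $ i * y $ j)"
    by (simp add: dot_def matrix_vector_mult_def transpose_def sum_distrib_right)
  also have "\<dots> = (\<Sum>i\<in>UNIV. \<Sum>j\<in>UNIV. M $ i $ j * l $ i * y $ j)" by (rule sum.swap)
  also have "\<dots> = dot l (M *v y)"
    by (simp add: dot_def matrix_vector_mult_def sum_distrib_left mult_ac)
  finally show ?thesis .
qed

lemma separating_covector:
  fixes W :: "(complex ^ 'n::finite) set"
  assumes W: "vec.subspace W" and x: "x \<notin> W"
  obtains l where "dot l x \<noteq> 0" "\<And>w. w \<in> W \<Longrightarrow> dot l w = 0"
proof -
  obtain b where b: "b \<subseteq> W" "vec.independent b" "W \<subseteq> vec.span b"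
    using vec.maximal_independent_subset[of W] by blast
  have "vec.span b \<subseteq> W" using b(1) W by (metis vec.span_minimal)
  then have "x \<notin> vec.span b" using x by blast
  then have ind: "vec.independent (insert x b)" using b(2) vec.independent_insertI by blast
  obtain g where g: "Vector_Spaces.linear (*s) (*s) g" "\<forall>y\<in>insert x b. g y = (if y = x then x else 0)"
    using vec.linear_independent_extend[OF ind, of "\<lambda>y. if y = x then x else 0"] by blast
  interpret g: Vector_Spaces.linear "(*s)" "(*s)" g by (rule g(1))
  have "x \<noteq> 0" using x W vec.subspace_0 by blast
  then obtain k where k: "x $ k \<noteq> 0" by (metis vec_eq_iff zero_index)
  define l where "l = (\<chi> i. g (axis i 1) $ k)"
  have l: "dot l y = g y $ k" for y
  proof -
    have "y = (\<Sum>i\<in>UNIV. y $ i *s axis i 1)"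
      by (simp add: vec_eq_iff sum_component axis_def if_distrib[of "\<lambda>x. _ * x"] cong: if_cong)
    then have "g y = (\<Sum>i\<in>UNIV. y $ i *s g (axis i 1))"
      by (metis (no_types, lifting) g.sum g.scale sum.cong)
    then show ?thesis by (simp add: dot_def l_def sum_component mult.commute)
  qed
  have "x \<notin> b" using x b(1) by blast
  have "dot l w = 0" if "w \<in> W" for w
  proof -
    have "w \<in> vec.span b" using b(3) that by blast
    then have "g w = 0"
    proof (rule g.eq_0_on_span[rotated])
      fix y assume "y \<in> b" then show "g y = 0" using g(2) \<open>x \<notin> b\<close> by auto
    qed
    then show ?thesis by (simp add: l)
  qed
  moreover have "dot l x \<noteq> 0" using g(2) k by (simp add: l)
  ultimately show ?thesis using that by blast
qed

lemma common_kernel_nonzero: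
  fixes u v :: "complex ^ 'n::finite"
  assumes "CARD('n) \<ge> 3"
  obtains k where "k \<noteq> 0" "dot u k = 0" "dot v k = 0"
proof -
  obtain i1 i2 i3 :: 'n where i: "i1 \<noteq> i2" "i1 \<noteq> i3" "i2 \<noteq> i3"
  proof -
    obtain T :: "'n set" where "card T = 3" using assms obtain_subset_with_card_n by metis
    then show ?thesis using that by (auto simp: card_3_iff)
  qed
  define N :: "complex ^ 'n ^ 'n" where "N = (\<chi> i. if i = i1 then u else v)"
  have "det N = 0"
    by (rule det_identical_rows[OF i(3)]) (use i in \<open>simp add: row_def N_def\<close>)
  then obtain k where k: "N *v k = 0" "k \<noteq> 0" using nonsingular_iff_injective by blast
  have "(N *v k) $ i1 = dot u k" "(N *v k) $ i2 = dot v k" using i by (simp_all add: matrix_vector_dot N_def)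
  then show ?thesis using that k by simp
qed

section \<open>Weights of a regular commuting space\<close>

definition eigencovector :: "(complex ^ 'n::finite ^ 'n) set \<Rightarrow> (complex ^ 'n ^ 'n \<Rightarrow> complex) \<Rightarrow> complex ^ 'n \<Rightarrow> bool" where
  "eigencovector V \<phi> l \<longleftrightarrow> l \<noteq> 0 \<and> (\<forall>B\<in>V. \<forall>x. dot l (B *v x) = \<phi> B * dot l x)"

lemma dot_vector_matrix: "dot (l v* M) y = dot l (M *v y)"
  using dot_transpose[of M l y] by simp

lemma regular_pointD:
  assumes "regular_point V z \<mu>"
  shows "\<mu> \<noteq> 0" "dot \<mu> v = 0 \<Longrightarrow> \<exists>B\<in>V. v = B *v z" "B \<in> V \<Longrightarrow> dot \<mu> (B *v z) = 0"
    "B \<in> V \<Longrightarrow> B *v z = 0 \<Longrightarrow> B = 0"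
proof -
  have r: "\<mu> \<noteq> 0" "\<forall>v. dot \<mu> v = 0 \<longleftrightarrow> (\<exists>B\<in>V. v = B *v z)" "\<forall>B\<in>V. B *v z = 0 \<longrightarrow> B = 0"
    using assms unfolding regular_point_def by simp_all
  show "\<mu> \<noteq> 0" by (rule r(1))
  show "\<exists>B\<in>V. v = B *v z" if "dot \<mu> v = 0" using r(2)[rule_format, of v] that by simp
  show "dot \<mu> (B *v z) = 0" if "B \<in> V" using r(2)[rule_format, of "B *v z"] that by auto
  show "B = 0" if "B \<in> V" "B *v z = 0" using r(3) that by simp
qed

text \<open>The linear algebra extracted from an abelian L-foliation: every hyperplane contains a regular point,
  and the regular points are not covered by finitely many hyperplanes.\<close>

locale regular_space =
  fixes V :: "(complex ^ 'n::finite ^ 'n) set"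
  assumes comm_space: "comm_space V"
    and dim3: "CARD('n) \<ge> 3"
    and hyperplane: "l \<noteq> 0 \<Longrightarrow> \<exists>z \<mu>. dot l z = 0 \<and> regular_point V z \<mu>"
    and generic: "finite S \<Longrightarrow> 0 \<notin> S \<Longrightarrow> \<exists>z \<mu>. regular_point V z \<mu> \<and> (\<forall>l\<in>S. dot l z \<noteq> 0)"
begin

lemma V_one: "mat 1 \<in> V" and V_add: "B \<in> V \<Longrightarrow> C \<in> V \<Longrightarrow> B + C \<in> V"
  and V_diff: "B \<in> V \<Longrightarrow> C \<in> V \<Longrightarrow> B - C \<in> V"
  and V_comm: "B \<in> V \<Longrightarrow> C \<in> V \<Longrightarrow> B ** C = C ** B"
  and V_scale: "B \<in> V \<Longrightarrow> mat c ** B \<in> V"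
  using comm_space unfolding comm_space_def by blast+

lemma V_mat: "mat c \<in> V" using V_scale[OF V_one, of c] by simp

lemma V_comm_vec: "B \<in> V \<Longrightarrow> C \<in> V \<Longrightarrow> B *v (C *v x) = C *v (B *v x)"
  using V_comm by (simp add: matrix_vector_mul_assoc)

lemma eigencovectorD: "eigencovector V \<phi> l \<Longrightarrow> B \<in> V \<Longrightarrow> dot l (B *v x) = \<phi> B * dot l x"
  unfolding eigencovector_def by blast

lemma eigencovector_nz: "eigencovector V \<phi> l \<Longrightarrow> l \<noteq> 0"
  unfolding eigencovector_def by blast

lemma invariant_covectors:
  assumes W: "vec.subspace W" "v \<in> W" "v \<noteq> 0"
    and inv: "\<And>B l. B \<in> V \<Longrightarrow> l \<in> W \<Longrightarrow> transpose B *v l \<in> W"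
  obtains l \<phi> where "l \<in> W" "eigencovector V \<phi> l"
proof -
  obtain l where l: "l \<in> W" "l \<noteq> 0" "\<And>B. B \<in> transpose ` V \<Longrightarrow> \<exists>c. B *v l = c *s l"
  proof (rule common_eigenvector[OF W, of "transpose ` V"])
    show "B *v x \<in> W" if "B \<in> transpose ` V" "x \<in> W" for B x using inv that by blast
    show "B ** C = C ** B" if "B \<in> transpose ` V" "C \<in> transpose ` V" for B C
      using that V_comm by (auto simp: matrix_transpose_mul[symmetric])
  qed blast
  then have "\<forall>B\<in>V. \<exists>c. transpose B *v l = c *s l" by blast
  then obtain \<phi> where \<phi>: "\<And>B. B \<in> V \<Longrightarrow> transpose B *v l = \<phi> B *s l" by metis
  have "dot l (B *v x) = \<phi> B * dot l x" if "B \<in> V" for B x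
    using \<phi>[OF that] by (simp add: dot_vector_matrix[symmetric] dot_scale_left)
  then have "eigencovector V \<phi> l" using l(2) by (simp add: eigencovector_def)
  then show ?thesis using that l(1) by blast
qed

text \<open>Regularity at a point of the kernel of an eigencovector \<open>l\<close>, where \<open>l\<close> itself has to be the
  annihilator of the tangent space, see \<open>eigencovector_free\<close>.\<close>

definition free_at :: "complex ^ 'n \<Rightarrow> complex ^ 'n \<Rightarrow> bool" where
  "free_at l z \<longleftrightarrow> dot l z = 0 \<and> (\<forall>w. dot l w = 0 \<longrightarrow> (\<exists>B\<in>V. w = B *v z)) \<and> (\<forall>B\<in>V. B *v z = 0 \<longrightarrow> B = 0)"

lemma free_atD: "free_at l z \<Longrightarrow> dot l z = 0"
  "free_at l z \<Longrightarrow> dot l w = 0 \<Longrightarrow> \<exists>B\<in>V. w = B *v z"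
  "free_at l z \<Longrightarrow> B \<in> V \<Longrightarrow> B *v z = 0 \<Longrightarrow> B = 0"
  unfolding free_at_def by blast+

lemma eigencovector_free:
  assumes l: "eigencovector V \<phi> l"
  obtains z where "free_at l z"
proof -
  obtain z \<mu> where z: "dot l z = 0" "regular_point V z \<mu>" using hyperplane[OF eigencovector_nz[OF l]] by blast
  have "dot l w = 0" if w: "dot \<mu> w = 0" for w
  proof -
    obtain B where "B \<in> V" "w = B *v z" using regular_pointD(2)[OF z(2) w] by blast
    then show ?thesis using eigencovectorD[OF l] z(1) by simp
  qed
  then obtain c where c: "l = c *s \<mu>" using dot_kernel_subset[of \<mu> l] by blast
  then have "c \<noteq> 0" using eigencovector_nz[OF l] by auto
  then have "dot \<mu> w = 0" if "dot l w = 0" for w using that c by (simp add: dot_scale_left)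
  then have "free_at l z"
    unfolding free_at_def using z(1) regular_pointD(2)[OF z(2)] regular_pointD(4)[OF z(2)] by simp
  then show ?thesis by (rule that)
qed

text \<open>Suppose \<open>c \<noteq> 0\<close>.  Then some eigencovector \<open>l\<close> has weight \<open>c\<close> at \<open>D\<close>; take a regular point
  \<open>z\<close> of its kernel.  All elements of \<open>V\<close> act on the pair \<open>(u, v)\<close> by the same scalar, so on
  \<open>V z = ker l\<close> the pair takes values in one line.  Hence a non-trivial combination of \<open>u\<close> and \<open>v\<close> is a
  multiple of \<open>l\<close>, which the different weights at \<open>D\<close> do not allow.\<close>

lemma weight_nilpotent:
  assumes u: "eigencovector V \<phi> u" and v: "eigencovector V \<phi> v" and ne: "\<And>c. v \<noteq> c *s u"
    and D: "D \<in> V" "\<phi> D = 0" and x: "x \<noteq> 0" "D *v x = c *s x"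
  shows "c = 0"
proof (rule ccontr)
  assume c: "c \<noteq> 0"
  define W where "W = {l. \<forall>y. dot l (D *v y) = c * dot l y}"
  have W: "vec.subspace W"
    unfolding vec.subspace_def W_def by (auto simp: dot_add_left dot_scale_left algebra_simps)
  have "(D - mat c) *v x = 0" using x(2) by (simp add: matrix_vector_mult_diff_rdistrib mat_vector)
  then have "det (D - mat c) = 0" using x(1) nonsingular_iff_injective by blast
  then have "det (transpose (D - mat c)) = 0" by (simp add: det_transpose)
  then obtain l0 where l0: "l0 \<noteq> 0" "transpose (D - mat c) *v l0 = 0" using nonsingular_iff_injective by blast
  have "dot l0 ((D - mat c) *v y) = 0" for y using l0(2) by (simp add: dot_vector_matrix[symmetric])
  then have "l0 \<in> W"
    by (simp add: W_def matrix_vector_mult_diff_rdistrib mat_vector dot_diff_right dot_scale_right)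
  then obtain l \<phi>' where l: "l \<in> W" "eigencovector V \<phi>' l"
  proof (rule invariant_covectors[OF W _ l0(1)])
    fix B m assume "B \<in> V" "m \<in> W"
    then show "transpose B *v m \<in> W" by (simp add: W_def dot_vector_matrix V_comm_vec[OF \<open>B \<in> V\<close> D(1)])
  qed
  have lc: "dot l (D *v y) = c * dot l y" for y using l(1) by (simp add: W_def)
  have uD: "dot u (D *v y) = 0" "dot v (D *v y) = 0" for y
    using eigencovectorD[OF u D(1)] eigencovectorD[OF v D(1)] D(2) by simp_all
  have indep: "e = 0" if "m = e *s l" "\<And>y. dot m (D *v y) = 0" for m e
  proof -
    have "e * c * dot l y = 0" for y using that(2)[of y] that(1) by (simp add: dot_scale_left lc)
    moreover obtain y where "dot l y \<noteq> 0" using eigencovector_nz[OF l(2)] dot_eq_0 by blast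
    ultimately show ?thesis using c by (metis mult_eq_0_iff)
  qed
  obtain z where z: "free_at l z" using eigencovector_free[OF l(2)] by blast
  define p q where "p = dot u z" "q = dot v z"
  have "dot (q *s u - p *s v) w = 0" if w: "dot l w = 0" for w
  proof -
    obtain B where "B \<in> V" "w = B *v z" using free_atD(2)[OF z w] by blast
    then show ?thesis
      using eigencovectorD[OF u] eigencovectorD[OF v] by (simp add: dot_diff_left dot_scale_left p_q_def)
  qed
  then obtain e where e: "q *s u - p *s v = e *s l" using dot_kernel_subset[of l] by blast
  have "e = 0" by (rule indep[OF e]) (simp add: dot_diff_left dot_scale_left uD)
  then have qp: "q *s u = p *s v" using e by simp
  have p: "p = 0"
  proof (rule ccontr)
    assume "p \<noteq> 0"
    then have "v = (q / p) *s u" using qp by (simp add: vec_eq_iff field_simps)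
    then show False using ne by blast
  qed
  have "dot u w = 0" if w: "dot l w = 0" for w
  proof -
    obtain B where "B \<in> V" "w = B *v z" using free_atD(2)[OF z w] by blast
    then show ?thesis using eigencovectorD[OF u] p by (simp add: p_q_def)
  qed
  then obtain e' where e': "u = e' *s l" using dot_kernel_subset[of l u] by blast
  have "e' = 0" by (rule indep[OF e']) (simp add: uD)
  then show False using e' eigencovector_nz[OF u] by simp
qed

text \<open>Suppose \<open>u\<close> and \<open>v\<close> are independent of the same weight, with regular points \<open>z\<^sub>1\<close> and
  \<open>z\<^sub>2\<close> in their kernels, and let \<open>K\<close> be the intersection of the kernels.  The map
  \<open>B z\<^sub>1 \<mapsto> B z\<^sub>2\<close> preserves \<open>K\<close> and has an eigenvector there, so some
  \<open>B \<noteq> 0\<close> in \<open>V\<close> kills \<open>y = z\<^sub>2 - t z\<^sub>1\<close>.  Some eigencovector \<open>l\<close> of the same weight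
  kills \<open>y\<close> as well, so that \<open>y = C z\<^sub>3\<close> with \<open>z\<^sub>3\<close> regular for \<open>l\<close>.  By
  \<open>weight_nilpotent\<close> the matrix \<open>C\<close> has only one eigenvalue, which is non-zero; hence \<open>B z\<^sub>3 = 0\<close>
  and \<open>B = 0\<close>.\<close>

lemma eigencovector_unique:
  assumes u: "eigencovector V \<phi> u" and v: "eigencovector V \<phi> v"
  shows "\<exists>c. v = c *s u"
proof (rule ccontr)
  assume "\<not> ?thesis"
  then have ne: "\<And>c. v \<noteq> c *s u" by blast
  obtain z1 where z1: "free_at u z1" using eigencovector_free[OF u] by blast
  obtain z2 where z2: "free_at v z2" using eigencovector_free[OF v] by blast
  have uz1: "dot u z1 = 0" and vz2: "dot v z2 = 0" using free_atD(1) z1 z2 by blast+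
  have vz1: "dot v z1 \<noteq> 0"
  proof
    assume "dot v z1 = 0"
    then have "dot v w = 0" if "dot u w = 0" for w
      using free_atD(2)[OF z1 that] eigencovectorD[OF v] by auto
    then show False using dot_kernel_subset[of u v] ne by blast
  qed
  have uz2: "dot u z2 \<noteq> 0"
  proof
    assume "dot u z2 = 0"
    then have "dot u w = 0" if "dot v w = 0" for w
      using free_atD(2)[OF z2 that] eigencovectorD[OF u] by auto
    then obtain c where c: "u = c *s v" using dot_kernel_subset[of v u] by blast
    then have "c \<noteq> 0" using eigencovector_nz[OF u] by auto
    then have "v = (1 / c) *s u" using c by simp
    then show False using ne by blast
  qed
  define K where "K = {k. dot u k = 0 \<and> dot v k = 0}"
  have K: "vec.subspace K"
    unfolding vec.subspace_def K_def by (auto simp: dot_add_right dot_scale_right)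
  obtain k0 where k0: "k0 \<in> K" "k0 \<noteq> 0" using common_kernel_nonzero[OF dim3, of u v] unfolding K_def by blast
  define lift where "lift k = (THE B. B \<in> V \<and> k = B *v z1)" for k
  have lift_ex: "\<exists>B. B \<in> V \<and> k = B *v z1" if "k \<in> K" for k
    using free_atD(2)[OF z1] that unfolding K_def by blast
  have z1_inj: "B = C" if "B \<in> V" "C \<in> V" "B *v z1 = C *v z1" for B C
    using free_atD(3)[OF z1 V_diff[OF that(1,2)]] that(3) by (simp add: matrix_vector_mult_diff_rdistrib)
  have lift_eq: "lift (B *v z1) = B" if "B \<in> V" for B
    unfolding lift_def using that z1_inj by (intro the_equality) auto
  have \<phi>0: "\<phi> B = 0" if "B \<in> V" "B *v z1 \<in> K" for B
    using eigencovectorD[OF v that(1), of z1] that(2) vz1 by (simp add: K_def)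
  define \<Theta> where "\<Theta> k = lift k *v z2" for k
  have \<Theta>: "\<Theta> (B *v z1) = B *v z2" if "B \<in> V" for B by (simp add: \<Theta>_def lift_eq that)
  obtain k t where k: "k \<in> K" "k \<noteq> 0" "\<Theta> k = t *s k"
  proof (rule eigenvector_on_subspace[OF K k0, of \<Theta>])
    show "\<Theta> x \<in> K" if x: "x \<in> K" for x
    proof -
      obtain B where B: "B \<in> V" "x = B *v z1" using lift_ex[OF x] by blast
      then show ?thesis
        using \<phi>0[of B] x eigencovectorD[OF u B(1), of z2] eigencovectorD[OF v B(1), of z2]
        by (simp add: \<Theta> K_def)
    qed
    show "\<Theta> (x + y) = \<Theta> x + \<Theta> y" if x: "x \<in> K" and y: "y \<in> K" for x y
    proof -
      obtain B where B: "B \<in> V" "x = B *v z1" using lift_ex[OF x] by blast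
      obtain C where C: "C \<in> V" "y = C *v z1" using lift_ex[OF y] by blast
      have "x + y = (B + C) *v z1" using B C by (simp add: matrix_vector_mult_add_rdistrib)
      then show ?thesis using B C \<Theta>[OF V_add[OF B(1) C(1)]] by (simp add: \<Theta> matrix_vector_mult_add_rdistrib)
    qed
    show "\<Theta> (c *s x) = c *s \<Theta> x" if x: "x \<in> K" for x c
    proof -
      obtain B where B: "B \<in> V" "x = B *v z1" using lift_ex[OF x] by blast
      have "c *s x = (mat c ** B) *v z1" using B by (simp add: matrix_vector_mul_assoc[symmetric] mat_vector)
      then show ?thesis using B \<Theta>[OF V_scale[OF B(1)], of c]
        by (simp add: \<Theta> matrix_vector_mul_assoc[symmetric] mat_vector)
    qed
  qed
  obtain B where B: "B \<in> V" "k = B *v z1" using lift_ex[OF k(1)] by blast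
  have Bz2: "B *v z2 = t *s (B *v z1)" using k(3) B \<Theta> by simp
  define y where "y = z2 - t *s z1"
  have By: "B *v y = 0" by (simp add: y_def matrix_vector_mult_diff_distrib vec.scale Bz2)
  have uy: "dot u y \<noteq> 0" using uz1 uz2 by (simp add: y_def dot_diff_right dot_scale_right)
  define l where "l = dot v y *s u - dot u y *s v"
  have "l \<noteq> 0"
  proof
    assume "l = 0"
    then have "v = (dot v y / dot u y) *s u" using uy by (simp add: l_def vec_eq_iff field_simps)
    then show False using ne by blast
  qed
  then have l: "eigencovector V \<phi> l"
    using eigencovectorD[OF u] eigencovectorD[OF v]
    by (auto simp: eigencovector_def l_def dot_diff_left dot_scale_left algebra_simps)
  have ly: "dot l y = 0" by (simp add: l_def dot_diff_left dot_scale_left mult.commute)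
  obtain z3 where z3: "free_at l z3" using eigencovector_free[OF l] by blast
  obtain C where C: "C \<in> V" "y = C *v z3" using free_atD(2)[OF z3 ly] by blast
  have "\<phi> C \<noteq> 0" using uy eigencovectorD[OF u C(1), of z3] C(2) by auto
  have C_inj: "x = 0" if x: "C *v x = 0" for x
  proof (rule ccontr)
    assume "x \<noteq> 0"
    define D where "D = C - mat (\<phi> C)"
    have D: "D \<in> V" unfolding D_def by (rule V_diff[OF C(1) V_mat])
    obtain w where w: "dot u w \<noteq> 0" using eigencovector_nz[OF u] dot_eq_0 by blast
    have "\<phi> D * dot u w = 0"
      using eigencovectorD[OF u D, of w] eigencovectorD[OF u C(1), of w]
      by (simp add: D_def matrix_vector_mult_diff_rdistrib mat_vector dot_diff_right dot_scale_right)
    then have "\<phi> D = 0" using w by simp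
    moreover have "D *v x = (- \<phi> C) *s x" using x by (simp add: D_def matrix_vector_mult_diff_rdistrib mat_vector)
    ultimately show False using weight_nilpotent[OF u v ne D _ \<open>x \<noteq> 0\<close>] \<open>\<phi> C \<noteq> 0\<close> by fastforce
  qed
  have "C *v (B *v z3) = 0" using By C V_comm_vec[OF B(1) C(1)] by simp
  then have "B = 0" using C_inj free_atD(3)[OF z3 B(1)] by blast
  then show False using B(2) k(2) by simp
qed

text \<open>The bicommutant of \<open>V\<close>.  It contains the algebra generated by \<open>V\<close>, is commutative because \<open>V\<close> is,
  and its closure properties need no polynomial expressions in elements of \<open>V\<close>.\<close>

definition alg :: "(complex ^ 'n ^ 'n) set" where
  "alg = {A. \<forall>C. (\<forall>B\<in>V. C ** B = B ** C) \<longrightarrow> A ** C = C ** A}"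

lemma V_alg: "B \<in> V \<Longrightarrow> B \<in> alg" by (auto simp: alg_def)

lemma algI:
  assumes "\<And>C. (\<And>B. B \<in> V \<Longrightarrow> C ** B = B ** C) \<Longrightarrow> A ** C = C ** A"
  shows "A \<in> alg"
  unfolding alg_def using assms by blast

lemma algD:
  assumes "A \<in> alg" "\<And>B. B \<in> V \<Longrightarrow> C ** B = B ** C"
  shows "A ** C = C ** A"
  using assms unfolding alg_def by blast

lemma alg_mult: assumes "A \<in> alg" "B \<in> alg" shows "A ** B \<in> alg"
proof (rule algI)
  fix C assume C: "\<And>B. B \<in> V \<Longrightarrow> C ** B = B ** C"
  have "(A ** B) ** C = A ** (C ** B)" using algD[OF assms(2) C] by (simp add: matrix_mul_assoc[symmetric])
  also have "\<dots> = C ** (A ** B)" using algD[OF assms(1) C] by (simp add: matrix_mul_assoc)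
  finally show "(A ** B) ** C = C ** (A ** B)" .
qed

lemma alg_diff: assumes "A \<in> alg" "B \<in> alg" shows "A - B \<in> alg"
proof (rule algI)
  fix C assume C: "\<And>B. B \<in> V \<Longrightarrow> C ** B = B ** C"
  have "A *v (C *v x) = C *v (A *v x)" "B *v (C *v x) = C *v (B *v x)" for x
    using algD[OF assms(1) C] algD[OF assms(2) C] by (simp_all add: matrix_vector_mul_assoc)
  then show "(A - B) ** C = C ** (A - B)"
    by (simp add: matrix_eq matrix_vector_mul_assoc[symmetric] matrix_vector_mult_diff_rdistrib
        matrix_vector_mult_diff_distrib)
qed

lemma alg_comm: assumes "A \<in> alg" "B \<in> alg" shows "A ** B = B ** A"
  by (rule algD[OF assms(1)], rule algD[OF assms(2)], rule V_comm)

lemma alg_comm_vec: "A \<in> alg \<Longrightarrow> B \<in> alg \<Longrightarrow> A *v (B *v x) = B *v (A *v x)"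
  using alg_comm by (simp add: matrix_vector_mul_assoc)

lemma alg_one: "mat 1 \<in> alg" and alg_mat: "mat c \<in> alg"
  using V_alg V_mat by blast+

lemma alg_eigencovector:
  assumes l: "eigencovector V \<phi> l" and A: "A \<in> alg"
  shows "\<exists>c. \<forall>x. dot l (A *v x) = c * dot l x"
proof -
  define l' where "l' = transpose A *v l"
  have l': "dot l' x = dot l (A *v x)" for x by (simp add: l'_def dot_vector_matrix)
  show ?thesis
  proof (cases "l' = 0")
    case True
    then show ?thesis using l' by (metis dot_zero_left mult_zero_left)
  next
    case False
    have "dot l' (B *v x) = \<phi> B * dot l' x" if "B \<in> V" for B x
      using eigencovectorD[OF l that] alg_comm_vec[OF A V_alg[OF that]] by (simp add: l')
    then have "eigencovector V \<phi> l'" using False by (simp add: eigencovector_def)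
    then obtain c where "l' = c *s l" using eigencovector_unique[OF l] by blast
    then show ?thesis using l' by (metis dot_scale_left)
  qed
qed

text \<open>In a combination of independent eigencovectors that is again one, every term that occurs has the weight of the
  sum; so there is only one term, by \<open>eigencovector_unique\<close>.\<close>

lemma eigencovector_basis:
  obtains S where "finite S" "0 \<notin> S" "\<And>l. l \<in> S \<Longrightarrow> \<exists>\<phi>. eigencovector V \<phi> l"
    "\<And>\<phi> l. eigencovector V \<phi> l \<Longrightarrow> \<exists>s\<in>S. \<exists>c. l = c *s s"
    "\<And>l m c. l \<in> S \<Longrightarrow> m \<in> S \<Longrightarrow> m = c *s l \<Longrightarrow> m = l"
proof -
  define E where "E = {l. \<exists>\<phi>. eigencovector V \<phi> l}"
  obtain S where S: "S \<subseteq> E" "vec.independent S" "E \<subseteq> vec.span S"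
    using vec.maximal_independent_subset[of E] by blast
  have fin: "finite S" using S(2) vec.finiteI_independent by blast
  have "0 \<notin> S" using S(2) vec.dependent_zero by blast
  have "\<forall>l\<in>S. \<exists>\<phi>. eigencovector V \<phi> l" using S(1) by (auto simp: E_def)
  then obtain \<phi>s where \<phi>s: "\<And>l. l \<in> S \<Longrightarrow> eigencovector V (\<phi>s l) l" by metis
  have "\<exists>s\<in>S. \<exists>c. l = c *s s" if l: "eigencovector V \<phi> l" for \<phi> l
  proof -
    have "l \<in> vec.span S" using l S(3) by (auto simp: E_def)
    then obtain a where a: "l = (\<Sum>s\<in>S. a s *s s)" using vec.span_finite[OF fin] by auto
    have "\<exists>s\<in>S. a s \<noteq> 0" using a eigencovector_nz[OF l] by (metis (no_types, lifting) sum.neutral vec.scale_zero_left)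
    then obtain s where s: "s \<in> S" "a s \<noteq> 0" by blast
    have "\<phi>s s B = \<phi> B" if B: "B \<in> V" for B
    proof -
      have "dot (\<Sum>s\<in>S. (a s * (\<phi>s s B - \<phi> B)) *s s) x = 0" for x
      proof -
        have "dot l (B *v x) = (\<Sum>s\<in>S. a s * dot s (B *v x))"
          by (simp add: a dot_commute[of _ "B *v x"] dot_sum_right dot_scale_right)
        also have "\<dots> = (\<Sum>s\<in>S. a s * \<phi>s s B * dot s x)"
          by (rule sum.cong) (simp_all add: eigencovectorD[OF \<phi>s B])
        finally have 1: "\<phi> B * dot l x = (\<Sum>s\<in>S. a s * \<phi>s s B * dot s x)" using eigencovectorD[OF l B] by simp
        have 2: "dot l x = (\<Sum>s\<in>S. a s * dot s x)"
          by (simp add: a dot_commute[of _ x] dot_sum_right dot_scale_right)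
        have "dot (\<Sum>s\<in>S. (a s * (\<phi>s s B - \<phi> B)) *s s) x = (\<Sum>s\<in>S. a s * (\<phi>s s B - \<phi> B) * dot s x)"
          by (simp add: dot_commute[of _ x] dot_sum_right dot_scale_right)
        also have "\<dots> = (\<Sum>s\<in>S. a s * \<phi>s s B * dot s x) - \<phi> B * (\<Sum>s\<in>S. a s * dot s x)"
          by (simp add: sum_subtractf[symmetric] sum_distrib_left algebra_simps)
        finally show ?thesis using 1 2 by simp
      qed
      then have "(\<Sum>s\<in>S. (a s * (\<phi>s s B - \<phi> B)) *s s) = 0" by (rule dot_eq_0)
      then have "a s * (\<phi>s s B - \<phi> B) = 0"
        using S(2) s(1) unfolding vec.independent_explicit by (auto dest!: spec[of _ "\<lambda>s. a s * (\<phi>s s B - \<phi> B)"])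
      then show ?thesis using s(2) by simp
    qed
    then have "eigencovector V \<phi> s" using \<phi>s[OF s(1)] by (auto simp: eigencovector_def)
    then show ?thesis using eigencovector_unique[OF _ l] s(1) by blast
  qed
  moreover have "m = l" if "l \<in> S" "m \<in> S" "m = c *s l" for l m c
  proof (rule ccontr)
    assume "m \<noteq> l"
    then have "l \<in> S - {m}" using that by blast
    then have "c *s l \<in> vec.span (S - {m})" by (intro vec.span_scale vec.span_base)
    then have "m \<in> vec.span (S - {m})" by (simp only: that(3)[symmetric])
    then show False using S(2) that(2) unfolding vec.dependent_def by blast
  qed
  ultimately show ?thesis using that[OF fin \<open>0 \<notin> S\<close>] \<phi>s by blast
qed

end

section \<open>Decomposition into truncated polynomial rings\<close>

lemma nilpotent_chain_independent:
  fixes f :: "complex ^ 'n::finite \<Rightarrow> complex ^ 'n"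
  assumes lin: "\<And>x y. f (x + y) = f x + f y" "\<And>c x. f (c *s x) = c *s f x"
    and nil: "(f ^^ d) w = 0" "(f ^^ (d - 1)) w \<noteq> 0"
    and sum0: "(\<Sum>k<d. \<beta> k *s (f ^^ k) w) = 0" and k: "k < d"
  shows "\<beta> k = 0"
  using k
proof (induction k rule: less_induct)
  case (less k)
  have f0: "f 0 = 0" using lin(2)[of 0 0] by simp
  have pw0: "(f ^^ n) 0 = 0" for n by (induction n) (simp_all add: f0)
  have pwadd: "(f ^^ n) (x + y) = (f ^^ n) x + (f ^^ n) y" for n x y by (induction n) (simp_all add: lin)
  have pwsc: "(f ^^ n) (c *s x) = c *s (f ^^ n) x" for n c x by (induction n) (simp_all add: lin)
  have pwsum: "(f ^^ n) (\<Sum>i\<in>I. g i) = (\<Sum>i\<in>I. (f ^^ n) (g i))" if "finite I" for n g and I :: "nat set"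
    using that by induction (simp_all add: pw0 pwadd)
  have big: "(f ^^ n) w = 0" if "n \<ge> d" for n
  proof -
    have "(f ^^ n) w = (f ^^ (n - d)) ((f ^^ d) w)" using that by (simp add: funpow_add[symmetric, THEN fun_cong, unfolded o_def])
    then show ?thesis by (simp add: nil pw0)
  qed
  have "(\<Sum>j<d. \<beta> j *s (f ^^ (d - 1 - k + j)) w) = (f ^^ (d - 1 - k)) (\<Sum>j<d. \<beta> j *s (f ^^ j) w)"
    by (simp add: pwsum pwsc funpow_add)
  also have "\<dots> = 0" by (simp add: sum0 pw0)
  also have "(\<Sum>j<d. \<beta> j *s (f ^^ (d - 1 - k + j)) w) = (\<Sum>j\<in>{k}. \<beta> j *s (f ^^ (d - 1 - k + j)) w)"
  proof (rule sum.mono_neutral_right)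
    show "\<forall>j\<in>{..<d} - {k}. \<beta> j *s (f ^^ (d - 1 - k + j)) w = 0"
    proof
      fix j assume j: "j \<in> {..<d} - {k}"
      show "\<beta> j *s (f ^^ (d - 1 - k + j)) w = 0"
      proof (cases "j < k")
        case True
        then show ?thesis using less.IH[of j] less.prems by simp
      next
        case False
        then have "d - 1 - k + j \<ge> d" using j less.prems by auto
        then show ?thesis by (simp add: big)
      qed
    qed
  qed (use less.prems in auto)
  finally have "\<beta> k *s (f ^^ (d - 1)) w = 0" using less.prems by simp
  then show ?case using nil(2) by (simp add: vec.scale_eq_0_iff)
qed

context regular_space
begin

text \<open>The covectors that annihilate \<open>alg z\<^sub>0\<close> form an invariant space; if it were non-zero it would
  contain an eigencovector, which does not vanish at \<open>z\<^sub>0\<close>.\<close>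

lemma cyclic:
  assumes "\<And>\<phi> l. eigencovector V \<phi> l \<Longrightarrow> dot l z0 \<noteq> 0"
  shows "\<exists>A\<in>alg. A *v z0 = v"
proof (rule ccontr)
  assume n: "\<not> ?thesis"
  define W where "W = {A *v z0 | A. A \<in> alg}"
  have W: "vec.subspace W"
    unfolding vec.subspace_def
  proof (intro conjI ballI allI)
    show "0 \<in> W" unfolding W_def using alg_mat[of 0] by (auto intro!: exI[of _ "mat 0"] simp: mat_vector)
  next
    fix x y assume "x \<in> W" "y \<in> W"
    then obtain A B where AB: "A \<in> alg" "B \<in> alg" "x = A *v z0" "y = B *v z0" unfolding W_def by blast
    have "A - mat (-1) ** B \<in> alg" using AB alg_diff alg_mult alg_mat by blast
    moreover have "(A - mat (-1) ** B) *v z0 = x + y"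
      using AB by (simp add: matrix_vector_mult_diff_rdistrib matrix_vector_mul_assoc[symmetric] mat_vector)
    ultimately show "x + y \<in> W" unfolding W_def by (metis (mono_tags, lifting) mem_Collect_eq)
  next
    fix c x assume "x \<in> W"
    then obtain A where A: "A \<in> alg" "x = A *v z0" unfolding W_def by blast
    have "(mat c ** A) *v z0 = c *s x" using A by (simp add: matrix_vector_mul_assoc[symmetric] mat_vector)
    moreover have "mat c ** A \<in> alg" using A alg_mult alg_mat by blast
    ultimately show "c *s x \<in> W" unfolding W_def by (metis (mono_tags, lifting) mem_Collect_eq)
  qed
  have "v \<notin> W" using n unfolding W_def by blast
  then obtain l where l: "dot l v \<noteq> 0" "\<And>w. w \<in> W \<Longrightarrow> dot l w = 0"
    using separating_covector[OF W] by blast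
  define P where "P = {m. \<forall>A\<in>alg. dot m (A *v z0) = 0}"
  have P: "vec.subspace P" unfolding vec.subspace_def P_def by (auto simp: dot_add_left dot_scale_left)
  have "l \<in> P" using l(2) unfolding P_def W_def by blast
  moreover have "l \<noteq> 0" using l(1) by auto
  ultimately obtain m \<phi> where m: "m \<in> P" "eigencovector V \<phi> m"
  proof (rule invariant_covectors[OF P])
    fix B m assume B: "B \<in> V" and m: "m \<in> P"
    have "dot m (B *v (A *v z0)) = 0" if "A \<in> alg" for A
      using m alg_mult[OF V_alg[OF B] that] unfolding P_def by (simp add: matrix_vector_mul_assoc)
    then show "transpose B *v m \<in> P" by (simp add: P_def dot_vector_matrix)
  qed
  have "dot m (mat 1 *v z0) = 0" using m(1) alg_one unfolding P_def by blast
  then show False using assms[OF m(2)] by simp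
qed

end

text \<open>A cyclic vector \<open>z0\<close> that is also regular and, for each eigencovector \<open>l\<close> in the list \<open>S\<close>, the
  element \<open>a l\<close> of the algebra that moves \<open>z0\<close> to a regular point of the kernel of \<open>l\<close>.  The
  image of \<open>a l\<close> is the whole kernel of \<open>l\<close>; in the local factor that belongs to \<open>l\<close> it is
  the generator of the maximal ideal, in the others it is a unit.\<close>

locale block_data = regular_space V for V :: "(complex ^ 'n::finite ^ 'n) set" +
  fixes S :: "(complex ^ 'n) set" and a :: "complex ^ 'n \<Rightarrow> complex ^ 'n ^ 'n" and z0 \<mu> :: "complex ^ 'n"
  assumes finite_S: "finite S"
    and S_eigen: "l \<in> S \<Longrightarrow> \<exists>\<phi>. eigencovector V \<phi> l"
    and S_all: "eigencovector V \<phi> l \<Longrightarrow> \<exists>s\<in>S. \<exists>c. l = c *s s"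
    and S_distinct: "l \<in> S \<Longrightarrow> m \<in> S \<Longrightarrow> m = c *s l \<Longrightarrow> m = l"
    and regular: "regular_point V z0 \<mu>"
    and z0_S: "l \<in> S \<Longrightarrow> dot l z0 \<noteq> 0"
    and a_alg: "a l \<in> alg"
    and a_free: "l \<in> S \<Longrightarrow> free_at l (a l *v z0)"
begin

lemma z0_cyclic: "\<exists>A\<in>alg. A *v z0 = v"
proof (rule cyclic)
  fix \<phi> l assume l: "eigencovector V \<phi> l"
  then obtain s c where sc: "s \<in> S" "l = c *s s" using S_all by blast
  have "c \<noteq> 0" using eigencovector_nz[OF l] sc(2) by auto
  then show "dot l z0 \<noteq> 0" using z0_S[OF sc(1)] sc(2) by (simp add: dot_scale_left)
qed

lemma alg_faithful:
  assumes A: "A \<in> alg" "A *v z0 = 0" shows "A = 0"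
proof -
  have "A *v v = 0 *v v" for v
  proof -
    obtain B where B: "B \<in> alg" "B *v z0 = v" using z0_cyclic by blast
    then show ?thesis using alg_comm_vec[OF A(1) B(1), of z0] A(2) by auto
  qed
  then show ?thesis by (simp add: matrix_eq)
qed

definition wt where "wt l A = (SOME c. \<forall>x. dot l (A *v x) = c * dot l x)"

lemma wt: "l \<in> S \<Longrightarrow> A \<in> alg \<Longrightarrow> dot l (A *v x) = wt l A * dot l x"
  unfolding wt_def using S_eigen alg_eigencovector someI_ex[of "\<lambda>c. \<forall>x. dot l (A *v x) = c * dot l x"] by blast

lemma a_kills: assumes l: "l \<in> S" shows "dot l (a l *v x) = 0"
proof -
  have "wt l (a l) * dot l z0 = 0" using wt[OF l a_alg, of l z0] free_atD(1)[OF a_free[OF l]] by simp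
  then show ?thesis using z0_S[OF l] wt[OF l a_alg, of l x] by simp
qed

lemma a_range: assumes l: "l \<in> S" and w: "dot l w = 0" shows "\<exists>y. w = a l *v y"
proof -
  obtain B where B: "B \<in> V" "w = B *v (a l *v z0)" using free_atD(2)[OF a_free[OF l] w] by blast
  then show ?thesis using alg_comm_vec[OF V_alg[OF B(1)] a_alg, of l z0] by auto
qed

lemma wt_a: assumes "l \<in> S" "m \<in> S" "l \<noteq> m" shows "wt l (a m) \<noteq> 0"
proof
  assume 0: "wt l (a m) = 0"
  have "dot l w = 0" if w: "dot m w = 0" for w
    using a_range[OF assms(2) w] wt[OF assms(1) a_alg] 0 by auto
  then obtain c where "l = c *s m" using dot_kernel_subset[of m l] by blast
  then show False using S_distinct[OF assms(2,1)] assms(3) by blast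
qed

text \<open>The algebra is commutative, so a product of generators depends on a multiset only.\<close>

definition Pr :: "(complex ^ 'n) multiset \<Rightarrow> complex ^ 'n ^ 'n" where
  "Pr ms = fold_mset (\<lambda>l M. a l ** M) (mat 1) ms"

lemma Pr_empty: "Pr {#} = mat 1" by (simp add: Pr_def)

lemma Pr_add: "Pr (add_mset l ms) = a l ** Pr ms"
proof -
  interpret comp_fun_commute "\<lambda>l M. a l ** M"
  proof
    fix l m
    show "(\<lambda>M. a m ** M) \<circ> (\<lambda>M. a l ** M) = (\<lambda>M. a l ** M) \<circ> (\<lambda>M. a m ** M)"
      using alg_comm[OF a_alg a_alg, of l m] by (simp add: fun_eq_iff matrix_mul_assoc)
  qed
  show ?thesis unfolding Pr_def by simp
qed

lemma Pr_alg: "Pr ms \<in> alg"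
  by (induction ms) (simp_all add: Pr_empty Pr_add alg_one alg_mult a_alg)

lemma Pr_union: "Pr (ms + ns) = Pr ms ** Pr ns"
  by (induction ms) (simp_all add: Pr_empty Pr_add matrix_mul_assoc)

lemma Pr_replicate: "Pr (replicate_mset k l + ns) *v x = ((*v) (a l) ^^ k) (Pr ns *v x)"
  by (induction k) (simp_all add: Pr_add matrix_vector_mul_assoc[symmetric])

lemma wt_Pr: "l \<in> S \<Longrightarrow> set_mset ms \<subseteq> S - {l} \<Longrightarrow> \<exists>c. c \<noteq> 0 \<and> (\<forall>x. dot l (Pr ms *v x) = c * dot l x)"
proof (induction ms)
  case empty
  then show ?case by (auto simp: Pr_empty intro!: exI[of _ 1])
next
  case (add m ms)
  then obtain c where c: "c \<noteq> 0" "\<And>x. dot l (Pr ms *v x) = c * dot l x" by auto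
  have "wt l (a m) \<noteq> 0" using add.prems wt_a[of l m] by auto
  then show ?case
    using c wt[OF add.prems(1) a_alg, of m]
    by (intro exI[of _ "wt l (a m) * c"]) (simp add: Pr_add matrix_vector_mul_assoc[symmetric])
qed

text \<open>The image of \<open>a l\<close> is a hyperplane.\<close>

lemma rank_drop: assumes l: "l \<in> S"
  shows "vec.dim (range ((*v) M)) \<le> vec.dim (range ((*v) (M ** a l))) + 1"
proof -
  let ?T = "range ((*v) (M ** a l))"
  have T: "vec.subspace ?T"
    unfolding vec.subspace_def
    by (auto simp: vec.add[symmetric] vec.scale[symmetric] intro: range_eqI[of _ _ 0])
  have "dot l z0 \<noteq> 0" using z0_S[OF l] .
  have "M *v x \<in> vec.span (insert (M *v z0) ?T)" for x
  proof -
    define c where "c = dot l x / dot l z0"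
    have "dot l (x - c *s z0) = 0" using \<open>dot l z0 \<noteq> 0\<close> by (simp add: c_def dot_diff_right dot_scale_right)
    then obtain y where y: "x - c *s z0 = a l *v y" using a_range[OF l] by blast
    have "M *v x = M *v (x - c *s z0) + c *s (M *v z0)" by (simp add: matrix_vector_mult_diff_distrib vec.scale)
    also have "\<dots> = (M ** a l) *v y + c *s (M *v z0)" by (simp only: y matrix_vector_mul_assoc)
    also have "\<dots> \<in> vec.span (insert (M *v z0) ?T)"
      by (intro vec.span_add vec.span_scale vec.span_base) auto
    finally show ?thesis .
  qed
  then have "vec.dim (range ((*v) M)) \<le> vec.dim (vec.span (insert (M *v z0) ?T))"
    by (intro vec.dim_subset) auto
  also have "\<dots> = vec.dim (insert (M *v z0) ?T)" by (rule vec.dim_span)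
  also have "\<dots> \<le> vec.dim ?T + 1" by (subst vec.dim_insert) simp
  finally show ?thesis .
qed

lemma rank_Pr: "set_mset ms \<subseteq> S \<Longrightarrow> CARD('n) \<le> vec.dim (range ((*v) (Pr ms))) + size ms"
proof (induction ms)
  case empty
  have "range ((*v) (Pr {#})) = (UNIV :: (complex ^ 'n) set)" by (simp add: Pr_empty image_def)
  then show ?case by (simp only: vec_dim_card)
next
  case (add l ms)
  have "Pr (add_mset l ms) = Pr ms ** a l" by (simp add: Pr_add alg_comm[OF a_alg Pr_alg])
  then show ?case using add rank_drop[of l "Pr ms"] by simp
qed

text \<open>The covectors that factor through \<open>M\<close> form an invariant space and contain an eigencovector
  \<open>l\<close>.  If \<open>l x = m (M x)\<close>, then \<open>m\<close> separates \<open>M z0\<close> from the image of \<open>a l M\<close>.\<close>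

lemma rank_strict: assumes M: "M \<in> alg" "M \<noteq> 0"
  obtains l where "l \<in> S" "vec.dim (range ((*v) (a l ** M))) < vec.dim (range ((*v) M))"
proof -
  define W where "W = {l. \<exists>m. \<forall>x. dot l x = dot m (M *v x)}"
  have W: "vec.subspace W"
    unfolding vec.subspace_def
  proof (intro conjI ballI allI)
    show "0 \<in> W" unfolding W_def by (auto intro!: exI[of _ 0])
  next
    fix l l' assume "l \<in> W" "l' \<in> W"
    then obtain m m' where "\<forall>x. dot l x = dot m (M *v x)" "\<forall>x. dot l' x = dot m' (M *v x)" unfolding W_def by blast
    then have "\<forall>x. dot (l + l') x = dot (m + m') (M *v x)" by (simp add: dot_add_left)
    then show "l + l' \<in> W" unfolding W_def by blast
  next
    fix c l assume "l \<in> W"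
    then obtain m where "\<forall>x. dot l x = dot m (M *v x)" unfolding W_def by blast
    then have "\<forall>x. dot (c *s l) x = dot (c *s m) (M *v x)" by (simp add: dot_scale_left)
    then show "c *s l \<in> W" unfolding W_def by blast
  qed
  obtain x where x: "M *v x \<noteq> 0" using M(2) by (metis matrix_eq matrix_vector_mult_0)
  then obtain m0 where m0: "dot m0 (M *v x) \<noteq> 0" by (metis dot_commute dot_eq_0)
  have "m0 v* M \<in> W" unfolding W_def using dot_vector_matrix by blast
  moreover have "m0 v* M \<noteq> 0" using m0 by (metis dot_vector_matrix dot_zero_left)
  ultimately obtain l' \<phi> where l': "l' \<in> W" "eigencovector V \<phi> l'"
  proof (rule invariant_covectors[OF W])
    fix B l assume B: "B \<in> V" and "l \<in> W"
    then obtain m where m: "\<forall>x. dot l x = dot m (M *v x)" unfolding W_def by blast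
    have "dot (l v* B) x = dot (m v* B) (M *v x)" for x
      using m alg_comm_vec[OF M(1) V_alg[OF B]] by (simp add: dot_vector_matrix)
    then show "transpose B *v l \<in> W" unfolding W_def by auto
  qed
  obtain s c where s: "s \<in> S" "l' = c *s s" using S_all[OF l'(2)] by blast
  have "c \<noteq> 0" using eigencovector_nz[OF l'(2)] s(2) by auto
  obtain m where m: "\<And>x. dot l' x = dot m (M *v x)" using l'(1) unfolding W_def by blast
  let ?T = "range ((*v) (a s ** M))" and ?U = "range ((*v) M)"
  have sub: "vec.subspace (range ((*v) (N :: complex ^ 'n ^ 'n)))" for N
    unfolding vec.subspace_def
    by (auto simp: vec.add[symmetric] vec.scale[symmetric] intro: range_eqI[of _ _ 0])
  have "?T \<subseteq> ?U"
    using alg_comm[OF a_alg M(1)] by (auto simp: matrix_vector_mul_assoc[symmetric])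
  moreover have "M *v z0 \<notin> ?T"
  proof
    assume "M *v z0 \<in> ?T"
    then obtain y where "M *v z0 = M *v (a s *v y)"
      using alg_comm[OF a_alg M(1)] by (auto simp: matrix_vector_mul_assoc[symmetric])
    then have "dot l' z0 = dot l' (a s *v y)" by (simp add: m)
    then show False using a_kills[OF s(1)] z0_S[OF s(1)] \<open>c \<noteq> 0\<close> by (simp add: s(2) dot_scale_left)
  qed
  ultimately have "?T \<subset> ?U" by blast
  then have "vec.span ?T \<subset> vec.span ?U" using sub vec.span_eq_iff by metis
  then show ?thesis using that[OF s(1)] vec.dim_psubset by blast
qed

lemma Pr_nilpotent: "\<exists>ms. set_mset ms \<subseteq> S \<and> Pr ms = 0"
proof -
  have "M \<in> alg \<Longrightarrow> \<exists>ms. set_mset ms \<subseteq> S \<and> Pr ms ** M = 0" for M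
  proof (induction "vec.dim (range ((*v) M))" arbitrary: M rule: less_induct)
    case less
    show ?case
    proof (cases "M = 0")
      case True
      then show ?thesis by (intro exI[of _ "{#}"]) (simp add: Pr_empty)
    next
      case False
      obtain l where l: "l \<in> S" "vec.dim (range ((*v) (a l ** M))) < vec.dim (range ((*v) M))"
        using rank_strict[OF less.prems False] by blast
      obtain ms where "set_mset ms \<subseteq> S" "Pr ms ** (a l ** M) = 0"
        using less.hyps[OF l(2) alg_mult[OF a_alg less.prems]] by blast
      then show ?thesis
        using l(1) by (intro exI[of _ "add_mset l ms"])
          (simp add: Pr_add alg_comm[OF a_alg Pr_alg] matrix_mul_assoc)
    qed
  qed
  from this[OF alg_one] show ?thesis by simp
qed

end

context block_data
begin

definition pw where "pw l k x = ((*v) (a l) ^^ k) x"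

lemma pw_0: "pw l 0 x = x" and pw_Suc: "pw l (Suc k) x = a l *v pw l k x"
  and pw_pw: "pw l k (pw l j x) = pw l (k + j) x"
  by (simp_all add: pw_def funpow_add)

lemma pw_alg: "A \<in> alg \<Longrightarrow> A *v pw l k x = pw l k (A *v x)"
  by (induction k) (simp_all add: pw_0 pw_Suc alg_comm_vec[OF _ a_alg])

lemma pw_add: "pw l k (x + y) = pw l k x + pw l k y"
  and pw_scale: "pw l k (c *s x) = c *s pw l k x" and pw_zero: "pw l k 0 = 0"
  by (induction k; simp add: pw_0 pw_Suc vec.add vec.scale)+

lemma pw_sum: "finite I \<Longrightarrow> pw l k (\<Sum>i\<in>I. g i) = (\<Sum>i\<in>I. pw l k (g i))"
  by (induction I rule: finite_induct) (simp_all add: pw_add pw_zero)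

lemma matrix_sum: "A *v (\<Sum>i\<in>I. g i) = (\<Sum>i\<in>I. A *v g i)" for A :: "complex ^ 'n ^ 'n"
  by (rule vec.sum)

text \<open>A multiset \<open>ms\<close> of least size with \<open>Pr ms = 0\<close> has at least as many elements as the dimension,
  since each factor lowers the rank by at most one.  The multiplicities \<open>d l\<close> are the block sizes: the partial
  products \<open>c l\<close> without the factor \<open>a l\<close> separate the blocks, and the chains
  \<open>a l\<^sup>k (e l)\<close>, with \<open>e l\<close> the component of \<open>z0\<close> in the block of \<open>l\<close>, are
  independent and hence a basis.  The functional is \<open>B \<mapsto> \<mu> (B z0)\<close>; it vanishes on \<open>V\<close> as
  \<open>z0\<close> is regular.  If it vanished on the socle element \<open>s l\<close>, this would lie in \<open>V\<close>, although it
  kills the regular point \<open>a l z0\<close>.\<close>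

lemma block_structure_data:
  obtains L :: "(complex ^ 'n) set" and b :: "complex ^ 'n \<Rightarrow> nat \<Rightarrow> complex ^ 'n" and d :: "complex ^ 'n \<Rightarrow> nat"
  where "finite L" "(\<Sum>l\<in>L. d l) = CARD('n)" "\<And>l. l \<in> L \<Longrightarrow> d l \<ge> 1"
    "\<And>\<beta> l k. (\<Sum>l\<in>L. \<Sum>k<d l. \<beta> l k *s b l k) = 0 \<Longrightarrow> l \<in> L \<Longrightarrow> k < d l \<Longrightarrow> \<beta> l k = (0 :: complex)"
    "\<And>B. B \<in> V \<Longrightarrow> \<exists>\<beta>. (\<forall>l\<in>L. \<forall>k<d l. B *v b l k = (\<Sum>j<d l - k. \<beta> l j *s b l (k + j))) \<and>
        (\<Sum>l\<in>L. \<Sum>k<d l. \<beta> l k * dot \<mu> (b l k)) = 0"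
    "\<And>l. l \<in> L \<Longrightarrow> dot \<mu> (b l (d l - 1)) \<noteq> 0"
proof -
  obtain ms where ms: "set_mset ms \<subseteq> S" "Pr ms = 0"
    and msmin: "\<And>ns. set_mset ns \<subseteq> S \<Longrightarrow> Pr ns = 0 \<Longrightarrow> size ms \<le> size ns"
  proof -
    obtain ms0 where "set_mset ms0 \<subseteq> S \<and> Pr ms0 = 0" using Pr_nilpotent by blast
    then show ?thesis
      using that arg_min_natI[of "\<lambda>ms. set_mset ms \<subseteq> S \<and> Pr ms = 0" ms0 size]
        arg_min_nat_le[of "\<lambda>ms. set_mset ms \<subseteq> S \<and> Pr ms = 0" _ size] by blast
  qed
  define L where "L = set_mset ms"
  define d where "d l = count ms l" for l
  define rest where "rest l = filter_mset (\<lambda>m. m \<noteq> l) ms" for l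
  define c where "c l = Pr (rest l)" for l
  have finL: "finite L" by (simp add: L_def)
  have LS: "l \<in> S" if "l \<in> L" for l using that ms(1) by (auto simp: L_def)
  have d1: "d l \<ge> 1" if "l \<in> L" for l using that by (simp add: L_def d_def Suc_le_eq)
  have c_alg: "c l \<in> alg" for l by (simp add: c_def Pr_alg)
  have split_ms: "ms = replicate_mset (d l) l + rest l" for l
    by (rule multiset_eqI) (simp add: d_def rest_def)
  have size_ms: "(\<Sum>l\<in>L. d l) = size ms" by (simp add: size_multiset_overloaded_eq L_def d_def)
  have size_ge: "CARD('n) \<le> size ms"
  proof -
    have "range ((*v) (0 :: complex ^ 'n ^ 'n)) = {0}" by auto
    then have "vec.dim (range ((*v) (Pr ms))) = 0" by (simp add: ms(2))
    then show ?thesis using rank_Pr[OF ms(1)] by linarith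
  qed
  have super0: "Pr ns = 0" if "ms \<subseteq># ns" for ns
  proof -
    obtain ps where "ns = ms + ps" using \<open>ms \<subseteq># ns\<close> by (metis subset_mset.add_diff_inverse)
    then show ?thesis by (simp add: Pr_union ms(2))
  qed
  have cc: "c l *v (c j *v x) = 0" if lj: "l \<in> L" "j \<in> L" "j \<noteq> l" for l j x
  proof -
    have "ms \<subseteq># rest l + rest j"
      using lj by (intro mset_subset_eqI) (simp add: rest_def)
    then have "Pr (rest l + rest j) = 0" by (rule super0)
    then show ?thesis by (simp add: c_def Pr_union matrix_vector_mul_assoc)
  qed
  have pwc: "pw l (d l) (c l *v x) = 0" for l x
    using Pr_replicate[of "d l" l "rest l" x] split_ms[of l] ms(2) by (simp add: pw_def c_def)
  define s where "s l = Pr (replicate_mset (d l - 1) l + rest l)" for l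
  have s_pw: "s l *v x = pw l (d l - 1) (c l *v x)" for l x
    by (simp add: s_def Pr_replicate pw_def c_def)
  have s_alg: "s l \<in> alg" for l by (simp add: s_def Pr_alg)
  have s_nz: "s l \<noteq> 0" if l: "l \<in> L" for l
  proof
    assume "s l = 0"
    moreover have "set_mset (replicate_mset (d l - 1) l + rest l) \<subseteq> S"
      using ms(1) LS[OF l] by (auto simp: rest_def)
    ultimately have "size ms \<le> size (replicate_mset (d l - 1) l + rest l)" using msmin unfolding s_def by blast
    moreover have "size ms = d l + size (rest l)" by (subst split_ms[of l]) simp
    ultimately show False using d1[OF l] by simp
  qed
  have s_a: "s l *v (a l *v x) = 0" if l: "l \<in> L" for l x
  proof -
    have "s l *v (a l *v x) = a l *v (s l *v x)" by (rule alg_comm_vec[OF s_alg a_alg])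
    also have "\<dots> = pw l (Suc (d l - 1)) (c l *v x)" by (simp only: s_pw pw_Suc)
    finally have "s l *v (a l *v x) = pw l (Suc (d l - 1)) (c l *v x)" .
    then show ?thesis using pwc[of l x] d1[OF l] by simp
  qed
  have c_wt: "\<exists>t. t \<noteq> 0 \<and> (\<forall>x. dot l (c l *v x) = t * dot l x)" if l: "l \<in> L" for l
    unfolding c_def by (rule wt_Pr[OF LS[OF l]]) (use ms(1) in \<open>auto simp: rest_def\<close>)
  have c_wt0: "dot l (c j *v x) = 0" if lj: "l \<in> L" "j \<in> L" "j \<noteq> l" for l j x
  proof -
    have "l \<in># rest j" using lj by (simp add: rest_def L_def)
    then obtain ns where "rest j = add_mset l ns" by (metis insert_DiffM)
    then have "c j *v x = a l *v (Pr ns *v x)" by (simp add: c_def Pr_add matrix_vector_mul_assoc)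
    then show ?thesis using a_kills[OF LS[OF lj(1)]] by simp
  qed
  have cs_nz: "c l *v (s l *v z0) \<noteq> 0" if l: "l \<in> L" for l
  proof -
    obtain t where t: "t \<noteq> 0" "\<And>x. dot l (c l *v x) = t * dot l x" using c_wt[OF l] by blast
    have "dot l (c l *v z0 - t *s z0) = 0" by (simp add: dot_diff_right dot_scale_right t(2))
    then obtain y where y: "c l *v z0 - t *s z0 = a l *v y" using a_range[OF LS[OF l]] by blast
    have "s l *v (c l *v z0 - t *s z0) = 0" unfolding y by (rule s_a[OF l])
    then have "c l *v (s l *v z0) = t *s (s l *v z0)"
      using alg_comm_vec[OF c_alg s_alg, of l l z0] by (simp add: matrix_vector_mult_diff_distrib vec.scale)
    moreover have "s l *v z0 \<noteq> 0" using alg_faithful[OF s_alg] s_nz[OF l] by blast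
    ultimately show ?thesis using t(1) by (simp add: vec.scale_eq_0_iff)
  qed
  \<comment> \<open>The argument is used for two systems of block generators: \<open>u l = c l z0\<close>, which shows that the chains
    are a basis, and the components \<open>e l\<close> of \<open>z0\<close> in this basis.\<close>
  have coeff_zero: "\<beta> j k = 0"
    if e1: "\<And>l j. l \<in> L \<Longrightarrow> j \<in> L \<Longrightarrow> j \<noteq> l \<Longrightarrow> c j *v e l = 0"
      and e2: "\<And>l. l \<in> L \<Longrightarrow> pw l (d l) (e l) = 0"
      and e3: "\<And>l. l \<in> L \<Longrightarrow> c l *v pw l (d l - 1) (e l) \<noteq> 0"
      and j: "j \<in> L" "k < d j" and van: "c j *v (\<Sum>l\<in>L. \<Sum>k<d l. \<beta> l k *s pw l k (e l)) = 0"
    for e :: "complex ^ 'n \<Rightarrow> complex ^ 'n" and \<beta> :: "complex ^ 'n \<Rightarrow> nat \<Rightarrow> complex" and j k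
  proof -
    define g where "g l = (\<Sum>k<d l. \<beta> l k *s pw l k (c j *v e l))" for l
    have "(\<Sum>l\<in>L. g l) = c j *v (\<Sum>l\<in>L. \<Sum>k<d l. \<beta> l k *s pw l k (e l))"
      by (simp add: g_def matrix_sum vec.scale pw_alg[OF c_alg])
    then have "(\<Sum>l\<in>L. g l) = 0" using van by simp
    moreover have "(\<Sum>l\<in>L. g l) = (\<Sum>l\<in>{j}. g l)"
    proof (rule sum.mono_neutral_right[OF finL])
      show "\<forall>l\<in>L - {j}. g l = 0"
      proof
        fix l assume "l \<in> L - {j}"
        then have "c j *v e l = 0" using e1[of l j] j(1) by auto
        then show "g l = 0" by (simp add: g_def pw_zero)
      qed
    qed (use j in auto)
    ultimately have "g j = 0" by simp
    then have g: "(\<Sum>k<d j. \<beta> j k *s ((*v) (a j) ^^ k) (c j *v e j)) = 0" by (simp add: g_def pw_def)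
    have "((*v) (a j) ^^ d j) (c j *v e j) = 0" "((*v) (a j) ^^ (d j - 1)) (c j *v e j) \<noteq> 0"
      using e2[OF j(1)] e3[OF j(1)] pw_alg[OF c_alg, of j j "d j" "e j"] pw_alg[OF c_alg, of j j "d j - 1" "e j"]
      by (simp_all add: pw_def)
    from nilpotent_chain_independent[OF _ _ this g j(2)] show ?thesis by (simp add: vec.add vec.scale)
  qed
  define I where "I = Sigma L (\<lambda>l. {..<d l})"
  have finI: "finite I" using finL by (simp add: I_def)
  have cardI: "card I = size ms" using finL by (simp add: I_def size_ms[symmetric])
  have sumI: "(\<Sum>i\<in>I. F (fst i) (snd i)) = (\<Sum>l\<in>L. \<Sum>k<d l. F l k)" for F :: "complex ^ 'n \<Rightarrow> nat \<Rightarrow> complex ^ 'n"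
    using sum.Sigma[OF finL, of "\<lambda>l. {..<d l}" F] by (simp add: I_def split_beta)
  have spans: "card I = CARD('n)" "\<exists>\<beta>. v = (\<Sum>l\<in>L. \<Sum>k<d l. \<beta> l k *s pw l k (e l))"
    if e1: "\<And>l j. l \<in> L \<Longrightarrow> j \<in> L \<Longrightarrow> j \<noteq> l \<Longrightarrow> c j *v e l = 0"
      and e2: "\<And>l. l \<in> L \<Longrightarrow> pw l (d l) (e l) = 0"
      and e3: "\<And>l. l \<in> L \<Longrightarrow> c l *v pw l (d l - 1) (e l) \<noteq> 0"
    for e :: "complex ^ 'n \<Rightarrow> complex ^ 'n" and v
  proof -
    have ind: "\<gamma> i = 0" if "(\<Sum>i\<in>I. \<gamma> i *s pw (fst i) (snd i) (e (fst i))) = 0" "i \<in> I" for \<gamma> i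
    proof -
      have "(\<Sum>l\<in>L. \<Sum>k<d l. \<gamma> (l, k) *s pw l k (e l)) = 0"
        using that(1) sumI[of "\<lambda>l k. \<gamma> (l, k) *s pw l k (e l)"] by simp
      then have "\<gamma> (fst i, snd i) = 0"
        using coeff_zero[OF e1 e2 e3, of "fst i" "snd i" "\<lambda>l k. \<gamma> (l, k)"] that(2) by (auto simp: I_def)
      then show ?thesis by simp
    qed
    have ge: "CARD('n) \<le> card I" using size_ge cardI by simp
    show "card I = CARD('n)" by (rule independent_family_spans(1)[where b = "\<lambda>i. pw (fst i) (snd i) (e (fst i))", OF finI ge]) (rule ind)
    obtain \<gamma> where "v = (\<Sum>i\<in>I. \<gamma> i *s pw (fst i) (snd i) (e (fst i)))"
    proof -
      have "\<exists>\<gamma>. v = (\<Sum>i\<in>I. \<gamma> i *s pw (fst i) (snd i) (e (fst i)))"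
        by (rule independent_family_spans(2)[OF finI ge]) (rule ind)
      then show ?thesis using that by blast
    qed
    then have "v = (\<Sum>l\<in>L. \<Sum>k<d l. \<gamma> (l, k) *s pw l k (e l))"
      using sumI[of "\<lambda>l k. \<gamma> (l, k) *s pw l k (e l)"] by simp
    then show "\<exists>\<beta>. v = (\<Sum>l\<in>L. \<Sum>k<d l. \<beta> l k *s pw l k (e l))" by (rule exI[of _ "\<lambda>l k. \<gamma> (l, k)"])
  qed
  define u where "u l = c l *v z0" for l
  have u1: "c j *v u l = 0" if "l \<in> L" "j \<in> L" "j \<noteq> l" for l j
    unfolding u_def using cc[OF that(2,1)] that(3) by simp
  have u2: "pw l (d l) (u l) = 0" if "l \<in> L" for l by (simp add: u_def pwc)
  have u3: "c l *v pw l (d l - 1) (u l) \<noteq> 0" if "l \<in> L" for l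
    using cs_nz[OF that] by (simp add: s_pw u_def)
  have cardI': "size ms = CARD('n)" using spans(1)[OF u1 u2 u3] cardI by simp
  obtain \<zeta> where \<zeta>: "z0 = (\<Sum>l\<in>L. \<Sum>k<d l. \<zeta> l k *s pw l k (u l))" using spans(2)[OF u1 u2 u3, of z0] by blast
  define e where "e l = (\<Sum>k<d l. \<zeta> l k *s pw l k (u l))" for l
  have z0e: "z0 = (\<Sum>l\<in>L. e l)" using \<zeta> by (simp add: e_def)
  \<comment> \<open>Otherwise \<open>l\<close> would vanish on every term of \<open>z0\<close>.\<close>
  have \<zeta>0: "\<zeta> l 0 \<noteq> 0" if l: "l \<in> L" for l
  proof
    assume z: "\<zeta> l 0 = 0"
    have "dot l (\<zeta> j k *s pw j k (u j)) = 0" if jk: "j \<in> L" "k < d j" for j k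
    proof (cases "j = l")
      case True
      show ?thesis
      proof (cases k)
        case 0
        then show ?thesis using z True by simp
      next
        case (Suc n)
        then show ?thesis using True a_kills[OF LS[OF l]] by (simp add: pw_Suc dot_scale_right)
      qed
    next
      case False
      then show ?thesis
        using c_wt0[OF l jk(1)] by (simp add: dot_scale_right u_def pw_alg[OF c_alg, symmetric])
    qed
    then have "dot l z0 = 0" by (subst \<zeta>) (simp add: dot_sum_right)
    then show False using z0_S[OF LS[OF l]] by simp
  qed
  have e_u: "pw l (d l - 1) (e l) = \<zeta> l 0 *s pw l (d l - 1) (u l)" if l: "l \<in> L" for l
  proof -
    have "pw l (d l - 1) (e l) = (\<Sum>k<d l. \<zeta> l k *s pw l (d l - 1 + k) (u l))"
      by (simp add: e_def pw_sum pw_scale pw_pw)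
    also have "\<dots> = (\<Sum>k\<in>{0}. \<zeta> l k *s pw l (d l - 1 + k) (u l))"
    proof (rule sum.mono_neutral_right)
      show "\<forall>k\<in>{..<d l} - {0}. \<zeta> l k *s pw l (d l - 1 + k) (u l) = 0"
      proof
        fix k assume "k \<in> {..<d l} - {0}"
        then have "d l - 1 + k = (k - 1) + d l" by simp
        then have "pw l (d l - 1 + k) (u l) = pw l (k - 1) (pw l (d l) (u l))" by (simp add: pw_pw)
        then show "\<zeta> l k *s pw l (d l - 1 + k) (u l) = 0" by (simp add: u2[OF l] pw_zero)
      qed
    qed (use d1[OF l] in auto)
    finally show ?thesis by simp
  qed
  have e1: "c j *v e l = 0" if "l \<in> L" "j \<in> L" "j \<noteq> l" for l j
    by (simp add: e_def matrix_sum vec.scale pw_alg[OF c_alg] u1[OF that] pw_zero)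
  have e2: "pw l (d l) (e l) = 0" if l: "l \<in> L" for l
  proof -
    have "d l = Suc (d l - 1)" using d1[OF l] by simp
    then have "pw l (d l) (e l) = a l *v pw l (d l - 1) (e l)" by (metis pw_Suc)
    also have "\<dots> = \<zeta> l 0 *s pw l (Suc (d l - 1)) (u l)" by (simp only: e_u[OF l] vec.scale pw_Suc)
    also have "\<dots> = 0" using u2[OF l] d1[OF l] by simp
    finally show ?thesis .
  qed
  have e3: "c l *v pw l (d l - 1) (e l) \<noteq> 0" if "l \<in> L" for l
    using u3[OF that] \<zeta>0[OF that] by (simp add: e_u[OF that, unfolded One_nat_def] vec.scale vec.scale_eq_0_iff)
  have big: "pw l n (e l) = 0" if "l \<in> L" "n \<ge> d l" for l n
  proof -
    have "pw l n (e l) = pw l (n - d l) (pw l (d l) (e l))" using that(2) by (simp add: pw_pw)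
    then show ?thesis by (simp add: e2[OF that(1)] pw_zero)
  qed
  have act: "\<exists>\<beta>. (\<forall>l\<in>L. \<forall>k<d l. B *v pw l k (e l) = (\<Sum>j<d l - k. \<beta> l j *s pw l (k + j) (e l))) \<and>
      (\<Sum>l\<in>L. \<Sum>k<d l. \<beta> l k * dot \<mu> (pw l k (e l))) = 0" if B: "B \<in> V" for B
  proof -
    have "\<exists>\<beta>. B *v e l = (\<Sum>k<d l. \<beta> k *s pw l k (e l))" if l: "l \<in> L" for l
    proof -
      obtain \<beta> where \<beta>: "B *v e l = (\<Sum>l\<in>L. \<Sum>k<d l. \<beta> l k *s pw l k (e l))"
        using spans(2)[OF e1 e2 e3, of "B *v e l"] by blast
      have "\<beta> j k = 0" if j: "j \<in> L" "j \<noteq> l" "k < d j" for j k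
      proof (rule coeff_zero[OF e1 e2 e3 j(1,3)])
        have "c j *v (B *v e l) = 0" using e1[OF l j(1,2)] alg_comm_vec[OF c_alg V_alg[OF B]] by simp
        then show "c j *v (\<Sum>l\<in>L. \<Sum>k<d l. \<beta> l k *s pw l k (e l)) = 0" by (simp only: \<beta>)
      qed
      then have "(\<Sum>m\<in>L. \<Sum>k<d m. \<beta> m k *s pw m k (e m)) = (\<Sum>m\<in>{l}. \<Sum>k<d m. \<beta> m k *s pw m k (e m))"
        by (intro sum.mono_neutral_right[OF finL]) (use l in auto)
      then show ?thesis using \<beta> by auto
    qed
    then obtain \<beta> where \<beta>: "\<And>l. l \<in> L \<Longrightarrow> B *v e l = (\<Sum>k<d l. \<beta> l k *s pw l k (e l))" by metis
    have 1: "B *v pw l k (e l) = (\<Sum>j<d l - k. \<beta> l j *s pw l (k + j) (e l))" if lk: "l \<in> L" "k < d l" for l k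
    proof -
      have "B *v pw l k (e l) = (\<Sum>j<d l. \<beta> l j *s pw l (k + j) (e l))"
        by (simp add: pw_alg[OF V_alg[OF B]] \<beta>[OF lk(1)] pw_sum pw_scale pw_pw)
      also have "\<dots> = (\<Sum>j<d l - k. \<beta> l j *s pw l (k + j) (e l))"
        by (rule sum.mono_neutral_right) (auto simp: big[OF lk(1)])
      finally show ?thesis .
    qed
    have "dot \<mu> (B *v z0) = 0" using regular_pointD(3)[OF regular B] .
    moreover have "B *v z0 = (\<Sum>l\<in>L. \<Sum>k<d l. \<beta> l k *s pw l k (e l))"
      by (subst z0e) (simp add: matrix_sum \<beta>)
    ultimately have "(\<Sum>l\<in>L. \<Sum>k<d l. \<beta> l k * dot \<mu> (pw l k (e l))) = 0"
      by (simp add: dot_sum_right dot_scale_right)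
    then show ?thesis using 1 by blast
  qed
  have top: "dot \<mu> (pw l (d l - 1) (e l)) \<noteq> 0" if l: "l \<in> L" for l
  proof
    assume "dot \<mu> (pw l (d l - 1) (e l)) = 0"
    then have "dot \<mu> (s l *v z0) = 0" using \<zeta>0[OF l] by (simp add: e_u[OF l, unfolded One_nat_def] dot_scale_right s_pw u_def)
    then obtain B where B: "B \<in> V" "s l *v z0 = B *v z0" using regular_pointD(2)[OF regular] by blast
    have "s l - B = 0"
      by (rule alg_faithful[OF alg_diff[OF s_alg V_alg[OF B(1)]]]) (simp add: matrix_vector_mult_diff_rdistrib B(2))
    then have "s l = B" by simp
    then have "B *v (a l *v z0) = 0" using s_a[OF l] by blast
    then have "B = 0" by (rule free_atD(3)[OF a_free[OF LS[OF l]] B(1)])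
    then show False using s_nz[OF l] \<open>s l = B\<close> by simp
  qed
  show ?thesis
  proof (rule that[of L d "\<lambda>l k. pw l k (e l)"])
    show "(\<Sum>l\<in>L. d l) = CARD('n)" using size_ms cardI' by simp
    show "\<beta> l k = 0" if "(\<Sum>l\<in>L. \<Sum>k<d l. \<beta> l k *s pw l k (e l)) = 0" "l \<in> L" "k < d l" for \<beta> l k
      using coeff_zero[OF e1 e2 e3 that(2,3), of \<beta>] that(1) by simp
  qed (use finL d1 act top in auto)
qed

end

lemma (in regular_space) block_structure:
  obtains L :: "(complex ^ 'n) set" and b :: "complex ^ 'n \<Rightarrow> nat \<Rightarrow> complex ^ 'n" and d :: "complex ^ 'n \<Rightarrow> nat" and \<mu>
  where "finite L" "(\<Sum>l\<in>L. d l) = CARD('n)" "\<And>l. l \<in> L \<Longrightarrow> d l \<ge> 1"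
    "\<And>\<beta> l k. (\<Sum>l\<in>L. \<Sum>k<d l. \<beta> l k *s b l k) = 0 \<Longrightarrow> l \<in> L \<Longrightarrow> k < d l \<Longrightarrow> \<beta> l k = (0 :: complex)"
    "\<And>B. B \<in> V \<Longrightarrow> \<exists>\<beta>. (\<forall>l\<in>L. \<forall>k<d l. B *v b l k = (\<Sum>j<d l - k. \<beta> l j *s b l (k + j))) \<and>
        (\<Sum>l\<in>L. \<Sum>k<d l. \<beta> l k * dot \<mu> (b l k)) = 0"
    "\<And>l. l \<in> L \<Longrightarrow> dot \<mu> (b l (d l - 1)) \<noteq> 0"
proof -
  obtain S where S: "finite S" "0 \<notin> S" "\<And>l. l \<in> S \<Longrightarrow> \<exists>\<phi>. eigencovector V \<phi> l"
    "\<And>\<phi> l. eigencovector V \<phi> l \<Longrightarrow> \<exists>s\<in>S. \<exists>c. l = c *s s"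
    "\<And>l m c. l \<in> S \<Longrightarrow> m \<in> S \<Longrightarrow> m = c *s l \<Longrightarrow> m = l"
    using eigencovector_basis by blast
  obtain z0 \<mu> where z0: "regular_point V z0 \<mu>" "\<And>l. l \<in> S \<Longrightarrow> dot l z0 \<noteq> 0"
    using generic[OF S(1,2)] by blast
  have z0e: "dot l z0 \<noteq> 0" if l: "eigencovector V \<phi> l" for \<phi> l
  proof -
    obtain s c where sc: "s \<in> S" "l = c *s s" using S(4)[OF l] by blast
    have "c \<noteq> 0" using eigencovector_nz[OF l] sc(2) by auto
    then show "dot l z0 \<noteq> 0" using z0(2)[OF sc(1)] sc(2) by (simp add: dot_scale_left)
  qed
  have "\<exists>A. A \<in> alg \<and> (l \<in> S \<longrightarrow> free_at l (A *v z0))" for l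
  proof (cases "l \<in> S")
    case True
    then obtain z where "free_at l z" using S(3) eigencovector_free by blast
    moreover have "\<exists>A\<in>alg. A *v z0 = z" by (rule cyclic) (rule z0e)
    ultimately show ?thesis by blast
  next
    case False
    then show ?thesis using alg_one by blast
  qed
  then obtain a where a: "\<And>l. a l \<in> alg" "\<And>l. l \<in> S \<Longrightarrow> free_at l (a l *v z0)" by metis
  interpret block_data V S a z0 \<mu>
  proof
    show "finite S" by (rule S(1))
    show "\<exists>\<phi>. eigencovector V \<phi> l" if "l \<in> S" for l by (rule S(3)[OF that])
    show "\<exists>s\<in>S. \<exists>c. l = c *s s" if "eigencovector V \<phi> l" for \<phi> l by (rule S(4)[OF that])
    show "m = l" if "l \<in> S" "m \<in> S" "m = c *s l" for l m c by (rule S(5)[OF that])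
    show "regular_point V z0 \<mu>" by (rule z0(1))
    show "dot l z0 \<noteq> 0" if "l \<in> S" for l by (rule z0(2)[OF that])
    show "a l \<in> alg" for l by (rule a(1))
    show "free_at l (a l *v z0)" if "l \<in> S" for l by (rule a(2)[OF that])
  qed
  show ?thesis by (rule block_structure_data) (rule that)
qed

section \<open>First integrals from differentials\<close>

definition cderiv :: "(complex ^ 'n::finite \<Rightarrow> complex) \<Rightarrow> complex ^ 'n \<Rightarrow> (complex ^ 'n \<Rightarrow> complex) \<Rightarrow> bool" where
  "cderiv f y D \<longleftrightarrow> (f has_derivative D) (at y) \<and> (\<forall>c v. D (c *s v) = c * D v)"

lemma cderiv_eq: "cderiv f y D \<Longrightarrow> (\<And>v. D v = E v) \<Longrightarrow> cderiv f y E"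
  by (metis ext)

lemma cderiv_coord: "cderiv (\<lambda>z. z $ i) y (\<lambda>v. v $ i)"
  unfolding cderiv_def
  using bounded_linear_imp_has_derivative[OF bounded_linear_vec_nth[of i]] by simp

lemma cderiv_const: "cderiv (\<lambda>z. c) y (\<lambda>v. 0)"
  by (simp add: cderiv_def)

lemma cderiv_add: "cderiv f y D \<Longrightarrow> cderiv g y E \<Longrightarrow> cderiv (\<lambda>z. f z + g z) y (\<lambda>v. D v + E v)"
  by (auto simp: cderiv_def algebra_simps intro: has_derivative_add)

lemma cderiv_diff: "cderiv f y D \<Longrightarrow> cderiv g y E \<Longrightarrow> cderiv (\<lambda>z. f z - g z) y (\<lambda>v. D v - E v)"
  by (auto simp: cderiv_def algebra_simps intro: has_derivative_diff)

lemma cderiv_mult: "cderiv f y D \<Longrightarrow> cderiv g y E \<Longrightarrow> cderiv (\<lambda>z. f z * g z) y (\<lambda>v. f y * E v + D v * g y)"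
  using has_derivative_mult[of f D y UNIV g E] by (auto simp: cderiv_def distrib_left distrib_right mult_ac)

lemma cderiv_chain:
  assumes "cderiv f y D" "(h has_field_derivative h') (at (f y))"
  shows "cderiv (\<lambda>z. h (f z)) y (\<lambda>v. h' * D v)"
  using assms diff_chain_at[of f D y h "(*) h'"]
  by (auto simp: cderiv_def has_field_derivative_def o_def algebra_simps)

lemma cderiv_exp: "cderiv f y D \<Longrightarrow> cderiv (\<lambda>z. exp (f z)) y (\<lambda>v. exp (f y) * D v)"
  by (rule cderiv_chain) (auto intro: DERIV_exp)

lemma cderiv_power: "cderiv f y D \<Longrightarrow> cderiv (\<lambda>z. f z ^ n) y (\<lambda>v. of_nat n * f y ^ (n - 1) * D v)"
  by (rule cderiv_chain) (auto intro!: derivative_eq_intros)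

lemma cderiv_cmult: "cderiv f y D \<Longrightarrow> cderiv (\<lambda>z. c * f z) y (\<lambda>v. c * D v)"
  by (rule cderiv_chain) (auto intro!: derivative_eq_intros)

lemma cderiv_inverse: "cderiv f y D \<Longrightarrow> f y \<noteq> 0 \<Longrightarrow> cderiv (\<lambda>z. inverse (f z)) y (\<lambda>v. - inverse (f y ^ 2) * D v)"
  by (rule cderiv_chain) (auto intro!: derivative_eq_intros simp: power2_eq_square)

lemma cderiv_divide:
  assumes "cderiv f y D" "cderiv g y E" "g y \<noteq> 0"
  shows "cderiv (\<lambda>z. f z / g z) y (\<lambda>v. (D v * g y - f y * E v) / g y ^ 2)"
  using cderiv_eq[OF cderiv_mult[OF assms(1) cderiv_inverse[OF assms(2,3)]], of "\<lambda>v. (D v * g y - f y * E v) / g y ^ 2"] assms(3)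
  by (simp add: divide_inverse[symmetric] field_simps power2_eq_square)

lemma cderiv_transform:
  assumes "cderiv g y D" "open U" "y \<in> U" "\<And>z. z \<in> U \<Longrightarrow> f z = g z"
  shows "cderiv f y D"
  using assms has_derivative_transform_within_open[of g D y UNIV U f] by (auto simp: cderiv_def)

lemma cderiv_unique:
  assumes "cderiv f y D" "cderiv f y E" shows "D = E"
  using assms has_derivative_unique unfolding cderiv_def by blast

lemma cderiv_holomorphic: "(\<And>z. z \<in> U \<Longrightarrow> \<exists>D. cderiv f z D) \<Longrightarrow> holomorphic_fun_on U f"
  unfolding holomorphic_fun_on_def cderiv_def using has_derivative_at_withinI by blast

lemma holomorphic_cderiv:
  assumes "holomorphic_fun_on U f" "open U" "y \<in> U" obtains D where "cderiv f y D"
  using assms unfolding holomorphic_fun_on_def cderiv_def by (metis at_within_open)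

text \<open>The differential of the affine coordinate \<open>z\<^sub>i / z\<^sub>j\<close> at \<open>y\<close>.\<close>

definition qd :: "complex ^ 'n::finite \<Rightarrow> 'n \<Rightarrow> 'n \<Rightarrow> complex ^ 'n \<Rightarrow> complex" where
  "qd y i j v = (v $ i * y $ j - y $ i * v $ j) / (y $ j)^2"

lemma cderiv_quot: "y $ j \<noteq> 0 \<Longrightarrow> cderiv (\<lambda>z. z $ i / z $ j) y (qd y i j)"
  using cderiv_divide[OF cderiv_coord cderiv_coord, of y j i] by (simp add: qd_def[abs_def])

lemma qd_eq: "y $ j \<noteq> 0 \<Longrightarrow> w $ j = b * y $ j \<Longrightarrow> w $ i = b * y $ i + c * y $ j \<Longrightarrow> qd y i j w = c"
  by (simp add: qd_def power2_eq_square field_simps)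

lemma power_detD:
  assumes "(U, p) \<in> power_det i a" "y \<in> U"
  shows "y $ i \<noteq> 0" "p y \<noteq> 0" "cderiv p y (\<lambda>v. p y * (a * (v $ i / y $ i)))"
proof -
  obtain l where U: "open U" and l: "holomorphic_fun_on U l" "\<And>z. z \<in> U \<Longrightarrow> exp (l z) = z $ i \<and> p z = exp (a * l z)"
    using assms(1) unfolding power_det_def region_def by blast
  show yi: "y $ i \<noteq> 0" and py: "p y \<noteq> 0" using l(2)[OF assms(2)] by (metis exp_not_eq_zero)+
  obtain D where D: "cderiv l y D" using holomorphic_cderiv[OF l(1) U assms(2)] by blast
  have "cderiv (\<lambda>z. z $ i) y (\<lambda>v. exp (l y) * D v)"
    by (rule cderiv_transform[OF cderiv_exp[OF D] U assms(2)]) (simp add: l(2))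
  then have "(\<lambda>v. exp (l y) * D v) = (\<lambda>v. v $ i)" using cderiv_coord by (rule cderiv_unique)
  then have "y $ i * D v = v $ i" for v using l(2)[OF assms(2)] by (metis (no_types))
  then have Dv: "D v = v $ i / y $ i" for v using yi by (simp add: field_simps)
  have "cderiv p y (\<lambda>v. exp (a * l y) * (a * D v))"
    by (rule cderiv_transform[OF cderiv_exp[OF cderiv_cmult[OF D]] U assms(2)]) (simp add: l(2))
  then show "cderiv p y (\<lambda>v. p y * (a * (v $ i / y $ i)))" using l(2)[OF assms(2)] by (simp add: Dv)
qed

lemma local_determinations:
  fixes y :: "complex ^ 'n::finite"
  assumes y: "\<And>i. y $ i \<noteq> 0"
  obtains U where "region U" "y \<in> U" "\<And>z i. z \<in> U \<Longrightarrow> z $ i \<noteq> 0" "\<And>i a. \<exists>p. (U, p) \<in> power_det i a"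
proof -
  define r where "r = Min (range (\<lambda>i. norm (y $ i)))"
  have r: "r > 0" unfolding r_def using y by (subst Min_gr_iff) auto
  have rle: "r \<le> norm (y $ i)" for i unfolding r_def by (rule Min_le) auto
  define U where "U = ball y r"
  have reg: "region U" unfolding region_def U_def using r by auto
  have near: "Re (z $ i / y $ i) > 0" if z: "z \<in> U" for z i
  proof -
    have "norm ((z - y) $ i) \<le> norm (z - y)" by (rule Finite_Cartesian_Product.norm_nth_le)
    also have "\<dots> < r" using z by (simp add: U_def dist_norm norm_minus_commute)
    finally have "norm (z $ i - y $ i) < norm (y $ i)" using rle[of i] by simp
    then have "norm ((z $ i - y $ i) / y $ i) < 1" using y[of i] by (simp add: norm_divide)
    then have "norm (z $ i / y $ i - 1) < 1" using y[of i] by (simp add: diff_divide_distrib)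
    then have "\<bar>Re (z $ i / y $ i - 1)\<bar> < 1" using abs_Re_le_cmod le_less_trans by blast
    then show ?thesis by simp
  qed
  have nz: "z $ i \<noteq> 0" if "z \<in> U" for z i using near[OF that, of i] by auto
  have "\<exists>p. (U, p) \<in> power_det i a" for i a
  proof -
    define l where "l z = Ln (z $ i / y $ i) + Ln (y $ i)" for z :: "complex ^ 'n"
    have "holomorphic_fun_on U l"
    proof (rule cderiv_holomorphic)
      fix z assume z: "z \<in> U"
      have "z $ i / y $ i \<notin> \<real>\<^sub>\<le>\<^sub>0" using near[OF z, of i] by (auto simp: complex_nonpos_Reals_iff)
      then have "(Ln has_field_derivative inverse (z $ i / y $ i)) (at (z $ i / y $ i))"
        by (rule has_field_derivative_Ln)
      moreover have "cderiv (\<lambda>z. z $ i / y $ i) z (\<lambda>v. (1 / y $ i) * v $ i)"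
        using cderiv_cmult[OF cderiv_coord, of "1 / y $ i" i z] by simp
      ultimately show "\<exists>D. cderiv l z D"
        unfolding l_def using cderiv_add[OF cderiv_chain cderiv_const] by blast
    qed
    moreover have "exp (l z) = z $ i" if "z \<in> U" for z
      using nz[OF that, of i] y[of i] by (simp add: l_def exp_add)
    ultimately have "(U, \<lambda>z. exp (a * l z)) \<in> power_det i a"
      unfolding power_det_def using reg by blast
    then show ?thesis by blast
  qed
  then show ?thesis using that[OF reg] nz r by (auto simp: U_def)
qed

lemma nonzero_coords_dense: "closure {y :: complex ^ 'n::finite. \<forall>i. y $ i \<noteq> 0} = UNIV"
proof -
  have "\<exists>y'\<in>{y. \<forall>i. y $ i \<noteq> 0}. dist y' y < e" if e: "e > 0" for y :: "complex ^ 'n" and e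
  proof -
    define N where "N = norm (1 :: complex ^ 'n) + 1"
    have N: "N > 0" unfolding N_def using norm_ge_zero[of "1 :: complex ^ 'n"] by linarith
    have "infinite {0<..<e / N}" using e N by (simp add: infinite_Ioo)
    moreover have "finite {t :: real. \<exists>i. complex_of_real t = - y $ i}"
    proof -
      have "{t :: real. \<exists>i. complex_of_real t = - y $ i} \<subseteq> range (\<lambda>i. Re (- y $ i))" 
      proof clarify
        fix t i assume "complex_of_real t = - y $ i"
        then have "t = Re (- y $ i)" by (metis Re_complex_of_real)
        then show "t \<in> range (\<lambda>i. Re (- y $ i))" by blast
      qed
      then show ?thesis by (rule finite_subset) simp
    qed
    ultimately obtain t where t: "t \<in> {0<..<e / N}" "\<not> (\<exists>i. complex_of_real t = - y $ i)"
      by (metis (mono_tags, lifting) finite_subset mem_Collect_eq subsetI)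
    have "(y + t *\<^sub>R 1) $ i \<noteq> 0" for i
    proof
      assume "(y + t *\<^sub>R 1) $ i = 0"
      then have "complex_of_real t = - y $ i" by (simp add: of_real_def eq_neg_iff_add_eq_0 add.commute)
      then show False using t(2) by blast
    qed
    moreover have "dist (y + t *\<^sub>R 1) y < e"
    proof -
      have "dist (y + t *\<^sub>R 1) y \<le> t * N" using t(1) by (simp add: dist_norm N_def mult_left_mono)
      also have "\<dots> < e" using t(1) N by (simp add: field_simps)
      finally show ?thesis .
    qed
    ultimately show ?thesis by blast
  qed
  then show ?thesis unfolding closure_approachable set_eq_iff by blast
qed

lemma dense_domains:
  assumes "\<And>y :: complex ^ 'n::finite. (\<And>i. y $ i \<noteq> 0) \<Longrightarrow> \<exists>U f. (U, f) \<in> F \<and> y \<in> U"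
  shows "closure (\<Union>(U, f)\<in>F. U) = UNIV"
proof -
  have "{y. \<forall>i. y $ i \<noteq> 0} \<subseteq> (\<Union>(U, f)\<in>F. U)" using assms by fast
  then have "closure {y :: complex ^ 'n. \<forall>i. y $ i \<noteq> 0} \<subseteq> closure (\<Union>(U, f)\<in>F. U)" by (rule closure_mono)
  then show ?thesis using nonzero_coords_dense by blast
qed

text \<open>A curve in a leaf has its velocity, transported by \<open>M\<close>, in the kernel of the form, hence of the form
  \<open>B (M y)\<close> with \<open>B \<in> V\<close>; so a differential that kills these velocities makes the function constant along
  the curve.\<close>

lemma first_integral_pullback:
  fixes A :: "complex ^ 'n::finite \<Rightarrow> complex ^ 'n"
  assumes reg: "\<And>z. A z \<noteq> 0 \<Longrightarrow> regular_point V z (A z)"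
    and dense: "\<And>y :: complex ^ 'n. (\<And>i. y $ i \<noteq> 0) \<Longrightarrow> \<exists>U f. (U, f) \<in> F \<and> y \<in> U"
    and regn: "\<And>U f. (U, f) \<in> F \<Longrightarrow> region U"
    and der: "\<And>U f y. (U, f) \<in> F \<Longrightarrow> y \<in> U \<Longrightarrow>
       \<exists>D. cderiv f y D \<and> (\<exists>v. D v \<noteq> 0) \<and> (\<forall>B\<in>V. \<forall>w. B *v (M *v y) = M *v w \<longrightarrow> D w = 0)"
  shows "first_integral (pullback_form M A) F"
  unfolding first_integral_def
proof (intro conjI ballI, rule dense_domains[OF dense], assumption, clarify)
  fix U f assume Uf: "(U, f) \<in> F"
  have U: "open U" "U \<noteq> {}" using regn[OF Uf] by (auto simp: region_def)
  have hol: "holomorphic_fun_on U f" using der[OF Uf] by (intro cderiv_holomorphic) blast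
  have ncon: "\<not> f constant_on U"
  proof
    assume "f constant_on U"
    then obtain c where c: "\<And>z. z \<in> U \<Longrightarrow> f z = c" unfolding constant_on_def by blast
    obtain y where y: "y \<in> U" using U(2) by blast
    obtain D v where D: "cderiv f y D" "D v \<noteq> 0" using der[OF Uf y] by blast
    have "cderiv f y (\<lambda>v. 0)" by (rule cderiv_transform[OF cderiv_const U(1) y c])
    then have "D = (\<lambda>v. 0)" using cderiv_unique[OF D(1)] by simp
    then show False using D(2) by simp
  qed
  have const: "f x = f y" if xy: "leaf_connected_in (pullback_form M A) U x y" for x y
  proof -
    obtain \<gamma> :: "real \<Rightarrow> complex ^ 'n" where g: "\<gamma> C1_differentiable_on {0..1}"
      "\<gamma> ` {0..1} \<subseteq> U - {0} - sing_set (pullback_form M A)" "\<gamma> 0 = x" "\<gamma> 1 = y"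
      "\<And>t. t \<in> {0..1} \<Longrightarrow> form_app (pullback_form M A) (\<gamma> t) (vector_derivative \<gamma> (at t)) = 0"
      using xy unfolding leaf_connected_in_def by blast
    obtain G where G: "\<And>t. t \<in> {0..1} \<Longrightarrow> (\<gamma> has_vector_derivative G t) (at t)"
      using g(1) unfolding C1_differentiable_on_def by blast
    have "((\<lambda>t. f (\<gamma> t)) has_derivative (\<lambda>h. 0)) (at t within {0..1})" if t: "t \<in> {0..1}" for t
    proof -
      have gt: "\<gamma> t \<in> U" "\<gamma> t \<notin> sing_set (pullback_form M A)"
        using subsetD[OF g(2) imageI[OF t]] by simp_all
      have pb: "form_app (pullback_form M A) z v = dot (A (M *v z)) (M *v v)" for z v
      proof -
        have "pullback_form M A z = A (M *v z) v* M"
          by (simp add: vec_eq_iff pullback_form_def vector_matrix_mult_def mult.commute)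
        then show ?thesis by (simp add: form_app_dot dot_vector_matrix)
      qed
      obtain D where D: "cderiv f (\<gamma> t) D" and D0: "\<forall>B\<in>V. \<forall>w. B *v (M *v \<gamma> t) = M *v w \<longrightarrow> D w = 0"
        using der[OF Uf gt(1)] by blast
      have "A (M *v \<gamma> t) \<noteq> 0"
      proof
        assume "A (M *v \<gamma> t) = 0"
        then have "\<gamma> t \<in> sing_set (pullback_form M A)" by (simp add: sing_set_def pullback_form_def)
        then show False using gt(2) by blast
      qed
      moreover have "dot (A (M *v \<gamma> t)) (M *v G t) = 0"
        using g(5)[OF t] vector_derivative_at[OF G[OF t]] by (simp add: pb)
      ultimately obtain B where "B \<in> V" "M *v G t = B *v (M *v \<gamma> t)" using regular_pointD(2)[OF reg] by blast
      then have "D (G t) = 0" using D0 by metis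
      have "((\<lambda>t. f (\<gamma> t)) has_derivative (\<lambda>h. D (h *\<^sub>R G t))) (at t within {0..1})"
        using diff_chain_within[of \<gamma> "\<lambda>h. h *\<^sub>R G t" t "{0..1}" f D] D G[OF t]
          has_derivative_at_withinI[of f D "\<gamma> t"] has_derivative_at_withinI[of \<gamma> "\<lambda>h. h *\<^sub>R G t" t]
        by (auto simp: cderiv_def has_vector_derivative_def o_def)
      moreover have "D (h *\<^sub>R G t) = 0" for h
        using D \<open>D (G t) = 0\<close> by (auto simp: cderiv_def has_derivative_def bounded_linear.linear linear_cmul)
      ultimately show ?thesis by simp
    qed
    then have "\<exists>c. \<forall>t\<in>{0..1}. f (\<gamma> t) = c" using has_derivative_zero_constant[of "{0..1::real}" "\<lambda>t. f (\<gamma> t)"] by auto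
    then show ?thesis using g(3,4) by force
  qed
  show "region U \<and> holomorphic_fun_on U f \<and> \<not> f constant_on U \<and>
      (\<forall>x y. leaf_connected_in (pullback_form M A) U x y \<longrightarrow> f x = f y)"
    using regn[OF Uf] hol ncon const by blast
qed

definition indep5 :: "complex ^ 5 \<Rightarrow> complex ^ 5 \<Rightarrow> complex ^ 5 \<Rightarrow> complex ^ 5 \<Rightarrow> complex ^ 5 \<Rightarrow> bool" where
  "indep5 v0 v1 v2 v3 v4 \<longleftrightarrow> (\<forall>a b c d e. a *s v0 + b *s v1 + c *s v2 + d *s v3 + e *s v4 = 0 \<longrightarrow>
     a = 0 \<and> b = 0 \<and> c = 0 \<and> d = 0 \<and> e = 0)"

lemma indep5_eq:
  assumes "indep5 v0 v1 v2 v3 v4"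
    "a0 *s v0 + a1 *s v1 + a2 *s v2 + a3 *s v3 + a4 *s v4 = b0 *s v0 + b1 *s v1 + b2 *s v2 + b3 *s v3 + b4 *s v4"
  shows "a0 = b0 \<and> a1 = b1 \<and> a2 = b2 \<and> a3 = b3 \<and> a4 = b4"
proof -
  have "(a0 - b0) *s v0 + (a1 - b1) *s v1 + (a2 - b2) *s v2 + (a3 - b3) *s v3 + (a4 - b4) *s v4 =
    (a0 *s v0 + a1 *s v1 + a2 *s v2 + a3 *s v3 + a4 *s v4) - (b0 *s v0 + b1 *s v1 + b2 *s v2 + b3 *s v3 + b4 *s v4)"
    by (simp add: vec_eq_iff algebra_simps)
  then have "(a0 - b0) *s v0 + (a1 - b1) *s v1 + (a2 - b2) *s v2 + (a3 - b3) *s v3 + (a4 - b4) *s v4 = 0"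
    by (simp only: assms(2)) simp
  then have "a0 - b0 = 0 \<and> a1 - b1 = 0 \<and> a2 - b2 = 0 \<and> a3 - b3 = 0 \<and> a4 - b4 = 0"
    using assms(1) unfolding indep5_def by blast
  then show ?thesis by simp
qed

lemma first_integral_columns:
  fixes A :: "complex ^ 5 \<Rightarrow> complex ^ 5"
  assumes reg: "\<And>z. A z \<noteq> 0 \<Longrightarrow> regular_point V z (A z)"
    and ind: "indep5 v0 v1 v2 v3 v4"
    and dense: "\<And>y :: complex ^ 5. (\<And>i. y $ i \<noteq> 0) \<Longrightarrow> \<exists>U f. (U, f) \<in> F \<and> y \<in> U"
    and regn: "\<And>U f. (U, f) \<in> F \<Longrightarrow> region U"
    and der: "\<And>U f y. (U, f) \<in> F \<Longrightarrow> y \<in> U \<Longrightarrow>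
       \<exists>D. cderiv f y D \<and> (\<exists>v. D v \<noteq> 0) \<and> (\<forall>B\<in>V. \<forall>w.
         B *v (y$0 *s v0 + y$1 *s v1 + y$2 *s v2 + y$3 *s v3 + y$4 *s v4) =
         w$0 *s v0 + w$1 *s v1 + w$2 *s v2 + w$3 *s v3 + w$4 *s v4 \<longrightarrow> D w = 0)"
  shows "\<exists>M :: complex ^ 5 ^ 5. invertible M \<and> first_integral (pullback_form M A) F"
proof -
  define col where "col c = (if c = 0 then v0 else if c = 1 then v1 else if c = 2 then v2 else if c = 3 then v3 else v4)" for c :: 5
  define M :: "complex ^ 5 ^ 5" where "M = (\<chi> r c. col c $ r)"
  have My: "M *v y = y$0 *s v0 + y$1 *s v1 + y$2 *s v2 + y$3 *s v3 + y$4 *s v4" for y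
    by (simp add: vec_eq_iff matrix_vector_mult_def M_def sum_5 col_def mult.commute)
  have "y = 0" if "M *v y = 0" for y
  proof -
    have "y$0 = 0 \<and> y$1 = 0 \<and> y$2 = 0 \<and> y$3 = 0 \<and> y$4 = 0"
      using ind that unfolding My indep5_def by blast
    then show ?thesis by (simp add: vec_eq_iff forall_5)
  qed
  then have "invertible M" using nonsingular_iff_injective invertible_det_nz by blast
  moreover have "first_integral (pullback_form M A) F"
    by (rule first_integral_pullback[OF reg dense regn]) (use der in \<open>simp_all add: My\<close>)
  ultimately show ?thesis by blast
qed

section \<open>Differentials of the eight integrals\<close>

definition logderiv :: "(complex ^ 'n::finite \<Rightarrow> complex) \<Rightarrow> complex ^ 'n \<Rightarrow> (complex ^ 'n \<Rightarrow> complex) \<Rightarrow> bool" where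
  "logderiv f y \<psi> \<longleftrightarrow> f y \<noteq> 0 \<and> cderiv f y (\<lambda>v. f y * \<psi> v)"

lemma logderiv_mult: "logderiv f y \<psi> \<Longrightarrow> logderiv g y \<theta> \<Longrightarrow> logderiv (\<lambda>z. f z * g z) y (\<lambda>v. \<psi> v + \<theta> v)"
  unfolding logderiv_def
  by (auto intro!: cderiv_eq[OF cderiv_mult] simp: algebra_simps)

lemma logderiv_divide: "logderiv f y \<psi> \<Longrightarrow> logderiv g y \<theta> \<Longrightarrow> logderiv (\<lambda>z. f z / g z) y (\<lambda>v. \<psi> v - \<theta> v)"
  unfolding logderiv_def
  by (auto intro!: cderiv_eq[OF cderiv_divide] simp: field_simps power2_eq_square)

lemma logderiv_exp: "cderiv g y D \<Longrightarrow> logderiv (\<lambda>z. exp (g z)) y D"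
  unfolding logderiv_def using cderiv_exp by auto

lemma logderiv_coord: "y $ i \<noteq> 0 \<Longrightarrow> logderiv (\<lambda>z. z $ i) y (\<lambda>v. v $ i / y $ i)"
  unfolding logderiv_def using cderiv_coord by auto

lemma logderiv_power_det: "(U, p) \<in> power_det i a \<Longrightarrow> y \<in> U \<Longrightarrow> logderiv p y (\<lambda>v. a * (v $ i / y $ i))"
  unfolding logderiv_def using power_detD by blast

lemma logderiv_transform:
  assumes "logderiv g y \<psi>" "open U" "y \<in> U" "\<And>z. z \<in> U \<Longrightarrow> f z = g z"
  shows "logderiv f y \<psi>"
  using assms cderiv_transform[OF _ assms(2-4)] unfolding logderiv_def by auto

lemma logderiv_nonzero: "logderiv f y \<psi> \<Longrightarrow> \<psi> v \<noteq> 0 \<Longrightarrow> (\<And>w. P w \<Longrightarrow> \<psi> w = 0) \<Longrightarrow>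
    \<exists>D. cderiv f y D \<and> (\<exists>v. D v \<noteq> 0) \<and> (\<forall>w. P w \<longrightarrow> D w = 0)"
  unfolding logderiv_def by (intro exI[of _ "\<lambda>v. f y * \<psi> v"] conjI exI[of _ v]) auto

abbreviation comb5 :: "complex ^ 5 \<Rightarrow> complex ^ 5 \<Rightarrow> complex ^ 5 \<Rightarrow> complex ^ 5 \<Rightarrow> complex ^ 5 \<Rightarrow> complex ^ 5 \<Rightarrow> complex ^ 5"
  where "comb5 y v0 v1 v2 v3 v4 \<equiv> y$0 *s v0 + y$1 *s v1 + y$2 *s v2 + y$3 *s v3 + y$4 *s v4"

text \<open>The vectors \<open>v\<^sub>0, \<dots>, v\<^sub>4\<close> are the columns of the change of coordinates.  The relation \<open>R\<close> collects
  what is known about the velocity \<open>w\<close> at the point \<open>y\<close> in the new coordinates.\<close>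

lemma columns_criterion:
  fixes A :: "complex ^ 5 \<Rightarrow> complex ^ 5"
  assumes reg: "\<And>z. A z \<noteq> 0 \<Longrightarrow> regular_point V z (A z)"
    and ind: "indep5 v0 v1 v2 v3 v4"
    and dense: "\<And>y :: complex ^ 5. (\<And>i. y $ i \<noteq> 0) \<Longrightarrow> \<exists>U f. (U, f) \<in> F \<and> y \<in> U"
    and regn: "\<And>U f. (U, f) \<in> F \<Longrightarrow> region U"
    and act: "\<And>B y w. B \<in> V \<Longrightarrow> B *v comb5 y v0 v1 v2 v3 v4 = comb5 w v0 v1 v2 v3 v4 \<Longrightarrow> R y w"
    and der: "\<And>U f y. (U, f) \<in> F \<Longrightarrow> y \<in> U \<Longrightarrow>
       \<exists>D. cderiv f y D \<and> (\<exists>v. D v \<noteq> 0) \<and> (\<forall>w. R y w \<longrightarrow> D w = 0)"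
  shows "\<exists>M :: complex ^ 5 ^ 5. invertible M \<and> first_integral (pullback_form M A) F"
proof (rule first_integral_columns[OF reg ind dense regn])
  fix U f y assume "(U, f) \<in> F" "y \<in> U"
  then obtain D where D: "cderiv f y D" "\<exists>v. D v \<noteq> 0" "\<And>w. R y w \<Longrightarrow> D w = 0" using der by blast
  show "\<exists>D. cderiv f y D \<and> (\<exists>v. D v \<noteq> 0) \<and> (\<forall>B\<in>V. \<forall>w.
      B *v comb5 y v0 v1 v2 v3 v4 = comb5 w v0 v1 v2 v3 v4 \<longrightarrow> D w = 0)"
    using D act by (intro exI[of _ D]) blast
qed

lemma action_coordinates:
  assumes "indep5 v0 v1 v2 v3 v4" "B *v comb5 y v0 v1 v2 v3 v4 = comb5 w v0 v1 v2 v3 v4"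
    and "B *v comb5 y v0 v1 v2 v3 v4 = e0 *s v0 + e1 *s v1 + e2 *s v2 + e3 *s v3 + e4 *s v4"
  shows "w $ 0 = e0 \<and> w $ 1 = e1 \<and> w $ 2 = e2 \<and> w $ 3 = e3 \<and> w $ 4 = e4"
  by (rule indep5_eq[OF assms(1)]) (use assms(2,3) in simp)

lemma integral1_logderiv:
  assumes "(U, f) \<in> integral1 \<kappa>" "y \<in> U"
  shows "\<forall>i. y $ i \<noteq> 0" "logderiv f y (\<lambda>v. \<kappa> 0 * (v$0 / y$0) + \<kappa> 1 * (v$1 / y$1) + \<kappa> 2 * (v$2 / y$2) + \<kappa> 3 * (v$3 / y$3) + \<kappa> 4 * (v$4 / y$4))"
proof -
  obtain p where U: "region U" and p: "\<And>i. (U, p i) \<in> power_det i (\<kappa> i)"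
    and f: "\<And>z. z \<in> U \<Longrightarrow> f z = p 0 z * p 1 z * p 2 z * p 3 z * p 4 z"
    using assms(1) unfolding integral1_def by blast
  have oU: "open U" using U by (simp add: region_def)
  show "\<forall>i. y $ i \<noteq> 0" using power_detD(1)[OF p assms(2)] by blast
  show "logderiv f y (\<lambda>v. \<kappa> 0 * (v$0 / y$0) + \<kappa> 1 * (v$1 / y$1) + \<kappa> 2 * (v$2 / y$2) + \<kappa> 3 * (v$3 / y$3) + \<kappa> 4 * (v$4 / y$4))"
    by (rule logderiv_transform[OF _ oU assms(2) f])
      (intro logderiv_mult logderiv_power_det[OF p assms(2)], assumption)
qed

lemma integral2_logderiv:
  assumes "(U, f) \<in> integral2 \<kappa> \<xi>" "y \<in> U"
  shows "y $ 1 \<noteq> 0" "y $ 2 \<noteq> 0" "y $ 3 \<noteq> 0" "y $ 4 \<noteq> 0"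
    "logderiv f y (\<lambda>v. (\<kappa> + \<xi> + 1) * (v$1 / y$1) - (\<kappa> * (v$2 / y$2) + \<xi> * (v$3 / y$3) + v$4 / y$4) + qd y 0 1 v)"
proof -
  obtain p q r where U: "region U" and p: "(U, p) \<in> power_det 1 (\<kappa> + \<xi> + 1)" and q: "(U, q) \<in> power_det 2 \<kappa>"
    and r: "(U, r) \<in> power_det 3 \<xi>" and f: "\<And>z. z \<in> U \<Longrightarrow> z $ 4 \<noteq> 0 \<and> f z = p z / (q z * r z * z $ 4) * exp (z $ 0 / z $ 1)"
    using assms(1) unfolding integral2_def by blast
  have oU: "open U" using U by (simp add: region_def)
  show nz: "y $ 1 \<noteq> 0" "y $ 2 \<noteq> 0" "y $ 3 \<noteq> 0" "y $ 4 \<noteq> 0"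
    using power_detD(1)[OF p assms(2)] power_detD(1)[OF q assms(2)] power_detD(1)[OF r assms(2)] f[OF assms(2)] by blast+
  have "logderiv (\<lambda>z. p z / (q z * r z * z $ 4) * exp (z $ 0 / z $ 1)) y
    (\<lambda>v. (\<kappa> + \<xi> + 1) * (v$1 / y$1) - (\<kappa> * (v$2 / y$2) + \<xi> * (v$3 / y$3) + v$4 / y$4) + qd y 0 1 v)"
    by (intro logderiv_mult logderiv_divide logderiv_exp cderiv_quot logderiv_coord nz logderiv_power_det[OF p assms(2)]
        logderiv_power_det[OF q assms(2)] logderiv_power_det[OF r assms(2)])
  then show "logderiv f y (\<lambda>v. (\<kappa> + \<xi> + 1) * (v$1 / y$1) - (\<kappa> * (v$2 / y$2) + \<xi> * (v$3 / y$3) + v$4 / y$4) + qd y 0 1 v)"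
    by (rule logderiv_transform[OF _ oU assms(2)]) (simp add: f)
qed

text \<open>The coordinate \<open>z\<^sub>4\<close> may vanish on the domain of a determination, so it is kept outside the logarithmic
  derivative.\<close>

lemma integral3_logderiv:
  assumes "(U, f) \<in> integral3 \<kappa>" "y \<in> U"
  shows "y $ 1 \<noteq> 0" "y $ 3 \<noteq> 0"
    "\<exists>g. g y \<noteq> 0 \<and> cderiv g y (\<lambda>v. g y * (\<kappa> * (v$3 / y$3) - (1 + \<kappa>) * (v$1 / y$1) + (qd y 2 3 v - qd y 0 1 v)))
      \<and> cderiv f y (\<lambda>v. y $ 4 * (g y * (\<kappa> * (v$3 / y$3) - (1 + \<kappa>) * (v$1 / y$1) + (qd y 2 3 v - qd y 0 1 v))) + v $ 4 * g y)"
proof -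
  obtain p q where U: "region U" and p: "(U, p) \<in> power_det 3 \<kappa>" and q: "(U, q) \<in> power_det 1 (1 + \<kappa>)"
    and f: "\<And>z. z \<in> U \<Longrightarrow> f z = p z * z $ 4 / q z * exp ((z $ 1 * z $ 2 - z $ 0 * z $ 3) / (z $ 1 * z $ 3))"
    using assms(1) unfolding integral3_def by blast
  have oU: "open U" using U by (simp add: region_def)
  have nzz: "z $ 1 \<noteq> 0" "z $ 3 \<noteq> 0" if "z \<in> U" for z
    using power_detD(1)[OF p that] power_detD(1)[OF q that] by blast+
  then show nz: "y $ 1 \<noteq> 0" "y $ 3 \<noteq> 0" using assms(2) by blast+
  have ex: "(z $ 1 * z $ 2 - z $ 0 * z $ 3) / (z $ 1 * z $ 3) = z $ 2 / z $ 3 - z $ 0 / z $ 1" if "z \<in> U" for z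
    using nzz[OF that] by (simp add: field_simps)
  let ?g = "\<lambda>z. p z / q z * exp (z $ 2 / z $ 3 - z $ 0 / z $ 1)"
  have g: "logderiv ?g y (\<lambda>v. \<kappa> * (v$3 / y$3) - (1 + \<kappa>) * (v$1 / y$1) + (qd y 2 3 v - qd y 0 1 v))"
    by (intro logderiv_mult logderiv_divide logderiv_exp cderiv_diff cderiv_quot nz
        logderiv_power_det[OF p assms(2)] logderiv_power_det[OF q assms(2)])
  have "cderiv f y (\<lambda>v. y $ 4 * (?g y * (\<kappa> * (v$3 / y$3) - (1 + \<kappa>) * (v$1 / y$1) + (qd y 2 3 v - qd y 0 1 v))) + v $ 4 * ?g y)"
    by (rule cderiv_transform[OF cderiv_mult[OF cderiv_coord] oU assms(2)])
      (use g in \<open>simp_all add: logderiv_def f ex\<close>)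
  then show "\<exists>g. g y \<noteq> 0 \<and> cderiv g y (\<lambda>v. g y * (\<kappa> * (v$3 / y$3) - (1 + \<kappa>) * (v$1 / y$1) + (qd y 2 3 v - qd y 0 1 v)))
      \<and> cderiv f y (\<lambda>v. y $ 4 * (g y * (\<kappa> * (v$3 / y$3) - (1 + \<kappa>) * (v$1 / y$1) + (qd y 2 3 v - qd y 0 1 v))) + v $ 4 * g y)"
    using g unfolding logderiv_def by (intro exI[of _ ?g]) simp
qed

lemma exponent32:
  assumes "y $ 1 \<noteq> 0" "y $ 4 \<noteq> (0::complex)"
  shows "cderiv (\<lambda>z. z$0 / z$1 - z$2 / z$4 + (z$3 / z$4)^2) y (\<lambda>v. qd y 0 1 v - qd y 2 4 v + 2 * (y$3 / y$4) * qd y 3 4 v)"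
  by (rule cderiv_eq[OF cderiv_add[OF cderiv_diff[OF cderiv_quot cderiv_quot] cderiv_power[OF cderiv_quot]]])
    (use assms in simp_all)

lemma exponent32_eq:
  fixes z :: "complex ^ 5"
  assumes "z $ 1 \<noteq> 0" "z $ 4 \<noteq> 0"
  shows "(z $ 0 * (z $ 4)^2 - z $ 1 * z $ 2 * z $ 4 + z $ 1 * (z $ 3)^2) / (z $ 1 * (z $ 4)^2) =
    z$0 / z$1 - z$2 / z$4 + (z$3 / z$4)^2"
  using assms by (simp add: field_simps power2_eq_square)

lemma integral4_cderiv:
  assumes "(U, f) \<in> integral4" "y \<in> U"
  shows "y $ 1 \<noteq> 0" "y $ 4 \<noteq> 0" "cderiv f y (\<lambda>v. qd y 0 1 v - qd y 2 4 v + 2 * (y$3 / y$4) * qd y 3 4 v)"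
proof -
  have U: "region U" and f: "\<And>z. z \<in> U \<Longrightarrow> z $ 1 \<noteq> 0 \<and> z $ 4 \<noteq> 0 \<and> f z =
      (z $ 0 * (z $ 4)^2 - z $ 1 * z $ 2 * z $ 4 + z $ 1 * (z $ 3)^2) / (z $ 1 * (z $ 4)^2)"
    using assms(1) unfolding integral4_def by blast+
  have oU: "open U" using U by (simp add: region_def)
  show nz: "y $ 1 \<noteq> 0" "y $ 4 \<noteq> 0" using f[OF assms(2)] by blast+
  show "cderiv f y (\<lambda>v. qd y 0 1 v - qd y 2 4 v + 2 * (y$3 / y$4) * qd y 3 4 v)"
    by (rule cderiv_transform[OF exponent32[OF nz] oU assms(2)]) (use f exponent32_eq in simp)
qed

lemma integral5_logderiv:
  assumes "(U, f) \<in> integral5" "y \<in> U"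
  shows "y $ 1 \<noteq> 0" "y $ 4 \<noteq> 0"
    "logderiv f y (\<lambda>v. v$1 / y$1 - v$4 / y$4 + (qd y 0 1 v - qd y 2 4 v + 2 * (y$3 / y$4) * qd y 3 4 v))"
proof -
  have U: "region U" and f: "\<And>z. z \<in> U \<Longrightarrow> z $ 1 \<noteq> 0 \<and> z $ 4 \<noteq> 0 \<and> f z = z $ 1 / z $ 4 * exp (
      (z $ 0 * (z $ 4)^2 - z $ 1 * z $ 2 * z $ 4 + z $ 1 * (z $ 3)^2) / (z $ 1 * (z $ 4)^2))"
    using assms(1) unfolding integral5_def by blast+
  have oU: "open U" using U by (simp add: region_def)
  show nz: "y $ 1 \<noteq> 0" "y $ 4 \<noteq> 0" using f[OF assms(2)] by blast+
  have "logderiv (\<lambda>z. z $ 1 / z $ 4 * exp (z$0 / z$1 - z$2 / z$4 + (z$3 / z$4)^2)) y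
     (\<lambda>v. v$1 / y$1 - v$4 / y$4 + (qd y 0 1 v - qd y 2 4 v + 2 * (y$3 / y$4) * qd y 3 4 v))"
    by (intro logderiv_mult logderiv_divide logderiv_exp logderiv_coord exponent32 nz)
  then show "logderiv f y (\<lambda>v. v$1 / y$1 - v$4 / y$4 + (qd y 0 1 v - qd y 2 4 v + 2 * (y$3 / y$4) * qd y 3 4 v))"
    by (rule logderiv_transform[OF _ oU assms(2)]) (use f exponent32_eq in simp)
qed

lemma integral6_logderiv:
  assumes "(U, f) \<in> integral6 \<kappa>" "y \<in> U"
  shows "y $ 0 \<noteq> 0" "y $ 1 \<noteq> 0" "y $ 4 \<noteq> 0"
    "logderiv f y (\<lambda>v. \<kappa> * (v$1 / y$1) + (1 - \<kappa>) * (v$4 / y$4) - v$0 / y$0 + (2 * (y$3 / y$4) * qd y 3 4 v - qd y 2 4 v))"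
proof -
  obtain p q where U: "region U" and p: "(U, p) \<in> power_det 1 \<kappa>" and q: "(U, q) \<in> power_det 4 (1 - \<kappa>)"
    and f: "\<And>z. z \<in> U \<Longrightarrow> z $ 0 \<noteq> 0 \<and> f z = p z * q z / z $ 0 * exp (((z $ 3)^2 - z $ 2 * z $ 4) / (z $ 4)^2)"
    using assms(1) unfolding integral6_def by blast
  have oU: "open U" using U by (simp add: region_def)
  have nz4: "z $ 4 \<noteq> 0" if "z \<in> U" for z using power_detD(1)[OF q that] .
  show nz: "y $ 0 \<noteq> 0" "y $ 1 \<noteq> 0" "y $ 4 \<noteq> 0"
    using f[OF assms(2)] power_detD(1)[OF p assms(2)] nz4[OF assms(2)] by blast+
  have e: "((z $ 3)^2 - z $ 2 * z $ 4) / (z $ 4)^2 = (z$3 / z$4)^2 - z$2 / z$4" if "z \<in> U" for z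
    using nz4[OF that] by (simp add: field_simps power2_eq_square)
  have "cderiv (\<lambda>z. (z$3 / z$4)^2 - z$2 / z$4) y (\<lambda>v. 2 * (y$3 / y$4) * qd y 3 4 v - qd y 2 4 v)"
    by (rule cderiv_eq[OF cderiv_diff[OF cderiv_power[OF cderiv_quot] cderiv_quot]]) (use nz in simp_all)
  then have "logderiv (\<lambda>z. p z * q z / z $ 0 * exp ((z$3 / z$4)^2 - z$2 / z$4)) y
    (\<lambda>v. \<kappa> * (v$1 / y$1) + (1 - \<kappa>) * (v$4 / y$4) - v$0 / y$0 + (2 * (y$3 / y$4) * qd y 3 4 v - qd y 2 4 v))"
    by (intro logderiv_mult logderiv_divide logderiv_exp logderiv_coord nz
      logderiv_power_det[OF p assms(2)] logderiv_power_det[OF q assms(2)])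
  then show "logderiv f y (\<lambda>v. \<kappa> * (v$1 / y$1) + (1 - \<kappa>) * (v$4 / y$4) - v$0 / y$0 + (2 * (y$3 / y$4) * qd y 3 4 v - qd y 2 4 v))"
    by (rule logderiv_transform[OF _ oU assms(2)]) (simp add: f e)
qed

text \<open>The coordinate \<open>z\<^sub>0\<close> may vanish here, so the differential of the product is written out, up to the
  exponential factor \<open>g\<close>.\<close>

lemma integral7_cderiv:
  assumes "(U, f) \<in> integral7" "y \<in> U"
  shows "y $ 4 \<noteq> 0"
    "\<exists>g. g \<noteq> 0 \<and> cderiv f y (\<lambda>v. g * (qd y 0 4 v + (y$0 / y$4) * (qd y 1 4 v + ((y$2 / y$4) * qd y 3 4 v + qd y 2 4 v * (y$3 / y$4))
        - 3 * (y$3 / y$4)^2 * qd y 3 4 v)))"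
proof -
  have U: "region U" and f: "\<And>z. z \<in> U \<Longrightarrow> z $ 4 \<noteq> 0 \<and> f z = z $ 0 / z $ 4 *
      exp ((z $ 1 * (z $ 4)^2 + z $ 2 * z $ 3 * z $ 4 - (z $ 3)^3) / (z $ 4)^3)"
    using assms(1) unfolding integral7_def by blast+
  have oU: "open U" using U by (simp add: region_def)
  show nz: "y $ 4 \<noteq> 0" using f[OF assms(2)] by blast
  have e: "(z $ 1 * (z $ 4)^2 + z $ 2 * z $ 3 * z $ 4 - (z $ 3)^3) / (z $ 4)^3 =
      z$1 / z$4 + (z$2 / z$4) * (z$3 / z$4) - (z$3 / z$4)^3" if "z \<in> U" for z
    using f[OF that] by (simp add: field_simps power2_eq_square power3_eq_cube)
  let ?g = "\<lambda>z :: complex ^ 5. exp (z$1 / z$4 + (z$2 / z$4) * (z$3 / z$4) - (z$3 / z$4)^3)"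
  let ?E = "\<lambda>v. qd y 1 4 v + ((y$2 / y$4) * qd y 3 4 v + qd y 2 4 v * (y$3 / y$4)) - 3 * (y$3 / y$4)^2 * qd y 3 4 v"
  have "cderiv (\<lambda>z. z$1 / z$4 + (z$2 / z$4) * (z$3 / z$4) - (z$3 / z$4)^3) y ?E"
    by (rule cderiv_eq[OF cderiv_diff[OF cderiv_add[OF cderiv_quot cderiv_mult[OF cderiv_quot cderiv_quot]] cderiv_power[OF cderiv_quot]]])
      (use nz in simp_all)
  then have "cderiv (\<lambda>z. z$0 / z$4 * ?g z) y (\<lambda>v. (y$0 / y$4) * (?g y * ?E v) + qd y 0 4 v * ?g y)"
    by (intro cderiv_mult cderiv_exp cderiv_quot nz)
  then have "cderiv f y (\<lambda>v. (y$0 / y$4) * (?g y * ?E v) + qd y 0 4 v * ?g y)"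
    by (rule cderiv_transform[OF _ oU assms(2)]) (simp add: f e)
  then have "cderiv f y (\<lambda>v. ?g y * (qd y 0 4 v + (y$0 / y$4) * ?E v))"
    by (rule cderiv_eq) (simp add: algebra_simps)
  then show "\<exists>g. g \<noteq> 0 \<and> cderiv f y (\<lambda>v. g * (qd y 0 4 v + (y$0 / y$4) * ?E v))"
    by (intro exI[of _ "?g y"]) simp
qed

lemma integral8_cderiv:
  assumes "(U, f) \<in> integral8" "y \<in> U"
  shows "y $ 4 \<noteq> 0"
    "cderiv f y (\<lambda>v. qd y 0 4 v + ((y$1 / y$4) * qd y 3 4 v + qd y 1 4 v * (y$3 / y$4)) - (y$2 / y$4) * qd y 2 4 v
       - (y$3 / y$4)^3 * qd y 3 4 v + ((y$2 / y$4) * (2 * (y$3 / y$4) * qd y 3 4 v) + qd y 2 4 v * (y$3 / y$4)^2))"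
proof -
  have U: "region U" and f: "\<And>z. z \<in> U \<Longrightarrow> z $ 4 \<noteq> 0 \<and> f z = (z $ 0 * (z $ 4)^3 + z $ 1 * z $ 3 * (z $ 4)^2 - (z $ 2)^2 * (z $ 4)^2 / 2
               - (z $ 3)^4 / 4 + z $ 2 * (z $ 3)^2 * z $ 4) / (z $ 4)^4"
    using assms(1) unfolding integral8_def by blast+
  have oU: "open U" using U by (simp add: region_def)
  show nz: "y $ 4 \<noteq> 0" using f[OF assms(2)] by blast
  have e: "f z = z$0 / z$4 + (z$1 / z$4) * (z$3 / z$4) - (1/2) * (z$2 / z$4)^2 - (1/4) * (z$3 / z$4)^4 + (z$2 / z$4) * (z$3 / z$4)^2"
    if "z \<in> U" for z
    using f[OF that] by (simp add: field_simps power2_eq_square power3_eq_cube power4_eq_xxxx)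
  show "cderiv f y (\<lambda>v. qd y 0 4 v + ((y$1 / y$4) * qd y 3 4 v + qd y 1 4 v * (y$3 / y$4)) - (y$2 / y$4) * qd y 2 4 v
       - (y$3 / y$4)^3 * qd y 3 4 v + ((y$2 / y$4) * (2 * (y$3 / y$4) * qd y 3 4 v) + qd y 2 4 v * (y$3 / y$4)^2))"
    by (rule cderiv_transform[OF cderiv_eq[OF cderiv_add[OF cderiv_diff[OF cderiv_diff[OF cderiv_add[OF cderiv_quot cderiv_mult[OF cderiv_quot cderiv_quot]]
        cderiv_cmult[OF cderiv_power[OF cderiv_quot]]] cderiv_cmult[OF cderiv_power[OF cderiv_quot]]]
        cderiv_mult[OF cderiv_quot cderiv_power[OF cderiv_quot]]]] oU assms(2) e])
      (use nz in simp_all)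
qed

section \<open>Normal forms of the action and their integrals\<close>

text \<open>In each of the eight lemmas the last equation of the hypothesis says that the logarithmic derivative
  (the derivative, in the rational cases) of the integral along \<open>z \<mapsto> B z\<close> is zero.\<close>

lemma normal_form1:
  fixes A :: "complex ^ 5 \<Rightarrow> complex ^ 5" and \<kappa> :: "5 \<Rightarrow> complex"
  assumes reg: "\<And>z. A z \<noteq> 0 \<Longrightarrow> regular_point V z (A z)"
    and ind: "indep5 v0 v1 v2 v3 v4"
    and \<kappa>0: "\<kappa> 0 \<noteq> 0"
    and act: "\<And>B. B \<in> V \<Longrightarrow> \<exists>b0 b1 b2 b3 b4. B *v v0 = b0 *s v0 \<and> B *v v1 = b1 *s v1 \<and> B *v v2 = b2 *s v2 \<and> B *v v3 = b3 *s v3 \<and> B *v v4 = b4 *s v4 \<and> \<kappa> 0 * b0 + \<kappa> 1 * b1 + \<kappa> 2 * b2 + \<kappa> 3 * b3 + \<kappa> 4 * b4 = 0"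
  shows "\<exists>M :: complex ^ 5 ^ 5. invertible M \<and> first_integral (pullback_form M A) (integral1 \<kappa>)"
proof (rule columns_criterion[OF reg ind, where R = "\<lambda>y w. \<exists>b0 b1 b2 b3 b4. w$0 = b0 * y$0 \<and> w$1 = b1 * y$1 \<and> w$2 = b2 * y$2 \<and> w$3 = b3 * y$3 \<and> w$4 = b4 * y$4 \<and> \<kappa> 0 * b0 + \<kappa> 1 * b1 + \<kappa> 2 * b2 + \<kappa> 3 * b3 + \<kappa> 4 * b4 = 0"])
  fix y :: "complex ^ 5" assume "\<And>i. y $ i \<noteq> 0"
  then obtain U where U: "region U" "y \<in> U" and nz: "\<And>z i. z \<in> U \<Longrightarrow> z $ i \<noteq> 0" and p: "\<And>i a. \<exists>p. (U, p) \<in> power_det i a"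
    by (rule local_determinations) (rule that)
  have "\<forall>i. \<exists>p. (U, p) \<in> power_det i (\<kappa> i)" using p by blast
  from choice[OF this] obtain p where "\<forall>i. (U, p i) \<in> power_det i (\<kappa> i)" ..
  then have "(U, \<lambda>z. p 0 z * p 1 z * p 2 z * p 3 z * p 4 z) \<in> integral1 \<kappa>" using U unfolding integral1_def by blast
  then show "\<exists>U f. (U, f) \<in> integral1 \<kappa> \<and> y \<in> U" using U by blast
next
  fix B and y w :: "complex ^ 5" assume B: "B \<in> V" and eq: "B *v comb5 y v0 v1 v2 v3 v4 = comb5 w v0 v1 v2 v3 v4"
  obtain b0 b1 b2 b3 b4 where b: "B *v v0 = b0 *s v0" "B *v v1 = b1 *s v1" "B *v v2 = b2 *s v2" "B *v v3 = b3 *s v3" "B *v v4 = b4 *s v4" "\<kappa> 0 * b0 + \<kappa> 1 * b1 + \<kappa> 2 * b2 + \<kappa> 3 * b3 + \<kappa> 4 * b4 = 0"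
    using act[OF B] by blast
  have "B *v comb5 y v0 v1 v2 v3 v4 = (b0 * y$0) *s v0 + (b1 * y$1) *s v1 + (b2 * y$2) *s v2 + (b3 * y$3) *s v3 + (b4 * y$4) *s v4"
    by (simp add: vec.add vec.scale b(1-5) vec_eq_iff algebra_simps)
  from action_coordinates[OF ind eq this] show "\<exists>b0 b1 b2 b3 b4. w$0 = b0 * y$0 \<and> w$1 = b1 * y$1 \<and> w$2 = b2 * y$2 \<and> w$3 = b3 * y$3 \<and> w$4 = b4 * y$4 \<and> \<kappa> 0 * b0 + \<kappa> 1 * b1 + \<kappa> 2 * b2 + \<kappa> 3 * b3 + \<kappa> 4 * b4 = 0"
    using b(6) by blast
next
  fix U f y assume F: "(U, f) \<in> (integral1 \<kappa>)" and y: "y \<in> U"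
  show "\<exists>D. cderiv f y D \<and> (\<exists>v. D v \<noteq> 0) \<and> (\<forall>w. (\<exists>b0 b1 b2 b3 b4. w$0 = b0 * y$0 \<and> w$1 = b1 * y$1 \<and> w$2 = b2 * y$2 \<and> w$3 = b3 * y$3 \<and> w$4 = b4 * y$4 \<and>
      \<kappa> 0 * b0 + \<kappa> 1 * b1 + \<kappa> 2 * b2 + \<kappa> 3 * b3 + \<kappa> 4 * b4 = 0) \<longrightarrow> D w = 0)"
    by (rule logderiv_nonzero[OF integral1_logderiv(2)[OF F y], of "axis 0 1"])
      (use integral1_logderiv(1)[OF F y] \<kappa>0 in \<open>auto simp: axis_def\<close>)
qed (auto simp: integral1_def)

lemma normal_form2:
  fixes A :: "complex ^ 5 \<Rightarrow> complex ^ 5" and \<kappa> \<xi> :: complex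
  assumes reg: "\<And>z. A z \<noteq> 0 \<Longrightarrow> regular_point V z (A z)"
    and ind: "indep5 v0 v1 v2 v3 v4"
    and act: "\<And>B. B \<in> V \<Longrightarrow> \<exists>b b' c2 c3 c4. B *v v1 = b *s v1 + b' *s v0 \<and> B *v v0 = b *s v0 \<and> B *v v2 = c2 *s v2 \<and> B *v v3 = c3 *s v3 \<and> B *v v4 = c4 *s v4 \<and> (\<kappa> + \<xi> + 1) * b + b' - \<kappa> * c2 - \<xi> * c3 - c4 = 0"
  shows "\<exists>M :: complex ^ 5 ^ 5. invertible M \<and> first_integral (pullback_form M A) (integral2 \<kappa> \<xi>)"
proof (rule columns_criterion[OF reg ind, where R = "\<lambda>y w. \<exists>b b' c2 c3 c4. w$0 = b * y$0 + b' * y$1 \<and> w$1 = b * y$1 \<and> w$2 = c2 * y$2 \<and> w$3 = c3 * y$3 \<and> w$4 = c4 * y$4 \<and> (\<kappa> + \<xi> + 1) * b + b' - \<kappa> * c2 - \<xi> * c3 - c4 = 0"])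
  fix y :: "complex ^ 5" assume "\<And>i. y $ i \<noteq> 0"
  then obtain U where U: "region U" "y \<in> U" and nz: "\<And>z i. z \<in> U \<Longrightarrow> z $ i \<noteq> 0" and p: "\<And>i a. \<exists>p. (U, p) \<in> power_det i a"
    by (rule local_determinations) (rule that)
  obtain p q r where "(U, p) \<in> power_det 1 (\<kappa> + \<xi> + 1)" "(U, q) \<in> power_det 2 (\<kappa>)" "(U, r) \<in> power_det 3 (\<xi>)" using p by metis
  then have "(U, \<lambda>z. p z / (q z * r z * z $ 4) * exp (z $ 0 / z $ 1)) \<in> integral2 \<kappa> \<xi>" using U nz unfolding integral2_def by blast
  then show "\<exists>U f. (U, f) \<in> integral2 \<kappa> \<xi> \<and> y \<in> U" using U by blast
next
  fix B and y w :: "complex ^ 5" assume B: "B \<in> V" and eq: "B *v comb5 y v0 v1 v2 v3 v4 = comb5 w v0 v1 v2 v3 v4"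
  obtain b b' c2 c3 c4 where b: "B *v v1 = b *s v1 + b' *s v0" "B *v v0 = b *s v0" "B *v v2 = c2 *s v2" "B *v v3 = c3 *s v3" "B *v v4 = c4 *s v4" "(\<kappa> + \<xi> + 1) * b + b' - \<kappa> * c2 - \<xi> * c3 - c4 = 0"
    using act[OF B] by blast
  have "B *v comb5 y v0 v1 v2 v3 v4 = (b * y$0 + b' * y$1) *s v0 + (b * y$1) *s v1 + (c2 * y$2) *s v2 + (c3 * y$3) *s v3 + (c4 * y$4) *s v4"
    by (simp add: vec.add vec.scale b(1-5) vec_eq_iff algebra_simps)
  from action_coordinates[OF ind eq this] show "\<exists>b b' c2 c3 c4. w$0 = b * y$0 + b' * y$1 \<and> w$1 = b * y$1 \<and> w$2 = c2 * y$2 \<and> w$3 = c3 * y$3 \<and> w$4 = c4 * y$4 \<and> (\<kappa> + \<xi> + 1) * b + b' - \<kappa> * c2 - \<xi> * c3 - c4 = 0"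
    using b(6) by blast
next
  fix U f y assume F: "(U, f) \<in> (integral2 \<kappa> \<xi>)" and y: "y \<in> U"
  note nz = integral2_logderiv(1-4)[OF F y]
  have "(\<kappa> + \<xi> + 1) * (w$1 / y$1) - (\<kappa> * (w$2 / y$2) + \<xi> * (w$3 / y$3) + w$4 / y$4) + qd y 0 1 w = 0" if R: "(\<exists>b b' c2 c3 c4. w$0 = b * y$0 + b' * y$1 \<and> w$1 = b * y$1 \<and> w$2 = c2 * y$2 \<and> w$3 = c3 * y$3 \<and> w$4 = c4 * y$4 \<and> (\<kappa> + \<xi> + 1) * b + b' - \<kappa> * c2 - \<xi> * c3 - c4 = 0)" for w
  proof -
    obtain b b' c2 c3 c4 where w: "w$0 = b * y$0 + b' * y$1" "w$1 = b * y$1" "w$2 = c2 * y$2" "w$3 = c3 * y$3" "w$4 = c4 * y$4"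
      "(\<kappa> + \<xi> + 1) * b + b' - \<kappa> * c2 - \<xi> * c3 - c4 = 0" using R by blast
    have "qd y 0 1 w = b'" by (rule qd_eq[OF nz(1) w(2,1)])
    then show ?thesis using w(6) nz by (simp add: w(2-5) algebra_simps)
  qed
  then show "\<exists>D. cderiv f y D \<and> (\<exists>v. D v \<noteq> 0) \<and> (\<forall>w. (\<exists>b b' c2 c3 c4. w$0 = b * y$0 + b' * y$1 \<and> w$1 = b * y$1 \<and> w$2 = c2 * y$2 \<and> w$3 = c3 * y$3 \<and> w$4 = c4 * y$4 \<and> (\<kappa> + \<xi> + 1) * b + b' - \<kappa> * c2 - \<xi> * c3 - c4 = 0) \<longrightarrow> D w = 0)"
    by (intro logderiv_nonzero[OF integral2_logderiv(5)[OF F y], of "axis 0 1"]) (use nz in \<open>auto simp: axis_def qd_def\<close>)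
qed (auto simp: integral2_def)

lemma normal_form3:
  fixes A :: "complex ^ 5 \<Rightarrow> complex ^ 5" and \<kappa> :: complex
  assumes reg: "\<And>z. A z \<noteq> 0 \<Longrightarrow> regular_point V z (A z)"
    and ind: "indep5 v0 v1 v2 v3 v4"
    and act: "\<And>B. B \<in> V \<Longrightarrow> \<exists>a a' b b' c. B *v v3 = a *s v3 + a' *s v2 \<and> B *v v2 = a *s v2 \<and> B *v v1 = b *s v1 + b' *s v0 \<and> B *v v0 = b *s v0 \<and> B *v v4 = c *s v4 \<and> \<kappa> * a + c - (1 + \<kappa>) * b + a' - b' = 0"
  shows "\<exists>M :: complex ^ 5 ^ 5. invertible M \<and> first_integral (pullback_form M A) (integral3 \<kappa>)"
proof (rule columns_criterion[OF reg ind, where R = "\<lambda>y w. \<exists>a a' b b' c. w$0 = b * y$0 + b' * y$1 \<and> w$1 = b * y$1 \<and> w$2 = a * y$2 + a' * y$3 \<and> w$3 = a * y$3 \<and> w$4 = c * y$4 \<and> \<kappa> * a + c - (1 + \<kappa>) * b + a' - b' = 0"])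
  fix y :: "complex ^ 5" assume "\<And>i. y $ i \<noteq> 0"
  then obtain U where U: "region U" "y \<in> U" and nz: "\<And>z i. z \<in> U \<Longrightarrow> z $ i \<noteq> 0" and p: "\<And>i a. \<exists>p. (U, p) \<in> power_det i a"
    by (rule local_determinations) (rule that)
  obtain p q where "(U, p) \<in> power_det 3 (\<kappa>)" "(U, q) \<in> power_det 1 (1 + \<kappa>)" using p by metis
  then have "(U, \<lambda>z. p z * z $ 4 / q z * exp ((z $ 1 * z $ 2 - z $ 0 * z $ 3) / (z $ 1 * z $ 3))) \<in> integral3 \<kappa>" using U nz unfolding integral3_def by blast
  then show "\<exists>U f. (U, f) \<in> integral3 \<kappa> \<and> y \<in> U" using U by blast
next
  fix B and y w :: "complex ^ 5" assume B: "B \<in> V" and eq: "B *v comb5 y v0 v1 v2 v3 v4 = comb5 w v0 v1 v2 v3 v4"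
  obtain a a' b b' c where b: "B *v v3 = a *s v3 + a' *s v2" "B *v v2 = a *s v2" "B *v v1 = b *s v1 + b' *s v0" "B *v v0 = b *s v0" "B *v v4 = c *s v4" "\<kappa> * a + c - (1 + \<kappa>) * b + a' - b' = 0"
    using act[OF B] by blast
  have "B *v comb5 y v0 v1 v2 v3 v4 = (b * y$0 + b' * y$1) *s v0 + (b * y$1) *s v1 + (a * y$2 + a' * y$3) *s v2 + (a * y$3) *s v3 + (c * y$4) *s v4"
    by (simp add: vec.add vec.scale b(1-5) vec_eq_iff algebra_simps)
  from action_coordinates[OF ind eq this] show "\<exists>a a' b b' c. w$0 = b * y$0 + b' * y$1 \<and> w$1 = b * y$1 \<and> w$2 = a * y$2 + a' * y$3 \<and> w$3 = a * y$3 \<and> w$4 = c * y$4 \<and> \<kappa> * a + c - (1 + \<kappa>) * b + a' - b' = 0"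
    using b(6) by blast
next
  fix U f y assume F: "(U, f) \<in> (integral3 \<kappa>)" and y: "y \<in> U"
  note nz = integral3_logderiv(1,2)[OF F y]
  obtain g where g: "g y \<noteq> 0"
      "cderiv f y (\<lambda>v. y $ 4 * (g y * (\<kappa> * (v$3 / y$3) - (1 + \<kappa>) * (v$1 / y$1) + (qd y 2 3 v - qd y 0 1 v))) + v $ 4 * g y)"
    using integral3_logderiv(3)[OF F y] by blast
  have "y $ 4 * (g y * (\<kappa> * (w$3 / y$3) - (1 + \<kappa>) * (w$1 / y$1) + (qd y 2 3 w - qd y 0 1 w))) + w $ 4 * g y = 0" if R: "(\<exists>a a' b b' c. w$0 = b * y$0 + b' * y$1 \<and> w$1 = b * y$1 \<and> w$2 = a * y$2 + a' * y$3 \<and> w$3 = a * y$3 \<and> w$4 = c * y$4 \<and> \<kappa> * a + c - (1 + \<kappa>) * b + a' - b' = 0)" for w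
  proof -
    obtain a a' b b' c where w: "w$0 = b * y$0 + b' * y$1" "w$1 = b * y$1" "w$2 = a * y$2 + a' * y$3" "w$3 = a * y$3" "w$4 = c * y$4"
      "\<kappa> * a + c - (1 + \<kappa>) * b + a' - b' = 0" using R by blast
    have q: "qd y 0 1 w = b'" "qd y 2 3 w = a'" by (rule qd_eq[OF nz(1) w(2,1)], rule qd_eq[OF nz(2) w(4,3)])
    have "y $ 4 * (g y * (\<kappa> * (w$3 / y$3) - (1 + \<kappa>) * (w$1 / y$1) + (qd y 2 3 w - qd y 0 1 w))) + w $ 4 * g y =
        y $ 4 * g y * (\<kappa> * a + c - (1 + \<kappa>) * b + a' - b')"
      using nz by (simp add: w(2,4,5) q algebra_simps)
    then show ?thesis using w(6) by simp
  qed
  then show "\<exists>D. cderiv f y D \<and> (\<exists>v. D v \<noteq> 0) \<and> (\<forall>w. (\<exists>a a' b b' c. w$0 = b * y$0 + b' * y$1 \<and> w$1 = b * y$1 \<and> w$2 = a * y$2 + a' * y$3 \<and> w$3 = a * y$3 \<and> w$4 = c * y$4 \<and> \<kappa> * a + c - (1 + \<kappa>) * b + a' - b' = 0) \<longrightarrow> D w = 0)"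
    using g nz by (intro exI[of _ "\<lambda>v. y $ 4 * (g y * (\<kappa> * (v$3 / y$3) - (1 + \<kappa>) * (v$1 / y$1) + (qd y 2 3 v - qd y 0 1 v))) + v $ 4 * g y"] conjI
      exI[of _ "axis 4 1"]) (auto simp: axis_def qd_def)
qed (auto simp: integral3_def)

lemma normal_form4:
  fixes A :: "complex ^ 5 \<Rightarrow> complex ^ 5"
  assumes reg: "\<And>z. A z \<noteq> 0 \<Longrightarrow> regular_point V z (A z)"
    and ind: "indep5 v0 v1 v2 v3 v4"
    and act: "\<And>B. B \<in> V \<Longrightarrow> \<exists>a a' a'' b b'. B *v v4 = a *s v4 + a' *s v3 + a'' *s v2 \<and> B *v v3 = a *s v3 + (2 * a') *s v2 \<and> B *v v2 = a *s v2 \<and> B *v v1 = b *s v1 + b' *s v0 \<and> B *v v0 = b *s v0 \<and> b' - a'' = 0"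
  shows "\<exists>M :: complex ^ 5 ^ 5. invertible M \<and> first_integral (pullback_form M A) integral4"
proof (rule columns_criterion[OF reg ind, where R = "\<lambda>y w. \<exists>a a' a'' b b'. w$0 = b * y$0 + b' * y$1 \<and> w$1 = b * y$1 \<and> w$2 = a * y$2 + 2 * a' * y$3 + a'' * y$4 \<and> w$3 = a * y$3 + a' * y$4 \<and> w$4 = a * y$4 \<and> b' - a'' = 0"])
  fix y :: "complex ^ 5" assume "\<And>i. y $ i \<noteq> 0"
  then obtain U where U: "region U" "y \<in> U" and nz: "\<And>z i. z \<in> U \<Longrightarrow> z $ i \<noteq> 0" and p: "\<And>i a. \<exists>p. (U, p) \<in> power_det i a"
    by (rule local_determinations) (rule that)
  show "\<exists>U f. (U, f) \<in> integral4 \<and> y \<in> U"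
    unfolding integral4_def using U nz by fast
next
  fix B and y w :: "complex ^ 5" assume B: "B \<in> V" and eq: "B *v comb5 y v0 v1 v2 v3 v4 = comb5 w v0 v1 v2 v3 v4"
  obtain a a' a'' b b' where b: "B *v v4 = a *s v4 + a' *s v3 + a'' *s v2" "B *v v3 = a *s v3 + (2 * a') *s v2" "B *v v2 = a *s v2" "B *v v1 = b *s v1 + b' *s v0" "B *v v0 = b *s v0" "b' - a'' = 0"
    using act[OF B] by blast
  have "B *v comb5 y v0 v1 v2 v3 v4 = (b * y$0 + b' * y$1) *s v0 + (b * y$1) *s v1 + (a * y$2 + 2 * a' * y$3 + a'' * y$4) *s v2 + (a * y$3 + a' * y$4) *s v3 + (a * y$4) *s v4"
    by (simp add: vec.add vec.scale b(1-5) vec_eq_iff algebra_simps)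
  from action_coordinates[OF ind eq this] show "\<exists>a a' a'' b b'. w$0 = b * y$0 + b' * y$1 \<and> w$1 = b * y$1 \<and> w$2 = a * y$2 + 2 * a' * y$3 + a'' * y$4 \<and> w$3 = a * y$3 + a' * y$4 \<and> w$4 = a * y$4 \<and> b' - a'' = 0"
    using b(6) by blast
next
  fix U f y assume F: "(U, f) \<in> integral4" and y: "y \<in> U"
  note nz = integral4_cderiv(1,2)[OF F y]
  have "qd y 0 1 w - qd y 2 4 w + 2 * (y$3 / y$4) * qd y 3 4 w = 0" if R: "(\<exists>a a' a'' b b'. w$0 = b * y$0 + b' * y$1 \<and> w$1 = b * y$1 \<and> w$2 = a * y$2 + 2 * a' * y$3 + a'' * y$4 \<and> w$3 = a * y$3 + a' * y$4 \<and> w$4 = a * y$4 \<and> b' - a'' = 0)" for w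
  proof -
    obtain a a' a'' b b' where w: "w$0 = b * y$0 + b' * y$1" "w$1 = b * y$1" "w$2 = a * y$2 + 2 * a' * y$3 + a'' * y$4" "w$3 = a * y$3 + a' * y$4" "w$4 = a * y$4"
      "b' - a'' = 0" using R by blast
    have q1: "qd y 0 1 w = b'" by (rule qd_eq[OF nz(1) w(2,1)])
    have q: "qd y 3 4 w = a'" by (rule qd_eq[OF nz(2) w(5,4)])
    have q2: "qd y 2 4 w = 2 * a' * (y$3 / y$4) + a''"
      by (rule qd_eq[OF nz(2) w(5)]) (simp add: w(3) distrib_right nz(2))
    have "qd y 0 1 w - qd y 2 4 w + 2 * (y$3 / y$4) * qd y 3 4 w = b' - a''" by (simp add: q q1 q2)
    then show ?thesis using w(6) by simp
  qed
  then show "\<exists>D. cderiv f y D \<and> (\<exists>v. D v \<noteq> 0) \<and> (\<forall>w. (\<exists>a a' a'' b b'. w$0 = b * y$0 + b' * y$1 \<and> w$1 = b * y$1 \<and> w$2 = a * y$2 + 2 * a' * y$3 + a'' * y$4 \<and> w$3 = a * y$3 + a' * y$4 \<and> w$4 = a * y$4 \<and> b' - a'' = 0) \<longrightarrow> D w = 0)"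
    using integral4_cderiv(3)[OF F y] nz by (intro exI[of _ "\<lambda>v. qd y 0 1 v - qd y 2 4 v + 2 * (y$3 / y$4) * qd y 3 4 v"] conjI
      exI[of _ "axis 0 1"]) (auto simp: axis_def qd_def)
qed (auto simp: integral4_def)

lemma normal_form5:
  fixes A :: "complex ^ 5 \<Rightarrow> complex ^ 5"
  assumes reg: "\<And>z. A z \<noteq> 0 \<Longrightarrow> regular_point V z (A z)"
    and ind: "indep5 v0 v1 v2 v3 v4"
    and act: "\<And>B. B \<in> V \<Longrightarrow> \<exists>a a' a'' b b'. B *v v4 = a *s v4 + a' *s v3 + a'' *s v2 \<and> B *v v3 = a *s v3 + (2 * a') *s v2 \<and> B *v v2 = a *s v2 \<and> B *v v1 = b *s v1 + b' *s v0 \<and> B *v v0 = b *s v0 \<and> b - a + b' - a'' = 0"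
  shows "\<exists>M :: complex ^ 5 ^ 5. invertible M \<and> first_integral (pullback_form M A) integral5"
proof (rule columns_criterion[OF reg ind, where R = "\<lambda>y w. \<exists>a a' a'' b b'. w$0 = b * y$0 + b' * y$1 \<and> w$1 = b * y$1 \<and> w$2 = a * y$2 + 2 * a' * y$3 + a'' * y$4 \<and> w$3 = a * y$3 + a' * y$4 \<and> w$4 = a * y$4 \<and> b - a + b' - a'' = 0"])
  fix y :: "complex ^ 5" assume "\<And>i. y $ i \<noteq> 0"
  then obtain U where U: "region U" "y \<in> U" and nz: "\<And>z i. z \<in> U \<Longrightarrow> z $ i \<noteq> 0" and p: "\<And>i a. \<exists>p. (U, p) \<in> power_det i a"
    by (rule local_determinations) (rule that)
  show "\<exists>U f. (U, f) \<in> integral5 \<and> y \<in> U"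
    unfolding integral5_def using U nz by fast
next
  fix B and y w :: "complex ^ 5" assume B: "B \<in> V" and eq: "B *v comb5 y v0 v1 v2 v3 v4 = comb5 w v0 v1 v2 v3 v4"
  obtain a a' a'' b b' where b: "B *v v4 = a *s v4 + a' *s v3 + a'' *s v2" "B *v v3 = a *s v3 + (2 * a') *s v2" "B *v v2 = a *s v2" "B *v v1 = b *s v1 + b' *s v0" "B *v v0 = b *s v0" "b - a + b' - a'' = 0"
    using act[OF B] by blast
  have "B *v comb5 y v0 v1 v2 v3 v4 = (b * y$0 + b' * y$1) *s v0 + (b * y$1) *s v1 + (a * y$2 + 2 * a' * y$3 + a'' * y$4) *s v2 + (a * y$3 + a' * y$4) *s v3 + (a * y$4) *s v4"
    by (simp add: vec.add vec.scale b(1-5) vec_eq_iff algebra_simps)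
  from action_coordinates[OF ind eq this] show "\<exists>a a' a'' b b'. w$0 = b * y$0 + b' * y$1 \<and> w$1 = b * y$1 \<and> w$2 = a * y$2 + 2 * a' * y$3 + a'' * y$4 \<and> w$3 = a * y$3 + a' * y$4 \<and> w$4 = a * y$4 \<and> b - a + b' - a'' = 0"
    using b(6) by blast
next
  fix U f y assume F: "(U, f) \<in> integral5" and y: "y \<in> U"
  note nz = integral5_logderiv(1,2)[OF F y]
  have "w$1 / y$1 - w$4 / y$4 + (qd y 0 1 w - qd y 2 4 w + 2 * (y$3 / y$4) * qd y 3 4 w) = 0" if R: "(\<exists>a a' a'' b b'. w$0 = b * y$0 + b' * y$1 \<and> w$1 = b * y$1 \<and> w$2 = a * y$2 + 2 * a' * y$3 + a'' * y$4 \<and> w$3 = a * y$3 + a' * y$4 \<and> w$4 = a * y$4 \<and> b - a + b' - a'' = 0)" for w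
  proof -
    obtain a a' a'' b b' where w: "w$0 = b * y$0 + b' * y$1" "w$1 = b * y$1" "w$2 = a * y$2 + 2 * a' * y$3 + a'' * y$4" "w$3 = a * y$3 + a' * y$4" "w$4 = a * y$4"
      "b - a + b' - a'' = 0" using R by blast
    have q1: "qd y 0 1 w = b'" by (rule qd_eq[OF nz(1) w(2,1)])
    have q: "qd y 3 4 w = a'" by (rule qd_eq[OF nz(2) w(5,4)])
    have q2: "qd y 2 4 w = 2 * a' * (y$3 / y$4) + a''"
      by (rule qd_eq[OF nz(2) w(5)]) (simp add: w(3) distrib_right nz(2))
    have "w$1 / y$1 = b" "w$4 / y$4 = a" using nz by (simp_all add: w(2,5))
    moreover have "qd y 0 1 w - qd y 2 4 w + 2 * (y$3 / y$4) * qd y 3 4 w = b' - a''" by (simp add: q q1 q2)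
    ultimately have "w$1 / y$1 - w$4 / y$4 + (qd y 0 1 w - qd y 2 4 w + 2 * (y$3 / y$4) * qd y 3 4 w) = b - a + b' - a''"
      by (simp only: add_diff_eq)
    then show ?thesis by (simp only: w(6))
  qed
  then show "\<exists>D. cderiv f y D \<and> (\<exists>v. D v \<noteq> 0) \<and> (\<forall>w. (\<exists>a a' a'' b b'. w$0 = b * y$0 + b' * y$1 \<and> w$1 = b * y$1 \<and> w$2 = a * y$2 + 2 * a' * y$3 + a'' * y$4 \<and> w$3 = a * y$3 + a' * y$4 \<and> w$4 = a * y$4 \<and> b - a + b' - a'' = 0) \<longrightarrow> D w = 0)"
    by (intro logderiv_nonzero[OF integral5_logderiv(3)[OF F y], of "axis 0 1"]) (use nz in \<open>auto simp: axis_def qd_def\<close>)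
qed (auto simp: integral5_def)

lemma normal_form6:
  fixes A :: "complex ^ 5 \<Rightarrow> complex ^ 5" and \<kappa> :: complex
  assumes reg: "\<And>z. A z \<noteq> 0 \<Longrightarrow> regular_point V z (A z)"
    and ind: "indep5 v0 v1 v2 v3 v4"
    and act: "\<And>B. B \<in> V \<Longrightarrow> \<exists>a a' a'' b c. B *v v4 = a *s v4 + a' *s v3 + a'' *s v2 \<and> B *v v3 = a *s v3 + (2 * a') *s v2 \<and> B *v v2 = a *s v2 \<and> B *v v1 = b *s v1 \<and> B *v v0 = c *s v0 \<and> \<kappa> * b + (1 - \<kappa>) * a - c - a'' = 0"
  shows "\<exists>M :: complex ^ 5 ^ 5. invertible M \<and> first_integral (pullback_form M A) (integral6 \<kappa>)"
proof (rule columns_criterion[OF reg ind, where R = "\<lambda>y w. \<exists>a a' a'' b c. w$0 = c * y$0 \<and> w$1 = b * y$1 \<and> w$2 = a * y$2 + 2 * a' * y$3 + a'' * y$4 \<and> w$3 = a * y$3 + a' * y$4 \<and> w$4 = a * y$4 \<and> \<kappa> * b + (1 - \<kappa>) * a - c - a'' = 0"])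
  fix y :: "complex ^ 5" assume "\<And>i. y $ i \<noteq> 0"
  then obtain U where U: "region U" "y \<in> U" and nz: "\<And>z i. z \<in> U \<Longrightarrow> z $ i \<noteq> 0" and p: "\<And>i a. \<exists>p. (U, p) \<in> power_det i a"
    by (rule local_determinations) (rule that)
  obtain p q where "(U, p) \<in> power_det 1 (\<kappa>)" "(U, q) \<in> power_det 4 (1 - \<kappa>)" using p by metis
  then have "(U, \<lambda>z. p z * q z / z $ 0 * exp (((z $ 3)^2 - z $ 2 * z $ 4) / (z $ 4)^2)) \<in> integral6 \<kappa>" using U nz unfolding integral6_def by blast
  then show "\<exists>U f. (U, f) \<in> integral6 \<kappa> \<and> y \<in> U" using U by blast
next
  fix B and y w :: "complex ^ 5" assume B: "B \<in> V" and eq: "B *v comb5 y v0 v1 v2 v3 v4 = comb5 w v0 v1 v2 v3 v4"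
  obtain a a' a'' b c where b: "B *v v4 = a *s v4 + a' *s v3 + a'' *s v2" "B *v v3 = a *s v3 + (2 * a') *s v2" "B *v v2 = a *s v2" "B *v v1 = b *s v1" "B *v v0 = c *s v0" "\<kappa> * b + (1 - \<kappa>) * a - c - a'' = 0"
    using act[OF B] by blast
  have "B *v comb5 y v0 v1 v2 v3 v4 = (c * y$0) *s v0 + (b * y$1) *s v1 + (a * y$2 + 2 * a' * y$3 + a'' * y$4) *s v2 + (a * y$3 + a' * y$4) *s v3 + (a * y$4) *s v4"
    by (simp add: vec.add vec.scale b(1-5) vec_eq_iff algebra_simps)
  from action_coordinates[OF ind eq this] show "\<exists>a a' a'' b c. w$0 = c * y$0 \<and> w$1 = b * y$1 \<and> w$2 = a * y$2 + 2 * a' * y$3 + a'' * y$4 \<and> w$3 = a * y$3 + a' * y$4 \<and> w$4 = a * y$4 \<and> \<kappa> * b + (1 - \<kappa>) * a - c - a'' = 0"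
    using b(6) by blast
next
  fix U f y assume F: "(U, f) \<in> (integral6 \<kappa>)" and y: "y \<in> U"
  note nz = integral6_logderiv(1-3)[OF F y]
  have "\<kappa> * (w$1 / y$1) + (1 - \<kappa>) * (w$4 / y$4) - w$0 / y$0 + (2 * (y$3 / y$4) * qd y 3 4 w - qd y 2 4 w) = 0" if R: "(\<exists>a a' a'' b c. w$0 = c * y$0 \<and> w$1 = b * y$1 \<and> w$2 = a * y$2 + 2 * a' * y$3 + a'' * y$4 \<and> w$3 = a * y$3 + a' * y$4 \<and> w$4 = a * y$4 \<and> \<kappa> * b + (1 - \<kappa>) * a - c - a'' = 0)" for w
  proof -
    obtain a a' a'' b c where w: "w$0 = c * y$0" "w$1 = b * y$1" "w$2 = a * y$2 + 2 * a' * y$3 + a'' * y$4" "w$3 = a * y$3 + a' * y$4" "w$4 = a * y$4"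
      "\<kappa> * b + (1 - \<kappa>) * a - c - a'' = 0" using R by blast
    have q: "qd y 3 4 w = a'" by (rule qd_eq[OF nz(3) w(5,4)])
    have q2: "qd y 2 4 w = 2 * a' * (y$3 / y$4) + a''"
      by (rule qd_eq[OF nz(3) w(5)]) (simp add: w(3) distrib_right nz(3))
    show ?thesis using w(6) nz by (simp add: q q2 w(1,2,5) algebra_simps)
  qed
  then show "\<exists>D. cderiv f y D \<and> (\<exists>v. D v \<noteq> 0) \<and> (\<forall>w. (\<exists>a a' a'' b c. w$0 = c * y$0 \<and> w$1 = b * y$1 \<and> w$2 = a * y$2 + 2 * a' * y$3 + a'' * y$4 \<and> w$3 = a * y$3 + a' * y$4 \<and> w$4 = a * y$4 \<and> \<kappa> * b + (1 - \<kappa>) * a - c - a'' = 0) \<longrightarrow> D w = 0)"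
    by (intro logderiv_nonzero[OF integral6_logderiv(4)[OF F y], of "axis 0 1"]) (use nz in \<open>auto simp: axis_def qd_def\<close>)
qed (auto simp: integral6_def)

lemma normal_form7:
  fixes A :: "complex ^ 5 \<Rightarrow> complex ^ 5"
  assumes reg: "\<And>z. A z \<noteq> 0 \<Longrightarrow> regular_point V z (A z)"
    and ind: "indep5 v0 v1 v2 v3 v4"
    and act: "\<And>B. B \<in> V \<Longrightarrow> \<exists>a a1 a2 a3 c. B *v v4 = a *s v4 + a1 *s v3 + a2 *s v2 + a3 *s v1 \<and> B *v v3 = a *s v3 + (3 * a1) *s v2 - a2 *s v1 \<and> B *v v2 = a *s v2 - a1 *s v1 \<and> B *v v1 = a *s v1 \<and> B *v v0 = c *s v0 \<and> c - a + a3 = 0"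
  shows "\<exists>M :: complex ^ 5 ^ 5. invertible M \<and> first_integral (pullback_form M A) integral7"
proof (rule columns_criterion[OF reg ind, where R = "\<lambda>y w. \<exists>a a1 a2 a3 c. w$0 = c * y$0 \<and> w$1 = a * y$1 - a1 * y$2 - a2 * y$3 + a3 * y$4 \<and> w$2 = a * y$2 + 3 * a1 * y$3 + a2 * y$4 \<and> w$3 = a * y$3 + a1 * y$4 \<and> w$4 = a * y$4 \<and> c - a + a3 = 0"])
  fix y :: "complex ^ 5" assume "\<And>i. y $ i \<noteq> 0"
  then obtain U where U: "region U" "y \<in> U" and nz: "\<And>z i. z \<in> U \<Longrightarrow> z $ i \<noteq> 0" and p: "\<And>i a. \<exists>p. (U, p) \<in> power_det i a"
    by (rule local_determinations) (rule that)
  show "\<exists>U f. (U, f) \<in> integral7 \<and> y \<in> U"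
    unfolding integral7_def using U nz by fast
next
  fix B and y w :: "complex ^ 5" assume B: "B \<in> V" and eq: "B *v comb5 y v0 v1 v2 v3 v4 = comb5 w v0 v1 v2 v3 v4"
  obtain a a1 a2 a3 c where b: "B *v v4 = a *s v4 + a1 *s v3 + a2 *s v2 + a3 *s v1" "B *v v3 = a *s v3 + (3 * a1) *s v2 - a2 *s v1" "B *v v2 = a *s v2 - a1 *s v1" "B *v v1 = a *s v1" "B *v v0 = c *s v0" "c - a + a3 = 0"
    using act[OF B] by blast
  have "B *v comb5 y v0 v1 v2 v3 v4 = (c * y$0) *s v0 + (a * y$1 - a1 * y$2 - a2 * y$3 + a3 * y$4) *s v1 + (a * y$2 + 3 * a1 * y$3 + a2 * y$4) *s v2 + (a * y$3 + a1 * y$4) *s v3 + (a * y$4) *s v4"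
    by (simp add: vec.add vec.scale b(1-5) vec_eq_iff algebra_simps)
  from action_coordinates[OF ind eq this] show "\<exists>a a1 a2 a3 c. w$0 = c * y$0 \<and> w$1 = a * y$1 - a1 * y$2 - a2 * y$3 + a3 * y$4 \<and> w$2 = a * y$2 + 3 * a1 * y$3 + a2 * y$4 \<and> w$3 = a * y$3 + a1 * y$4 \<and> w$4 = a * y$4 \<and> c - a + a3 = 0"
    using b(6) by blast
next
  fix U f y assume F: "(U, f) \<in> integral7" and y: "y \<in> U"
  note nz = integral7_cderiv(1)[OF F y]
  let ?E = "\<lambda>v. qd y 1 4 v + ((y$2 / y$4) * qd y 3 4 v + qd y 2 4 v * (y$3 / y$4)) - 3 * (y$3 / y$4)^2 * qd y 3 4 v"
  obtain g where g: "g \<noteq> 0" "cderiv f y (\<lambda>v. g * (qd y 0 4 v + (y$0 / y$4) * ?E v))"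
    using integral7_cderiv(2)[OF F y] by blast
  have "g * (qd y 0 4 w + (y$0 / y$4) * ?E w) = 0" if R: "(\<exists>a a1 a2 a3 c. w$0 = c * y$0 \<and> w$1 = a * y$1 - a1 * y$2 - a2 * y$3 + a3 * y$4 \<and> w$2 = a * y$2 + 3 * a1 * y$3 + a2 * y$4 \<and> w$3 = a * y$3 + a1 * y$4 \<and> w$4 = a * y$4 \<and> c - a + a3 = 0)" for w
  proof -
    obtain a a1 a2 a3 c where w: "w$0 = c * y$0" "w$1 = a * y$1 - a1 * y$2 - a2 * y$3 + a3 * y$4"
      "w$2 = a * y$2 + 3 * a1 * y$3 + a2 * y$4" "w$3 = a * y$3 + a1 * y$4" "w$4 = a * y$4" "c - a + a3 = 0"
      using R by blast
    have q0: "qd y 0 4 w = (c - a) * (y$0 / y$4)"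
      by (rule qd_eq[OF nz w(5)]) (use nz in \<open>simp add: w(1) field_simps\<close>)
    have q1: "qd y 1 4 w = a3 - a1 * (y$2 / y$4) - a2 * (y$3 / y$4)"
      by (rule qd_eq[OF nz w(5)]) (simp add: w(2) distrib_right left_diff_distrib nz)
    have q2: "qd y 2 4 w = 3 * a1 * (y$3 / y$4) + a2"
      by (rule qd_eq[OF nz w(5)]) (simp add: w(3) distrib_right left_diff_distrib nz)
    have q3: "qd y 3 4 w = a1" by (rule qd_eq[OF nz w(5,4)])
    define T2 T3 where "T2 = y$2 / y$4" "T3 = y$3 / y$4"
    have "?E w = a3" unfolding q1 q2 q3 T2_T3_def[symmetric] by (simp add: power2_eq_square algebra_simps)
    moreover have "c - a = - a3" using w(6) by (simp add: eq_neg_iff_add_eq_0)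
    ultimately show ?thesis by (simp add: q0)
  qed
  then show "\<exists>D. cderiv f y D \<and> (\<exists>v. D v \<noteq> 0) \<and> (\<forall>w. (\<exists>a a1 a2 a3 c. w$0 = c * y$0 \<and> w$1 = a * y$1 - a1 * y$2 - a2 * y$3 + a3 * y$4 \<and> w$2 = a * y$2 + 3 * a1 * y$3 + a2 * y$4 \<and> w$3 = a * y$3 + a1 * y$4 \<and> w$4 = a * y$4 \<and> c - a + a3 = 0) \<longrightarrow> D w = 0)"
    using g nz by (intro exI[of _ "\<lambda>v. g * (qd y 0 4 v + (y$0 / y$4) * ?E v)"] conjI exI[of _ "axis 0 1"]) (auto simp: axis_def qd_def)
qed (auto simp: integral7_def)

lemma normal_form8:
  fixes A :: "complex ^ 5 \<Rightarrow> complex ^ 5"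
  assumes reg: "\<And>z. A z \<noteq> 0 \<Longrightarrow> regular_point V z (A z)"
    and ind: "indep5 v0 v1 v2 v3 v4"
    and act: "\<And>B. B \<in> V \<Longrightarrow> \<exists>a a1 a2 a3 a4. B *v v4 = a *s v4 + a1 *s v3 + a2 *s v2 - a3 *s v1 + a4 *s v0 \<and> B *v v3 = a *s v3 + a1 *s v2 - a2 *s v1 + a3 *s v0 \<and> B *v v2 = a *s v2 - a1 *s v1 + a2 *s v0 \<and> B *v v1 = a *s v1 - a1 *s v0 \<and> B *v v0 = a *s v0 \<and> a4 = 0"
  shows "\<exists>M :: complex ^ 5 ^ 5. invertible M \<and> first_integral (pullback_form M A) integral8"
proof (rule columns_criterion[OF reg ind, where R = "\<lambda>y w. \<exists>a a1 a2 a3 a4. w$0 = a * y$0 - a1 * y$1 + a2 * y$2 + a3 * y$3 + a4 * y$4 \<and> w$1 = a * y$1 - a1 * y$2 - a2 * y$3 - a3 * y$4 \<and> w$2 = a * y$2 + a1 * y$3 + a2 * y$4 \<and> w$3 = a * y$3 + a1 * y$4 \<and> w$4 = a * y$4 \<and> a4 = 0"])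
  fix y :: "complex ^ 5" assume "\<And>i. y $ i \<noteq> 0"
  then obtain U where U: "region U" "y \<in> U" and nz: "\<And>z i. z \<in> U \<Longrightarrow> z $ i \<noteq> 0" and p: "\<And>i a. \<exists>p. (U, p) \<in> power_det i a"
    by (rule local_determinations) (rule that)
  show "\<exists>U f. (U, f) \<in> integral8 \<and> y \<in> U"
    unfolding integral8_def using U nz by fast
next
  fix B and y w :: "complex ^ 5" assume B: "B \<in> V" and eq: "B *v comb5 y v0 v1 v2 v3 v4 = comb5 w v0 v1 v2 v3 v4"
  obtain a a1 a2 a3 a4 where b: "B *v v4 = a *s v4 + a1 *s v3 + a2 *s v2 - a3 *s v1 + a4 *s v0" "B *v v3 = a *s v3 + a1 *s v2 - a2 *s v1 + a3 *s v0" "B *v v2 = a *s v2 - a1 *s v1 + a2 *s v0" "B *v v1 = a *s v1 - a1 *s v0" "B *v v0 = a *s v0" "a4 = 0"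
    using act[OF B] by blast
  have "B *v comb5 y v0 v1 v2 v3 v4 = (a * y$0 - a1 * y$1 + a2 * y$2 + a3 * y$3 + a4 * y$4) *s v0 + (a * y$1 - a1 * y$2 - a2 * y$3 - a3 * y$4) *s v1 + (a * y$2 + a1 * y$3 + a2 * y$4) *s v2 + (a * y$3 + a1 * y$4) *s v3 + (a * y$4) *s v4"
    by (simp add: vec.add vec.scale b(1-5) vec_eq_iff algebra_simps)
  from action_coordinates[OF ind eq this] show "\<exists>a a1 a2 a3 a4. w$0 = a * y$0 - a1 * y$1 + a2 * y$2 + a3 * y$3 + a4 * y$4 \<and> w$1 = a * y$1 - a1 * y$2 - a2 * y$3 - a3 * y$4 \<and> w$2 = a * y$2 + a1 * y$3 + a2 * y$4 \<and> w$3 = a * y$3 + a1 * y$4 \<and> w$4 = a * y$4 \<and> a4 = 0"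
    using b(6) by blast
next
  fix U f y assume F: "(U, f) \<in> integral8" and y: "y \<in> U"
  note nz = integral8_cderiv(1)[OF F y]
  let ?D = "\<lambda>v. qd y 0 4 v + ((y$1 / y$4) * qd y 3 4 v + qd y 1 4 v * (y$3 / y$4)) - (y$2 / y$4) * qd y 2 4 v
       - (y$3 / y$4)^3 * qd y 3 4 v + ((y$2 / y$4) * (2 * (y$3 / y$4) * qd y 3 4 v) + qd y 2 4 v * (y$3 / y$4)^2)"
  have "?D w = 0" if R: "(\<exists>a a1 a2 a3 a4. w$0 = a * y$0 - a1 * y$1 + a2 * y$2 + a3 * y$3 + a4 * y$4 \<and> w$1 = a * y$1 - a1 * y$2 - a2 * y$3 - a3 * y$4 \<and> w$2 = a * y$2 + a1 * y$3 + a2 * y$4 \<and> w$3 = a * y$3 + a1 * y$4 \<and> w$4 = a * y$4 \<and> a4 = 0)" for w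
  proof -
    obtain a a1 a2 a3 a4 where w: "w$0 = a * y$0 - a1 * y$1 + a2 * y$2 + a3 * y$3 + a4 * y$4" "w$1 = a * y$1 - a1 * y$2 - a2 * y$3 - a3 * y$4"
      "w$2 = a * y$2 + a1 * y$3 + a2 * y$4" "w$3 = a * y$3 + a1 * y$4" "w$4 = a * y$4" "a4 = 0"
      using R by blast
    have q0: "qd y 0 4 w = a2 * (y$2 / y$4) + a3 * (y$3 / y$4) - a1 * (y$1 / y$4)"
      by (rule qd_eq[OF nz w(5)]) (simp add: w(1,6) distrib_right left_diff_distrib nz)
    have q1: "qd y 1 4 w = - a1 * (y$2 / y$4) - a2 * (y$3 / y$4) - a3"
      by (rule qd_eq[OF nz w(5)]) (simp add: w(2) distrib_right left_diff_distrib nz)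
    have q2: "qd y 2 4 w = a1 * (y$3 / y$4) + a2"
      by (rule qd_eq[OF nz w(5)]) (simp add: w(3) distrib_right left_diff_distrib nz)
    have q3: "qd y 3 4 w = a1" by (rule qd_eq[OF nz w(5,4)])
    define T1 T2 T3 where "T1 = y$1 / y$4" "T2 = y$2 / y$4" "T3 = y$3 / y$4"
    show ?thesis unfolding q0 q1 q2 q3 T1_T2_T3_def[symmetric] by (simp add: power2_eq_square power3_eq_cube algebra_simps)
  qed
  then show "\<exists>D. cderiv f y D \<and> (\<exists>v. D v \<noteq> 0) \<and> (\<forall>w. (\<exists>a a1 a2 a3 a4. w$0 = a * y$0 - a1 * y$1 + a2 * y$2 + a3 * y$3 + a4 * y$4 \<and> w$1 = a * y$1 - a1 * y$2 - a2 * y$3 - a3 * y$4 \<and> w$2 = a * y$2 + a1 * y$3 + a2 * y$4 \<and> w$3 = a * y$3 + a1 * y$4 \<and> w$4 = a * y$4 \<and> a4 = 0) \<longrightarrow> D w = 0)"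
    using integral8_cderiv(2)[OF F y] nz by (intro exI[of _ ?D] conjI exI[of _ "axis 0 1"]) (auto simp: axis_def qd_def)
qed (auto simp: integral8_def)

section \<open>Normalisation of the blocks\<close>

text \<open>The block is \<open>\<complex>[x] / x\<^sup>3\<close> with basis \<open>g0 = 1, g1 = x, g2 = x\<^sup>2\<close>.  Replacing
  \<open>x\<close> by \<open>x + e x\<^sup>2\<close> removes the middle coefficient \<open>l1\<close> of the functional.  The scaling by
  \<open>\<rho>\<close> and the factor 2 are those for which \<open>s\<close> times the functional turns the
  \<open>x\<^sup>2\<close> term of the logarithm into \<open>(z\<^sub>3 / z\<^sub>4)\<^sup>2 - z\<^sub>2 / z\<^sub>4\<close>.\<close>

lemma normal_block3:
  fixes g0 g1 g2 :: "complex ^ 'n::finite"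
  assumes l2: "l2 \<noteq> 0" and s: "s \<noteq> 0"
  obtains v3 v2 p q r where "p \<noteq> 0" "r \<noteq> 0" "v3 = p *s g1 + q *s g2" "v2 = r *s g2"
    "\<And>B \<beta>0 \<beta>1 \<beta>2. B *v g0 = \<beta>0 *s g0 + \<beta>1 *s g1 + \<beta>2 *s g2 \<Longrightarrow> B *v g1 = \<beta>0 *s g1 + \<beta>1 *s g2 \<Longrightarrow> B *v g2 = \<beta>0 *s g2 \<Longrightarrow>
      \<exists>a' a''. B *v g0 = \<beta>0 *s g0 + a' *s v3 + a'' *s v2 \<and> B *v v3 = \<beta>0 *s v3 + (2 * a') *s v2 \<and> B *v v2 = \<beta>0 *s v2 \<and>
        s * (l0 * \<beta>0 + l1 * \<beta>1 + l2 * \<beta>2) = s * l0 * \<beta>0 - a''"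
proof -
  define \<rho> where "\<rho> = csqrt (- s * l2 / 2)"
  have r2: "2 * \<rho>^2 = - s * l2" by (simp add: \<rho>_def)
  have r0: "\<rho> \<noteq> 0" using r2 l2 s by auto
  define e where "e = - l1 / l2"
  have e: "e * l2 = - l1" using l2 by (simp add: e_def)
  define v3 where "v3 = (1 / \<rho>) *s g1 + (e / \<rho>) *s g2"
  define v2 where "v2 = (1 / (2 * \<rho>^2)) *s g2"
  show ?thesis
  proof (rule that[OF _ _ v3_def v2_def])
    show "1 / \<rho> \<noteq> 0" "1 / (2 * \<rho>^2) \<noteq> 0" using r0 by simp_all
    fix B \<beta>0 \<beta>1 \<beta>2
    assume B: "B *v g0 = \<beta>0 *s g0 + \<beta>1 *s g1 + \<beta>2 *s g2" "B *v g1 = \<beta>0 *s g1 + \<beta>1 *s g2" "B *v g2 = \<beta>0 *s g2"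
    define b2 where "b2 = \<beta>2 - e * \<beta>1"
    have \<beta>2: "\<beta>2 = b2 + e * \<beta>1" by (simp add: b2_def)
    have 1: "B *v g0 = \<beta>0 *s g0 + (\<rho> * \<beta>1) *s v3 + (2 * \<rho>^2 * b2) *s v2"
      unfolding B v3_def v2_def \<beta>2 using r0 by (simp add: vec_eq_iff field_simps)
    have 2: "B *v v3 = \<beta>0 *s v3 + (2 * (\<rho> * \<beta>1)) *s v2"
      unfolding v3_def v2_def using r0 by (simp add: vec.add vec.scale B vec_eq_iff field_simps power2_eq_square)
    have 3: "B *v v2 = \<beta>0 *s v2" unfolding v2_def by (simp add: vec.scale B mult.commute)
    have 4: "s * (l0 * \<beta>0 + l1 * \<beta>1 + l2 * \<beta>2) = s * l0 * \<beta>0 - 2 * \<rho>^2 * b2"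
      unfolding r2 \<beta>2 using e by algebra
    show "\<exists>a' a''. B *v g0 = \<beta>0 *s g0 + a' *s v3 + a'' *s v2 \<and> B *v v3 = \<beta>0 *s v3 + (2 * a') *s v2 \<and> B *v v2 = \<beta>0 *s v2 \<and>
        s * (l0 * \<beta>0 + l1 * \<beta>1 + l2 * \<beta>2) = s * l0 * \<beta>0 - a''"
      using 1 2 3 4 by blast
  qed
qed

text \<open>As before, with the new generator \<open>x + e x\<^sup>2 + f x\<^sup>3\<close>, chosen to kill \<open>l1\<close> and \<open>l2\<close>, and with a cube
  root as scaling.  The factor 3 and the signs come from
  \<open>log (1 + t\<^sub>1 x + t\<^sub>2 x\<^sup>2 + t\<^sub>3 x\<^sup>3)\<close>, whose last coefficient is
  \<open>t\<^sub>3 - t\<^sub>1 t\<^sub>2 + t\<^sub>1\<^sup>3 / 3\<close>.\<close>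

lemma normal_block4:
  fixes g0 g1 g2 g3 :: "complex ^ 'n::finite"
  assumes l3: "l3 \<noteq> 0" and s: "s \<noteq> 0"
  obtains v3 v2 v1 p1 p2 p3 q2 q3 r where "p1 \<noteq> 0" "q2 \<noteq> 0" "r \<noteq> 0" "v3 = p1 *s g1 + p2 *s g2 + p3 *s g3" "v2 = q2 *s g2 + q3 *s g3" "v1 = r *s g3"
    "\<And>B \<beta>0 \<beta>1 \<beta>2 \<beta>3. B *v g0 = \<beta>0 *s g0 + \<beta>1 *s g1 + \<beta>2 *s g2 + \<beta>3 *s g3 \<Longrightarrow> B *v g1 = \<beta>0 *s g1 + \<beta>1 *s g2 + \<beta>2 *s g3 \<Longrightarrow>
      B *v g2 = \<beta>0 *s g2 + \<beta>1 *s g3 \<Longrightarrow> B *v g3 = \<beta>0 *s g3 \<Longrightarrow>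
      \<exists>a1 a2 a3. B *v g0 = \<beta>0 *s g0 + a1 *s v3 + a2 *s v2 + a3 *s v1 \<and> B *v v3 = \<beta>0 *s v3 + (3 * a1) *s v2 - a2 *s v1 \<and>
        B *v v2 = \<beta>0 *s v2 - a1 *s v1 \<and> B *v v1 = \<beta>0 *s v1 \<and>
        s * (l0 * \<beta>0 + l1 * \<beta>1 + l2 * \<beta>2 + l3 * \<beta>3) = s * l0 * \<beta>0 + a3"
proof -
  define \<rho> where "\<rho> = exp (Ln (- s * l3 / 3) / 3)"
  have "\<rho>^3 = - s * l3 / 3"
    unfolding \<rho>_def exp_of_nat_mult[symmetric] using l3 s by (simp add: exp_Ln)
  then have r3: "3 * \<rho>^3 = - s * l3" by simp
  have r0: "\<rho> \<noteq> 0" by (simp add: \<rho>_def)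
  define e where "e = - l2 / (2 * l3)"
  define f where "f = - (l1 + e * l2) / l3"
  have e: "2 * e * l3 = - l2" using l3 by (simp add: e_def)
  have f: "f * l3 = - (l1 + e * l2)" using l3 by (simp add: f_def)
  define v3 where "v3 = (1 / \<rho>) *s g1 + (e / \<rho>) *s g2 + (f / \<rho>) *s g3"
  define v2 where "v2 = (1 / (3 * \<rho>^2)) *s g2 + (2 * e / (3 * \<rho>^2)) *s g3"
  define v1 where "v1 = (- 1 / (3 * \<rho>^3)) *s g3"
  show ?thesis
  proof (rule that[OF _ _ _ v3_def v2_def v1_def])
    show "1 / \<rho> \<noteq> 0" "1 / (3 * \<rho>^2) \<noteq> 0" "- 1 / (3 * \<rho>^3) \<noteq> 0" using r0 by simp_all
    fix B \<beta>0 \<beta>1 \<beta>2 \<beta>3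
    assume B: "B *v g0 = \<beta>0 *s g0 + \<beta>1 *s g1 + \<beta>2 *s g2 + \<beta>3 *s g3" "B *v g1 = \<beta>0 *s g1 + \<beta>1 *s g2 + \<beta>2 *s g3"
      "B *v g2 = \<beta>0 *s g2 + \<beta>1 *s g3" "B *v g3 = \<beta>0 *s g3"
    define b2 where "b2 = \<beta>2 - e * \<beta>1"
    define b3 where "b3 = \<beta>3 - f * \<beta>1 - 2 * e * b2"
    have \<beta>2: "\<beta>2 = b2 + e * \<beta>1" and \<beta>3: "\<beta>3 = b3 + f * \<beta>1 + 2 * e * b2" by (simp_all add: b2_def b3_def)
    have 1: "B *v g0 = \<beta>0 *s g0 + (\<rho> * \<beta>1) *s v3 + (3 * \<rho>^2 * b2) *s v2 + (- 3 * \<rho>^3 * b3) *s v1"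
      unfolding B v3_def v2_def v1_def \<beta>2 \<beta>3 using r0 by (simp add: vec_eq_iff field_simps)
    have 2: "B *v v3 = \<beta>0 *s v3 + (3 * (\<rho> * \<beta>1)) *s v2 - (3 * \<rho>^2 * b2) *s v1"
      unfolding v3_def v2_def v1_def
      using r0 by (simp add: vec.add vec.scale B \<beta>2 vec_eq_iff field_simps power2_eq_square power3_eq_cube)
    have 3: "B *v v2 = \<beta>0 *s v2 - (\<rho> * \<beta>1) *s v1"
      unfolding v2_def v1_def
      using r0 by (simp add: vec.add vec.scale B vec_eq_iff field_simps power2_eq_square power3_eq_cube)
    have 4: "B *v v1 = \<beta>0 *s v1" unfolding v1_def vec.scale B by (simp add: mult.commute)
    have m: "- 3 * \<rho>^3 * b3 = s * l3 * b3" using r3 by algebra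
    have 5: "s * (l0 * \<beta>0 + l1 * \<beta>1 + l2 * \<beta>2 + l3 * \<beta>3) = s * l0 * \<beta>0 + - 3 * \<rho>^3 * b3"
      unfolding m \<beta>2 \<beta>3 using e f by algebra
    show "\<exists>a1 a2 a3. B *v g0 = \<beta>0 *s g0 + a1 *s v3 + a2 *s v2 + a3 *s v1 \<and> B *v v3 = \<beta>0 *s v3 + (3 * a1) *s v2 - a2 *s v1 \<and>
        B *v v2 = \<beta>0 *s v2 - a1 *s v1 \<and> B *v v1 = \<beta>0 *s v1 \<and>
        s * (l0 * \<beta>0 + l1 * \<beta>1 + l2 * \<beta>2 + l3 * \<beta>3) = s * l0 * \<beta>0 + a3"
      using 1 2 3 4 5 by blast
  qed
qed

text \<open>The new generator is \<open>x + e x\<^sup>2 + f x\<^sup>3 + h x\<^sup>4\<close>; the coefficients of its powers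
  \<open>x\<^sup>2 + 2 e x\<^sup>3 + (e\<^sup>2 + 2 f) x\<^sup>4\<close> and \<open>x\<^sup>3 + 3 e x\<^sup>4\<close> appear in \<open>v2\<close> and \<open>v1\<close>, the
  latter with the sign that the last integral of the list attaches to the third power.\<close>

lemma normal_block5:
  fixes g0 g1 g2 g3 g4 :: "complex ^ 'n::finite"
  assumes l4: "l4 \<noteq> 0"
  obtains v3 v2 v1 e f h m where "v3 = g1 + e *s g2 + f *s g3 + h *s g4" "v2 = g2 + (2 * e) *s g3 + m *s g4" "v1 = - (g3 + (3 * e) *s g4)"
    "\<And>B \<beta>0 \<beta>1 \<beta>2 \<beta>3 \<beta>4. B *v g0 = \<beta>0 *s g0 + \<beta>1 *s g1 + \<beta>2 *s g2 + \<beta>3 *s g3 + \<beta>4 *s g4 \<Longrightarrow>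
      B *v g1 = \<beta>0 *s g1 + \<beta>1 *s g2 + \<beta>2 *s g3 + \<beta>3 *s g4 \<Longrightarrow> B *v g2 = \<beta>0 *s g2 + \<beta>1 *s g3 + \<beta>2 *s g4 \<Longrightarrow>
      B *v g3 = \<beta>0 *s g3 + \<beta>1 *s g4 \<Longrightarrow> B *v g4 = \<beta>0 *s g4 \<Longrightarrow>
      \<exists>a1 a2 a3 a4. B *v g0 = \<beta>0 *s g0 + a1 *s v3 + a2 *s v2 - a3 *s v1 + a4 *s g4 \<and>
        B *v v3 = \<beta>0 *s v3 + a1 *s v2 - a2 *s v1 + a3 *s g4 \<and>
        B *v v2 = \<beta>0 *s v2 - a1 *s v1 + a2 *s g4 \<and> B *v v1 = \<beta>0 *s v1 - a1 *s g4 \<and>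
        l0 * \<beta>0 + l1 * \<beta>1 + l2 * \<beta>2 + l3 * \<beta>3 + l4 * \<beta>4 = l0 * \<beta>0 + l4 * a4"
proof -
  define e where "e = - l3 / (3 * l4)"
  define f where "f = - (l2 + 2 * e * l3 + e^2 * l4) / (2 * l4)"
  define h where "h = - (l1 + e * l2 + f * l3) / l4"
  have e: "3 * e * l4 = - l3" using l4 by (simp add: e_def)
  have f: "2 * f * l4 = - (l2 + 2 * e * l3 + e^2 * l4)" using l4 by (simp add: f_def)
  have h: "h * l4 = - (l1 + e * l2 + f * l3)" using l4 by (simp add: h_def)
  define v3 where "v3 = g1 + e *s g2 + f *s g3 + h *s g4"
  define v2 where "v2 = g2 + (2 * e) *s g3 + (e^2 + 2 * f) *s g4"
  define v1 where "v1 = - (g3 + (3 * e) *s g4)"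
  show ?thesis
  proof (rule that[OF v3_def v2_def v1_def])
    fix B \<beta>0 \<beta>1 \<beta>2 \<beta>3 \<beta>4
    assume B: "B *v g0 = \<beta>0 *s g0 + \<beta>1 *s g1 + \<beta>2 *s g2 + \<beta>3 *s g3 + \<beta>4 *s g4"
      "B *v g1 = \<beta>0 *s g1 + \<beta>1 *s g2 + \<beta>2 *s g3 + \<beta>3 *s g4" "B *v g2 = \<beta>0 *s g2 + \<beta>1 *s g3 + \<beta>2 *s g4"
      "B *v g3 = \<beta>0 *s g3 + \<beta>1 *s g4" "B *v g4 = \<beta>0 *s g4"
    define a2 where "a2 = \<beta>2 - e * \<beta>1"
    define a3 where "a3 = \<beta>3 - f * \<beta>1 - 2 * e * a2"
    define a4 where "a4 = \<beta>4 - h * \<beta>1 - (e^2 + 2 * f) * a2 - 3 * e * a3"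
    have \<beta>: "\<beta>2 = a2 + e * \<beta>1" "\<beta>3 = a3 + f * \<beta>1 + 2 * e * a2" "\<beta>4 = a4 + h * \<beta>1 + (e^2 + 2 * f) * a2 + 3 * e * a3"
      by (simp_all add: a2_def a3_def a4_def)
    have 1: "B *v g0 = \<beta>0 *s g0 + \<beta>1 *s v3 + a2 *s v2 - a3 *s v1 + a4 *s g4"
      unfolding B v3_def v2_def v1_def \<beta> by (simp add: vec_eq_iff algebra_simps power2_eq_square)
    have 2: "B *v v3 = \<beta>0 *s v3 + \<beta>1 *s v2 - a2 *s v1 + a3 *s g4"
      unfolding v3_def v2_def v1_def by (simp add: vec.add vec.scale B \<beta> vec_eq_iff algebra_simps power2_eq_square)
    have 3: "B *v v2 = \<beta>0 *s v2 - \<beta>1 *s v1 + a2 *s g4"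
      unfolding v2_def v1_def by (simp add: vec.add vec.scale B \<beta> vec_eq_iff algebra_simps power2_eq_square)
    have 4: "B *v v1 = \<beta>0 *s v1 - \<beta>1 *s g4"
      unfolding v1_def by (simp add: vec.neg vec.add vec.scale B vec_eq_iff algebra_simps)
    have 5: "l0 * \<beta>0 + l1 * \<beta>1 + l2 * \<beta>2 + l3 * \<beta>3 + l4 * \<beta>4 = l0 * \<beta>0 + l4 * a4"
      unfolding \<beta> using e f h by algebra
    show "\<exists>a1 a2 a3 a4. B *v g0 = \<beta>0 *s g0 + a1 *s v3 + a2 *s v2 - a3 *s v1 + a4 *s g4 \<and>
        B *v v3 = \<beta>0 *s v3 + a1 *s v2 - a2 *s v1 + a3 *s g4 \<and>
        B *v v2 = \<beta>0 *s v2 - a1 *s v1 + a2 *s g4 \<and> B *v v1 = \<beta>0 *s v1 - a1 *s g4 \<and>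
        l0 * \<beta>0 + l1 * \<beta>1 + l2 * \<beta>2 + l3 * \<beta>3 + l4 * \<beta>4 = l0 * \<beta>0 + l4 * a4"
      using 1 2 3 4 5 by blast
  qed
qed

section \<open>The seven block types\<close>

lemma partitions_of_5:
  fixes xs :: "nat list"
  assumes "sorted_wrt (\<ge>) xs" "\<And>x. x \<in> set xs \<Longrightarrow> x \<ge> 1" "sum_list xs = 5"
  shows "xs \<in> {[1,1,1,1,1], [2,1,1,1], [2,2,1], [3,1,1], [3,2], [4,1], [5]}"
proof -
  consider "xs = []" | a where "xs = [a]" | a b where "xs = [a, b]" | a b c where "xs = [a, b, c]"
    | a b c d where "xs = [a, b, c, d]" | a b c d e ys where "xs = a # b # c # d # e # ys"
    by (metis neq_Nil_conv)
  then show ?thesis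
  proof cases
    case (6 a b c d e ys)
    have 1: "a \<ge> 1" "b \<ge> 1" "c \<ge> 1" "d \<ge> 1" "e \<ge> 1" using assms(2) 6 by auto
    have 2: "a + b + c + d + e + sum_list ys = 5" using assms(3) 6 by simp
    have "ys = []"
    proof (cases ys)
      case (Cons f zs)
      then have "f \<ge> 1" using assms(2) 6 by auto
      then show ?thesis using 1 2 Cons by simp
    qed
    moreover have "a = 1" "b = 1" "c = 1" "d = 1" "e = 1" using 1 2 by linarith+
    ultimately show ?thesis using 6 by simp
  next
    case 1
    then show ?thesis using assms(3) by simp
  next
    case (2 a)
    then show ?thesis using assms(3) by simp
  next
    case (3 a b)
    have "a \<ge> b" "b \<ge> 1" "a + b = 5" using assms(1,3) assms(2)[of b] 3 by simp_all
    then have "a = 4 \<and> b = 1 \<or> a = 3 \<and> b = 2" by presburger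
    then show ?thesis using 3 by auto
  next
    case (4 a b c)
    have "a \<ge> b" "b \<ge> c" "c \<ge> 1" "a + b + c = 5" using assms(1,3) assms(2)[of c] 4 by simp_all
    then have "a = 3 \<and> b = 1 \<and> c = 1 \<or> a = 2 \<and> b = 2 \<and> c = 1" by linarith
    then show ?thesis using 4 by auto
  next
    case (5 a b c d)
    have "a \<ge> b" "b \<ge> c" "c \<ge> d" "d \<ge> 1" "a + b + c + d = 5" using assms(1,3) assms(2)[of d] 5 by simp_all
    then have "a = 2 \<and> b = 1 \<and> c = 1 \<and> d = 1" by linarith
    then show ?thesis using 5 by simp
  qed
qed

lemma sum_lessThan_small:
  fixes f :: "nat \<Rightarrow> 'a::comm_monoid_add"
  shows "(\<Sum>k<1. f k) = f 0" "(\<Sum>k<2. f k) = f 0 + f 1" "(\<Sum>k<3. f k) = f 0 + f 1 + f 2"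
    "(\<Sum>k<4. f k) = f 0 + f 1 + f 2 + f 3" "(\<Sum>k<5. f k) = f 0 + f 1 + f 2 + f 3 + f 4"
  by (simp_all add: eval_nat_numeral)

lemma block_action:
  fixes b :: "nat \<Rightarrow> complex ^ 'n::finite"
  assumes "\<And>k. k < d \<Longrightarrow> B *v b k = (\<Sum>j<d - k. \<beta> j *s b (k + j))"
  shows "d = 1 \<Longrightarrow> B *v b 0 = \<beta> 0 *s b 0"
    and "d = 2 \<Longrightarrow> B *v b 0 = \<beta> 0 *s b 0 + \<beta> 1 *s b 1 \<and> B *v b 1 = \<beta> 0 *s b 1"
    and "d = 3 \<Longrightarrow> B *v b 0 = \<beta> 0 *s b 0 + \<beta> 1 *s b 1 + \<beta> 2 *s b 2 \<and> B *v b 1 = \<beta> 0 *s b 1 + \<beta> 1 *s b 2 \<and> B *v b 2 = \<beta> 0 *s b 2"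
    and "d = 4 \<Longrightarrow> B *v b 0 = \<beta> 0 *s b 0 + \<beta> 1 *s b 1 + \<beta> 2 *s b 2 + \<beta> 3 *s b 3 \<and> B *v b 1 = \<beta> 0 *s b 1 + \<beta> 1 *s b 2 + \<beta> 2 *s b 3 \<and>
      B *v b 2 = \<beta> 0 *s b 2 + \<beta> 1 *s b 3 \<and> B *v b 3 = \<beta> 0 *s b 3"
    and "d = 5 \<Longrightarrow> B *v b 0 = \<beta> 0 *s b 0 + \<beta> 1 *s b 1 + \<beta> 2 *s b 2 + \<beta> 3 *s b 3 + \<beta> 4 *s b 4 \<and>
      B *v b 1 = \<beta> 0 *s b 1 + \<beta> 1 *s b 2 + \<beta> 2 *s b 3 + \<beta> 3 *s b 4 \<and> B *v b 2 = \<beta> 0 *s b 2 + \<beta> 1 *s b 3 + \<beta> 2 *s b 4 \<and>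
      B *v b 3 = \<beta> 0 *s b 3 + \<beta> 1 *s b 4 \<and> B *v b 4 = \<beta> 0 *s b 4"
  using assms[of 0] assms[of 1] assms[of 2] assms[of 3] assms[of 4]
  by (simp_all add: eval_nat_numeral)

lemma sorted_blocks:
  fixes d :: "'l \<Rightarrow> nat"
  assumes "finite L" "(\<Sum>l\<in>L. d l) = 5" "\<And>l. l \<in> L \<Longrightarrow> d l \<ge> 1"
  obtains xs where "distinct xs" "set xs = L"
    "map d xs \<in> {[1,1,1,1,1], [2,1,1,1], [2,2,1], [3,1,1], [3,2], [4,1], [5]}"
proof -
  obtain ys where ys: "set ys = L" "distinct ys" using finite_distinct_list[OF assms(1)] by blast
  define xs where "xs = rev (sort_key d ys)"
  have xs: "distinct xs" "set xs = L" using ys by (simp_all add: xs_def)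
  have "sorted (map d (sort_key d ys))" by simp
  then have "sorted_wrt (\<ge>) (map d xs)" by (simp add: xs_def rev_map[symmetric] sorted_wrt_rev)
  moreover have "sum_list (map d xs) = 5" using sum_list_distinct_conv_sum_set[OF xs(1), of d] xs(2) assms(2) by simp
  ultimately show ?thesis using that[OF xs] partitions_of_5[of "map d xs"] xs(2) assms(3) by auto
qed

text \<open>The functional may be multiplied by a scalar \<open>s\<close>, which is used to give some coefficient the value \<open>1\<close> or
  \<open>-1\<close> that the normal form prescribes.  The identity belongs to \<open>V\<close>, so the values of the functional on the
  idempotents add up to zero; this is the relation between the exponents of each integral.\<close>

lemma block_first_integrals:
  fixes A :: "complex ^ 5 \<Rightarrow> complex ^ 5" and L :: "'l set" and b :: "'l \<Rightarrow> nat \<Rightarrow> complex ^ 5"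
  assumes reg: "\<And>z. A z \<noteq> 0 \<Longrightarrow> regular_point V z (A z)" and one: "mat 1 \<in> V"
    and fin: "finite L" and sum5: "(\<Sum>l\<in>L. d l) = 5" and d1: "\<And>l. l \<in> L \<Longrightarrow> d l \<ge> 1"
    and indep: "\<And>\<beta> l k. (\<Sum>l\<in>L. \<Sum>k<d l. \<beta> l k *s b l k) = 0 \<Longrightarrow> l \<in> L \<Longrightarrow> k < d l \<Longrightarrow> \<beta> l k = (0 :: complex)"
    and act: "\<And>B. B \<in> V \<Longrightarrow> \<exists>\<beta>. (\<forall>l\<in>L. \<forall>k<d l. B *v b l k = (\<Sum>j<d l - k. \<beta> l j *s b l (k + j))) \<and>
        (\<Sum>l\<in>L. \<Sum>k<d l. \<beta> l k * dot \<mu> (b l k)) = 0"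
    and top0: "\<And>l. l \<in> L \<Longrightarrow> dot \<mu> (b l (d l - 1)) \<noteq> 0"
  shows "\<exists>M :: complex ^ 5 ^ 5. invertible M \<and>
    ((\<exists>\<kappa> :: 5 \<Rightarrow> complex. (\<Sum>j\<in>UNIV. \<kappa> j) = 0 \<and>
        first_integral (pullback_form M A) (integral1 \<kappa>)) \<or>
     (\<exists>\<kappa> \<xi>. first_integral (pullback_form M A) (integral2 \<kappa> \<xi>)) \<or>
     (\<exists>\<kappa>. first_integral (pullback_form M A) (integral3 \<kappa>)) \<or>
     first_integral (pullback_form M A) integral4 \<or>
     first_integral (pullback_form M A) integral5 \<or>
     (\<exists>\<kappa>. first_integral (pullback_form M A) (integral6 \<kappa>)) \<or>
     first_integral (pullback_form M A) integral7 \<or>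
     first_integral (pullback_form M A) integral8)"
proof -
  have idsum: "(\<Sum>l\<in>L. dot \<mu> (b l 0)) = 0"
  proof -
    obtain \<beta> where \<beta>: "\<And>l k. l \<in> L \<Longrightarrow> k < d l \<Longrightarrow> mat 1 *v b l k = (\<Sum>j<d l - k. \<beta> l j *s b l (k + j))"
      "(\<Sum>l\<in>L. \<Sum>k<d l. \<beta> l k * dot \<mu> (b l k)) = 0" using act[OF one] by blast
    define \<delta> :: "nat \<Rightarrow> complex" where "\<delta> k = (if k = 0 then 1 else 0)" for k
    have delta: "(\<Sum>k<d l. \<delta> k *s b l k) = b l 0" if "l \<in> L" for l
    proof -
      have "(\<Sum>k<d l. \<delta> k *s b l k) = (\<Sum>k\<in>{0}. \<delta> k *s b l k)"
        by (rule sum.mono_neutral_right) (use d1[OF that] in \<open>auto simp: \<delta>_def\<close>)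
      then show ?thesis by (simp add: \<delta>_def)
    qed
    have "(\<Sum>l\<in>L. \<Sum>k<d l. (\<beta> l k - \<delta> k) *s b l k) = 0"
    proof (rule sum.neutral, rule ballI)
      fix l assume l: "l \<in> L"
      have "(\<Sum>k<d l. \<beta> l k *s b l k) = b l 0" using \<beta>(1)[OF l, of 0] d1[OF l] by simp
      then show "(\<Sum>k<d l. (\<beta> l k - \<delta> k) *s b l k) = 0"
        using delta[OF l] by (simp add: vec.scale_left_diff_distrib sum_subtractf)
    qed
    from indep[OF this] have \<beta>\<delta>: "\<beta> l k = \<delta> k" if "l \<in> L" "k < d l" for l k using that by simp
    have "(\<Sum>k<d l. \<beta> l k * dot \<mu> (b l k)) = dot \<mu> (b l 0)" if l: "l \<in> L" for l
    proof -
      have "(\<Sum>k<d l. \<beta> l k * dot \<mu> (b l k)) = dot \<mu> (\<Sum>k<d l. \<delta> k *s b l k)"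
        by (simp add: dot_sum_right dot_scale_right \<beta>\<delta>[OF l])
      then show ?thesis by (simp add: delta[OF l])
    qed
    then show ?thesis using \<beta>(2) by simp
  qed
  obtain xs where x: "distinct xs" "set xs = L"
    "map d xs \<in> {[1,1,1,1,1], [2,1,1,1], [2,2,1], [3,1,1], [3,2], [4,1], [5]}"
    using sorted_blocks[OF fin sum5 d1] by blast
  from x(3) consider "map d xs = [1,1,1,1,1]" | "map d xs = [2,1,1,1]" | "map d xs = [2,2,1]" | "map d xs = [3,1,1]"
    | "map d xs = [3,2]" | "map d xs = [4,1]" | "map d xs = [5]" by blast
  then show ?thesis
  proof cases
    case 1
    note DS = this
    obtain l0 l1 l2 l3 l4 where xs: "xs = [l0, l1, l2, l3, l4]" using DS by (auto simp: map_eq_Cons_conv)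
    have L: "L = {l0, l1, l2, l3, l4}" and ne: "l0 \<noteq> l1" "l0 \<noteq> l2" "l0 \<noteq> l3" "l0 \<noteq> l4" "l1 \<noteq> l2" "l1 \<noteq> l3" "l1 \<noteq> l4" "l2 \<noteq> l3" "l2 \<noteq> l4" "l3 \<noteq> l4" using x(1,2) xs by auto
    have dv: "d l0 = 1" "d l1 = 1" "d l2 = 1" "d l3 = 1" "d l4 = 1" using DS xs by simp_all
    have inL: "l0 \<in> L" "l1 \<in> L" "l2 \<in> L" "l3 \<in> L" "l4 \<in> L" using L by auto
    have indR: "c00 = 0 \<and> c10 = 0 \<and> c20 = 0 \<and> c30 = 0 \<and> c40 = 0" if z: "c00 *s b l0 0 + c10 *s b l1 0 + c20 *s b l2 0 + c30 *s b l3 0 + c40 *s b l4 0 = 0" for c00 c10 c20 c30 c40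
    proof -
      define \<beta> where "\<beta> x k = (if x = l0 then (c00) else if x = l1 then (c10) else if x = l2 then (c20) else if x = l3 then (c30) else (c40))" for x :: 'l and k :: nat
      have "(\<Sum>l\<in>L. \<Sum>k<d l. \<beta> l k *s b l k) = 0"
        using z ne by (simp add: L dv sum_lessThan_small lessThan_Suc \<beta>_def add.assoc ne[symmetric])
      from indep[OF this] have "\<beta> l0 0 = 0" "\<beta> l1 0 = 0" "\<beta> l2 0 = 0" "\<beta> l3 0 = 0" "\<beta> l4 0 = 0" using inL dv by simp_all
      then show ?thesis using ne by (simp add: \<beta>_def ne[symmetric])
    qed
    have actR: "\<exists>\<beta>00 \<beta>10 \<beta>20 \<beta>30 \<beta>40. B *v b l0 0 = \<beta>00 *s b l0 0 \<and> B *v b l1 0 = \<beta>10 *s b l1 0 \<and> B *v b l2 0 = \<beta>20 *s b l2 0 \<and> B *v b l3 0 = \<beta>30 *s b l3 0 \<and> B *v b l4 0 = \<beta>40 *s b l4 0 \<and> dot \<mu> (b l0 0) * \<beta>00 + dot \<mu> (b l1 0) * \<beta>10 + dot \<mu> (b l2 0) * \<beta>20 + dot \<mu> (b l3 0) * \<beta>30 + dot \<mu> (b l4 0) * \<beta>40 = 0" if B: "B \<in> V" for B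
    proof -
      obtain \<beta> where \<beta>: "\<And>l k. l \<in> L \<Longrightarrow> k < d l \<Longrightarrow> B *v b l k = (\<Sum>j<d l - k. \<beta> l j *s b l (k + j))"
        "(\<Sum>l\<in>L. \<Sum>k<d l. \<beta> l k * dot \<mu> (b l k)) = 0" using act[OF B] by blast
      note B0 = block_action(1)[OF \<beta>(1)[OF inL(1)] dv(1)]
      note B1 = block_action(1)[OF \<beta>(1)[OF inL(2)] dv(2)]
      note B2 = block_action(1)[OF \<beta>(1)[OF inL(3)] dv(3)]
      note B3 = block_action(1)[OF \<beta>(1)[OF inL(4)] dv(4)]
      note B4 = block_action(1)[OF \<beta>(1)[OF inL(5)] dv(5)]
      have S: "dot \<mu> (b l0 0) * \<beta> l0 0 + dot \<mu> (b l1 0) * \<beta> l1 0 + dot \<mu> (b l2 0) * \<beta> l2 0 + dot \<mu> (b l3 0) * \<beta> l3 0 + dot \<mu> (b l4 0) * \<beta> l4 0 = 0"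
        using \<beta>(2) ne by (simp add: L dv sum_lessThan_small lessThan_Suc algebra_simps ne[symmetric])
      show ?thesis using B0 B1 B2 B3 B4 S
        by (intro exI[of _ "\<beta> l0 0"] exI[of _ "\<beta> l1 0"] exI[of _ "\<beta> l2 0"] exI[of _ "\<beta> l3 0"] exI[of _ "\<beta> l4 0"]) simp
    qed
    have top: "dot \<mu> (b l0 0) \<noteq> 0" "dot \<mu> (b l1 0) \<noteq> 0" "dot \<mu> (b l2 0) \<noteq> 0" "dot \<mu> (b l3 0) \<noteq> 0" "dot \<mu> (b l4 0) \<noteq> 0" using top0[OF inL(1)] top0[OF inL(2)] top0[OF inL(3)] top0[OF inL(4)] top0[OF inL(5)] dv by simp_all
    have idR: "dot \<mu> (b l0 0) + dot \<mu> (b l1 0) + dot \<mu> (b l2 0) + dot \<mu> (b l3 0) + dot \<mu> (b l4 0) = 0" using idsum ne by (simp add: L ne[symmetric] add.assoc)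
    have ind: "indep5 (b l0 0) (b l1 0) (b l2 0) (b l3 0) (b l4 0)"
      unfolding indep5_def using indR by blast
    define \<kappa> :: "5 \<Rightarrow> complex" where "\<kappa> i = (if i = 0 then dot \<mu> (b l0 0) else if i = 1 then dot \<mu> (b l1 0) else if i = 2 then dot \<mu> (b l2 0)
      else if i = 3 then dot \<mu> (b l3 0) else dot \<mu> (b l4 0))" for i
    have \<kappa>: "\<kappa> 0 = dot \<mu> (b l0 0)" "\<kappa> 1 = dot \<mu> (b l1 0)" "\<kappa> 2 = dot \<mu> (b l2 0)" "\<kappa> 3 = dot \<mu> (b l3 0)" "\<kappa> 4 = dot \<mu> (b l4 0)"
      by (simp_all add: \<kappa>_def)
    have "(\<Sum>j\<in>UNIV. \<kappa> j) = 0" using idR by (simp only: sum_5 \<kappa>)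
    moreover have "\<exists>M :: complex ^ 5 ^ 5. invertible M \<and> first_integral (pullback_form M A) (integral1 \<kappa>)"
      by (rule normal_form1[OF reg ind]) (assumption, simp only: \<kappa> top not_False_eq_True, unfold \<kappa>, rule actR, assumption)
    ultimately show ?thesis by blast
  next
    case 2
    note DS = this
    obtain l0 l1 l2 l3 where xs: "xs = [l0, l1, l2, l3]" using DS by (auto simp: map_eq_Cons_conv)
    have L: "L = {l0, l1, l2, l3}" and ne: "l0 \<noteq> l1" "l0 \<noteq> l2" "l0 \<noteq> l3" "l1 \<noteq> l2" "l1 \<noteq> l3" "l2 \<noteq> l3" using x(1,2) xs by auto
    have dv: "d l0 = 2" "d l1 = 1" "d l2 = 1" "d l3 = 1" using DS xs by simp_all
    have inL: "l0 \<in> L" "l1 \<in> L" "l2 \<in> L" "l3 \<in> L" using L by auto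
    have indR: "c00 = 0 \<and> c01 = 0 \<and> c10 = 0 \<and> c20 = 0 \<and> c30 = 0" if z: "c00 *s b l0 0 + c01 *s b l0 1 + c10 *s b l1 0 + c20 *s b l2 0 + c30 *s b l3 0 = 0" for c00 c01 c10 c20 c30
    proof -
      define \<beta> where "\<beta> x k = (if x = l0 then (if k = 0 then c00 else c01) else if x = l1 then (c10) else if x = l2 then (c20) else (c30))" for x :: 'l and k :: nat
      have "(\<Sum>l\<in>L. \<Sum>k<d l. \<beta> l k *s b l k) = 0"
        using z ne by (simp add: L dv sum_lessThan_small lessThan_Suc \<beta>_def add.assoc ne[symmetric])
      from indep[OF this] have "\<beta> l0 0 = 0" "\<beta> l0 1 = 0" "\<beta> l1 0 = 0" "\<beta> l2 0 = 0" "\<beta> l3 0 = 0" using inL dv by simp_all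
      then show ?thesis using ne by (simp add: \<beta>_def ne[symmetric])
    qed
    have actR: "\<exists>\<beta>00 \<beta>01 \<beta>10 \<beta>20 \<beta>30. B *v b l0 0 = \<beta>00 *s b l0 0 + \<beta>01 *s b l0 1 \<and> B *v b l0 1 = \<beta>00 *s b l0 1 \<and> B *v b l1 0 = \<beta>10 *s b l1 0 \<and> B *v b l2 0 = \<beta>20 *s b l2 0 \<and> B *v b l3 0 = \<beta>30 *s b l3 0 \<and> dot \<mu> (b l0 0) * \<beta>00 + dot \<mu> (b l0 1) * \<beta>01 + dot \<mu> (b l1 0) * \<beta>10 + dot \<mu> (b l2 0) * \<beta>20 + dot \<mu> (b l3 0) * \<beta>30 = 0" if B: "B \<in> V" for B
    proof -
      obtain \<beta> where \<beta>: "\<And>l k. l \<in> L \<Longrightarrow> k < d l \<Longrightarrow> B *v b l k = (\<Sum>j<d l - k. \<beta> l j *s b l (k + j))"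
        "(\<Sum>l\<in>L. \<Sum>k<d l. \<beta> l k * dot \<mu> (b l k)) = 0" using act[OF B] by blast
      note B0 = block_action(2)[OF \<beta>(1)[OF inL(1)] dv(1)]
      note B1 = block_action(1)[OF \<beta>(1)[OF inL(2)] dv(2)]
      note B2 = block_action(1)[OF \<beta>(1)[OF inL(3)] dv(3)]
      note B3 = block_action(1)[OF \<beta>(1)[OF inL(4)] dv(4)]
      have S: "dot \<mu> (b l0 0) * \<beta> l0 0 + dot \<mu> (b l0 1) * \<beta> l0 1 + dot \<mu> (b l1 0) * \<beta> l1 0 + dot \<mu> (b l2 0) * \<beta> l2 0 + dot \<mu> (b l3 0) * \<beta> l3 0 = 0"
        using \<beta>(2) ne by (simp add: L dv sum_lessThan_small lessThan_Suc algebra_simps ne[symmetric])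
      show ?thesis using B0 B1 B2 B3 S
        by (intro exI[of _ "\<beta> l0 0"] exI[of _ "\<beta> l0 1"] exI[of _ "\<beta> l1 0"] exI[of _ "\<beta> l2 0"] exI[of _ "\<beta> l3 0"]) simp
    qed
    have top: "dot \<mu> (b l0 1) \<noteq> 0" "dot \<mu> (b l1 0) \<noteq> 0" "dot \<mu> (b l2 0) \<noteq> 0" "dot \<mu> (b l3 0) \<noteq> 0" using top0[OF inL(1)] top0[OF inL(2)] top0[OF inL(3)] top0[OF inL(4)] dv by simp_all
    have idR: "dot \<mu> (b l0 0) + dot \<mu> (b l1 0) + dot \<mu> (b l2 0) + dot \<mu> (b l3 0) = 0" using idsum ne by (simp add: L ne[symmetric] add.assoc)
    define s where "s = - 1 / dot \<mu> (b l3 0)"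
    have s: "s * dot \<mu> (b l3 0) = - 1" "s \<noteq> 0" using top by (simp_all add: s_def)
    define \<tau> where "\<tau> = s * dot \<mu> (b l0 1)"
    have \<tau>: "\<tau> \<noteq> 0" using s top by (simp add: \<tau>_def)
    define v0 v1 v2 v3 v4 where v: "v0 = (1 / \<tau>) *s b l0 1" "v1 = b l0 0" "v2 = b l1 0" "v3 = b l2 0" "v4 = b l3 0"
    have ind: "indep5 v0 v1 v2 v3 v4"
      unfolding indep5_def
    proof (intro allI impI)
      fix a b' c d' e :: complex assume z: "a *s v0 + b' *s v1 + c *s v2 + d' *s v3 + e *s v4 = 0"
      have "(b') *s b l0 0 + (a * (1 / \<tau>)) *s b l0 1 + (c) *s b l1 0 + (d') *s b l2 0 + (e) *s b l3 0 = a *s v0 + b' *s v1 + c *s v2 + d' *s v3 + e *s v4"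
        unfolding v by (simp add: vec_eq_iff algebra_simps)
      from indR[OF this[unfolded z]] show "a = 0 \<and> b' = 0 \<and> c = 0 \<and> d' = 0 \<and> e = 0"
        using \<tau> by auto
    qed
    have "\<exists>M :: complex ^ 5 ^ 5. invertible M \<and> first_integral (pullback_form M A) (integral2 (- s * dot \<mu> (b l1 0)) (- s * dot \<mu> (b l2 0)))"
    proof (rule normal_form2[OF reg ind])
      fix B assume B: "B \<in> V"
      obtain \<beta>00 \<beta>01 \<beta>10 \<beta>20 \<beta>30 where R: "B *v b l0 0 = \<beta>00 *s b l0 0 + \<beta>01 *s b l0 1" "B *v b l0 1 = \<beta>00 *s b l0 1" "B *v b l1 0 = \<beta>10 *s b l1 0" "B *v b l2 0 = \<beta>20 *s b l2 0" "B *v b l3 0 = \<beta>30 *s b l3 0" "dot \<mu> (b l0 0) * \<beta>00 + dot \<mu> (b l0 1) * \<beta>01 + dot \<mu> (b l1 0) * \<beta>10 + dot \<mu> (b l2 0) * \<beta>20 + dot \<mu> (b l3 0) * \<beta>30 = 0" using actR[OF B] by blast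
      have "(- s * dot \<mu> (b l1 0) + - s * dot \<mu> (b l2 0) + 1) * \<beta>00 + \<tau> * \<beta>01 - (- s * dot \<mu> (b l1 0)) * \<beta>10 - (- s * dot \<mu> (b l2 0)) * \<beta>20 - \<beta>30 = 0"
        unfolding \<tau>_def using s(1) idR R(6) by algebra
      moreover have "B *v v1 = \<beta>00 *s v1 + (\<tau> * \<beta>01) *s v0" "B *v v0 = \<beta>00 *s v0" "B *v v2 = \<beta>10 *s v2" "B *v v3 = \<beta>20 *s v3" "B *v v4 = \<beta>30 *s v4"
        unfolding v using \<tau> by (simp_all add: vec.scale R[unfolded One_nat_def] mult.commute)
      ultimately show "\<exists>bb b' c2 c3 c4. B *v v1 = bb *s v1 + b' *s v0 \<and> B *v v0 = bb *s v0 \<and> B *v v2 = c2 *s v2 \<and> B *v v3 = c3 *s v3 \<and> B *v v4 = c4 *s v4 \<and>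
          (- s * dot \<mu> (b l1 0) + - s * dot \<mu> (b l2 0) + 1) * bb + b' - (- s * dot \<mu> (b l1 0)) * c2 - (- s * dot \<mu> (b l2 0)) * c3 - c4 = 0" by blast
    qed
    then show ?thesis by blast
  next
    case 3
    note DS = this
    obtain l0 l1 l2 where xs: "xs = [l0, l1, l2]" using DS by (auto simp: map_eq_Cons_conv)
    have L: "L = {l0, l1, l2}" and ne: "l0 \<noteq> l1" "l0 \<noteq> l2" "l1 \<noteq> l2" using x(1,2) xs by auto
    have dv: "d l0 = 2" "d l1 = 2" "d l2 = 1" using DS xs by simp_all
    have inL: "l0 \<in> L" "l1 \<in> L" "l2 \<in> L" using L by auto
    have indR: "c00 = 0 \<and> c01 = 0 \<and> c10 = 0 \<and> c11 = 0 \<and> c20 = 0" if z: "c00 *s b l0 0 + c01 *s b l0 1 + c10 *s b l1 0 + c11 *s b l1 1 + c20 *s b l2 0 = 0" for c00 c01 c10 c11 c20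
    proof -
      define \<beta> where "\<beta> x k = (if x = l0 then (if k = 0 then c00 else c01) else if x = l1 then (if k = 0 then c10 else c11) else (c20))" for x :: 'l and k :: nat
      have "(\<Sum>l\<in>L. \<Sum>k<d l. \<beta> l k *s b l k) = 0"
        using z ne by (simp add: L dv sum_lessThan_small lessThan_Suc \<beta>_def add.assoc ne[symmetric])
      from indep[OF this] have "\<beta> l0 0 = 0" "\<beta> l0 1 = 0" "\<beta> l1 0 = 0" "\<beta> l1 1 = 0" "\<beta> l2 0 = 0" using inL dv by simp_all
      then show ?thesis using ne by (simp add: \<beta>_def ne[symmetric])
    qed
    have actR: "\<exists>\<beta>00 \<beta>01 \<beta>10 \<beta>11 \<beta>20. B *v b l0 0 = \<beta>00 *s b l0 0 + \<beta>01 *s b l0 1 \<and> B *v b l0 1 = \<beta>00 *s b l0 1 \<and> B *v b l1 0 = \<beta>10 *s b l1 0 + \<beta>11 *s b l1 1 \<and> B *v b l1 1 = \<beta>10 *s b l1 1 \<and> B *v b l2 0 = \<beta>20 *s b l2 0 \<and> dot \<mu> (b l0 0) * \<beta>00 + dot \<mu> (b l0 1) * \<beta>01 + dot \<mu> (b l1 0) * \<beta>10 + dot \<mu> (b l1 1) * \<beta>11 + dot \<mu> (b l2 0) * \<beta>20 = 0" if B: "B \<in> V" for B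
    proof -
      obtain \<beta> where \<beta>: "\<And>l k. l \<in> L \<Longrightarrow> k < d l \<Longrightarrow> B *v b l k = (\<Sum>j<d l - k. \<beta> l j *s b l (k + j))"
        "(\<Sum>l\<in>L. \<Sum>k<d l. \<beta> l k * dot \<mu> (b l k)) = 0" using act[OF B] by blast
      note B0 = block_action(2)[OF \<beta>(1)[OF inL(1)] dv(1)]
      note B1 = block_action(2)[OF \<beta>(1)[OF inL(2)] dv(2)]
      note B2 = block_action(1)[OF \<beta>(1)[OF inL(3)] dv(3)]
      have S: "dot \<mu> (b l0 0) * \<beta> l0 0 + dot \<mu> (b l0 1) * \<beta> l0 1 + dot \<mu> (b l1 0) * \<beta> l1 0 + dot \<mu> (b l1 1) * \<beta> l1 1 + dot \<mu> (b l2 0) * \<beta> l2 0 = 0"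
        using \<beta>(2) ne by (simp add: L dv sum_lessThan_small lessThan_Suc algebra_simps ne[symmetric])
      show ?thesis using B0 B1 B2 S
        by (intro exI[of _ "\<beta> l0 0"] exI[of _ "\<beta> l0 1"] exI[of _ "\<beta> l1 0"] exI[of _ "\<beta> l1 1"] exI[of _ "\<beta> l2 0"]) simp
    qed
    have top: "dot \<mu> (b l0 1) \<noteq> 0" "dot \<mu> (b l1 1) \<noteq> 0" "dot \<mu> (b l2 0) \<noteq> 0" using top0[OF inL(1)] top0[OF inL(2)] top0[OF inL(3)] dv by simp_all
    have idR: "dot \<mu> (b l0 0) + dot \<mu> (b l1 0) + dot \<mu> (b l2 0) = 0" using idsum ne by (simp add: L ne[symmetric] add.assoc)
    define s where "s = 1 / dot \<mu> (b l2 0)"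
    have s: "s * dot \<mu> (b l2 0) = 1" "s \<noteq> 0" using top by (simp_all add: s_def)
    define \<sigma> where "\<sigma> = s * dot \<mu> (b l0 1)"
    define \<tau> where "\<tau> = - s * dot \<mu> (b l1 1)"
    have \<tau>: "\<sigma> \<noteq> 0" "\<tau> \<noteq> 0" using s top by (simp_all add: \<sigma>_def \<tau>_def)
    define v0 v1 v2 v3 v4 where v: "v0 = (1 / \<tau>) *s b l1 1" "v1 = b l1 0" "v2 = (1 / \<sigma>) *s b l0 1" "v3 = b l0 0" "v4 = b l2 0"
    have ind: "indep5 v0 v1 v2 v3 v4"
      unfolding indep5_def
    proof (intro allI impI)
      fix a b' c d' e :: complex assume z: "a *s v0 + b' *s v1 + c *s v2 + d' *s v3 + e *s v4 = 0"
      have "(d') *s b l0 0 + (c * (1 / \<sigma>)) *s b l0 1 + (b') *s b l1 0 + (a * (1 / \<tau>)) *s b l1 1 + (e) *s b l2 0 = a *s v0 + b' *s v1 + c *s v2 + d' *s v3 + e *s v4"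
        unfolding v by (simp add: vec_eq_iff algebra_simps)
      from indR[OF this[unfolded z]] show "a = 0 \<and> b' = 0 \<and> c = 0 \<and> d' = 0 \<and> e = 0"
        using \<tau> by auto
    qed
    have "\<exists>M :: complex ^ 5 ^ 5. invertible M \<and> first_integral (pullback_form M A) (integral3 (s * dot \<mu> (b l0 0)))"
    proof (rule normal_form3[OF reg ind])
      fix B assume B: "B \<in> V"
      obtain \<beta>00 \<beta>01 \<beta>10 \<beta>11 \<beta>20 where R: "B *v b l0 0 = \<beta>00 *s b l0 0 + \<beta>01 *s b l0 1" "B *v b l0 1 = \<beta>00 *s b l0 1" "B *v b l1 0 = \<beta>10 *s b l1 0 + \<beta>11 *s b l1 1" "B *v b l1 1 = \<beta>10 *s b l1 1" "B *v b l2 0 = \<beta>20 *s b l2 0" "dot \<mu> (b l0 0) * \<beta>00 + dot \<mu> (b l0 1) * \<beta>01 + dot \<mu> (b l1 0) * \<beta>10 + dot \<mu> (b l1 1) * \<beta>11 + dot \<mu> (b l2 0) * \<beta>20 = 0" using actR[OF B] by blast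
      have "s * dot \<mu> (b l0 0) * \<beta>00 + \<beta>20 - (1 + s * dot \<mu> (b l0 0)) * \<beta>10 + \<sigma> * \<beta>01 - \<tau> * \<beta>11 = 0"
        unfolding \<sigma>_def \<tau>_def using s(1) idR R(6) by algebra
      moreover have "B *v v3 = \<beta>00 *s v3 + (\<sigma> * \<beta>01) *s v2" "B *v v2 = \<beta>00 *s v2" "B *v v1 = \<beta>10 *s v1 + (\<tau> * \<beta>11) *s v0" "B *v v0 = \<beta>10 *s v0" "B *v v4 = \<beta>20 *s v4"
        unfolding v using \<tau> by (simp_all add: vec.scale R[unfolded One_nat_def] mult.commute)
      ultimately show "\<exists>a a' bb b' c. B *v v3 = a *s v3 + a' *s v2 \<and> B *v v2 = a *s v2 \<and> B *v v1 = bb *s v1 + b' *s v0 \<and> B *v v0 = bb *s v0 \<and> B *v v4 = c *s v4 \<and>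
          s * dot \<mu> (b l0 0) * a + c - (1 + s * dot \<mu> (b l0 0)) * bb + a' - b' = 0" by blast
    qed
    then show ?thesis by blast
  next
    case 4
    note DS = this
    obtain l0 l1 l2 where xs: "xs = [l0, l1, l2]" using DS by (auto simp: map_eq_Cons_conv)
    have L: "L = {l0, l1, l2}" and ne: "l0 \<noteq> l1" "l0 \<noteq> l2" "l1 \<noteq> l2" using x(1,2) xs by auto
    have dv: "d l0 = 3" "d l1 = 1" "d l2 = 1" using DS xs by simp_all
    have inL: "l0 \<in> L" "l1 \<in> L" "l2 \<in> L" using L by auto
    have indR: "c00 = 0 \<and> c01 = 0 \<and> c02 = 0 \<and> c10 = 0 \<and> c20 = 0" if z: "c00 *s b l0 0 + c01 *s b l0 1 + c02 *s b l0 2 + c10 *s b l1 0 + c20 *s b l2 0 = 0" for c00 c01 c02 c10 c20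
    proof -
      define \<beta> where "\<beta> x k = (if x = l0 then (if k = 0 then c00 else if k = 1 then c01 else c02) else if x = l1 then (c10) else (c20))" for x :: 'l and k :: nat
      have "(\<Sum>l\<in>L. \<Sum>k<d l. \<beta> l k *s b l k) = 0"
        using z ne by (simp add: L dv sum_lessThan_small lessThan_Suc \<beta>_def add.assoc ne[symmetric])
      from indep[OF this] have "\<beta> l0 0 = 0" "\<beta> l0 1 = 0" "\<beta> l0 2 = 0" "\<beta> l1 0 = 0" "\<beta> l2 0 = 0" using inL dv by simp_all
      then show ?thesis using ne by (simp add: \<beta>_def ne[symmetric])
    qed
    have actR: "\<exists>\<beta>00 \<beta>01 \<beta>02 \<beta>10 \<beta>20. B *v b l0 0 = \<beta>00 *s b l0 0 + \<beta>01 *s b l0 1 + \<beta>02 *s b l0 2 \<and> B *v b l0 1 = \<beta>00 *s b l0 1 + \<beta>01 *s b l0 2 \<and> B *v b l0 2 = \<beta>00 *s b l0 2 \<and> B *v b l1 0 = \<beta>10 *s b l1 0 \<and> B *v b l2 0 = \<beta>20 *s b l2 0 \<and> dot \<mu> (b l0 0) * \<beta>00 + dot \<mu> (b l0 1) * \<beta>01 + dot \<mu> (b l0 2) * \<beta>02 + dot \<mu> (b l1 0) * \<beta>10 + dot \<mu> (b l2 0) * \<beta>20 = 0" if B: "B \<in> V" for B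
    proof -
      obtain \<beta> where \<beta>: "\<And>l k. l \<in> L \<Longrightarrow> k < d l \<Longrightarrow> B *v b l k = (\<Sum>j<d l - k. \<beta> l j *s b l (k + j))"
        "(\<Sum>l\<in>L. \<Sum>k<d l. \<beta> l k * dot \<mu> (b l k)) = 0" using act[OF B] by blast
      note B0 = block_action(3)[OF \<beta>(1)[OF inL(1)] dv(1)]
      note B1 = block_action(1)[OF \<beta>(1)[OF inL(2)] dv(2)]
      note B2 = block_action(1)[OF \<beta>(1)[OF inL(3)] dv(3)]
      have S: "dot \<mu> (b l0 0) * \<beta> l0 0 + dot \<mu> (b l0 1) * \<beta> l0 1 + dot \<mu> (b l0 2) * \<beta> l0 2 + dot \<mu> (b l1 0) * \<beta> l1 0 + dot \<mu> (b l2 0) * \<beta> l2 0 = 0"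
        using \<beta>(2) ne by (simp add: L dv sum_lessThan_small lessThan_Suc algebra_simps ne[symmetric])
      show ?thesis using B0 B1 B2 S
        by (intro exI[of _ "\<beta> l0 0"] exI[of _ "\<beta> l0 1"] exI[of _ "\<beta> l0 2"] exI[of _ "\<beta> l1 0"] exI[of _ "\<beta> l2 0"]) simp
    qed
    have top: "dot \<mu> (b l0 2) \<noteq> 0" "dot \<mu> (b l1 0) \<noteq> 0" "dot \<mu> (b l2 0) \<noteq> 0" using top0[OF inL(1)] top0[OF inL(2)] top0[OF inL(3)] dv by simp_all
    have idR: "dot \<mu> (b l0 0) + dot \<mu> (b l1 0) + dot \<mu> (b l2 0) = 0" using idsum ne by (simp add: L ne[symmetric] add.assoc)
    define s where "s = - 1 / dot \<mu> (b l2 0)"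
    have s: "s * dot \<mu> (b l2 0) = - 1" "s \<noteq> 0" using top by (simp_all add: s_def)
    obtain v3 v2 p q r where pr: "p \<noteq> 0" "r \<noteq> 0" and v32: "v3 = p *s b l0 1 + q *s b l0 2" "v2 = r *s b l0 2"
      and nb: "\<And>B \<beta>0 \<beta>1 \<beta>2. B *v b l0 0 = \<beta>0 *s b l0 0 + \<beta>1 *s b l0 1 + \<beta>2 *s b l0 2 \<Longrightarrow> B *v b l0 1 = \<beta>0 *s b l0 1 + \<beta>1 *s b l0 2 \<Longrightarrow> B *v b l0 2 = \<beta>0 *s b l0 2 \<Longrightarrow>
      \<exists>a' a''. B *v b l0 0 = \<beta>0 *s b l0 0 + a' *s v3 + a'' *s v2 \<and> B *v v3 = \<beta>0 *s v3 + (2 * a') *s v2 \<and> B *v v2 = \<beta>0 *s v2 \<and>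
        s * (dot \<mu> (b l0 0) * \<beta>0 + dot \<mu> (b l0 1) * \<beta>1 + dot \<mu> (b l0 2) * \<beta>2) = s * dot \<mu> (b l0 0) * \<beta>0 - a''"
      by (rule normal_block3[OF top(1) s(2), where ?g0.0 = "b l0 0" and ?g1.0 = "b l0 1" and ?g2.0 = "b l0 2" and ?l0.0 = "dot \<mu> (b l0 0)" and ?l1.0 = "dot \<mu> (b l0 1)"]) (rule that)
    define v0 v1 v4 where v: "v0 = b l2 0" "v1 = b l1 0" "v4 = b l0 0"
    have ind: "indep5 v0 v1 v2 v3 v4"
      unfolding indep5_def
    proof (intro allI impI)
      fix a b' c d' e :: complex assume z: "a *s v0 + b' *s v1 + c *s v2 + d' *s v3 + e *s v4 = 0"
      have "(e) *s b l0 0 + (d' * p) *s b l0 1 + (d' * q + c * r) *s b l0 2 + (b') *s b l1 0 + (a) *s b l2 0 = a *s v0 + b' *s v1 + c *s v2 + d' *s v3 + e *s v4"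
        unfolding v v32 by (simp add: vec_eq_iff algebra_simps)
      from indR[OF this[unfolded z]] show "a = 0 \<and> b' = 0 \<and> c = 0 \<and> d' = 0 \<and> e = 0"
        using pr by auto
    qed
    have "\<exists>M :: complex ^ 5 ^ 5. invertible M \<and> first_integral (pullback_form M A) (integral6 (s * dot \<mu> (b l1 0)))"
    proof (rule normal_form6[OF reg ind])
      fix B assume B: "B \<in> V"
      obtain \<beta>00 \<beta>01 \<beta>02 \<beta>10 \<beta>20 where R: "B *v b l0 0 = \<beta>00 *s b l0 0 + \<beta>01 *s b l0 1 + \<beta>02 *s b l0 2" "B *v b l0 1 = \<beta>00 *s b l0 1 + \<beta>01 *s b l0 2" "B *v b l0 2 = \<beta>00 *s b l0 2" "B *v b l1 0 = \<beta>10 *s b l1 0" "B *v b l2 0 = \<beta>20 *s b l2 0" "dot \<mu> (b l0 0) * \<beta>00 + dot \<mu> (b l0 1) * \<beta>01 + dot \<mu> (b l0 2) * \<beta>02 + dot \<mu> (b l1 0) * \<beta>10 + dot \<mu> (b l2 0) * \<beta>20 = 0" using actR[OF B] by blast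
      obtain a' a'' where N: "B *v b l0 0 = \<beta>00 *s b l0 0 + a' *s v3 + a'' *s v2" "B *v v3 = \<beta>00 *s v3 + (2 * a') *s v2" "B *v v2 = \<beta>00 *s v2"
        "s * (dot \<mu> (b l0 0) * \<beta>00 + dot \<mu> (b l0 1) * \<beta>01 + dot \<mu> (b l0 2) * \<beta>02) = s * dot \<mu> (b l0 0) * \<beta>00 - a''"
        using nb[OF R(1-3)] by blast
      have "s * dot \<mu> (b l1 0) * \<beta>10 + (1 - s * dot \<mu> (b l1 0)) * \<beta>00 - \<beta>20 - a'' = 0"
        using s(1) idR R(6) N(4) by algebra
      moreover have "B *v v1 = \<beta>10 *s v1" "B *v v0 = \<beta>20 *s v0" unfolding v by (simp_all add: R)
      ultimately show "\<exists>a a' a'' bb c. B *v v4 = a *s v4 + a' *s v3 + a'' *s v2 \<and> B *v v3 = a *s v3 + (2 * a') *s v2 \<and> B *v v2 = a *s v2 \<and>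
          B *v v1 = bb *s v1 \<and> B *v v0 = c *s v0 \<and> s * dot \<mu> (b l1 0) * bb + (1 - s * dot \<mu> (b l1 0)) * a - c - a'' = 0"
        using N(1-3) unfolding v(3) by blast
    qed
    then show ?thesis by blast
  next
    case 5
    note DS = this
    obtain l0 l1 where xs: "xs = [l0, l1]" using DS by (auto simp: map_eq_Cons_conv)
    have L: "L = {l0, l1}" and ne: "l0 \<noteq> l1" using x(1,2) xs by auto
    have dv: "d l0 = 3" "d l1 = 2" using DS xs by simp_all
    have inL: "l0 \<in> L" "l1 \<in> L" using L by auto
    have indR: "c00 = 0 \<and> c01 = 0 \<and> c02 = 0 \<and> c10 = 0 \<and> c11 = 0" if z: "c00 *s b l0 0 + c01 *s b l0 1 + c02 *s b l0 2 + c10 *s b l1 0 + c11 *s b l1 1 = 0" for c00 c01 c02 c10 c11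
    proof -
      define \<beta> where "\<beta> x k = (if x = l0 then (if k = 0 then c00 else if k = 1 then c01 else c02) else (if k = 0 then c10 else c11))" for x :: 'l and k :: nat
      have "(\<Sum>l\<in>L. \<Sum>k<d l. \<beta> l k *s b l k) = 0"
        using z ne by (simp add: L dv sum_lessThan_small lessThan_Suc \<beta>_def add.assoc ne[symmetric])
      from indep[OF this] have "\<beta> l0 0 = 0" "\<beta> l0 1 = 0" "\<beta> l0 2 = 0" "\<beta> l1 0 = 0" "\<beta> l1 1 = 0" using inL dv by simp_all
      then show ?thesis using ne by (simp add: \<beta>_def ne[symmetric])
    qed
    have actR: "\<exists>\<beta>00 \<beta>01 \<beta>02 \<beta>10 \<beta>11. B *v b l0 0 = \<beta>00 *s b l0 0 + \<beta>01 *s b l0 1 + \<beta>02 *s b l0 2 \<and> B *v b l0 1 = \<beta>00 *s b l0 1 + \<beta>01 *s b l0 2 \<and> B *v b l0 2 = \<beta>00 *s b l0 2 \<and> B *v b l1 0 = \<beta>10 *s b l1 0 + \<beta>11 *s b l1 1 \<and> B *v b l1 1 = \<beta>10 *s b l1 1 \<and> dot \<mu> (b l0 0) * \<beta>00 + dot \<mu> (b l0 1) * \<beta>01 + dot \<mu> (b l0 2) * \<beta>02 + dot \<mu> (b l1 0) * \<beta>10 + dot \<mu> (b l1 1) * \<beta>11 = 0" if B: "B \<in> V" for B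
    proof -
      obtain \<beta> where \<beta>: "\<And>l k. l \<in> L \<Longrightarrow> k < d l \<Longrightarrow> B *v b l k = (\<Sum>j<d l - k. \<beta> l j *s b l (k + j))"
        "(\<Sum>l\<in>L. \<Sum>k<d l. \<beta> l k * dot \<mu> (b l k)) = 0" using act[OF B] by blast
      note B0 = block_action(3)[OF \<beta>(1)[OF inL(1)] dv(1)]
      note B1 = block_action(2)[OF \<beta>(1)[OF inL(2)] dv(2)]
      have S: "dot \<mu> (b l0 0) * \<beta> l0 0 + dot \<mu> (b l0 1) * \<beta> l0 1 + dot \<mu> (b l0 2) * \<beta> l0 2 + dot \<mu> (b l1 0) * \<beta> l1 0 + dot \<mu> (b l1 1) * \<beta> l1 1 = 0"
        using \<beta>(2) ne by (simp add: L dv sum_lessThan_small lessThan_Suc algebra_simps ne[symmetric])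
      show ?thesis using B0 B1 S
        by (intro exI[of _ "\<beta> l0 0"] exI[of _ "\<beta> l0 1"] exI[of _ "\<beta> l0 2"] exI[of _ "\<beta> l1 0"] exI[of _ "\<beta> l1 1"]) simp
    qed
    have top: "dot \<mu> (b l0 2) \<noteq> 0" "dot \<mu> (b l1 1) \<noteq> 0" using top0[OF inL(1)] top0[OF inL(2)] dv by simp_all
    have idR: "dot \<mu> (b l0 0) + dot \<mu> (b l1 0) = 0" using idsum ne by (simp add: L ne[symmetric] add.assoc)
    \<comment> \<open>The functional takes opposite values on the two idempotents.  If they are zero, the integral is rational;
      otherwise they are scaled to \<open>1\<close> and \<open>-1\<close>.\<close>
    define s where "s = (if dot \<mu> (b l1 0) = 0 then 1 else 1 / dot \<mu> (b l1 0))"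
    have s: "dot \<mu> (b l1 0) \<noteq> 0 \<Longrightarrow> s * dot \<mu> (b l1 0) = 1" "s \<noteq> 0" by (auto simp: s_def)
    define \<tau> where "\<tau> = s * dot \<mu> (b l1 1)"
    have \<tau>: "\<tau> \<noteq> 0" using s top by (simp add: \<tau>_def)
    obtain v3 v2 p q r where pr: "p \<noteq> 0" "r \<noteq> 0" and v32: "v3 = p *s b l0 1 + q *s b l0 2" "v2 = r *s b l0 2"
      and nb: "\<And>B \<beta>0 \<beta>1 \<beta>2. B *v b l0 0 = \<beta>0 *s b l0 0 + \<beta>1 *s b l0 1 + \<beta>2 *s b l0 2 \<Longrightarrow> B *v b l0 1 = \<beta>0 *s b l0 1 + \<beta>1 *s b l0 2 \<Longrightarrow> B *v b l0 2 = \<beta>0 *s b l0 2 \<Longrightarrow>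
      \<exists>a' a''. B *v b l0 0 = \<beta>0 *s b l0 0 + a' *s v3 + a'' *s v2 \<and> B *v v3 = \<beta>0 *s v3 + (2 * a') *s v2 \<and> B *v v2 = \<beta>0 *s v2 \<and>
        s * (dot \<mu> (b l0 0) * \<beta>0 + dot \<mu> (b l0 1) * \<beta>1 + dot \<mu> (b l0 2) * \<beta>2) = s * dot \<mu> (b l0 0) * \<beta>0 - a''"
      by (rule normal_block3[OF top(1) s(2), where ?g0.0 = "b l0 0" and ?g1.0 = "b l0 1" and ?g2.0 = "b l0 2" and ?l0.0 = "dot \<mu> (b l0 0)" and ?l1.0 = "dot \<mu> (b l0 1)"]) (rule that)
    define v0 v1 v4 where v: "v0 = (1 / \<tau>) *s b l1 1" "v1 = b l1 0" "v4 = b l0 0"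
    have ind: "indep5 v0 v1 v2 v3 v4"
      unfolding indep5_def
    proof (intro allI impI)
      fix a b' c d' e :: complex assume z: "a *s v0 + b' *s v1 + c *s v2 + d' *s v3 + e *s v4 = 0"
      have "(e) *s b l0 0 + (d' * p) *s b l0 1 + (d' * q + c * r) *s b l0 2 + (b') *s b l1 0 + (a * (1 / \<tau>)) *s b l1 1 = a *s v0 + b' *s v1 + c *s v2 + d' *s v3 + e *s v4"
        unfolding v v32 by (simp add: vec_eq_iff algebra_simps)
      from indR[OF this[unfolded z]] show "a = 0 \<and> b' = 0 \<and> c = 0 \<and> d' = 0 \<and> e = 0"
        using pr \<tau> by auto
    qed
    have main: "\<exists>a a' a'' bb b'. B *v v4 = a *s v4 + a' *s v3 + a'' *s v2 \<and> B *v v3 = a *s v3 + (2 * a') *s v2 \<and> B *v v2 = a *s v2 \<and>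
          B *v v1 = bb *s v1 + b' *s v0 \<and> B *v v0 = bb *s v0 \<and> s * dot \<mu> (b l1 0) * (bb - a) + b' - a'' = 0" if B: "B \<in> V" for B
    proof -
      obtain \<beta>00 \<beta>01 \<beta>02 \<beta>10 \<beta>11 where R: "B *v b l0 0 = \<beta>00 *s b l0 0 + \<beta>01 *s b l0 1 + \<beta>02 *s b l0 2" "B *v b l0 1 = \<beta>00 *s b l0 1 + \<beta>01 *s b l0 2" "B *v b l0 2 = \<beta>00 *s b l0 2" "B *v b l1 0 = \<beta>10 *s b l1 0 + \<beta>11 *s b l1 1" "B *v b l1 1 = \<beta>10 *s b l1 1" "dot \<mu> (b l0 0) * \<beta>00 + dot \<mu> (b l0 1) * \<beta>01 + dot \<mu> (b l0 2) * \<beta>02 + dot \<mu> (b l1 0) * \<beta>10 + dot \<mu> (b l1 1) * \<beta>11 = 0" using actR[OF B] by blast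
      obtain a' a'' where N: "B *v b l0 0 = \<beta>00 *s b l0 0 + a' *s v3 + a'' *s v2" "B *v v3 = \<beta>00 *s v3 + (2 * a') *s v2" "B *v v2 = \<beta>00 *s v2"
        "s * (dot \<mu> (b l0 0) * \<beta>00 + dot \<mu> (b l0 1) * \<beta>01 + dot \<mu> (b l0 2) * \<beta>02) = s * dot \<mu> (b l0 0) * \<beta>00 - a''"
        using nb[OF R(1-3)] by blast
      have "s * dot \<mu> (b l1 0) * (\<beta>10 - \<beta>00) + \<tau> * \<beta>11 - a'' = 0"
        unfolding \<tau>_def using idR R(6) N(4) by algebra
      moreover have "B *v v1 = \<beta>10 *s v1 + (\<tau> * \<beta>11) *s v0" "B *v v0 = \<beta>10 *s v0"
        unfolding v using \<tau> by (simp_all add: vec.scale R[unfolded One_nat_def] mult.commute)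
      ultimately show ?thesis using N(1-3) unfolding v(3) by blast
    qed
    show ?thesis
    proof (cases "dot \<mu> (b l1 0) = 0")
      case True
      have "\<exists>M :: complex ^ 5 ^ 5. invertible M \<and> first_integral (pullback_form M A) integral4"
        by (rule normal_form4[OF reg ind], assumption) (rule main[unfolded True mult_zero_right mult_zero_left add_0_left])
      then show ?thesis by blast
    next
      case False
      have "\<exists>M :: complex ^ 5 ^ 5. invertible M \<and> first_integral (pullback_form M A) integral5"
        by (rule normal_form5[OF reg ind], assumption) (rule main[unfolded s(1)[OF False] mult_1_left])
      then show ?thesis by blast
    qed
  next
    case 6
    note DS = this
    obtain l0 l1 where xs: "xs = [l0, l1]" using DS by (auto simp: map_eq_Cons_conv)
    have L: "L = {l0, l1}" and ne: "l0 \<noteq> l1" using x(1,2) xs by auto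
    have dv: "d l0 = 4" "d l1 = 1" using DS xs by simp_all
    have inL: "l0 \<in> L" "l1 \<in> L" using L by auto
    have indR: "c00 = 0 \<and> c01 = 0 \<and> c02 = 0 \<and> c03 = 0 \<and> c10 = 0" if z: "c00 *s b l0 0 + c01 *s b l0 1 + c02 *s b l0 2 + c03 *s b l0 3 + c10 *s b l1 0 = 0" for c00 c01 c02 c03 c10
    proof -
      define \<beta> where "\<beta> x k = (if x = l0 then (if k = 0 then c00 else if k = 1 then c01 else if k = 2 then c02 else c03) else (c10))" for x :: 'l and k :: nat
      have "(\<Sum>l\<in>L. \<Sum>k<d l. \<beta> l k *s b l k) = 0"
        using z ne by (simp add: L dv sum_lessThan_small lessThan_Suc \<beta>_def add.assoc ne[symmetric])
      from indep[OF this] have "\<beta> l0 0 = 0" "\<beta> l0 1 = 0" "\<beta> l0 2 = 0" "\<beta> l0 3 = 0" "\<beta> l1 0 = 0" using inL dv by simp_all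
      then show ?thesis using ne by (simp add: \<beta>_def ne[symmetric])
    qed
    have actR: "\<exists>\<beta>00 \<beta>01 \<beta>02 \<beta>03 \<beta>10. B *v b l0 0 = \<beta>00 *s b l0 0 + \<beta>01 *s b l0 1 + \<beta>02 *s b l0 2 + \<beta>03 *s b l0 3 \<and> B *v b l0 1 = \<beta>00 *s b l0 1 + \<beta>01 *s b l0 2 + \<beta>02 *s b l0 3 \<and> B *v b l0 2 = \<beta>00 *s b l0 2 + \<beta>01 *s b l0 3 \<and> B *v b l0 3 = \<beta>00 *s b l0 3 \<and> B *v b l1 0 = \<beta>10 *s b l1 0 \<and> dot \<mu> (b l0 0) * \<beta>00 + dot \<mu> (b l0 1) * \<beta>01 + dot \<mu> (b l0 2) * \<beta>02 + dot \<mu> (b l0 3) * \<beta>03 + dot \<mu> (b l1 0) * \<beta>10 = 0" if B: "B \<in> V" for B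
    proof -
      obtain \<beta> where \<beta>: "\<And>l k. l \<in> L \<Longrightarrow> k < d l \<Longrightarrow> B *v b l k = (\<Sum>j<d l - k. \<beta> l j *s b l (k + j))"
        "(\<Sum>l\<in>L. \<Sum>k<d l. \<beta> l k * dot \<mu> (b l k)) = 0" using act[OF B] by blast
      note B0 = block_action(4)[OF \<beta>(1)[OF inL(1)] dv(1)]
      note B1 = block_action(1)[OF \<beta>(1)[OF inL(2)] dv(2)]
      have S: "dot \<mu> (b l0 0) * \<beta> l0 0 + dot \<mu> (b l0 1) * \<beta> l0 1 + dot \<mu> (b l0 2) * \<beta> l0 2 + dot \<mu> (b l0 3) * \<beta> l0 3 + dot \<mu> (b l1 0) * \<beta> l1 0 = 0"
        using \<beta>(2) ne by (simp add: L dv sum_lessThan_small lessThan_Suc algebra_simps ne[symmetric])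
      show ?thesis using B0 B1 S
        by (intro exI[of _ "\<beta> l0 0"] exI[of _ "\<beta> l0 1"] exI[of _ "\<beta> l0 2"] exI[of _ "\<beta> l0 3"] exI[of _ "\<beta> l1 0"]) simp
    qed
    have top: "dot \<mu> (b l0 3) \<noteq> 0" "dot \<mu> (b l1 0) \<noteq> 0" using top0[OF inL(1)] top0[OF inL(2)] dv by simp_all
    have idR: "dot \<mu> (b l0 0) + dot \<mu> (b l1 0) = 0" using idsum ne by (simp add: L ne[symmetric] add.assoc)
    define s where "s = 1 / dot \<mu> (b l1 0)"
    have s: "s * dot \<mu> (b l1 0) = 1" "s \<noteq> 0" using top by (simp_all add: s_def)
    obtain v3 v2 v1 p1 p2 p3 q2 q3 r where pr: "p1 \<noteq> 0" "q2 \<noteq> 0" "r \<noteq> 0"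
      and v31: "v3 = p1 *s b l0 1 + p2 *s b l0 2 + p3 *s b l0 3" "v2 = q2 *s b l0 2 + q3 *s b l0 3" "v1 = r *s b l0 3"
      and nb: "\<And>B \<beta>0 \<beta>1 \<beta>2 \<beta>3. B *v b l0 0 = \<beta>0 *s b l0 0 + \<beta>1 *s b l0 1 + \<beta>2 *s b l0 2 + \<beta>3 *s b l0 3 \<Longrightarrow>
      B *v b l0 1 = \<beta>0 *s b l0 1 + \<beta>1 *s b l0 2 + \<beta>2 *s b l0 3 \<Longrightarrow> B *v b l0 2 = \<beta>0 *s b l0 2 + \<beta>1 *s b l0 3 \<Longrightarrow> B *v b l0 3 = \<beta>0 *s b l0 3 \<Longrightarrow>
      \<exists>a1 a2 a3. B *v b l0 0 = \<beta>0 *s b l0 0 + a1 *s v3 + a2 *s v2 + a3 *s v1 \<and> B *v v3 = \<beta>0 *s v3 + (3 * a1) *s v2 - a2 *s v1 \<and>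
        B *v v2 = \<beta>0 *s v2 - a1 *s v1 \<and> B *v v1 = \<beta>0 *s v1 \<and>
        s * (dot \<mu> (b l0 0) * \<beta>0 + dot \<mu> (b l0 1) * \<beta>1 + dot \<mu> (b l0 2) * \<beta>2 + dot \<mu> (b l0 3) * \<beta>3) = s * dot \<mu> (b l0 0) * \<beta>0 + a3"
      by (rule normal_block4[OF top(1) s(2), where ?g0.0 = "b l0 0" and ?g1.0 = "b l0 1" and ?g2.0 = "b l0 2" and ?g3.0 = "b l0 3"
        and ?l0.0 = "dot \<mu> (b l0 0)" and ?l1.0 = "dot \<mu> (b l0 1)" and ?l2.0 = "dot \<mu> (b l0 2)"]) (rule that)
    define v0 v4 where v: "v0 = b l1 0" "v4 = b l0 0"
    have ind: "indep5 v0 v1 v2 v3 v4"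
      unfolding indep5_def
    proof (intro allI impI)
      fix a b' c d' e :: complex assume z: "a *s v0 + b' *s v1 + c *s v2 + d' *s v3 + e *s v4 = 0"
      have "(e) *s b l0 0 + (d' * p1) *s b l0 1 + (d' * p2 + c * q2) *s b l0 2 + (d' * p3 + c * q3 + b' * r) *s b l0 3 + (a) *s b l1 0 = a *s v0 + b' *s v1 + c *s v2 + d' *s v3 + e *s v4"
        unfolding v v31 by (simp add: vec_eq_iff algebra_simps)
      from indR[OF this[unfolded z]] show "a = 0 \<and> b' = 0 \<and> c = 0 \<and> d' = 0 \<and> e = 0"
        using pr by auto
    qed
    have "\<exists>M :: complex ^ 5 ^ 5. invertible M \<and> first_integral (pullback_form M A) integral7"
    proof (rule normal_form7[OF reg ind])
      fix B assume B: "B \<in> V"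
      obtain \<beta>00 \<beta>01 \<beta>02 \<beta>03 \<beta>10 where R: "B *v b l0 0 = \<beta>00 *s b l0 0 + \<beta>01 *s b l0 1 + \<beta>02 *s b l0 2 + \<beta>03 *s b l0 3" "B *v b l0 1 = \<beta>00 *s b l0 1 + \<beta>01 *s b l0 2 + \<beta>02 *s b l0 3" "B *v b l0 2 = \<beta>00 *s b l0 2 + \<beta>01 *s b l0 3" "B *v b l0 3 = \<beta>00 *s b l0 3" "B *v b l1 0 = \<beta>10 *s b l1 0" "dot \<mu> (b l0 0) * \<beta>00 + dot \<mu> (b l0 1) * \<beta>01 + dot \<mu> (b l0 2) * \<beta>02 + dot \<mu> (b l0 3) * \<beta>03 + dot \<mu> (b l1 0) * \<beta>10 = 0" using actR[OF B] by blast
      obtain a1 a2 a3 where N: "B *v b l0 0 = \<beta>00 *s b l0 0 + a1 *s v3 + a2 *s v2 + a3 *s v1" "B *v v3 = \<beta>00 *s v3 + (3 * a1) *s v2 - a2 *s v1"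
        "B *v v2 = \<beta>00 *s v2 - a1 *s v1" "B *v v1 = \<beta>00 *s v1"
        "s * (dot \<mu> (b l0 0) * \<beta>00 + dot \<mu> (b l0 1) * \<beta>01 + dot \<mu> (b l0 2) * \<beta>02 + dot \<mu> (b l0 3) * \<beta>03) = s * dot \<mu> (b l0 0) * \<beta>00 + a3"
        using nb[OF R(1-4)] by blast
      have "\<beta>10 - \<beta>00 + a3 = 0" using s(1) idR R(6) N(5) by algebra
      moreover have "B *v v0 = \<beta>10 *s v0" unfolding v by (simp add: R)
      ultimately show "\<exists>a a1 a2 a3 c. B *v v4 = a *s v4 + a1 *s v3 + a2 *s v2 + a3 *s v1 \<and> B *v v3 = a *s v3 + (3 * a1) *s v2 - a2 *s v1 \<and>
          B *v v2 = a *s v2 - a1 *s v1 \<and> B *v v1 = a *s v1 \<and> B *v v0 = c *s v0 \<and> c - a + a3 = 0"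
        using N(1-4) unfolding v(2) by blast
    qed
    then show ?thesis by blast
  next
    case 7
    note DS = this
    obtain l0 where xs: "xs = [l0]" using DS by (auto simp: map_eq_Cons_conv)
    have L: "L = {l0}" using x(1,2) xs by auto
    have dv: "d l0 = 5" using DS xs by simp_all
    have inL: "l0 \<in> L" using L by auto
    have indR: "c00 = 0 \<and> c01 = 0 \<and> c02 = 0 \<and> c03 = 0 \<and> c04 = 0" if z: "c00 *s b l0 0 + c01 *s b l0 1 + c02 *s b l0 2 + c03 *s b l0 3 + c04 *s b l0 4 = 0" for c00 c01 c02 c03 c04
    proof -
      define \<beta> where "\<beta> x k = ((if k = 0 then c00 else if k = 1 then c01 else if k = 2 then c02 else if k = 3 then c03 else c04))" for x :: 'l and k :: nat
      have "(\<Sum>l\<in>L. \<Sum>k<d l. \<beta> l k *s b l k) = 0"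
        using z by (simp add: L dv sum_lessThan_small lessThan_Suc \<beta>_def add.assoc)
      from indep[OF this] have "\<beta> l0 0 = 0" "\<beta> l0 1 = 0" "\<beta> l0 2 = 0" "\<beta> l0 3 = 0" "\<beta> l0 4 = 0" using inL dv by simp_all
      then show ?thesis by (simp add: \<beta>_def)
    qed
    have actR: "\<exists>\<beta>00 \<beta>01 \<beta>02 \<beta>03 \<beta>04. B *v b l0 0 = \<beta>00 *s b l0 0 + \<beta>01 *s b l0 1 + \<beta>02 *s b l0 2 + \<beta>03 *s b l0 3 + \<beta>04 *s b l0 4 \<and> B *v b l0 1 = \<beta>00 *s b l0 1 + \<beta>01 *s b l0 2 + \<beta>02 *s b l0 3 + \<beta>03 *s b l0 4 \<and> B *v b l0 2 = \<beta>00 *s b l0 2 + \<beta>01 *s b l0 3 + \<beta>02 *s b l0 4 \<and> B *v b l0 3 = \<beta>00 *s b l0 3 + \<beta>01 *s b l0 4 \<and> B *v b l0 4 = \<beta>00 *s b l0 4 \<and> dot \<mu> (b l0 0) * \<beta>00 + dot \<mu> (b l0 1) * \<beta>01 + dot \<mu> (b l0 2) * \<beta>02 + dot \<mu> (b l0 3) * \<beta>03 + dot \<mu> (b l0 4) * \<beta>04 = 0" if B: "B \<in> V" for B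
    proof -
      obtain \<beta> where \<beta>: "\<And>l k. l \<in> L \<Longrightarrow> k < d l \<Longrightarrow> B *v b l k = (\<Sum>j<d l - k. \<beta> l j *s b l (k + j))"
        "(\<Sum>l\<in>L. \<Sum>k<d l. \<beta> l k * dot \<mu> (b l k)) = 0" using act[OF B] by blast
      note B0 = block_action(5)[OF \<beta>(1)[OF inL] dv]
      have S: "dot \<mu> (b l0 0) * \<beta> l0 0 + dot \<mu> (b l0 1) * \<beta> l0 1 + dot \<mu> (b l0 2) * \<beta> l0 2 + dot \<mu> (b l0 3) * \<beta> l0 3 + dot \<mu> (b l0 4) * \<beta> l0 4 = 0"
        using \<beta>(2) by (simp add: L dv sum_lessThan_small lessThan_Suc algebra_simps)
      show ?thesis using B0 S
        by (intro exI[of _ "\<beta> l0 0"] exI[of _ "\<beta> l0 1"] exI[of _ "\<beta> l0 2"] exI[of _ "\<beta> l0 3"] exI[of _ "\<beta> l0 4"]) simp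
    qed
    have top: "dot \<mu> (b l0 4) \<noteq> 0" using top0[OF inL] dv by simp_all
    have idR: "dot \<mu> (b l0 0) = 0" using idsum by (simp add: L add.assoc)
    obtain v3 v2 v1 \<epsilon> f h m where v31: "v3 = b l0 1 + \<epsilon> *s b l0 2 + f *s b l0 3 + h *s b l0 4" "v2 = b l0 2 + (2 * \<epsilon>) *s b l0 3 + m *s b l0 4"
        "v1 = - (b l0 3 + (3 * \<epsilon>) *s b l0 4)"
      and nb: "\<And>B \<beta>0 \<beta>1 \<beta>2 \<beta>3 \<beta>4. B *v b l0 0 = \<beta>0 *s b l0 0 + \<beta>1 *s b l0 1 + \<beta>2 *s b l0 2 + \<beta>3 *s b l0 3 + \<beta>4 *s b l0 4 \<Longrightarrow>
      B *v b l0 1 = \<beta>0 *s b l0 1 + \<beta>1 *s b l0 2 + \<beta>2 *s b l0 3 + \<beta>3 *s b l0 4 \<Longrightarrow> B *v b l0 2 = \<beta>0 *s b l0 2 + \<beta>1 *s b l0 3 + \<beta>2 *s b l0 4 \<Longrightarrow>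
      B *v b l0 3 = \<beta>0 *s b l0 3 + \<beta>1 *s b l0 4 \<Longrightarrow> B *v b l0 4 = \<beta>0 *s b l0 4 \<Longrightarrow>
      \<exists>a1 a2 a3 a4. B *v b l0 0 = \<beta>0 *s b l0 0 + a1 *s v3 + a2 *s v2 - a3 *s v1 + a4 *s b l0 4 \<and>
        B *v v3 = \<beta>0 *s v3 + a1 *s v2 - a2 *s v1 + a3 *s b l0 4 \<and>
        B *v v2 = \<beta>0 *s v2 - a1 *s v1 + a2 *s b l0 4 \<and> B *v v1 = \<beta>0 *s v1 - a1 *s b l0 4 \<and>
        dot \<mu> (b l0 0) * \<beta>0 + dot \<mu> (b l0 1) * \<beta>1 + dot \<mu> (b l0 2) * \<beta>2 + dot \<mu> (b l0 3) * \<beta>3 + dot \<mu> (b l0 4) * \<beta>4 =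
          dot \<mu> (b l0 0) * \<beta>0 + dot \<mu> (b l0 4) * a4"
      by (rule normal_block5[OF top, where ?g0.0 = "b l0 0" and ?g1.0 = "b l0 1" and ?g2.0 = "b l0 2" and ?g3.0 = "b l0 3" and ?g4.0 = "b l0 4"
        and ?l0.0 = "dot \<mu> (b l0 0)" and ?l1.0 = "dot \<mu> (b l0 1)" and ?l2.0 = "dot \<mu> (b l0 2)" and ?l3.0 = "dot \<mu> (b l0 3)"]) (rule that)
    define v0 v4 where v: "v0 = b l0 4" "v4 = b l0 0"
    have ind: "indep5 v0 v1 v2 v3 v4"
      unfolding indep5_def
    proof (intro allI impI)
      fix a b' c d' e :: complex assume z: "a *s v0 + b' *s v1 + c *s v2 + d' *s v3 + e *s v4 = 0"
      have "(e) *s b l0 0 + (d') *s b l0 1 + (d' * \<epsilon> + c) *s b l0 2 + (d' * f + c * (2 * \<epsilon>) - b') *s b l0 3 + (d' * h + c * m - b' * (3 * \<epsilon>) + a) *s b l0 4 = a *s v0 + b' *s v1 + c *s v2 + d' *s v3 + e *s v4"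
        unfolding v v31 by (simp add: vec_eq_iff algebra_simps)
      from indR[OF this[unfolded z]] show "a = 0 \<and> b' = 0 \<and> c = 0 \<and> d' = 0 \<and> e = 0"
        using top by auto
    qed
    have "\<exists>M :: complex ^ 5 ^ 5. invertible M \<and> first_integral (pullback_form M A) integral8"
    proof (rule normal_form8[OF reg ind])
      fix B assume B: "B \<in> V"
      obtain \<beta>00 \<beta>01 \<beta>02 \<beta>03 \<beta>04 where R: "B *v b l0 0 = \<beta>00 *s b l0 0 + \<beta>01 *s b l0 1 + \<beta>02 *s b l0 2 + \<beta>03 *s b l0 3 + \<beta>04 *s b l0 4" "B *v b l0 1 = \<beta>00 *s b l0 1 + \<beta>01 *s b l0 2 + \<beta>02 *s b l0 3 + \<beta>03 *s b l0 4" "B *v b l0 2 = \<beta>00 *s b l0 2 + \<beta>01 *s b l0 3 + \<beta>02 *s b l0 4" "B *v b l0 3 = \<beta>00 *s b l0 3 + \<beta>01 *s b l0 4" "B *v b l0 4 = \<beta>00 *s b l0 4" "dot \<mu> (b l0 0) * \<beta>00 + dot \<mu> (b l0 1) * \<beta>01 + dot \<mu> (b l0 2) * \<beta>02 + dot \<mu> (b l0 3) * \<beta>03 + dot \<mu> (b l0 4) * \<beta>04 = 0" using actR[OF B] by blast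
      obtain a1 a2 a3 a4 where N: "B *v b l0 0 = \<beta>00 *s b l0 0 + a1 *s v3 + a2 *s v2 - a3 *s v1 + a4 *s b l0 4"
        "B *v v3 = \<beta>00 *s v3 + a1 *s v2 - a2 *s v1 + a3 *s b l0 4"
        "B *v v2 = \<beta>00 *s v2 - a1 *s v1 + a2 *s b l0 4" "B *v v1 = \<beta>00 *s v1 - a1 *s b l0 4"
        "dot \<mu> (b l0 0) * \<beta>00 + dot \<mu> (b l0 1) * \<beta>01 + dot \<mu> (b l0 2) * \<beta>02 + dot \<mu> (b l0 3) * \<beta>03 + dot \<mu> (b l0 4) * \<beta>04 =
          dot \<mu> (b l0 0) * \<beta>00 + dot \<mu> (b l0 4) * a4"
        using nb[OF R(1-5)] by blast
      have "a4 = 0" using N(5) R(6) idR top by simp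
      then show "\<exists>a a1 a2 a3 a4. B *v v4 = a *s v4 + a1 *s v3 + a2 *s v2 - a3 *s v1 + a4 *s v0 \<and> B *v v3 = a *s v3 + a1 *s v2 - a2 *s v1 + a3 *s v0 \<and>
          B *v v2 = a *s v2 - a1 *s v1 + a2 *s v0 \<and> B *v v1 = a *s v1 - a1 *s v0 \<and> B *v v0 = a *s v0 \<and> a4 = 0"
        using N(1-4) R(5) unfolding v by blast
    qed
    then show ?thesis by blast
  qed
qed

theorem mainTheorem3:
  fixes A :: "complex ^ 5 \<Rightarrow> complex ^ 5"
  assumes "foliation 3 A"
    and "L_foliation A"
    and "abelian (tangent_algebra A)"
  shows "\<exists>M :: complex ^ 5 ^ 5. invertible M \<and>
    ((\<exists>\<kappa> :: 5 \<Rightarrow> complex. (\<Sum>j\<in>UNIV. \<kappa> j) = 0 \<and>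
        first_integral (pullback_form M A) (integral1 \<kappa>)) \<or>
     (\<exists>\<kappa> \<xi>. first_integral (pullback_form M A) (integral2 \<kappa> \<xi>)) \<or>
     (\<exists>\<kappa>. first_integral (pullback_form M A) (integral3 \<kappa>)) \<or>
     first_integral (pullback_form M A) integral4 \<or>
     first_integral (pullback_form M A) integral5 \<or>
     (\<exists>\<kappa>. first_integral (pullback_form M A) (integral6 \<kappa>)) \<or>
     first_integral (pullback_form M A) integral7 \<or>
     first_integral (pullback_form M A) integral8)"
proof -
  obtain V where V: "comm_space V" "\<And>z. A z \<noteq> 0 \<Longrightarrow> regular_point V z (A z)"
    "\<And>l. l \<noteq> 0 \<Longrightarrow> \<exists>z. dot l z = 0 \<and> A z \<noteq> 0"
    "\<And>S. finite S \<Longrightarrow> 0 \<notin> S \<Longrightarrow> \<exists>z. A z \<noteq> 0 \<and> (\<forall>l\<in>S. dot l z \<noteq> 0)"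
    using L_foliation_comm_space[OF assms] by blast
  interpret regular_space V
  proof
    show "comm_space V" by (rule V(1))
    show "CARD(5) \<ge> 3" by simp
    show "\<exists>z \<mu>. dot l z = 0 \<and> regular_point V z \<mu>" if "l \<noteq> 0" for l
      using V(3)[OF that] V(2) by blast
    show "\<exists>z \<mu>. regular_point V z \<mu> \<and> (\<forall>l\<in>S. dot l z \<noteq> 0)" if "finite S" "0 \<notin> S" for S
      using V(4)[OF that] V(2) by blast
  qed
  obtain L :: "(complex ^ 5) set" and b d \<mu>
    where fin: "finite L" and card: "(\<Sum>l\<in>L. d l) = CARD(5)" and d1: "\<And>l. l \<in> L \<Longrightarrow> d l \<ge> 1"
      and indep: "\<And>\<beta> l k. (\<Sum>l\<in>L. \<Sum>k<d l. \<beta> l k *s b l k) = 0 \<Longrightarrow> l \<in> L \<Longrightarrow> k < d l \<Longrightarrow> \<beta> l k = (0 :: complex)"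
      and act: "\<And>B. B \<in> V \<Longrightarrow> \<exists>\<beta>. (\<forall>l\<in>L. \<forall>k<d l. B *v b l k = (\<Sum>j<d l - k. \<beta> l j *s b l (k + j))) \<and>
        (\<Sum>l\<in>L. \<Sum>k<d l. \<beta> l k * dot \<mu> (b l k)) = 0"
      and top: "\<And>l. l \<in> L \<Longrightarrow> dot \<mu> (b l (d l - 1)) \<noteq> 0"
    by (rule block_structure) (rule that)
  show ?thesis
  proof (rule block_first_integrals[where V = V and L = L and d = d and b = b and \<mu> = \<mu>])
    show "regular_point V z (A z)" if "A z \<noteq> 0" for z by (rule V(2)[OF that])
    show "mat 1 \<in> V" by (rule V_one)
    show "finite L" by (rule fin)
    show "(\<Sum>l\<in>L. d l) = 5" using card by simp
    show "d l \<ge> 1" if "l \<in> L" for l by (rule d1[OF that])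
    show "\<beta> l k = (0 :: complex)" if "(\<Sum>l\<in>L. \<Sum>k<d l. \<beta> l k *s b l k) = 0" "l \<in> L" "k < d l" for \<beta> l k
      using that by (rule indep)
    show "\<exists>\<beta>. (\<forall>l\<in>L. \<forall>k<d l. B *v b l k = (\<Sum>j<d l - k. \<beta> l j *s b l (k + j))) \<and>
        (\<Sum>l\<in>L. \<Sum>k<d l. \<beta> l k * dot \<mu> (b l k)) = 0" if "B \<in> V" for B by (rule act[OF that])
    show "dot \<mu> (b l (d l - 1)) \<noteq> 0" if "l \<in> L" for l by (rule top[OF that])
  qed
qed

end
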